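(* Let $R$ be a $\Psi$-ring and let $M$ be a $\Psi$-module over $R$. Let $I$ be the category with one object associated to the multiplicative monoid of the nonzero natural numbers. Then there exists a spectral sequence $$E_2^{p,q}=H^p_{BW}(I,\mathcal H^q(R,M))\Rightarrow H^{p+q}_\Psi(R,M),$$ where $\mathcal H^q(R,M)$ is the natural system on $I$ whose value on a morphism $\alpha$ of $I$ is $H^q_{AQ}(R,M^\alpha)$.
   Context: **$\Psi$-rings and $\Psi$-modules.** $\mathbb N=\{1,2,\dots\}$. A $\Psi$-ring is a commutative unital ring $R$ with ring homomorphisms $\Psi^i:R\to R$ ($i\in\mathbb N$) such that $\Psi^1=\mathrm{id}$ and $\Psi^i\Psi^j=\Psi^{ij}$; maps of $\Psi$-rings are ring homomorphisms commuting with all $\Psi^i$. A $\Psi$-module over $R$ is an $R$-module $M$ with additive maps $\psi^i:M\to M$ ($i\in\mathbb N$) such that $\psi^1=\mathrm{id}$, $\psi^i(rm)=\Psi^i(r)\psi^i(m)$, $\psi^i\psi^j=\psi^{ij}$. A $\Psi$-derivation $d:R\to M$ is an additive map with $d(rs)=rd(s)+d(r)s$ and $\psi^id=d\Psi^i$ for all $i$. For a $\Psi$-ring $S\to R$ over $R$, $M$ is a $\Psi$-module over $S$ by restriction, and $\mathrm{Der}_\Psi(S,M)$ is the abelian group of $\Psi$-derivations. **Cohomology of $\Psi$-rings.** The forgetful functor from $\Psi$-rings to sets has a left adjoint (free $\Psi$-ring); let $\mathbb G_I=(G_I,\varepsilon,\delta)$ be the resulting comonad on $\Psi$-rings. $H^n_\Psi(R,M)$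 is the $n$-th cohomology of the complex with $\mathrm{Der}_\Psi(G_I^{n+1}(R),M)$ in degree $n\ge 0$ and coboundary the alternating sum of the maps induced by $G_I^i\varepsilon G_I^{n-i}$. **André–Quillen cohomology.** $H^*_{AQ}(R,N)$ is defined in the same way for the underlying commutative ring $R$ (over $\mathbb Z$) and an $R$-module $N$, using the free commutative ring comonad on commutative rings and ordinary derivations. **Natural system.** For a morphism $f\in\mathbb N$ of $I$, $M^f$ is the abelian group $M$ with $R$-action $(r,m)\mapsto\Psi^f(r)m$. For $u,v\in\mathbb N$, the map $u_*:H^q_{AQ}(R,M^f)\to H^q_{AQ}(R,M^{uf})$ is induced by $\psi^u:M^f\to M^{uf}$, and $v^*:H^q_{AQ}(R,M^f)\to H^q_{AQ}(R,M^{fv})$ is induced by $\Psi^v:R\to R$. **Baues–Wirsching cohomology.** The category of factorizations $\mathcal FI$ has as objects the morphisms of $I$; a morphism $f\to g$ is a pair $(\alpha,\beta)$ with $g=\alpha f\beta$. A natural system on $I$ is a functor $D:\mathcal FI\to\mathfrak{Ab}$, with induced maps $\alpha_*:D(f)\to D(\alpha f)$ and $\beta^*:D(f)\to D(f\beta)$. $H^*_{BW}(I,D)$ is the cohomology of the complex $C^n_{BW}(I,D)=\prod_{(\alpha_1,\dots,\alpha_n)}D(\alpha_1\cdots\alpha_n)$ over composable $n$-tuples, with $(df)(\alpha_1,\dots,\alpha_{n+1})=(\alpha_1)_*f(\alpha_2,\dots,\alpha_{n+1})+\sum_{j=1}^n(-1)^jf(\alpha_1,\dots,\alpha_j\alpha_{j+1},\dots,\alpha_{n+1})+(-1)^{n+1}(\alpha_{n+1})^*f(\alpha_1,\dots,\alpha_n)$.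 *)

theory Defs
  imports "HOL-Library.Multiset" "HOL-Library.FSet" "HOL-Library.Poly_Mapping"
    "HOL-Algebra.Module" "HOL-Algebra.Product_Groups"
begin

section \<open>Psi-rings, Psi-modules and derivations\<close>

text \<open>
  The operations \<open>\<Psi>\<^sup>i\<close> are indexed by the positive integers; the value of the operation
  fields below at index 0 is never constrained or used.
\<close>

record 'a psi_ring = "'a ring" +
  Psi :: "nat \<Rightarrow> 'a \<Rightarrow> 'a"

record ('a, 'm) psi_module = "('a, 'm) module" +
  psi :: "nat \<Rightarrow> 'm \<Rightarrow> 'm"

locale psi_ring = cring R for R :: "('a, 'x) psi_ring_scheme" (structure) +
  assumes Psi_hom: "0 < i \<Longrightarrow> Psi R i \<in> ring_hom R R"
    and Psi_1: "x \<in> carrier R \<Longrightarrow> Psi R 1 x = x"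
    and Psi_Psi: "\<lbrakk>0 < i; 0 < j; x \<in> carrier R\<rbrakk> \<Longrightarrow> Psi R i (Psi R j x) = Psi R (i * j) x"

locale psi_module = psi_ring R + module R M
  for R :: "('a, 'x) psi_ring_scheme" (structure)
    and M :: "('a, 'm, 'y) psi_module_scheme" (structure) +
  assumes psi_closed: "\<lbrakk>0 < i; m \<in> carrier M\<rbrakk> \<Longrightarrow> psi M i m \<in> carrier M"
    and psi_add: "\<lbrakk>0 < i; m \<in> carrier M; n \<in> carrier M\<rbrakk>
      \<Longrightarrow> psi M i (m \<oplus>\<^bsub>M\<^esub> n) = psi M i m \<oplus>\<^bsub>M\<^esub> psi M i n"
    and psi_1: "m \<in> carrier M \<Longrightarrow> psi M 1 m = m"
    and psi_smult: "\<lbrakk>0 < i; r \<in> carrier R; m \<in> carrier M\<rbrakk>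
      \<Longrightarrow> psi M i (r \<odot>\<^bsub>M\<^esub> m) = Psi R i r \<odot>\<^bsub>M\<^esub> psi M i m"
    and psi_psi: "\<lbrakk>0 < i; 0 < j; m \<in> carrier M\<rbrakk> \<Longrightarrow> psi M i (psi M j m) = psi M (i * j) m"

text \<open>
  Derivations of a ring \<open>S\<close> over the base ring via \<open>p : S \<rightarrow> R\<close>, with values in an \<open>R\<close>-module
  restricted along \<open>p\<close>.  They are extensional functions, so that equality of derivations is
  equality on the carrier of \<open>S\<close>.
\<close>

definition derivations ::
  "('u, 'x) ring_scheme \<Rightarrow> ('u \<Rightarrow> 'a) \<Rightarrow> ('a, 'm, 'y) module_scheme \<Rightarrow> ('u \<Rightarrow> 'm) set" where
  "derivations S p M = {d \<in> carrier S \<rightarrow>\<^sub>E carrier M.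
     (\<forall>r\<in>carrier S. \<forall>s\<in>carrier S. d (r \<oplus>\<^bsub>S\<^esub> s) = d r \<oplus>\<^bsub>M\<^esub> d s) \<and>
     (\<forall>r\<in>carrier S. \<forall>s\<in>carrier S.
        d (r \<otimes>\<^bsub>S\<^esub> s) = (p r \<odot>\<^bsub>M\<^esub> d s) \<oplus>\<^bsub>M\<^esub> (p s \<odot>\<^bsub>M\<^esub> d r))}"

definition psi_derivations ::
  "('u, 'x) psi_ring_scheme \<Rightarrow> ('u \<Rightarrow> 'a) \<Rightarrow> ('a, 'm, 'y) psi_module_scheme \<Rightarrow> ('u \<Rightarrow> 'm) set"
  where
  "psi_derivations S p M =
     {d \<in> derivations S p M. \<forall>i>0. \<forall>s\<in>carrier S. psi M i (d s) = d (Psi S i s)}"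

text \<open>The module \<open>M\<^sup>f\<close>: the action of \<open>r\<close> is that of \<open>\<Psi>\<^sup>f(r)\<close>.\<close>

definition twist ::
  "('a, 'x) psi_ring_scheme \<Rightarrow> ('a, 'm, 'y) module_scheme \<Rightarrow> nat \<Rightarrow> ('a, 'm, 'y) module_scheme"
  where
  "twist R M f = M\<lparr>smult := \<lambda>r m. Psi R f r \<odot>\<^bsub>M\<^esub> m\<rparr>"


section \<open>Cohomology of cochain complexes\<close>

text \<open>
  Abelian groups are \<^typ>\<open>'c monoid\<close> records in multiplicative notation.  A cochain complex is a
  family of groups \<open>C n\<close> with coboundaries \<open>\<delta> n : C n \<rightarrow> C (n + 1)\<close>.
\<close>

definition cocycles ::
  "(nat \<Rightarrow> 'c monoid) \<Rightarrow> (nat \<Rightarrow> 'c \<Rightarrow> 'c) \<Rightarrow> nat \<Rightarrow> 'c set" where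
  "cocycles C \<delta> n = kernel (C n) (C (Suc n)) (\<delta> n)"

definition coboundaries ::
  "(nat \<Rightarrow> 'c monoid) \<Rightarrow> (nat \<Rightarrow> 'c \<Rightarrow> 'c) \<Rightarrow> nat \<Rightarrow> 'c set" where
  "coboundaries C \<delta> n =
     (case n of 0 \<Rightarrow> {\<one>\<^bsub>C 0\<^esub>} | Suc k \<Rightarrow> \<delta> k ` carrier (C k))"

definition cohomology ::
  "(nat \<Rightarrow> 'c monoid) \<Rightarrow> (nat \<Rightarrow> 'c \<Rightarrow> 'c) \<Rightarrow> nat \<Rightarrow> 'c set monoid" where
  "cohomology C \<delta> n = (C n\<lparr>carrier := cocycles C \<delta> n\<rparr>) Mod coboundaries C \<delta> n"

text \<open>
  The map induced on degree \<open>n\<close> cohomology by a cochain map \<open>\<phi>\<close> into the complex \<open>(C, \<delta>)\<close>; it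
  sends the class of \<open>x\<close> to the class of \<open>\<phi> x\<close>.
\<close>

definition induced_map ::
  "(nat \<Rightarrow> 'c monoid) \<Rightarrow> (nat \<Rightarrow> 'c \<Rightarrow> 'c) \<Rightarrow> nat \<Rightarrow> ('b \<Rightarrow> 'c) \<Rightarrow> 'b set \<Rightarrow> 'c set" where
  "induced_map C \<delta> n \<phi> Y = coboundaries C \<delta> n <#>\<^bsub>C n\<^esub> (\<phi> ` Y)"


section \<open>Free commutative rings and free Psi-rings\<close>

text \<open>
  Iterating a free-ring functor has to stay inside one type.  The type \<open>'a univ\<close> contains a copy
  \<open>Base x\<close> of the elements of the ring one starts with, formal symbols \<open>Adams i x\<close> (the
  indeterminate standing for \<open>\<Psi>\<^sup>i x\<close>), and every integer polynomial whose indeterminates are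
  elements of \<open>'a univ\<close>.  A polynomial is an element of
  \<^typ>\<open>'v multiset \<Rightarrow>\<^sub>0 int\<close> (monomials are finite multisets of indeterminates); as \<open>\<Rightarrow>\<^sub>0\<close> does not
  admit datatype recursion, it is stored as the finite graph of its nonzero coefficients.
\<close>

datatype 'a univ =
    Base (the_Base: 'a)
  | Adams nat "'a univ"
  | Poly "('a univ multiset \<times> int) fset"

definition enc :: "('a univ multiset \<Rightarrow>\<^sub>0 int) \<Rightarrow> 'a univ" where
  "enc p = Poly (Abs_fset ((\<lambda>m. (m, Poly_Mapping.lookup p m)) ` Poly_Mapping.keys p))"

lemma inj_enc: "inj enc"
proof (rule injI)
  fix p q :: "'a univ multiset \<Rightarrow>\<^sub>0 int"
  assume "enc p = enc q"
  then have eq: "(\<lambda>m. (m, Poly_Mapping.lookup p m)) ` Poly_Mapping.keys p =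
      (\<lambda>m. (m, Poly_Mapping.lookup q m)) ` Poly_Mapping.keys q"
    unfolding enc_def by (simp add: Abs_fset_inject)
  show "p = q"
  proof (rule poly_mapping_eqI)
    fix m
    have "(m, Poly_Mapping.lookup p m) \<in> (\<lambda>m. (m, Poly_Mapping.lookup q m)) ` Poly_Mapping.keys q"
      if "m \<in> Poly_Mapping.keys p"
      using that eq by blast
    moreover have "(m, Poly_Mapping.lookup q m) \<in> (\<lambda>m. (m, Poly_Mapping.lookup p m)) ` Poly_Mapping.keys p"
      if "m \<in> Poly_Mapping.keys q"
      using that eq by blast
    ultimately show "Poly_Mapping.lookup p m = Poly_Mapping.lookup q m"
      by (cases "m \<in> Poly_Mapping.keys p"; cases "m \<in> Poly_Mapping.keys q")
        (auto simp: in_keys_iff)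
  qed
qed

definition dec :: "'a univ \<Rightarrow> ('a univ multiset \<Rightarrow>\<^sub>0 int)" where
  "dec = inv_into UNIV enc"

lemma dec_enc [simp]: "dec (enc p) = p"
  by (simp add: dec_def inj_enc)

definition gen :: "'a univ \<Rightarrow> 'a univ" where
  "gen v = enc (Poly_Mapping.single {#v#} 1)"

definition int_poly_ring :: "'a univ set \<Rightarrow> 'a univ ring" where
  "int_poly_ring V = \<lparr>carrier = enc ` {p. \<forall>m\<in>Poly_Mapping.keys p. set_mset m \<subseteq> V},
     monoid.mult = (\<lambda>a b. enc (dec a * dec b)), monoid.one = enc 1,
     ring.zero = enc 0, ring.add = (\<lambda>a b. enc (dec a + dec b))\<rparr>"

text \<open>
  \<open>poly_ev A h\<close> is the ring homomorphism from a polynomial ring to \<open>A\<close> that sends each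
  indeterminate \<open>v\<close> to \<open>h v\<close>.
\<close>

definition poly_ev :: "('b, 'x) ring_scheme \<Rightarrow> ('a univ \<Rightarrow> 'b) \<Rightarrow> 'a univ \<Rightarrow> 'b" where
  "poly_ev A h u = (\<Oplus>\<^bsub>A\<^esub>m\<in>Poly_Mapping.keys (dec u).
     [Poly_Mapping.lookup (dec u) m] \<cdot>\<^bsub>A\<^esub> (\<Otimes>\<^bsub>A\<^esub>v\<in>set_mset m. h v [^]\<^bsub>A\<^esub> count m v))"

definition free_ring :: "'a univ set \<Rightarrow> 'a univ ring" where
  "free_ring Y = int_poly_ring Y"

text \<open>The free Psi-ring on \<open>Y\<close> is \<open>\<int>[x\<^sub>i : x \<in> Y, i \<ge> 1]\<close> with \<open>\<Psi>\<^sup>j x\<^sub>i = x\<^sub>j\<^sub>i\<close>.\<close>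

fun adams_var :: "(nat \<Rightarrow> 'a univ \<Rightarrow> 'b) \<Rightarrow> 'a univ \<Rightarrow> 'b" where
  "adams_var h (Adams i x) = h i x"
| "adams_var h _ = undefined"

definition free_psi_ring :: "'a univ set \<Rightarrow> 'a univ psi_ring" where
  "free_psi_ring Y =
     (let P = int_poly_ring {Adams i x |i x. 0 < i \<and> x \<in> Y}
      in ring.extend P
           (psi_ring.fields (\<lambda>j. poly_ev P (adams_var (\<lambda>i x. gen (Adams (j * i) x))))))"


section \<open>Comonads and their cohomology\<close>

text \<open>
  The object part, the arrow part (the first argument is the target of the arrow) and the counit
  of a comonad on rings with extra structure \<open>'x\<close>.  The comultiplication does not enter the
  complex computing cohomology and is left out.
\<close>

record ('u, 'x) ring_comonad =
  Ob :: "('u, 'x) ring_scheme \<Rightarrow> ('u, 'x) ring_scheme"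
  Ar :: "('u, 'x) ring_scheme \<Rightarrow> ('u \<Rightarrow> 'u) \<Rightarrow> 'u \<Rightarrow> 'u"
  Eps :: "('u, 'x) ring_scheme \<Rightarrow> 'u \<Rightarrow> 'u"

definition ring_free_comonad :: "('a univ, unit) ring_comonad" where
  "ring_free_comonad = \<lparr>
     Ob = (\<lambda>A. free_ring (carrier A)),
     Ar = (\<lambda>B f. poly_ev (free_ring (carrier B)) (\<lambda>x. gen (f x))),
     Eps = (\<lambda>A. poly_ev A (\<lambda>x. x))\<rparr>"

definition psi_free_comonad :: "('a univ, ('a univ, unit) psi_ring_ext) ring_comonad" where
  "psi_free_comonad = \<lparr>
     Ob = (\<lambda>A. free_psi_ring (carrier A)),
     Ar = (\<lambda>B f. poly_ev (free_psi_ring (carrier B)) (adams_var (\<lambda>i x. gen (Adams i (f x))))),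
     Eps = (\<lambda>A. poly_ev A (adams_var (Psi A)))\<rparr>"

primrec Ar_pow :: "('u, 'x) ring_comonad \<Rightarrow> nat \<Rightarrow> ('u, 'x) ring_scheme \<Rightarrow>
    ('u \<Rightarrow> 'u) \<Rightarrow> 'u \<Rightarrow> 'u" where
  "Ar_pow G 0 B f = f"
| "Ar_pow G (Suc i) B f = Ar G ((Ob G ^^ i) B) (Ar_pow G i B f)"

text \<open>\<open>face G A n i\<close> is \<open>G\<^sup>i \<epsilon> G\<^sup>n\<^sup>-\<^sup>i : G\<^sup>n\<^sup>+\<^sup>1 A \<rightarrow> G\<^sup>n A\<close>, for \<open>i \<le> n\<close>.\<close>

definition face :: "('u, 'x) ring_comonad \<Rightarrow> ('u, 'x) ring_scheme \<Rightarrow> nat \<Rightarrow> nat \<Rightarrow> 'u \<Rightarrow> 'u" where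
  "face G A n i = Ar_pow G i ((Ob G ^^ (n - i)) A) (Eps G ((Ob G ^^ (n - i)) A))"

primrec augmentation ::
  "('u, 'x) ring_comonad \<Rightarrow> ('u, 'x) ring_scheme \<Rightarrow> nat \<Rightarrow> 'u \<Rightarrow> 'u" where
  "augmentation G A 0 u = u"
| "augmentation G A (Suc n) u = augmentation G A n (Eps G ((Ob G ^^ n) A) u)"

text \<open>
  The complex with \<open>Der (G\<^sup>n\<^sup>+\<^sup>1 A) M\<close> in degree \<open>n\<close>, where \<open>Der\<close> is \<^const>\<open>derivations\<close> or
  \<^const>\<open>psi_derivations\<close> and \<open>p\<close> identifies \<open>A\<close> with the ring over which \<open>M\<close> is a module.
\<close>

definition der_cochains ::
  "('u, 'x) ring_comonad \<Rightarrow> (('u, 'x) ring_scheme \<Rightarrow> ('u \<Rightarrow> 'a) \<Rightarrow> ('u \<Rightarrow> 'm) set) \<Rightarrow>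
   ('u, 'x) ring_scheme \<Rightarrow> ('u \<Rightarrow> 'a) \<Rightarrow> ('a, 'm, 'y) module_scheme \<Rightarrow> nat \<Rightarrow> ('u \<Rightarrow> 'm) monoid"
  where
  "der_cochains G Der A p M n =
     (let S = (Ob G ^^ Suc n) A
      in \<lparr>carrier = Der S (p \<circ> augmentation G A (Suc n)),
          monoid.mult = (\<lambda>d e. \<lambda>s\<in>carrier S. d s \<oplus>\<^bsub>M\<^esub> e s),
          monoid.one = (\<lambda>s\<in>carrier S. \<zero>\<^bsub>M\<^esub>)\<rparr>)"

definition der_coboundary ::
  "('u, 'x) ring_comonad \<Rightarrow> ('u, 'x) ring_scheme \<Rightarrow> ('a, 'm, 'y) module_scheme \<Rightarrow> nat \<Rightarrow>
   ('u \<Rightarrow> 'm) \<Rightarrow> ('u \<Rightarrow> 'm)" where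
  "der_coboundary G A M n d =
     (\<lambda>s\<in>carrier ((Ob G ^^ Suc (Suc n)) A).
        \<Oplus>\<^bsub>M\<^esub>i\<in>{..Suc n}. [((- 1 :: int) ^ i)] \<cdot>\<^bsub>M\<^esub> d (face G A (Suc n) i s))"

text \<open>The isomorphic copies of a ring and of a Psi-ring on the carrier \<open>Base ` carrier R\<close>.\<close>

definition base_ring :: "('a, 'x) ring_scheme \<Rightarrow> 'a univ ring" where
  "base_ring R = \<lparr>carrier = Base ` carrier R,
     monoid.mult = (\<lambda>a b. Base (the_Base a \<otimes>\<^bsub>R\<^esub> the_Base b)), monoid.one = Base \<one>\<^bsub>R\<^esub>,
     ring.zero = Base \<zero>\<^bsub>R\<^esub>, ring.add = (\<lambda>a b. Base (the_Base a \<oplus>\<^bsub>R\<^esub> the_Base b))\<rparr>"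

definition base_psi_ring :: "('a, 'x) psi_ring_scheme \<Rightarrow> 'a univ psi_ring" where
  "base_psi_ring R =
     ring.extend (base_ring R) (psi_ring.fields (\<lambda>i a. Base (Psi R i (the_Base a))))"

definition H_Psi ::
  "('a, 'x) psi_ring_scheme \<Rightarrow> ('a, 'm, 'y) psi_module_scheme \<Rightarrow> nat \<Rightarrow> ('a univ \<Rightarrow> 'm) set monoid"
  where
  "H_Psi R M = cohomology
     (der_cochains psi_free_comonad (\<lambda>S p. psi_derivations S p M) (base_psi_ring R) the_Base M)
     (der_coboundary psi_free_comonad (base_psi_ring R) M)"

definition AQ_cochains ::
  "('a, 'x) ring_scheme \<Rightarrow> ('a, 'm, 'y) module_scheme \<Rightarrow> nat \<Rightarrow> ('a univ \<Rightarrow> 'm) monoid" where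
  "AQ_cochains R N =
     der_cochains ring_free_comonad (\<lambda>S p. derivations S p N) (base_ring R) the_Base N"

definition AQ_coboundary ::
  "('a, 'x) ring_scheme \<Rightarrow> ('a, 'm, 'y) module_scheme \<Rightarrow> nat \<Rightarrow> ('a univ \<Rightarrow> 'm) \<Rightarrow> ('a univ \<Rightarrow> 'm)"
  where
  "AQ_coboundary R N = der_coboundary ring_free_comonad (base_ring R) N"

definition H_AQ ::
  "('a, 'x) ring_scheme \<Rightarrow> ('a, 'm, 'y) module_scheme \<Rightarrow> nat \<Rightarrow> ('a univ \<Rightarrow> 'm) set monoid" where
  "H_AQ R N = cohomology (AQ_cochains R N) (AQ_coboundary R N)"


section \<open>Natural systems and Baues--Wirsching cohomology\<close>

text \<open>
  A category with one object is given by its monoid \<open>I\<close> of morphisms.  In the category of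
  factorizations the objects are the elements of \<open>I\<close>, and \<open>(\<alpha>, \<beta>)\<close> is a morphism from \<open>f\<close> to
  \<open>\<alpha> f \<beta>\<close>; composition is \<open>(\<alpha>', \<beta>') \<circ> (\<alpha>, \<beta>) = (\<alpha>' \<alpha>, \<beta> \<beta>')\<close>.  \<open>NMap D \<alpha> \<beta> f\<close> is the
  value of \<open>D\<close> on \<open>(\<alpha>, \<beta>) : f \<rightarrow> \<alpha> f \<beta>\<close>.
\<close>

record ('i, 'd) nat_system =
  NOb :: "'i \<Rightarrow> 'd monoid"
  NMap :: "'i \<Rightarrow> 'i \<Rightarrow> 'i \<Rightarrow> 'd \<Rightarrow> 'd"

definition natural_system :: "('i, 'z) monoid_scheme \<Rightarrow> ('i, 'd) nat_system \<Rightarrow> bool" where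
  "natural_system I D \<longleftrightarrow>
     (\<forall>f\<in>carrier I. comm_group (NOb D f)) \<and>
     (\<forall>\<alpha>\<in>carrier I. \<forall>\<beta>\<in>carrier I. \<forall>f\<in>carrier I.
        NMap D \<alpha> \<beta> f \<in> hom (NOb D f) (NOb D (\<alpha> \<otimes>\<^bsub>I\<^esub> f \<otimes>\<^bsub>I\<^esub> \<beta>))) \<and>
     (\<forall>f\<in>carrier I. \<forall>x\<in>carrier (NOb D f). NMap D \<one>\<^bsub>I\<^esub> \<one>\<^bsub>I\<^esub> f x = x) \<and>
     (\<forall>\<alpha>\<in>carrier I. \<forall>\<beta>\<in>carrier I. \<forall>\<alpha>'\<in>carrier I. \<forall>\<beta>'\<in>carrier I.
        \<forall>f\<in>carrier I. \<forall>x\<in>carrier (NOb D f).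
        NMap D (\<alpha>' \<otimes>\<^bsub>I\<^esub> \<alpha>) (\<beta> \<otimes>\<^bsub>I\<^esub> \<beta>') f x =
        NMap D \<alpha>' \<beta>' (\<alpha> \<otimes>\<^bsub>I\<^esub> f \<otimes>\<^bsub>I\<^esub> \<beta>) (NMap D \<alpha> \<beta> f x))"

definition comp_list :: "('i, 'z) monoid_scheme \<Rightarrow> 'i list \<Rightarrow> 'i" where
  "comp_list I \<alpha>s = foldr (\<lambda>\<alpha> \<beta>. \<alpha> \<otimes>\<^bsub>I\<^esub> \<beta>) \<alpha>s \<one>\<^bsub>I\<^esub>"

definition BW_cochains ::
  "('i, 'z) monoid_scheme \<Rightarrow> ('i, 'd) nat_system \<Rightarrow> nat \<Rightarrow> ('i list \<Rightarrow> 'd) monoid" where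
  "BW_cochains I D n =
     product_group {\<alpha>s. set \<alpha>s \<subseteq> carrier I \<and> length \<alpha>s = n} (\<lambda>\<alpha>s. NOb D (comp_list I \<alpha>s))"

text \<open>\<open>merge I j\<close> replaces the adjacent entries \<open>\<alpha>\<^sub>j, \<alpha>\<^sub>j\<^sub>+\<^sub>1\<close> (counted from 1) by their product.\<close>

definition merge :: "('i, 'z) monoid_scheme \<Rightarrow> nat \<Rightarrow> 'i list \<Rightarrow> 'i list" where
  "merge I j \<alpha>s = take (j - 1) \<alpha>s @ [\<alpha>s ! (j - 1) \<otimes>\<^bsub>I\<^esub> \<alpha>s ! j] @ drop (j + 1) \<alpha>s"

definition BW_coboundary ::
  "('i, 'z) monoid_scheme \<Rightarrow> ('i, 'd) nat_system \<Rightarrow> nat \<Rightarrow> ('i list \<Rightarrow> 'd) \<Rightarrow> ('i list \<Rightarrow> 'd)"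
  where
  "BW_coboundary I D n c =
     (\<lambda>\<alpha>s \<in> {\<alpha>s. set \<alpha>s \<subseteq> carrier I \<and> length \<alpha>s = Suc n}.
        let T = NOb D (comp_list I \<alpha>s) in
        NMap D (hd \<alpha>s) \<one>\<^bsub>I\<^esub> (comp_list I (tl \<alpha>s)) (c (tl \<alpha>s))
        \<otimes>\<^bsub>T\<^esub> (\<Otimes>\<^bsub>T\<^esub>j\<in>{1..n}. c (merge I j \<alpha>s) [^]\<^bsub>T\<^esub> ((- 1 :: int) ^ j))
        \<otimes>\<^bsub>T\<^esub> NMap D \<one>\<^bsub>I\<^esub> (last \<alpha>s) (comp_list I (butlast \<alpha>s)) (c (butlast \<alpha>s))
              [^]\<^bsub>T\<^esub> ((- 1 :: int) ^ Suc n))"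

definition H_BW ::
  "('i, 'z) monoid_scheme \<Rightarrow> ('i, 'd) nat_system \<Rightarrow> nat \<Rightarrow> ('i list \<Rightarrow> 'd) set monoid" where
  "H_BW I D = cohomology (BW_cochains I D) (BW_coboundary I D)"

definition pos_nat_monoid :: "nat monoid" where
  "pos_nat_monoid = \<lparr>carrier = {n. 0 < n}, monoid.mult = (*), monoid.one = 1\<rparr>"

text \<open>
  The maps \<open>u\<^sub>* : H\<^sup>q(R, M\<^sup>f) \<rightarrow> H\<^sup>q(R, M\<^sup>u\<^sup>f)\<close> and \<open>v\<^sup>* : H\<^sup>q(R, M\<^sup>f) \<rightarrow> H\<^sup>q(R, M\<^sup>f\<^sup>v)\<close>, given on cochains
  by composition with \<open>\<psi>\<^sup>u\<close> and precomposition with the map that \<open>\<Psi>\<^sup>v\<close> induces on the resolution.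
\<close>

definition AQ_lower ::
  "('a, 'x) psi_ring_scheme \<Rightarrow> ('a, 'm, 'y) psi_module_scheme \<Rightarrow> nat \<Rightarrow> nat \<Rightarrow> nat \<Rightarrow>
   ('a univ \<Rightarrow> 'm) set \<Rightarrow> ('a univ \<Rightarrow> 'm) set" where
  "AQ_lower R M q u f =
     induced_map (AQ_cochains R (twist R M (u * f))) (AQ_coboundary R (twist R M (u * f))) q
       (\<lambda>c. \<lambda>s\<in>carrier ((Ob ring_free_comonad ^^ Suc q) (base_ring R)). psi M u (c s))"

definition AQ_upper ::
  "('a, 'x) psi_ring_scheme \<Rightarrow> ('a, 'm, 'y) psi_module_scheme \<Rightarrow> nat \<Rightarrow> nat \<Rightarrow> nat \<Rightarrow>
   ('a univ \<Rightarrow> 'm) set \<Rightarrow> ('a univ \<Rightarrow> 'm) set" where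
  "AQ_upper R M q v f =
     induced_map (AQ_cochains R (twist R M (f * v))) (AQ_coboundary R (twist R M (f * v))) q
       (\<lambda>c. \<lambda>s\<in>carrier ((Ob ring_free_comonad ^^ Suc q) (base_ring R)).
          c (Ar_pow ring_free_comonad (Suc q) (base_ring R) (Psi (base_psi_ring R) v) s))"

definition AQ_system ::
  "('a, 'x) psi_ring_scheme \<Rightarrow> ('a, 'm, 'y) psi_module_scheme \<Rightarrow> nat \<Rightarrow>
   (nat, ('a univ \<Rightarrow> 'm) set) nat_system" where
  "AQ_system R M q = \<lparr>
     NOb = (\<lambda>f. H_AQ R (twist R M f) q),
     NMap = (\<lambda>\<alpha> \<beta> f. AQ_upper R M q \<beta> (\<alpha> * f) \<circ> AQ_lower R M q \<alpha> f)\<rparr>"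


section \<open>Spectral sequences\<close>

text \<open>
  Cohomologically graded spectral sequences of abelian groups starting at the second page:
  \<open>d\<^sub>r\<close> has bidegree \<open>(r, 1 - r)\<close>.
\<close>

definition spectral_sequence ::
  "(nat \<Rightarrow> int \<Rightarrow> int \<Rightarrow> 'e monoid) \<Rightarrow> (nat \<Rightarrow> int \<Rightarrow> int \<Rightarrow> 'e \<Rightarrow> 'e) \<Rightarrow> bool" where
  "spectral_sequence E d \<longleftrightarrow>
     (\<forall>r\<ge>2. \<forall>p q.
        comm_group (E r p q) \<and>
        d r p q \<in> hom (E r p q) (E r (p + int r) (q - int r + 1)) \<and>
        d r (p - int r) (q + int r - 1) ` carrier (E r (p - int r) (q + int r - 1))
          \<subseteq> kernel (E r p q) (E r (p + int r) (q - int r + 1)) (d r p q) \<and>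
        E (Suc r) p q \<cong>
          (E r p q\<lparr>carrier := kernel (E r p q) (E r (p + int r) (q - int r + 1)) (d r p q)\<rparr>)
          Mod (d r (p - int r) (q + int r - 1) ` carrier (E r (p - int r) (q + int r - 1))))"

definition first_quadrant :: "(nat \<Rightarrow> int \<Rightarrow> int \<Rightarrow> 'e monoid) \<Rightarrow> bool" where
  "first_quadrant E \<longleftrightarrow> (\<forall>r\<ge>2. \<forall>p q. p < 0 \<or> q < 0 \<longrightarrow> trivial_group (E r p q))"

text \<open>
  Bounded convergence: \<open>H n\<close> carries a finite decreasing filtration whose graded pieces are the
  groups \<open>E\<^sub>\<infinity>\<^sup>p\<^sup>,\<^sup>n\<^sup>-\<^sup>p\<close>, where \<open>E\<^sub>\<infinity>\<^sup>p\<^sup>,\<^sup>q\<close> is \<open>E\<^sub>r\<^sup>p\<^sup>,\<^sup>q\<close> for any \<open>r\<close> from which on all differentials into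
  and out of position \<open>(p, q)\<close> vanish.
\<close>

definition converges_to ::
  "(nat \<Rightarrow> int \<Rightarrow> int \<Rightarrow> 'e monoid) \<Rightarrow> (nat \<Rightarrow> int \<Rightarrow> int \<Rightarrow> 'e \<Rightarrow> 'e) \<Rightarrow> (nat \<Rightarrow> 'h monoid) \<Rightarrow> bool"
  where
  "converges_to E d H \<longleftrightarrow>
     (\<forall>n. \<exists>F :: int \<Rightarrow> 'h set.
        (\<forall>p. subgroup (F p) (H n) \<and> F (p + 1) \<subseteq> F p) \<and>
        (\<exists>s. F s = carrier (H n)) \<and> (\<exists>t. F t = {\<one>\<^bsub>H n\<^esub>}) \<and>
        (\<forall>p q. p + q = int n \<longrightarrow> (\<exists>r0\<ge>2. \<forall>r\<ge>r0.
           (\<forall>x\<in>carrier (E r p q). d r p q x = \<one>\<^bsub>E r (p + int r) (q - int r + 1)\<^esub>) \<and>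
           (\<forall>x\<in>carrier (E r (p - int r) (q + int r - 1)).
              d r (p - int r) (q + int r - 1) x = \<one>\<^bsub>E r p q\<^esub>) \<and>
           E r p q \<cong> (H n\<lparr>carrier := F p\<rparr>) Mod F (p + 1))))"

end

theory Submission
  imports Defs "HOL-Library.Function_Algebras"
begin

text \<open>
  For a \<open>\<Psi>\<close>-ring \<open>A\<close> over \<open>R\<close> let \<open>K(A)\<close> be the total complex of the double complex
  \<open>C\<^sup>p\<^sup>,\<^sup>q(A) = \<Prod> Der(G\<^sup>q\<^sup>+\<^sup>1 A, M\<^sup>f)\<close>, where \<open>G\<close> is the free ring comonad, the product runs over all
  \<open>p\<close>-tuples of positive numbers and \<open>f\<close> denotes the product of the tuple; the differentials are those
  of Baues and Wirsching and of Andre and Quillen.  Filtering \<open>K(R)\<close> by \<open>p\<close> gives a spectral sequence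
  with the required second page, so it remains to identify \<open>H\<^sup>n(K(R))\<close> with \<open>H\<^sup>n\<^sub>\<Psi>(R, M)\<close>.

  If \<open>F\<close> is a free \<open>\<Psi>\<close>-ring, then \<open>K(F)\<close> is a resolution of \<open>Der\<^sub>\<Psi>(F, M)\<close>: in the direction of
  \<open>q\<close> the underlying ring of \<open>F\<close> is free and \<open>F \<rightarrow> G F\<close>, sending an indeterminate to its own
  indeterminate, gives a contraction, and in the direction of \<open>p\<close> a derivation on \<open>F\<close> is a
  function on the indeterminates \<open>x\<^sub>i = \<Psi>\<^sup>i x\<^sub>1\<close>, that is, the complex is coinduced.  On the other hand
  \<open>K\<^sup>n\<close> only depends on the underlying set of a ring over \<open>R\<close>, because of the leading free functor in
  \<open>G\<^sup>q\<^sup>+\<^sup>1\<close>; hence the map of sets \<open>x \<mapsto> x\<^sub>1\<close> contracts the cosimplicial resolution of \<open>K\<^sup>n(R)\<close> by the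
  groups \<open>K\<^sup>n(G\<^sub>I\<^sup>s\<^sup>+\<^sup>1 R)\<close>.  Comparing the two edges of the resulting double complex proves the claim.
\<close>

section \<open>Groups presented as quotients of additive subgroups\<close>

text \<open>Two obstacles shape the argument. A contraction in the direction of \<open>p\<close>
  exists only on the augmentation row Der(F, M^f): there the Adams operations act freely on the
  indeterminates x_i. On Der(G^(q+1) F, M^f) they act on the elements of G^q F, where nothing is
  free. So a total cocycle over a free \<Psi>-ring is first pushed to the row q = 0 by exactness in
  the other direction, then lifted to the augmentation row, and only there contracted. The map x
  \<mapsto> x_1 is not a homomorphism, so the contraction it induces on each K^n commutes with
  neither differential of K. It therefore contracts the groups K^n one degree at a time, which is
  why a second double complex and a comparison of its edges replace a homotopy equivalence of
  complexes. Quotient records are awkward to chase through diagrams. All complexes therefore live on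
  subgroups of type-class groups, and a cohomology group is only ever described by representatives:
  cocycles, and the test for being a boundary.\<close>

definition subgrp :: "'x::ab_group_add set \<Rightarrow> bool" where
  "subgrp S \<longleftrightarrow> 0 \<in> S \<and> (\<forall>x\<in>S. \<forall>y\<in>S. x - y \<in> S)"

lemma subgrp_zero: "subgrp S \<Longrightarrow> 0 \<in> S"
  and subgrp_diff: "subgrp S \<Longrightarrow> x \<in> S \<Longrightarrow> y \<in> S \<Longrightarrow> x - y \<in> S"
  by (auto simp: subgrp_def)

lemma subgrp_minus: "subgrp S \<Longrightarrow> x \<in> S \<Longrightarrow> - x \<in> S"
  using subgrp_diff[of S 0 x] by (simp add: subgrp_zero)

lemma subgrp_add: "subgrp S \<Longrightarrow> x \<in> S \<Longrightarrow> y \<in> S \<Longrightarrow> x + y \<in> S"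
  using subgrp_diff[of S x "- y"] by (simp add: subgrp_minus)

lemma subgrp_sum: "subgrp S \<Longrightarrow> (\<And>i. i \<in> I \<Longrightarrow> f i \<in> S) \<Longrightarrow> sum f I \<in> S"
  by (induction I rule: infinite_finite_induct) (auto simp: subgrp_zero subgrp_add)

text \<open>An epimorphism from \<open>Z\<close> whose kernel is the part of \<open>B\<close> inside
  \<open>Z\<close>. Since \<open>B\<close> is only tested on \<open>Z\<close>, it can be given by a
  convenient formula instead of a subgroup of \<open>Z\<close>.\<close>

definition presents ::
  "('x::ab_group_add \<Rightarrow> 'g) \<Rightarrow> 'x set \<Rightarrow> 'x set \<Rightarrow> ('g, 'z) monoid_scheme \<Rightarrow> bool" where
  "presents h Z B G \<longleftrightarrow> group G \<and> subgrp Z \<and> h ` Z = carrier G \<and>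
     (\<forall>x\<in>Z. \<forall>y\<in>Z. h (x + y) = h x \<otimes>\<^bsub>G\<^esub> h y) \<and> (\<forall>x\<in>Z. h x = \<one>\<^bsub>G\<^esub> \<longleftrightarrow> x \<in> B)"

context
  fixes h :: "'x::ab_group_add \<Rightarrow> 'g" and Z B and G :: "('g, 'z) monoid_scheme"
  assumes pres: "presents h Z B G"
begin

lemma presents_group: "group G"
  and presents_subgrp: "subgrp Z"
  and presents_image: "h ` Z = carrier G"
  and presents_add: "x \<in> Z \<Longrightarrow> y \<in> Z \<Longrightarrow> h (x + y) = h x \<otimes>\<^bsub>G\<^esub> h y"
  and presents_one_iff: "x \<in> Z \<Longrightarrow> h x = \<one>\<^bsub>G\<^esub> \<longleftrightarrow> x \<in> B"
  using pres by (auto simp: presents_def)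

lemma presents_closed: "x \<in> Z \<Longrightarrow> h x \<in> carrier G"
  using presents_image by blast

lemma presents_zero: "h 0 = \<one>\<^bsub>G\<^esub>"
proof -
  interpret group G by (rule presents_group)
  have "h 0 \<otimes>\<^bsub>G\<^esub> h 0 = h 0"
    using presents_add[of 0 0] presents_subgrp by (simp add: subgrp_zero)
  then show ?thesis
    using presents_closed[of 0] presents_subgrp by (simp add: subgrp_zero)
qed

lemma presents_zero_mem: "0 \<in> B"
  using presents_zero presents_one_iff presents_subgrp subgrp_zero by blast

lemma presents_minus: "x \<in> Z \<Longrightarrow> h (- x) = inv\<^bsub>G\<^esub> h x"
proof -
  assume x: "x \<in> Z"
  interpret group G by (rule presents_group)
  have mx: "- x \<in> Z" using x presents_subgrp subgrp_minus by blast
  have "h (- x) \<otimes>\<^bsub>G\<^esub> h x = \<one>\<^bsub>G\<^esub>"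
    using presents_add[OF mx x] by (simp add: presents_zero)
  then show ?thesis using presents_closed x mx by (metis inv_equality)
qed

lemma presents_diff: "x \<in> Z \<Longrightarrow> y \<in> Z \<Longrightarrow> h (x - y) = h x \<otimes>\<^bsub>G\<^esub> inv\<^bsub>G\<^esub> h y"
  using presents_add[of x "- y"] presents_minus[of y] subgrp_minus[OF presents_subgrp, of y]
  by simp

lemma presents_eq_iff: "x \<in> Z \<Longrightarrow> y \<in> Z \<Longrightarrow> h x = h y \<longleftrightarrow> x - y \<in> B"
proof -
  assume xy: "x \<in> Z" "y \<in> Z"
  interpret group G by (rule presents_group)
  have "h x = h y \<longleftrightarrow> h (x - y) = \<one>\<^bsub>G\<^esub>"
    using presents_diff[OF xy] presents_closed[OF xy(1)] presents_closed[OF xy(2)]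
    by (metis inv_closed inv_inv inv_equality r_inv)
  also have "\<dots> \<longleftrightarrow> x - y \<in> B"
    using presents_one_iff[OF subgrp_diff[OF presents_subgrp xy]] .
  finally show ?thesis .
qed

lemma presents_comm_group: "comm_group G"
proof (rule group.group_comm_groupI[OF presents_group])
  fix a b assume "a \<in> carrier G" "b \<in> carrier G"
  then obtain x y where "x \<in> Z" "y \<in> Z" "a = h x" "b = h y"
    using presents_image by (metis imageE)
  then show "a \<otimes>\<^bsub>G\<^esub> b = b \<otimes>\<^bsub>G\<^esub> a"
    by (metis presents_add add.commute)
qed

lemma presents_subgroup: "subgrp Y \<Longrightarrow> Y \<subseteq> Z \<Longrightarrow> subgroup (h ` Y) G"
proof (rule group.subgroupI[OF presents_group])
  assume Y: "subgrp Y" "Y \<subseteq> Z"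
  show "h ` Y \<subseteq> carrier G" using Y presents_closed by blast
  show "h ` Y \<noteq> {}" using Y subgrp_zero by blast
  show "inv\<^bsub>G\<^esub> a \<in> h ` Y" if a: "a \<in> h ` Y" for a
  proof -
    obtain x where "x \<in> Y" "a = h x" using a by blast
    then show ?thesis using Y presents_minus[of x] subgrp_minus[of Y x] by (metis image_eqI subsetD)
  qed
  show "a \<otimes>\<^bsub>G\<^esub> b \<in> h ` Y" if ab: "a \<in> h ` Y" "b \<in> h ` Y" for a b
  proof -
    obtain x y where "x \<in> Y" "a = h x" "y \<in> Y" "b = h y" using ab by blast
    then show ?thesis using Y presents_add[of x y] subgrp_add[of Y x y] by (metis image_eqI subsetD)
  qed
qed

text \<open>The isomorphism theorems for representatives: the coset of \<open>h x\<close> is trivial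
  iff \<open>h x = h y\<close> for some \<open>y\<close> in \<open>Z2\<close>, that is, iff
  \<open>x\<close> and \<open>y\<close> differ by an element of \<open>B\<close>. This one
  construction yields cohomology groups, the passage from a page to the next, and graded pieces of
  filtrations.\<close>

lemma presents_subquot:
  assumes Z1: "subgrp Z1" "Z1 \<subseteq> Z" and Z2: "subgrp Z2" "Z2 \<subseteq> Z1"
  shows "presents (\<lambda>x. h ` Z2 #>\<^bsub>G\<^esub> h x) Z1 {x. \<exists>y\<in>Z2. x - y \<in> B}
    (G\<lparr>carrier := h ` Z1\<rparr> Mod h ` Z2)"
proof -
  interpret G: comm_group G by (rule presents_comm_group)
  let ?G1 = "G\<lparr>carrier := h ` Z1\<rparr>"
  have s1: "subgroup (h ` Z1) G" and s2: "subgroup (h ` Z2) G"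
    using Z1 Z2 presents_subgroup by auto
  have g1: "comm_group ?G1"
  proof (rule group.group_comm_groupI)
    show "group ?G1" using G.subgroup_imp_group s1 by blast
    show "x \<otimes>\<^bsub>?G1\<^esub> y = y \<otimes>\<^bsub>?G1\<^esub> x" if "x \<in> carrier ?G1" "y \<in> carrier ?G1" for x y
      using that subgroup.subset[OF s1] by (auto intro: G.m_comm)
  qed
  interpret G1: comm_group ?G1 by (rule g1)
  have s3: "subgroup (h ` Z2) ?G1"
    using G.subgroup_incl s1 s2 Z2 by blast
  then have n: "h ` Z2 \<lhd> ?G1"
    by (simp add: G1.normal_iff_subgroup)
  interpret N: normal "h ` Z2" ?G1 by (rule n)
  have co: "h ` Z2 #>\<^bsub>G\<^esub> a = h ` Z2 #>\<^bsub>?G1\<^esub> a" for a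
    by (simp add: r_coset_def)
  have sum: "h ` Z2 #>\<^bsub>G\<^esub> h (x + y) = (h ` Z2 #>\<^bsub>G\<^esub> h x) <#>\<^bsub>G\<^esub> (h ` Z2 #>\<^bsub>G\<^esub> h y)"
    if "x \<in> Z1" "y \<in> Z1" for x y
  proof -
    have "(h ` Z2 #>\<^bsub>?G1\<^esub> h x) <#>\<^bsub>?G1\<^esub> (h ` Z2 #>\<^bsub>?G1\<^esub> h y) = h ` Z2 #>\<^bsub>?G1\<^esub> (h x \<otimes>\<^bsub>?G1\<^esub> h y)"
      by (rule N.rcos_sum) (use that in auto)
    moreover have "h x \<otimes>\<^bsub>?G1\<^esub> h y = h (x + y)"
      using presents_add[of x y] subsetD[OF Z1(2)] that by simp
    moreover have "A <#>\<^bsub>?G1\<^esub> A' = A <#>\<^bsub>G\<^esub> A'" for A A'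
      by (simp add: set_mult_def)
    ultimately show ?thesis
      by (simp only: co)
  qed
  have one: "h ` Z2 #>\<^bsub>G\<^esub> h x = h ` Z2 \<longleftrightarrow> (\<exists>y\<in>Z2. x - y \<in> B)" if x: "x \<in> Z1" for x
  proof -
    have xZ: "x \<in> Z" using x Z1 by blast
    have "h ` Z2 #>\<^bsub>G\<^esub> h x = h ` Z2 \<longleftrightarrow> h x \<in> h ` Z2"
      using s2 presents_closed[OF xZ]
      by (metis G.coset_join1 G.coset_join2 subgroup.subset)
    also have "\<dots> \<longleftrightarrow> (\<exists>y\<in>Z2. x - y \<in> B)"
      using Z1 Z2 presents_eq_iff[OF xZ] by blast
    finally show ?thesis .
  qed
  show ?thesis
    unfolding presents_def
  proof (intro conjI ballI)
    show "group (?G1 Mod h ` Z2)" by (rule N.factorgroup_is_group)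
    show "subgrp Z1" by fact
    show "(\<lambda>x. h ` Z2 #>\<^bsub>G\<^esub> h x) ` Z1 = carrier (?G1 Mod h ` Z2)"
      by (auto simp: FactGroup_def RCOSETS_def r_coset_def)
    show "h ` Z2 #>\<^bsub>G\<^esub> h (x + y) = (h ` Z2 #>\<^bsub>G\<^esub> h x) \<otimes>\<^bsub>?G1 Mod h ` Z2\<^esub> (h ` Z2 #>\<^bsub>G\<^esub> h y)"
      if "x \<in> Z1" "y \<in> Z1" for x y
      using sum[OF that] by (simp add: FactGroup_def set_mult_def)
    show "(h ` Z2 #>\<^bsub>G\<^esub> h x = \<one>\<^bsub>?G1 Mod h ` Z2\<^esub>) = (x \<in> {x. \<exists>y\<in>Z2. x - y \<in> B})"
      if "x \<in> Z1" for x
      using one[OF that] by simp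
  qed
qed

lemma presents_pull:
  fixes \<phi> :: "'y::ab_group_add \<Rightarrow> 'x"
  assumes "subgrp Y" "\<phi> ` Y = Z" "\<And>x y. x \<in> Y \<Longrightarrow> y \<in> Y \<Longrightarrow> \<phi> (x + y) = \<phi> x + \<phi> y"
    and "\<And>x. x \<in> Y \<Longrightarrow> x \<in> A \<longleftrightarrow> \<phi> x \<in> B"
  shows "presents (\<lambda>x. h (\<phi> x)) Y A G"
  unfolding presents_def
proof (intro conjI ballI)
  show "(\<lambda>x. h (\<phi> x)) ` Y = carrier G"
    using presents_image assms(2) by (metis image_image)
  show "h (\<phi> (x + y)) = h (\<phi> x) \<otimes>\<^bsub>G\<^esub> h (\<phi> y)" if "x \<in> Y" "y \<in> Y" for x y
    using that assms presents_add by (metis imageI)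
  show "(h (\<phi> x) = \<one>\<^bsub>G\<^esub>) = (x \<in> A)" if "x \<in> Y" for x
    using that assms presents_one_iff by (metis imageI)
qed (use assms presents_group in auto)

text \<open>Zigzags in a double complex match cocycles by a relation, not by a map. If the relation
  is additive, total on both sides and respects boundaries, it still transports a
  presentation.\<close>

lemma presents_rel:
  fixes R :: "'x \<Rightarrow> 'y::ab_group_add \<Rightarrow> bool"
  assumes Y: "subgrp Y"
    and ex1: "\<And>b. b \<in> Y \<Longrightarrow> \<exists>a\<in>Z. R a b" and ex2: "\<And>a. a \<in> Z \<Longrightarrow> \<exists>b\<in>Y. R a b"
    and diff: "\<And>a b a' b'. R a b \<Longrightarrow> R a' b' \<Longrightarrow> R (a - a') (b - b')"
    and iff: "\<And>a b. a \<in> Z \<Longrightarrow> b \<in> Y \<Longrightarrow> R a b \<Longrightarrow> a \<in> B \<longleftrightarrow> b \<in> A"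
  shows "\<exists>k. presents k Y A G"
proof -
  \<comment> \<open>The choice \<open>s\<close> need not be additive, but two elements related to
    the same \<open>b\<close> differ by an element related to 0, which lies in \<open>B\<close>. So
    \<open>h\<close> after \<open>s\<close> is well defined and additive.\<close>
  define s where "s b = (SOME a. a \<in> Z \<and> R a b)" for b
  have s: "s b \<in> Z" "R (s b) b" if "b \<in> Y" for b
    using someI_ex[of "\<lambda>a. a \<in> Z \<and> R a b"] ex1[OF that] by (auto simp: s_def)
  have R0: "R 0 0"
    using diff[OF s(2) s(2), of 0 0] Y subgrp_zero by auto
  have add: "R (a + a') (b + b')" if "R a b" "R a' b'" for a a' b b'
    using diff[OF that(1) diff[OF R0 that(2)]] by simp
  have A0: "0 \<in> A"
    using iff[OF subgrp_zero[OF presents_subgrp] subgrp_zero[OF Y] R0] presents_zero_mem by simp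
  have eq: "h (s b) = h a" if "b \<in> Y" "a \<in> Z" "R a b" for a b
  proof -
    have "R (s b - a) 0" using diff[OF s(2)[OF that(1)] that(3)] by simp
    then have "s b - a \<in> B"
      using iff[OF subgrp_diff[OF presents_subgrp s(1) that(2)] subgrp_zero[OF Y]] A0 that(1) by simp
    then show ?thesis using presents_eq_iff[OF s(1) that(2)] that(1) by simp
  qed
  have "presents (\<lambda>b. h (s b)) Y A G"
    unfolding presents_def
  proof (intro conjI ballI)
    show "(\<lambda>b. h (s b)) ` Y = carrier G"
    proof
      show "(\<lambda>b. h (s b)) ` Y \<subseteq> carrier G" using s presents_closed by blast
      show "carrier G \<subseteq> (\<lambda>b. h (s b)) ` Y"
      proof
        fix g assume "g \<in> carrier G"
        then obtain a where a: "a \<in> Z" "g = h a" using presents_image by blast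
        then obtain b where b: "b \<in> Y" "R a b" using ex2 by blast
        then show "g \<in> (\<lambda>b. h (s b)) ` Y" using eq[OF b(1) a(1) b(2)] a(2) b(1) by (metis image_eqI)
      qed
    qed
    show "h (s (x + y)) = h (s x) \<otimes>\<^bsub>G\<^esub> h (s y)" if "x \<in> Y" "y \<in> Y" for x y
    proof -
      have "h (s (x + y)) = h (s x + s y)"
        by (rule eq[OF subgrp_add[OF Y that] subgrp_add[OF presents_subgrp s(1) s(1)] add[OF s(2) s(2)]])
          (fact that)+
      then show ?thesis using presents_add[OF s(1) s(1)] that by simp
    qed
    show "(h (s x) = \<one>\<^bsub>G\<^esub>) = (x \<in> A)" if "x \<in> Y" for x
      using presents_one_iff[OF s(1)] iff[OF s(1) that s(2)] that by simp
  qed (use Y presents_group in auto)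
  then show ?thesis by blast
qed

text \<open>Shrinks the cocycles to a subgroup that meets every class, and at the same time
  exchanges the description of the boundaries for one that agrees with it there.\<close>

lemma presents_restrict:
  assumes Y: "subgrp Y" "Y \<subseteq> Z" and ex: "\<And>x. x \<in> Z \<Longrightarrow> \<exists>y\<in>Y. x - y \<in> B"
    and A: "\<And>x. x \<in> Y \<Longrightarrow> x \<in> B \<longleftrightarrow> x \<in> A"
  shows "presents h Y A G"
  unfolding presents_def
proof (intro conjI ballI)
  show "h ` Y = carrier G"
  proof
    show "h ` Y \<subseteq> carrier G" using Y(2) presents_image by blast
    show "carrier G \<subseteq> h ` Y"
    proof
      fix g assume "g \<in> carrier G"
      then obtain x where x: "x \<in> Z" "g = h x" using presents_image by blast
      then obtain y where y: "y \<in> Y" "x - y \<in> B" using ex by blast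
      then have "g = h y" using x presents_eq_iff[OF x(1) subsetD[OF Y(2) y(1)]] by simp
      then show "g \<in> h ` Y" using y(1) by simp
    qed
  qed
  show "h (x + y) = h x \<otimes>\<^bsub>G\<^esub> h y" if "x \<in> Y" "y \<in> Y" for x y
    using presents_add subsetD[OF Y(2)] that by simp
  show "(h x = \<one>\<^bsub>G\<^esub>) = (x \<in> A)" if "x \<in> Y" for x
    using presents_one_iff[OF subsetD[OF Y(2) that]] A[OF that] by simp
qed (use Y presents_group in auto)

text \<open>Both maps have the same fibres on \<open>Z\<close>, so sending \<open>h x\<close> to
  \<open>k x\<close> is well defined and bijective.\<close>

lemma presents_iso:
  assumes "presents k Z A H" and "\<And>x. x \<in> Z \<Longrightarrow> x \<in> A \<longleftrightarrow> x \<in> B"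
  shows "G \<cong> H"
proof -
  have eqs: "h x = h y \<longleftrightarrow> k x = k y" if "x \<in> Z" "y \<in> Z" for x y
    using that presents_eq_iff[OF that] Submission.presents_eq_iff[OF assms(1) that]
      assms(2)[OF subgrp_diff[OF presents_subgrp that]] by simp
  define f where "f g = k (inv_into Z h g)" for g
  have f: "f (h x) = k x" if "x \<in> Z" for x
    using that eqs[of "inv_into Z h (h x)" x] unfolding f_def
    by (meson f_inv_into_f image_eqI inv_into_into)
  have "f \<in> iso G H"
  proof (rule isoI)
    show "f \<in> hom G H"
    proof (rule homI)
      fix a assume "a \<in> carrier G"
      then show "f a \<in> carrier H"
        using f presents_image Submission.presents_closed[OF assms(1)] by (metis imageE)
    next
      fix a b assume "a \<in> carrier G" "b \<in> carrier G"
      then obtain x y where xy: "x \<in> Z" "y \<in> Z" "a = h x" "b = h y"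
        using presents_image by (metis imageE)
      then have "a \<otimes>\<^bsub>G\<^esub> b = h (x + y)" using presents_add by simp
      then show "f (a \<otimes>\<^bsub>G\<^esub> b) = f a \<otimes>\<^bsub>H\<^esub> f b"
        using xy f Submission.presents_add[OF assms(1)] presents_subgrp subgrp_add by metis
    qed
    have "inj_on f (h ` Z)" using f eqs by (auto simp: inj_on_def)
    moreover have "f ` (h ` Z) = carrier H"
      using f Submission.presents_image[OF assms(1)] by (force simp: image_iff)
    ultimately show "bij_betw f (carrier G) (carrier H)"
      by (simp add: bij_betw_def presents_image)
  qed
  then show ?thesis by (auto simp: is_iso_def)
qed

end

text \<open>Builds the quotient of \<open>Z\<close> by \<open>B\<close> inside any type that has
  room for the cosets. This is how the pages are placed in the element type that the theorem
  prescribes.\<close>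

lemma presents_make:
  assumes Z: "subgrp Z" and B: "subgrp B"
    and e: "\<And>x y. x \<in> Z \<Longrightarrow> y \<in> Z \<Longrightarrow> e x = e y \<longleftrightarrow> x - y \<in> B"
  shows "presents e Z B \<lparr>carrier = e ` Z,
    monoid.mult = (\<lambda>a b. e (inv_into Z e a + inv_into Z e b)), one = e 0\<rparr>"
    (is "presents e Z B ?G")
proof -
  have m: "e x \<otimes>\<^bsub>?G\<^esub> e y = e (x + y)" if "x \<in> Z" "y \<in> Z" for x y
  proof -
    let ?x = "inv_into Z e (e x)" and ?y = "inv_into Z e (e y)"
    have Zs: "?x \<in> Z" "?y \<in> Z" using that by (simp_all add: inv_into_into)
    have "e ?x = e x" "e ?y = e y" using that by (simp_all add: f_inv_into_f)
    then have "?x - x \<in> B" "?y - y \<in> B" using e that Zs by auto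
    then have "(?x - x) + (?y - y) \<in> B" using B subgrp_add by blast
    then have "(?x + ?y) - (x + y) \<in> B" by (simp add: algebra_simps)
    then have "e (?x + ?y) = e (x + y)"
      using e[of "?x + ?y" "x + y"] that Zs Z by (simp add: subgrp_add)
    then show ?thesis by simp
  qed
  have one: "\<one>\<^bsub>?G\<^esub> = e 0" and carr: "carrier ?G = e ` Z" by simp_all
  have "group ?G"
  proof (rule groupI)
    fix a assume "a \<in> carrier ?G"
    then obtain x where x: "x \<in> Z" "a = e x" by auto
    have "e (- x) \<otimes>\<^bsub>?G\<^esub> a = \<one>\<^bsub>?G\<^esub>"
      using x m[of "- x" x] Z by (simp add: subgrp_minus del: monoid.simps(1))
    then show "\<exists>b\<in>carrier ?G. b \<otimes>\<^bsub>?G\<^esub> a = \<one>\<^bsub>?G\<^esub>"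
      using x Z subgrp_minus by (metis carr imageI)
  next
    fix a b c assume "a \<in> carrier ?G" "b \<in> carrier ?G" "c \<in> carrier ?G"
    then obtain x y z where "x \<in> Z" "y \<in> Z" "z \<in> Z" "a = e x" "b = e y" "c = e z" by auto
    then show "a \<otimes>\<^bsub>?G\<^esub> b \<otimes>\<^bsub>?G\<^esub> c = a \<otimes>\<^bsub>?G\<^esub> (b \<otimes>\<^bsub>?G\<^esub> c)"
      using Z by (simp add: m subgrp_add add.assoc del: monoid.simps(1))
  next
    fix a assume "a \<in> carrier ?G"
    then obtain x where x: "x \<in> Z" "a = e x" by auto
    then show "\<one>\<^bsub>?G\<^esub> \<otimes>\<^bsub>?G\<^esub> a = a"
      using m[of 0 x] Z by (simp add: subgrp_zero del: monoid.simps(1))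
  next
    fix a b assume "a \<in> carrier ?G" "b \<in> carrier ?G"
    then obtain x y where xy: "x \<in> Z" "y \<in> Z" "a = e x" "b = e y" by auto
    then show "a \<otimes>\<^bsub>?G\<^esub> b \<in> carrier ?G"
      using m[of x y] Z by (auto simp: subgrp_add simp del: monoid.simps(1))
  qed (use Z subgrp_zero in auto)
  then show ?thesis
    unfolding presents_def using Z m e[of _ 0] by (auto simp: subgrp_zero)
qed

section \<open>Additive maps and the cohomology of presented complexes\<close>

definition additive :: "('x::ab_group_add \<Rightarrow> 'y::ab_group_add) \<Rightarrow> bool" where
  "additive f \<longleftrightarrow> (\<forall>x y. f (x + y) = f x + f y)"

lemma additive_add: "additive f \<Longrightarrow> f (x + y) = f x + f y"
  by (simp add: additive_def)

lemma additive_zero: "additive f \<Longrightarrow> f 0 = 0"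
  using additive_add[of f 0 0] by simp

lemma additive_minus: "additive f \<Longrightarrow> f (- x) = - f x"
  using additive_add[of f x "- x"] additive_zero[of f] by (simp add: eq_neg_iff_add_eq_0 add.commute)

lemma additive_diff: "additive f \<Longrightarrow> f (x - y) = f x - f y"
  using additive_add[of f x "- y"] additive_minus[of f y] by simp

lemma additive_sum: "additive f \<Longrightarrow> f (sum g I) = (\<Sum>i\<in>I. f (g i))"
  by (induction I rule: infinite_finite_induct) (auto simp: additive_zero additive_add)

lemma subgrp_image: "additive f \<Longrightarrow> subgrp S \<Longrightarrow> subgrp (f ` S)"
  unfolding subgrp_def by (auto simp: image_iff) (metis additive_zero, metis additive_diff)

context
  fixes C :: "nat \<Rightarrow> 'c monoid" and \<delta> and h :: "nat \<Rightarrow> 'x::ab_group_add \<Rightarrow> 'c"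
    and S :: "nat \<Rightarrow> 'x set" and N D
  assumes pres: "\<And>n. presents (h n) (S n) (N n) (C n)"
    and D: "\<And>n x. x \<in> S n \<Longrightarrow> D n x \<in> S (Suc n)" "\<And>n. additive (D n)"
    and comm: "\<And>n x. x \<in> S n \<Longrightarrow> \<delta> n (h n x) = h (Suc n) (D n x)"
begin

lemma presents_coboundaries:
  "coboundaries C \<delta> n = h n ` (case n of 0 \<Rightarrow> {0} | Suc k \<Rightarrow> D k ` S k)"
proof (cases n)
  case 0
  then show ?thesis using presents_zero[OF pres[of 0]] by (simp add: coboundaries_def)
next
  case (Suc k)
  then show ?thesis
    using presents_image[OF pres[of k], symmetric] comm
    by (simp add: coboundaries_def image_image)
qed

lemma subgrp_boundaries: "subgrp (case n of 0 \<Rightarrow> {0} | Suc k \<Rightarrow> D k ` S k)"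
  using subgrp_image[OF D(2) presents_subgrp[OF pres]] by (cases n) (auto simp: subgrp_def)

lemma boundaries_subset: "(case n of 0 \<Rightarrow> {0} | Suc k \<Rightarrow> D k ` S k) \<subseteq> S n"
  using D(1) subgrp_zero[OF presents_subgrp[OF pres]] by (cases n) auto

text \<open>\<open>N n\<close> collects the representatives of zero in degree \<open>n\<close>. It
  is \<open>{0}\<close> for complexes of derivations, but not for Baues-Wirsching cochains with
  values in a cohomology group, which are classes already; there a cocycle is an \<open>x\<close>
  whose coboundary represents zero.\<close>

lemma presents_cohomology:
  assumes DD: "\<And>n x. x \<in> S n \<Longrightarrow> D (Suc n) (D n x) \<in> N (Suc (Suc n))"
  shows "presents (\<lambda>x. coboundaries C \<delta> n #>\<^bsub>C n\<^esub> h n x) {x \<in> S n. D n x \<in> N (Suc n)}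
    {x. case n of 0 \<Rightarrow> x \<in> N 0 | Suc k \<Rightarrow> \<exists>y\<in>S k. x - D k y \<in> N n} (cohomology C \<delta> n)"
proof -
  let ?Z1 = "{x \<in> S n. D n x \<in> N (Suc n)}"
  define Z2 where "Z2 = (case n of 0 \<Rightarrow> {0} | Suc k \<Rightarrow> D k ` S k)"
  have S: "subgrp (S n)" for n using pres presents_subgrp by blast
  have N0: "0 \<in> N n" for n using pres presents_zero_mem by blast
  have cyc: "cocycles C \<delta> n = h n ` ?Z1"
    unfolding cocycles_def kernel_def
    using presents_image[OF pres[of n], symmetric] comm D(1) presents_one_iff[OF pres[of "Suc n"]]
    by auto
  have cob: "coboundaries C \<delta> n = h n ` Z2"
    by (simp add: Z2_def presents_coboundaries)
  have Nd: "x - y \<in> N m" if "x \<in> N m" "y \<in> N m" "x \<in> S m" "y \<in> S m" for x y m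
    using that presents_one_iff[OF pres] presents_eq_iff[OF pres] by metis
  have Z1: "subgrp ?Z1"
    unfolding subgrp_def using S[of n] N0 D
    by (auto simp: subgrp_zero subgrp_diff additive_zero additive_diff intro!: Nd)
  have Z2: "subgrp Z2"
    unfolding Z2_def by (rule subgrp_boundaries)
  have "Z2 \<subseteq> ?Z1"
  proof (cases n)
    case 0
    then show ?thesis using S[of n] N0 D by (auto simp: Z2_def subgrp_zero additive_zero)
  next
    case (Suc k)
    then show ?thesis using D(1) DD by (auto simp: Z2_def)
  qed
  then have pr: "presents (\<lambda>x. h n ` Z2 #>\<^bsub>C n\<^esub> h n x) ?Z1 {x. \<exists>y\<in>Z2. x - y \<in> N n}
      (C n\<lparr>carrier := h n ` ?Z1\<rparr> Mod h n ` Z2)"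
    using Z1 Z2 by (intro presents_subquot[OF pres]) auto
  have eq: "{x. \<exists>y\<in>Z2. x - y \<in> N n} =
      {x. case n of 0 \<Rightarrow> x \<in> N 0 | Suc k \<Rightarrow> \<exists>y\<in>S k. x - D k y \<in> N n}"
    by (cases n) (auto simp: Z2_def)
  show ?thesis
    using pr unfolding cohomology_def cyc cob eq .
qed

end

text \<open>\<open>\<Phi>\<close> carries boundaries into boundaries, so multiplying the image of a
  coset by all coboundaries of the target fills up exactly one coset, that of
  \<open>\<Phi> n x\<close>.\<close>

lemma induced_map_presents:
  fixes C :: "nat \<Rightarrow> 'c monoid" and C' :: "nat \<Rightarrow> 'd monoid"
    and h :: "nat \<Rightarrow> 'x::ab_group_add \<Rightarrow> 'c" and h' :: "nat \<Rightarrow> 'y::ab_group_add \<Rightarrow> 'd"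
  assumes pres: "\<And>n. presents (h n) (S n) (N n) (C n)" and pres': "\<And>n. presents (h' n) (S' n) (N' n) (C' n)"
    and \<Phi>: "\<And>n. additive (\<Phi> n)" "\<And>n x. x \<in> S n \<Longrightarrow> \<Phi> n x \<in> S' n"
    and \<phi>: "\<And>x. x \<in> S n \<Longrightarrow> \<phi> (h n x) = h' n (\<Phi> n x)"
    and D: "\<And>n x. x \<in> S n \<Longrightarrow> D n x \<in> S (Suc n)" "\<And>n. additive (D n)"
    and D': "\<And>n x. x \<in> S' n \<Longrightarrow> D' n x \<in> S' (Suc n)" "\<And>n. additive (D' n)"
    and comm: "\<And>n x. x \<in> S n \<Longrightarrow> \<delta> n (h n x) = h (Suc n) (D n x)"
    and comm': "\<And>n x. x \<in> S' n \<Longrightarrow> \<delta>' n (h' n x) = h' (Suc n) (D' n x)"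
    and nat: "\<And>n x. x \<in> S n \<Longrightarrow> \<Phi> (Suc n) (D n x) = D' n (\<Phi> n x)"
    and x: "x \<in> S n"
  shows "induced_map C' \<delta>' n \<phi> (coboundaries C \<delta> n #>\<^bsub>C n\<^esub> h n x)
    = coboundaries C' \<delta>' n #>\<^bsub>C' n\<^esub> h' n (\<Phi> n x)"
proof -
  define Z2 where "Z2 = (case n of 0 \<Rightarrow> {0} | Suc k \<Rightarrow> D k ` S k)"
  define Z2' where "Z2' = (case n of 0 \<Rightarrow> {0} | Suc k \<Rightarrow> D' k ` S' k)"
  have cob: "coboundaries C \<delta> n = h n ` Z2" and Z2: "subgrp Z2" "Z2 \<subseteq> S n"
    unfolding Z2_def
    using presents_coboundaries[where C=C and \<delta>=\<delta> and h=h and S=S and N=N and D=D, OF pres D comm] subgrp_boundaries[where C=C and \<delta>=\<delta> and h=h and S=S and N=N and D=D, OF pres D comm]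
      boundaries_subset[where C=C and \<delta>=\<delta> and h=h and S=S and N=N and D=D, OF pres D comm] by auto
  have cob': "coboundaries C' \<delta>' n = h' n ` Z2'" and Z2': "subgrp Z2'" "Z2' \<subseteq> S' n"
    unfolding Z2'_def
    using presents_coboundaries[where C=C' and \<delta>=\<delta>' and h=h' and S=S' and N=N' and D=D', OF pres' D' comm'] subgrp_boundaries[where C=C' and \<delta>=\<delta>' and h=h' and S=S' and N=N' and D=D', OF pres' D' comm']
      boundaries_subset[where C=C' and \<delta>=\<delta>' and h=h' and S=S' and N=N' and D=D', OF pres' D' comm'] by auto
  have \<Phi>Z: "\<Phi> n z \<in> Z2'" if "z \<in> Z2" for z
    using that \<Phi> nat by (cases n) (auto simp: Z2_def Z2'_def additive_zero)
  have "induced_map C' \<delta>' n \<phi> (coboundaries C \<delta> n #>\<^bsub>C n\<^esub> h n x)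
      = {h' n b \<otimes>\<^bsub>C' n\<^esub> \<phi> (h n z \<otimes>\<^bsub>C n\<^esub> h n x) |b z. b \<in> Z2' \<and> z \<in> Z2}"
    by (auto simp: induced_map_def set_mult_def r_coset_def cob cob')
  also have "\<dots> = {h' n (b + \<Phi> n z + \<Phi> n x) |b z. b \<in> Z2' \<and> z \<in> Z2}"
  proof -
    have "h' n b \<otimes>\<^bsub>C' n\<^esub> \<phi> (h n z \<otimes>\<^bsub>C n\<^esub> h n x) = h' n (b + \<Phi> n z + \<Phi> n x)"
      if "b \<in> Z2'" "z \<in> Z2" for b z
    proof -
      have zS: "z \<in> S n" and bS: "b \<in> S' n" using that Z2 Z2' by auto
      have "\<phi> (h n z \<otimes>\<^bsub>C n\<^esub> h n x) = h' n (\<Phi> n (z + x))"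
        using zS x presents_add[OF pres, symmetric] presents_subgrp[OF pres] by (simp add: \<phi> subgrp_add)
      then have "h' n b \<otimes>\<^bsub>C' n\<^esub> \<phi> (h n z \<otimes>\<^bsub>C n\<^esub> h n x) = h' n (b + \<Phi> n (z + x))"
        using presents_add[OF pres', of b n "\<Phi> n (z + x)"] bS \<Phi>(2)[of "z + x" n] zS x
          presents_subgrp[OF pres] by (simp add: subgrp_add)
      then show ?thesis by (simp add: additive_add[OF \<Phi>(1)] add.assoc)
    qed
    then show ?thesis by (metis (no_types, lifting))
  qed
  also have "\<dots> = {h' n (b + \<Phi> n x) |b. b \<in> Z2'}"
  proof (intro equalityI subsetI)
    fix y assume "y \<in> {h' n (b + \<Phi> n z + \<Phi> n x) |b z. b \<in> Z2' \<and> z \<in> Z2}"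
    then obtain b z where "y = h' n (b + \<Phi> n z + \<Phi> n x)" "b \<in> Z2'" "z \<in> Z2" by auto
    then show "y \<in> {h' n (b + \<Phi> n x) |b. b \<in> Z2'}"
      using subgrp_add[OF Z2'(1) _ \<Phi>Z] by auto
  next
    fix y assume "y \<in> {h' n (b + \<Phi> n x) |b. b \<in> Z2'}"
    then obtain b where "y = h' n (b + \<Phi> n 0 + \<Phi> n x)" "b \<in> Z2'"
      by (auto simp: additive_zero[OF \<Phi>(1)])
    then show "y \<in> {h' n (b + \<Phi> n z + \<Phi> n x) |b z. b \<in> Z2' \<and> z \<in> Z2}"
      using subgrp_zero[OF Z2(1)] by blast
  qed
  also have "\<dots> = coboundaries C' \<delta>' n #>\<^bsub>C' n\<^esub> h' n (\<Phi> n x)"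
  proof -
    have "h' n b \<otimes>\<^bsub>C' n\<^esub> h' n (\<Phi> n x) = h' n (b + \<Phi> n x)" if "b \<in> Z2'" for b
      using presents_add[OF pres' _ \<Phi>(2)[OF x], of b] that Z2' by auto
    then have "(\<Union>b\<in>Z2'. {h' n b \<otimes>\<^bsub>C' n\<^esub> h' n (\<Phi> n x)}) = (\<Union>b\<in>Z2'. {h' n (b + \<Phi> n x)})"
      by (rule SUP_cong[OF refl, of Z2', OF arg_cong[of _ _ "\<lambda>y. {y}"]])
    then show ?thesis by (auto simp: cob' r_coset_def)
  qed
  finally show ?thesis .
qed

text \<open>Representatives of a product are families of representatives, extended by 0 off
  \<open>I\<close> so that they form a subgroup of a function type. Surjectivity chooses a preimage
  in every factor.\<close>

lemma presents_product:
  assumes pres: "\<And>i. i \<in> I \<Longrightarrow> presents (h i) (Z i) (B i) (G i)"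
  shows "presents (\<lambda>y. \<lambda>i\<in>I. h i (y i)) {y. \<forall>i. if i \<in> I then y i \<in> Z i else y i = 0}
    {y. \<forall>i\<in>I. y i \<in> B i} (product_group I G)"
  unfolding presents_def
proof (intro conjI ballI)
  let ?Y = "{y. \<forall>i. if i \<in> I then y i \<in> Z i else y i = 0}"
  show "group (product_group I G)"
    using pres presents_group by (metis product_group)
  have "subgrp (Z i)" if "i \<in> I" for i using pres[OF that] presents_subgrp by blast
  then show "subgrp ?Y"
    by (auto simp: subgrp_def)
  show "(\<lambda>y. \<lambda>i\<in>I. h i (y i)) ` ?Y = carrier (product_group I G)"
  proof
    show "(\<lambda>y. \<lambda>i\<in>I. h i (y i)) ` ?Y \<subseteq> carrier (product_group I G)"
      using presents_closed[OF pres] by (auto split: if_splits)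
    show "carrier (product_group I G) \<subseteq> (\<lambda>y. \<lambda>i\<in>I. h i (y i)) ` ?Y"
    proof
      fix g assume g: "g \<in> carrier (product_group I G)"
      have "\<exists>z. z \<in> Z i \<and> h i z = g i" if "i \<in> I" for i
      proof -
        have "g i \<in> carrier (G i)" using g that by (auto simp: PiE_iff)
        then have "g i \<in> h i ` Z i" using presents_image[OF pres[OF that]] by simp
        then show ?thesis by (auto elim!: imageE)
      qed
      then have "\<forall>i. \<exists>z. i \<in> I \<longrightarrow> z \<in> Z i \<and> h i z = g i" by simp
      then have "\<exists>z. \<forall>i. i \<in> I \<longrightarrow> z i \<in> Z i \<and> h i (z i) = g i" by (rule choice)
      then obtain z where "\<forall>i. i \<in> I \<longrightarrow> z i \<in> Z i \<and> h i (z i) = g i" by (elim exE)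
      then have z: "z i \<in> Z i \<and> h i (z i) = g i" if "i \<in> I" for i using that by simp
      have "g = (\<lambda>i\<in>I. h i (if i \<in> I then z i else 0))"
        using g z by (auto simp: PiE_iff extensional_def restrict_def fun_eq_iff)
      then show "g \<in> (\<lambda>y. \<lambda>i\<in>I. h i (y i)) ` ?Y"
        using z by (intro image_eqI[of _ _ "\<lambda>i. if i \<in> I then z i else 0"]) auto
    qed
  qed
  show "(\<lambda>i\<in>I. h i ((x + y) i)) = (\<lambda>i\<in>I. h i (x i)) \<otimes>\<^bsub>product_group I G\<^esub> (\<lambda>i\<in>I. h i (y i))"
    if "x \<in> ?Y" "y \<in> ?Y" for x y
    using that presents_add[OF pres] by (auto simp: restrict_def fun_eq_iff split: if_splits)
  show "((\<lambda>i\<in>I. h i (x i)) = \<one>\<^bsub>product_group I G\<^esub>) = (x \<in> {y. \<forall>i\<in>I. y i \<in> B i})"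
    if "x \<in> ?Y" for x
    using that presents_one_iff[OF pres] by (fastforce simp: restrict_def fun_eq_iff split: if_splits)
qed

text \<open>The action of (-1)^n, available in every abelian group of the type class, where no
  scalar multiplication is at hand.\<close>

definition sg :: "nat \<Rightarrow> 'x::ab_group_add \<Rightarrow> 'x" where
  "sg n x = (if even n then x else - x)"

lemma sg_0 [simp]: "sg 0 x = x" and sg_Suc [simp]: "sg (Suc n) x = - sg n x"
  and sg_zero [simp]: "sg n 0 = 0" and sg_minus: "sg n (- x) = - sg n x"
  and sg_add: "sg n (x + y) = sg n x + sg n y" and sg_diff: "sg n (x - y) = sg n x - sg n y"
  and sg_sg [simp]: "sg n (sg n x) = x" and sg_plus: "sg (m + n) x = sg m (sg n x)"
  and sg_eq_0_iff [simp]: "sg n x = 0 \<longleftrightarrow> x = 0"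
  by (auto simp: sg_def)

lemma sg_apply: "sg n f x = sg n (f x)"
  by (simp add: sg_def)

lemma sg_sum: "sg n (sum f I) = (\<Sum>i\<in>I. sg n (f i))"
  by (simp add: sg_def sum_negf)

lemma additive_sg: "additive f \<Longrightarrow> f (sg n x) = sg n (f x)"
  by (simp add: sg_def additive_minus)

lemma subgrp_sg: "subgrp S \<Longrightarrow> x \<in> S \<Longrightarrow> sg n x \<in> S"
  by (simp add: sg_def subgrp_minus)

lemma sum_fun_apply: "(\<Sum>i\<in>I. f i) x = (\<Sum>i\<in>I. f i x)" for f :: "'i \<Rightarrow> 'y \<Rightarrow> 'x::ab_group_add"
  by (induction I rule: infinite_finite_induct) auto

text \<open>The cancellation behind every "boundary of a boundary is zero" below: (j, i) \<mapsto>
  (i, j - 1) matches the terms with i < j with those with j \<le> i, and matched terms carry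
  opposite signs.\<close>

lemma alternating_double_sum:
  fixes t :: "nat \<Rightarrow> nat \<Rightarrow> 'x::ab_group_add"
  assumes "\<And>i j. i < j \<Longrightarrow> j \<le> Suc n \<Longrightarrow> t j i = t i (j - 1)"
  shows "(\<Sum>j\<le>Suc n. sg j (\<Sum>i\<le>n. sg i (t j i))) = 0"
proof -
  let ?f = "\<lambda>(j, i). sg j (sg i (t j i))"
  let ?A = "{(j, i). i < j \<and> j \<le> Suc n}" and ?B = "{(j, i). j \<le> i \<and> i \<le> n}"
  have fin: "finite ?A" "finite ?B"
    by (rule finite_subset[of _ "{..Suc n} \<times> {..Suc n}"]; auto)+
  have "(\<Sum>j\<le>Suc n. sg j (\<Sum>i\<le>n. sg i (t j i))) = (\<Sum>j\<le>Suc n. \<Sum>i\<le>n. sg j (sg i (t j i)))"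
    by (simp only: sg_sum)
  also have "\<dots> = sum ?f ({..Suc n} \<times> {..n})"
    by (simp only: sum.cartesian_product)
  also have "{..Suc n} \<times> {..n} = ?A \<union> ?B" by auto
  also have "sum ?f (?A \<union> ?B) = sum ?f ?A + sum ?f ?B"
    by (rule sum.union_disjoint) (use fin in auto)
  also have "sum ?f ?A = (\<Sum>x\<in>?B. - ?f x)"
    by (rule sum.reindex_bij_witness[of _ "\<lambda>(a, b). (Suc b, a)" "\<lambda>(j, i). (i, j - 1)"])
      (auto simp: assms sg_def)
  finally show ?thesis by (simp add: sum_negf)
qed

text \<open>Plain implications instead of a locale interpretation, because after
  \<open>transfer\<close> the group is a bound variable.\<close>

lemma comm_group_laws:
  assumes "comm_group G"
  shows "\<one>\<^bsub>G\<^esub> \<in> carrier G"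
    and "x \<in> carrier G \<Longrightarrow> y \<in> carrier G \<Longrightarrow> x \<otimes>\<^bsub>G\<^esub> y \<in> carrier G"
    and "x \<in> carrier G \<Longrightarrow> inv\<^bsub>G\<^esub> x \<in> carrier G"
    and "x \<in> carrier G \<Longrightarrow> \<one>\<^bsub>G\<^esub> \<otimes>\<^bsub>G\<^esub> x = x"
    and "x \<in> carrier G \<Longrightarrow> inv\<^bsub>G\<^esub> x \<otimes>\<^bsub>G\<^esub> x = \<one>\<^bsub>G\<^esub>"
    and "x \<in> carrier G \<Longrightarrow> y \<in> carrier G \<Longrightarrow> z \<in> carrier G \<Longrightarrow>
      x \<otimes>\<^bsub>G\<^esub> y \<otimes>\<^bsub>G\<^esub> z = x \<otimes>\<^bsub>G\<^esub> (y \<otimes>\<^bsub>G\<^esub> z)"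
    and "x \<in> carrier G \<Longrightarrow> y \<in> carrier G \<Longrightarrow> x \<otimes>\<^bsub>G\<^esub> y = y \<otimes>\<^bsub>G\<^esub> x"
proof -
  interpret comm_group G by fact
  show "\<one>\<^bsub>G\<^esub> \<in> carrier G" by simp
  show "x \<in> carrier G \<Longrightarrow> y \<in> carrier G \<Longrightarrow> x \<otimes>\<^bsub>G\<^esub> y \<in> carrier G" by simp
  show "x \<in> carrier G \<Longrightarrow> inv\<^bsub>G\<^esub> x \<in> carrier G" by simp
  show "x \<in> carrier G \<Longrightarrow> \<one>\<^bsub>G\<^esub> \<otimes>\<^bsub>G\<^esub> x = x" by simp
  show "x \<in> carrier G \<Longrightarrow> inv\<^bsub>G\<^esub> x \<otimes>\<^bsub>G\<^esub> x = \<one>\<^bsub>G\<^esub>" by simp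
  show "x \<in> carrier G \<Longrightarrow> y \<in> carrier G \<Longrightarrow> z \<in> carrier G \<Longrightarrow>
      x \<otimes>\<^bsub>G\<^esub> y \<otimes>\<^bsub>G\<^esub> z = x \<otimes>\<^bsub>G\<^esub> (y \<otimes>\<^bsub>G\<^esub> z)" by (rule m_assoc)
  show "x \<in> carrier G \<Longrightarrow> y \<in> carrier G \<Longrightarrow> x \<otimes>\<^bsub>G\<^esub> y = y \<otimes>\<^bsub>G\<^esub> x" by (rule m_comm)
qed

text \<open>
  The product of all abelian groups whose elements are of type \<open>'m\<close>: every such group embeds
  into this one type, on which addition is a type class operation.
\<close>

typedef 'm big = "{f :: 'm monoid \<Rightarrow> 'm. \<forall>G. if comm_group G then f G \<in> carrier G else f G = undefined}"
proof (rule exI)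
  show "(\<lambda>G. if comm_group G then \<one>\<^bsub>G\<^esub> else undefined) \<in>
    {f. \<forall>G. if comm_group G then f G \<in> carrier G else f G = undefined}"
    by (simp add: comm_group_laws)
qed

setup_lifting type_definition_big

lift_definition big_pr :: "'m monoid \<Rightarrow> 'm big \<Rightarrow> 'm" is "\<lambda>G f. f G" .

lift_definition big_emb :: "'m monoid \<Rightarrow> 'm \<Rightarrow> 'm big" is
  "\<lambda>G x H. if comm_group H then (if H = G \<and> x \<in> carrier G then x else \<one>\<^bsub>H\<^esub>) else undefined"
  by (simp add: comm_group_laws)

instantiation big :: (type) ab_group_add
begin

lift_definition zero_big :: "'a big" is "\<lambda>G. if comm_group G then \<one>\<^bsub>G\<^esub> else undefined"
  by (simp add: comm_group_laws)

lift_definition plus_big :: "'a big \<Rightarrow> 'a big \<Rightarrow> 'a big" is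
  "\<lambda>f g G. if comm_group G then f G \<otimes>\<^bsub>G\<^esub> g G else undefined"
  by (simp add: comm_group_laws)

lift_definition uminus_big :: "'a big \<Rightarrow> 'a big" is
  "\<lambda>f G. if comm_group G then inv\<^bsub>G\<^esub> f G else undefined"
  by (simp add: comm_group_laws)

definition minus_big :: "'a big \<Rightarrow> 'a big \<Rightarrow> 'a big" where
  "minus_big x y = x + - y"

instance
proof
  fix a b c :: "'a big"
  show "a + b + c = a + (b + c)"
    by transfer (simp add: comm_group_laws(1-6) fun_eq_iff split: if_split_asm)
  show "a + b = b + a"
    by transfer (rule ext, simp add: comm_group_laws(7) split: if_split_asm)
  show "0 + a = a"
    by transfer (simp add: comm_group_laws(1-6) fun_eq_iff split: if_split_asm)
  show "- a + a = 0"
    by transfer (simp add: comm_group_laws(1-6) fun_eq_iff split: if_split_asm)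
  show "a - b = a + - b" by (rule minus_big_def)
qed

end

lemma big_pr_emb [simp]: "comm_group G \<Longrightarrow> x \<in> carrier G \<Longrightarrow> big_pr G (big_emb G x) = x"
  by transfer simp

lemma big_pr_closed: "comm_group G \<Longrightarrow> big_pr G z \<in> carrier G"
  by transfer metis

lemma big_pr_zero: "comm_group G \<Longrightarrow> big_pr G 0 = \<one>\<^bsub>G\<^esub>"
  by transfer simp

lemma big_pr_add: "comm_group G \<Longrightarrow> big_pr G (y + z) = big_pr G y \<otimes>\<^bsub>G\<^esub> big_pr G z"
  by transfer simp

lemma big_emb_one: "comm_group G \<Longrightarrow> big_emb G \<one>\<^bsub>G\<^esub> = 0"
  by transfer (simp add: comm_group_laws(1-6) fun_eq_iff split: if_split_asm)

lemma big_emb_mult: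
  "comm_group G \<Longrightarrow> x \<in> carrier G \<Longrightarrow> y \<in> carrier G \<Longrightarrow>
    big_emb G (x \<otimes>\<^bsub>G\<^esub> y) = big_emb G x + big_emb G y"
  by transfer (simp add: comm_group_laws(1-6) fun_eq_iff split: if_split_asm)

section \<open>Double complexes\<close>

text \<open>The squares anticommute, so the total differential is the plain sum of \<open>d1\<close>
  and \<open>d2\<close>; the instances put the sign into one of their differentials.\<close>

locale double_complex =
  fixes C :: "nat \<Rightarrow> nat \<Rightarrow> 'x::ab_group_add set" and d1 d2 :: "nat \<Rightarrow> nat \<Rightarrow> 'x \<Rightarrow> 'x"
  assumes subgrp_C: "subgrp (C i j)"
    and add1: "additive (d1 i j)" and add2: "additive (d2 i j)"
    and d1_closed: "x \<in> C i j \<Longrightarrow> d1 i j x \<in> C (Suc i) j"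
    and d2_closed: "x \<in> C i j \<Longrightarrow> d2 i j x \<in> C i (Suc j)"
    and d1_d1: "x \<in> C i j \<Longrightarrow> d1 (Suc i) j (d1 i j x) = 0"
    and d2_d2: "x \<in> C i j \<Longrightarrow> d2 i (Suc j) (d2 i j x) = 0"
    and anticomm: "x \<in> C i j \<Longrightarrow> d1 i (Suc j) (d2 i j x) + d2 (Suc i) j (d1 i j x) = 0"
begin

definition Tot :: "nat \<Rightarrow> (nat \<Rightarrow> nat \<Rightarrow> 'x) set" where
  "Tot m = {t. \<forall>i j. t i j \<in> C i j \<and> (i + j \<noteq> m \<longrightarrow> t i j = 0)}"

definition Tot_pred :: "nat \<Rightarrow> (nat \<Rightarrow> nat \<Rightarrow> 'x) set" where
  "Tot_pred m = (case m of 0 \<Rightarrow> {0} | Suc k \<Rightarrow> Tot k)"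

definition D :: "(nat \<Rightarrow> nat \<Rightarrow> 'x) \<Rightarrow> nat \<Rightarrow> nat \<Rightarrow> 'x" where
  "D t = (\<lambda>i j. (case i of 0 \<Rightarrow> 0 | Suc k \<Rightarrow> d1 k j (t k j)) + (case j of 0 \<Rightarrow> 0 | Suc k \<Rightarrow> d2 i k (t i k)))"

definition single :: "nat \<Rightarrow> nat \<Rightarrow> 'x \<Rightarrow> nat \<Rightarrow> nat \<Rightarrow> 'x" where
  "single i j x = (\<lambda>a b. if a = i \<and> b = j then x else 0)"

lemma transpose: "double_complex (\<lambda>i j. C j i) (\<lambda>i j. d2 j i) (\<lambda>i j. d1 j i)"
  by unfold_locales
    (simp_all add: subgrp_C add1 add2 d1_closed d2_closed d1_d1 d2_d2, metis anticomm add.commute)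

lemma C_zero: "0 \<in> C i j"
  by (rule subgrp_zero[OF subgrp_C])

lemma subgrp_Tot: "subgrp (Tot m)"
  using subgrp_C by (auto simp: Tot_def subgrp_def)

lemma subgrp_Tot_pred: "subgrp (Tot_pred m)"
  using subgrp_Tot by (cases m) (auto simp: Tot_pred_def, simp add: subgrp_def)

lemma Tot_C: "t \<in> Tot m \<Longrightarrow> t i j \<in> C i j"
  and Tot_0: "t \<in> Tot m \<Longrightarrow> i + j \<noteq> m \<Longrightarrow> t i j = 0"
  by (auto simp: Tot_def)

lemma additive_D: "additive D"
  unfolding additive_def D_def
  by (auto simp: fun_eq_iff additive_add[OF add1] additive_add[OF add2] split: nat.split)

lemma D_zero: "D 0 = 0" by (rule additive_zero[OF additive_D])

lemma D_Suc_Suc: "D t (Suc i) (Suc j) = d1 i (Suc j) (t i (Suc j)) + d2 (Suc i) j (t (Suc i) j)"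
  and D_Suc_0: "D t (Suc i) 0 = d1 i 0 (t i 0)"
  and D_0_Suc: "D t 0 (Suc j) = d2 0 j (t 0 j)"
  and D_0_0: "D t 0 0 = 0"
  by (simp_all add: D_def)

lemma D_closed: "t \<in> Tot m \<Longrightarrow> D t \<in> Tot (Suc m)"
  unfolding Tot_def
proof (intro CollectI allI)
  fix i j assume "t \<in> {t. \<forall>i j. t i j \<in> C i j \<and> (i + j \<noteq> m \<longrightarrow> t i j = 0)}"
  then show "D t i j \<in> C i j \<and> (i + j \<noteq> Suc m \<longrightarrow> D t i j = 0)"
    by (cases i; cases j)
      (auto simp: D_def C_zero d1_closed d2_closed additive_zero[OF add1] additive_zero[OF add2]
        intro!: subgrp_add[OF subgrp_C])
qed

lemma D_D: "t \<in> Tot m \<Longrightarrow> D (D t) = 0"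
proof (intro ext)
  fix i j assume t: "t \<in> Tot m"
  show "D (D t) i j = 0 i j"
  proof (cases i)
    case 0
    then show ?thesis
    proof (cases j)
      case (Suc k)
      then show ?thesis using 0 t by (cases k) (simp_all add: D_def additive_zero[OF add2] d2_d2 Tot_C)
    qed (simp add: D_def)
  next
    case (Suc l)
    show ?thesis
    proof (cases j)
      case 0
      then show ?thesis using Suc t by (cases l) (simp_all add: D_def additive_zero[OF add1] d1_d1 Tot_C)
    next
      case (Suc k)
      have "d1 l (Suc k) (d2 l k (t l k)) + d2 (Suc l) k (d1 l k (t l k)) = 0"
        using anticomm t Tot_C by blast
      then show ?thesis
        using Suc \<open>i = Suc l\<close> t
        by (cases l; cases k)
          (simp_all add: D_def additive_add[OF add1] additive_add[OF add2] d1_d1 d2_d2 Tot_C algebra_simps)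
    qed
  qed
qed

lemma single_Tot: "x \<in> C i j \<Longrightarrow> m = i + j \<Longrightarrow> single i j x \<in> Tot m"
  by (auto simp: Tot_def single_def C_zero)

lemma D_single: "D (single i j x) = single (Suc i) j (d1 i j x) + single i (Suc j) (d2 i j x)"
  by (auto simp: D_def single_def fun_eq_iff additive_zero[OF add1] additive_zero[OF add2] split: nat.split)

lemma single_add: "single i j (x + y) = single i j x + single i j y"
  and single_diff: "single i j (x - y) = single i j x - single i j y"
  by (auto simp: single_def fun_eq_iff)

lemma single_apply: "single i j x i j = x"
  by (simp add: single_def)

lemma Tot_concentrated: "t \<in> Tot m \<Longrightarrow> (\<And>i j. t (Suc i) j = 0) \<Longrightarrow> t = single 0 m (t 0 m)"
proof (intro ext)
  fix i j assume t: "t \<in> Tot m" "\<And>i j. t (Suc i) j = 0"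
  show "t i j = single 0 m (t 0 m) i j"
    using t Tot_0[OF t(1), of i j] by (cases i) (auto simp: single_def)
qed

text \<open>Exactness is asked for in positive positions only. The kernel of \<open>d1\<close> in
  position 0 is the edge that survives.\<close>

definition exact1 :: bool where
  "exact1 \<longleftrightarrow> (\<forall>i j. \<forall>x\<in>C (Suc i) j. d1 (Suc i) j x = 0 \<longrightarrow> (\<exists>y\<in>C i j. d1 i j y = x))"

definition exact2 :: bool where
  "exact2 \<longleftrightarrow> (\<forall>i j. \<forall>x\<in>C i (Suc j). d2 i (Suc j) x = 0 \<longrightarrow> (\<exists>y\<in>C i j. d2 i j y = x))"

text \<open>The entry with the largest first index is a \<open>d1\<close>-cocycle, because nothing
  else contributes to \<open>D t\<close> to its right. Subtracting \<open>D\<close> of a preimage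
  moves it one step to the left, until only first index 0 is left. \<open>D t\<close> is left free
  at first index 0, so that a primitive of an edge cocycle can be swept as well, not only a
  cocycle.\<close>

lemma concentrate:
  assumes ex: exact1 and t: "t \<in> Tot m" and Dt: "\<And>i j. D t (Suc i) j = 0"
  shows "\<exists>u\<in>Tot_pred m. \<exists>a\<in>C 0 m. t - D u = single 0 m a"
proof -
  have "\<exists>u\<in>Tot_pred m. \<forall>i j. (t - D u) (Suc i) j = 0"
    if "t \<in> Tot m" "\<And>i j. D t (Suc i) j = 0" "\<And>i j. k \<le> i \<Longrightarrow> t (Suc i) j = 0" for k t
    using that
  proof (induction k arbitrary: t)
    case 0
    have "t - D 0 = t" by (simp only: D_zero diff_0_right)
    then have "\<forall>i j. (t - D 0) (Suc i) j = 0" using 0(3)[OF le0] by metis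
    then show ?case using subgrp_zero[OF subgrp_Tot_pred] by (rule bexI)
  next
    case (Suc k t)
    show ?case
    proof (cases "Suc k \<le> m")
      case False
      then have "t (Suc i) j = 0" if "k \<le> i" for i j
        using that by (intro Tot_0[OF Suc.prems(1)]) auto
      then show ?thesis using Suc.IH[OF Suc.prems(1,2)] by blast
    next
      case True
      \<comment> \<open>The only entry with first index \<open>Suc k\<close> that can be nonzero in
        total degree \<open>m\<close>.\<close>
      define j where "j = m - Suc k"
      have m: "m = Suc (k + j)" using True by (simp add: j_def)
      \<comment> \<open>The \<open>d2\<close> summand vanishes, since \<open>t\<close> has no
        entries with first index beyond \<open>Suc k\<close>.\<close>
      have "D t (Suc (Suc k)) j = d1 (Suc k) j (t (Suc k) j)"
        using Suc.prems(3)[of "Suc k"] by (simp add: D_def additive_zero[OF add2] split: nat.split)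
      then have "d1 (Suc k) j (t (Suc k) j) = 0" using Suc.prems(2) by simp
      then obtain w where w: "w \<in> C k j" "d1 k j w = t (Suc k) j"
        using ex Tot_C[OF Suc.prems(1)] unfolding exact1_def by blast
      let ?u = "single k j w"
      have u: "?u \<in> Tot_pred m" using w m by (simp add: Tot_pred_def single_Tot)
      have u': "?u \<in> Tot (k + j)" using w by (simp add: single_Tot)
      let ?t = "t - D ?u"
      have t': "?t \<in> Tot m"
        using subgrp_diff[OF subgrp_Tot Suc.prems(1)] D_closed[OF u'] m by simp
      have Dt: "D ?t = D t"
        using D_D[OF u'] by (simp add: additive_diff[OF additive_D])
      have "?t (Suc i) j' = 0" if "k \<le> i" for i j'
      proof (cases "i = k \<and> j' = j")
        case True
        then show ?thesis by (simp add: D_single w) (simp add: single_def)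
      next
        case False
        have "t (Suc i) j' = 0"
        proof (cases "i = k")
          case True
          then show ?thesis using False m by (intro Tot_0[OF Suc.prems(1)]) auto
        next
          case False
          then show ?thesis using that by (intro Suc.prems(3)) auto
        qed
        then show ?thesis using False that by (simp add: D_single) (auto simp: single_def)
      qed
      then obtain v where v: "v \<in> Tot_pred m" "\<forall>i j. (?t - D v) (Suc i) j = 0"
        using Suc.IH[OF t'] Suc.prems(2) Dt by metis
      have "t - D (?u + v) = ?t - D v"
        by (simp add: additive_add[OF additive_D] algebra_simps)
      then show ?thesis
        using v u subgrp_add[OF subgrp_Tot_pred] by metis
    qed
  qed
  \<comment> \<open>For degree reasons no entry has first index above \<open>m\<close>, so the sweep
    may start there.\<close>
  from this[OF t Dt, of m] obtain u where u: "u \<in> Tot_pred m" "\<And>i j. (t - D u) (Suc i) j = 0"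
    using Tot_0[OF t] by auto
  have "D u \<in> Tot m"
    using u(1) D_closed subgrp_zero[OF subgrp_Tot] by (cases m) (auto simp: Tot_pred_def D_zero)
  then have tu: "t - D u \<in> Tot m" using t subgrp_diff[OF subgrp_Tot] by blast
  then show ?thesis
    using Tot_concentrated[OF tu u(2)] Tot_C[OF tu] u(1) by blast
qed

lemma Tot_pred_D_D: "u \<in> Tot_pred m \<Longrightarrow> D (D u) = 0"
  using D_D by (cases m) (auto simp: Tot_pred_def D_zero)

lemma single_cocycle:
  assumes "D (single 0 m a) = 0"
  shows "d1 0 m a = 0" "d2 0 m a = 0"
proof -
  have *: "single (Suc 0) m (d1 0 m a) + single 0 (Suc m) (d2 0 m a) = 0"
    using assms by (simp add: D_single)
  show "d1 0 m a = 0" using fun_cong[OF fun_cong[OF *, of "Suc 0"], of m] by (simp add: single_def)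
  show "d2 0 m a = 0" using fun_cong[OF fun_cong[OF *, of 0], of "Suc m"] by (simp add: single_def)
qed

lemma cocycle_concentrate:
  assumes ex: exact1 and t: "t \<in> Tot m" and Dt: "D t = 0"
  shows "\<exists>u\<in>Tot_pred m. \<exists>a\<in>C 0 m. t - D u = single 0 m a \<and> d1 0 m a = 0 \<and> d2 0 m a = 0"
proof -
  obtain u a where u: "u \<in> Tot_pred m" "a \<in> C 0 m" "t - D u = single 0 m a"
    using concentrate[OF ex t] Dt by auto
  have "D (single 0 m a) = 0"
    using Tot_pred_D_D[OF u(1)] Dt by (simp add: u(3)[symmetric] additive_diff[OF additive_D])
  then show ?thesis using u single_cocycle by blast
qed

text \<open>A cocycle on one edge is related to a cocycle on the other if they are cohomologous in
  the total complex.\<close>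

definition edge_rel :: "nat \<Rightarrow> 'x \<Rightarrow> 'x \<Rightarrow> bool" where
  "edge_rel n a b \<longleftrightarrow> (\<exists>u\<in>Tot_pred n. single 0 n a - single n 0 b = D u)"

definition edge_cocycles :: "nat \<Rightarrow> 'x set" where
  "edge_cocycles n = {a \<in> C 0 n. d1 0 n a = 0 \<and> d2 0 n a = 0}"

definition edge_boundaries :: "nat \<Rightarrow> 'x set" where
  "edge_boundaries n = {a. case n of 0 \<Rightarrow> a = 0 | Suc k \<Rightarrow> \<exists>b\<in>C 0 k. d1 0 k b = 0 \<and> a = d2 0 k b}"

lemma subgrp_edge_cocycles: "subgrp (edge_cocycles n)"
  unfolding edge_cocycles_def subgrp_def
  by (auto simp: C_zero subgrp_diff[OF subgrp_C] additive_zero[OF add1] additive_zero[OF add2]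
      additive_diff[OF add1] additive_diff[OF add2])

lemma edge_rel_diff: "edge_rel n a b \<Longrightarrow> edge_rel n a' b' \<Longrightarrow> edge_rel n (a - a') (b - b')"
  unfolding edge_rel_def
proof (elim bexE)
  fix u v assume "u \<in> Tot_pred n" "v \<in> Tot_pred n"
    "single 0 n a - single n 0 b = D u" "single 0 n a' - single n 0 b' = D v"
  then show "\<exists>u\<in>Tot_pred n. single 0 n (a - a') - single n 0 (b - b') = D u"
    by (intro bexI[of _ "u - v"] subgrp_diff[OF subgrp_Tot_pred])
      (simp_all add: single_diff additive_diff[OF additive_D] algebra_simps)
qed

lemma single_cocycle': "d1 n 0 b = 0 \<Longrightarrow> d2 n 0 b = 0 \<Longrightarrow> D (single n 0 b) = 0"
  by (simp add: D_single) (simp add: single_def fun_eq_iff)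

lemma edge_rel_exists:
  assumes exact1 "b \<in> C n 0" "d1 n 0 b = 0" "d2 n 0 b = 0"
  shows "\<exists>a\<in>edge_cocycles n. edge_rel n a b"
proof -
  have "single n 0 b \<in> Tot n" using assms by (simp add: single_Tot)
  then obtain u a where u: "u \<in> Tot_pred n" "a \<in> C 0 n" "single n 0 b - D u = single 0 n a"
    "d1 0 n a = 0" "d2 0 n a = 0"
    using cocycle_concentrate[OF assms(1) _ single_cocycle'[OF assms(3,4)]] by blast
  have "single 0 n a - single n 0 b = D (- u)"
    using u(3) by (simp add: additive_minus[OF additive_D] algebra_simps)
  then show ?thesis
    using u subgrp_minus[OF subgrp_Tot_pred u(1)] unfolding edge_rel_def edge_cocycles_def by blast
qed

text \<open>If \<open>b\<close> bounds \<open>c\<close> on its own edge, then adding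
  \<open>c\<close> to the total cochain that relates \<open>a\<close> and \<open>b\<close> gives a
  primitive of \<open>a\<close> alone. Sweeping that primitive to first index 0 leaves a primitive
  inside the other edge.\<close>

lemma edge_rel_boundary:
  assumes ex: exact1 and R: "edge_rel n a b" and a: "a \<in> C 0 n"
    and b: "case n of 0 \<Rightarrow> b = 0 | Suc k \<Rightarrow> \<exists>c\<in>C k 0. d2 k 0 c = 0 \<and> b = d1 k 0 c"
  shows "a \<in> edge_boundaries n"
proof (cases n)
  case 0
  have "single 0 0 a - single 0 0 b = D 0" using R 0 by (simp add: edge_rel_def Tot_pred_def)
  then have "(single 0 0 a - single 0 0 b) 0 0 = 0" by (simp only: D_zero zero_fun_apply)
  then show ?thesis using 0 b by (simp add: edge_boundaries_def single_apply)
next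
  case (Suc k)
  obtain u where u: "u \<in> Tot k" "single 0 n a - single n 0 b = D u"
    using R Suc by (auto simp: edge_rel_def Tot_pred_def)
  obtain c where c: "c \<in> C k 0" "d2 k 0 c = 0" "b = d1 k 0 c" using b Suc by auto
  let ?v = "u + single k 0 c"
  have v: "?v \<in> Tot k" using u c subgrp_add[OF subgrp_Tot] by (simp add: single_Tot)
  have "D (single k 0 c) = single n 0 b"
    using c Suc by (simp add: D_single) (simp add: single_def fun_eq_iff)
  then have Dv: "D ?v = single 0 n a"
    using u(2) by (simp add: additive_add[OF additive_D] algebra_simps)
  obtain w a' where w: "w \<in> Tot_pred k" "a' \<in> C 0 k" "?v - D w = single 0 k a'"
    using concentrate[OF ex v] Dv by (auto simp: single_def)
  have "D (single 0 k a') = single 0 n a"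
    using Tot_pred_D_D[OF w(1)] Dv by (simp add: w(3)[symmetric] additive_diff[OF additive_D])
  then have *: "single (Suc 0) k (d1 0 k a') + single 0 n (d2 0 k a') = single 0 n a"
    using Suc by (simp add: D_single)
  have "d1 0 k a' = 0" using fun_cong[OF fun_cong[OF *, of "Suc 0"], of k] Suc by (simp add: single_def)
  moreover have "a = d2 0 k a'" using fun_cong[OF fun_cong[OF *, of 0], of n] Suc by (simp add: single_def)
  ultimately show ?thesis using w Suc by (auto simp: edge_boundaries_def)
qed

end

section \<open>The transposed complex and the comparison of the two edges\<close>

context double_complex
begin

interpretation T: double_complex "\<lambda>i j. C j i" "\<lambda>i j. d2 j i" "\<lambda>i j. d1 j i"
  by (rule transpose)

lemma T_Tot: "t \<in> T.Tot m \<longleftrightarrow> (\<lambda>i j. t j i) \<in> Tot m"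
  by (auto simp: T.Tot_def Tot_def add.commute)

lemma T_Tot_pred: "t \<in> T.Tot_pred m \<longleftrightarrow> (\<lambda>i j. t j i) \<in> Tot_pred m"
  by (cases m) (auto simp: T.Tot_pred_def Tot_pred_def T_Tot fun_eq_iff)

lemma T_D: "T.D t i j = D (\<lambda>i j. t j i) j i"
  by (simp add: T.D_def D_def add.commute)

lemma single_flip: "single i j x a b = single j i x b a"
  by (auto simp: single_def)

lemma T_exact1: "T.exact1 \<longleftrightarrow> exact2"
  by (auto simp: T.exact1_def exact2_def)

lemma T_edge_rel: "edge_rel n a b \<Longrightarrow> T.edge_rel n b a"
proof -
  assume "edge_rel n a b"
  then obtain u where u: "u \<in> Tot_pred n" "single 0 n a - single n 0 b = D u"
    by (auto simp: edge_rel_def)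
  \<comment> \<open>Transposition exchanges the two edge terms and thereby reverses the sign of
    their difference.\<close>
  have "single 0 n b - single n 0 a = T.D (\<lambda>i j. - u j i)"
  proof (intro ext)
    fix i j
    have "(single 0 n a - single n 0 b) j i = D u j i" by (simp only: u(2))
    moreover have "D (\<lambda>i j. - u i j) j i = - D u j i"
      using fun_cong[OF fun_cong[OF additive_minus[OF additive_D, of u], of j], of i]
      by (simp add: fun_Compl_def)
    ultimately show "(single 0 n b - single n 0 a) i j = T.D (\<lambda>i j. - u j i) i j"
      by (simp add: single_flip[of 0 n b i j] single_flip[of n 0 a i j] T_D algebra_simps)
  qed
  moreover have "(\<lambda>i j. - u j i) \<in> T.Tot_pred n"
    using subgrp_minus[OF subgrp_Tot_pred u(1)] by (simp add: T_Tot_pred fun_Compl_def)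
  ultimately show ?thesis by (auto simp: T.edge_rel_def)
qed

lemma T_edge_rel': "T.edge_rel n b a \<Longrightarrow> edge_rel n a b"
proof -
  assume "T.edge_rel n b a"
  then obtain u where u: "u \<in> T.Tot_pred n" "single 0 n b - single n 0 a = T.D u"
    by (auto simp: T.edge_rel_def)
  have "single 0 n a - single n 0 b = D (\<lambda>i j. - u j i)"
  proof (intro ext)
    fix i j
    have "(single 0 n b - single n 0 a) j i = T.D u j i" by (simp only: u(2))
    moreover have "D (\<lambda>i j. - u j i) i j = - D (\<lambda>i j. u j i) i j"
      using fun_cong[OF fun_cong[OF additive_minus[OF additive_D, of "\<lambda>i j. u j i"], of i], of j]
      by (simp add: fun_Compl_def)
    ultimately show "(single 0 n a - single n 0 b) i j = D (\<lambda>i j. - u j i) i j"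
      by (simp add: single_flip[of 0 n a i j] single_flip[of n 0 b i j] T_D algebra_simps)
  qed
  moreover have "(\<lambda>i j. - u j i) \<in> Tot_pred n"
    using subgrp_minus[OF subgrp_Tot_pred, of "\<lambda>i j. u j i" n] u(1)
    by (simp add: T_Tot_pred fun_Compl_def)
  ultimately show ?thesis by (auto simp: edge_rel_def)
qed

lemma cocycle_concentrate':
  assumes exact2 and t: "t \<in> Tot m" and Dt: "D t = 0"
  shows "\<exists>u\<in>Tot_pred m. \<exists>a\<in>C m 0. t - D u = single m 0 a \<and> d1 m 0 a = 0 \<and> d2 m 0 a = 0"
proof -
  let ?t = "\<lambda>i j. t j i"
  have tT: "?t \<in> T.Tot m" using t by (simp add: T_Tot)
  have "T.D ?t = 0" using Dt by (simp add: T_D fun_eq_iff)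
  with tT obtain u a where u: "u \<in> T.Tot_pred m" "a \<in> C m 0" "?t - T.D u = single 0 m a"
    "d1 m 0 a = 0" "d2 m 0 a = 0"
    using T.cocycle_concentrate[of ?t m] assms(1) T_exact1 by blast
  have "t - D (\<lambda>i j. u j i) = single m 0 a"
  proof (intro ext)
    fix i j
    have "(?t - T.D u) j i = single 0 m a j i" by (simp only: u(3))
    then show "(t - D (\<lambda>i j. u j i)) i j = single m 0 a i j"
      by (simp add: T_D single_flip[of m 0 a i j])
  qed
  then show ?thesis using u T_Tot_pred by blast
qed

text \<open>If both directions are exact in positive positions, both edges compute the cohomology of
  the total complex. The group \<open>G\<close> is carried over along \<open>edge_rel\<close>, and
  every claim about the second edge is the claim about the first edge in the transposed
  complex.\<close>

theorem edge_transfer: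
  assumes ex: exact1 exact2 and pres: "presents h (edge_cocycles n) (edge_boundaries n) G"
  shows "\<exists>k. presents k {b \<in> C n 0. d2 n 0 b = 0 \<and> d1 n 0 b = 0}
    {b. case n of 0 \<Rightarrow> b = 0 | Suc k \<Rightarrow> \<exists>c\<in>C k 0. d2 k 0 c = 0 \<and> b = d1 k 0 c} G"
proof -
  have Tc: "T.edge_cocycles n = {b \<in> C n 0. d2 n 0 b = 0 \<and> d1 n 0 b = 0}"
    by (simp add: T.edge_cocycles_def)
  have Tb: "T.edge_boundaries n =
      {b. case n of 0 \<Rightarrow> b = 0 | Suc k \<Rightarrow> \<exists>c\<in>C k 0. d2 k 0 c = 0 \<and> b = d1 k 0 c}"
    by (simp add: T.edge_boundaries_def)
  have "\<exists>k. presents k (T.edge_cocycles n) (T.edge_boundaries n) G"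
  proof (rule presents_rel[OF pres, where R = "edge_rel n"])
    show "subgrp (T.edge_cocycles n)" by (rule T.subgrp_edge_cocycles)
    show "\<exists>a\<in>edge_cocycles n. edge_rel n a b" if "b \<in> T.edge_cocycles n" for b
      using edge_rel_exists[OF ex(1), of b n] that by (simp add: Tc)
    show "\<exists>b\<in>T.edge_cocycles n. edge_rel n a b" if "a \<in> edge_cocycles n" for a
      using T.edge_rel_exists[of a n] that ex(2) T_exact1 T_edge_rel'
      by (auto simp: edge_cocycles_def)
    show "edge_rel n (a - a') (b - b')" if "edge_rel n a b" "edge_rel n a' b'" for a b a' b'
      using that by (rule edge_rel_diff)
    show "a \<in> edge_boundaries n \<longleftrightarrow> b \<in> T.edge_boundaries n"
      if "a \<in> edge_cocycles n" "b \<in> T.edge_cocycles n" "edge_rel n a b" for a b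
    proof
      assume "a \<in> edge_boundaries n"
      then show "b \<in> T.edge_boundaries n"
        using T.edge_rel_boundary[of n b a] T_edge_rel[OF that(3)] ex(2) T_exact1 that(2)
        by (simp add: edge_boundaries_def Tc)
    next
      assume "b \<in> T.edge_boundaries n"
      then show "a \<in> edge_boundaries n"
        using edge_rel_boundary[OF ex(1) that(3)] that(1)
        by (simp add: Tb edge_cocycles_def)
    qed
  qed
  then show ?thesis by (simp add: Tc Tb)
qed

end

section \<open>The spectral sequence of a filtered complex\<close>

text \<open>\<open>F p n\<close> is step \<open>p\<close> of a decreasing filtration in degree
  \<open>n\<close>. Integer indices match the bidegrees of the pages; \<open>F_high\<close> at p = 0
  makes the complex zero in negative degrees.\<close>

locale filtered_complex =
  fixes F :: "int \<Rightarrow> int \<Rightarrow> 'x::ab_group_add set" and D :: "'x \<Rightarrow> 'x"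
  assumes subgrp_F: "subgrp (F p n)"
    and F_Suc: "F (p + 1) n \<subseteq> F p n"
    and F_low: "p \<le> 0 \<Longrightarrow> F p n = F 0 n"
    and F_high: "n < p \<Longrightarrow> F p n = {0}"
    and additive_D: "additive D"
    and D_F: "x \<in> F p n \<Longrightarrow> D x \<in> F p (n + 1)"
    and D_D: "x \<in> F p n \<Longrightarrow> D (D x) = 0"
begin

lemma F_mono: "p \<le> p' \<Longrightarrow> F p' n \<subseteq> F p n"
  by (induction p' rule: int_ge_induct) (use F_Suc in blast)+

definition Z :: "nat \<Rightarrow> int \<Rightarrow> int \<Rightarrow> 'x set" where
  "Z r p q = {x \<in> F p (p + q). D x \<in> F (p + int r) (p + q + 1)}"

text \<open>The whole denominator of the page: besides the boundaries it contains the
  almost-cocycles one filtration step deeper, so that E_r is \<open>Z r\<close> modulo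
  \<open>B r\<close>.\<close>

definition B :: "nat \<Rightarrow> int \<Rightarrow> int \<Rightarrow> 'x set" where
  "B r p q = {y + D u |y u. y \<in> Z (r - 1) (p + 1) (q - 1) \<and> u \<in> Z (r - 1) (p - int r + 1) (q + int r - 2)}"

lemma subgrp_Z: "subgrp (Z r p q)"
  unfolding Z_def subgrp_def
  by (auto simp: subgrp_zero[OF subgrp_F] subgrp_diff[OF subgrp_F] additive_zero[OF additive_D]
      additive_diff[OF additive_D])

lemma B_I: "y \<in> Z (r - 1) (p + 1) (q - 1) \<Longrightarrow> u \<in> Z (r - 1) (p - int r + 1) (q + int r - 2) \<Longrightarrow>
    y + D u \<in> B r p q"
  by (auto simp: B_def)

lemma B_I1: "y \<in> Z (r - 1) (p + 1) (q - 1) \<Longrightarrow> y \<in> B r p q"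
  using B_I[of y r p q 0] by (simp add: subgrp_zero[OF subgrp_Z] additive_zero[OF additive_D])

lemma B_I2: "u \<in> Z (r - 1) (p - int r + 1) (q + int r - 2) \<Longrightarrow> D u \<in> B r p q"
  using B_I[of 0 r p q u] by (simp add: subgrp_zero[OF subgrp_Z])

lemma subgrp_B: "subgrp (B r p q)"
  unfolding subgrp_def
proof (intro conjI ballI)
  show "0 \<in> B r p q" by (rule B_I1) (rule subgrp_zero[OF subgrp_Z])
  fix x x' assume "x \<in> B r p q" "x' \<in> B r p q"
  then obtain y u y' u' where "x = y + D u" "x' = y' + D u'"
    and Z: "y \<in> Z (r - 1) (p + 1) (q - 1)" "y' \<in> Z (r - 1) (p + 1) (q - 1)"
      "u \<in> Z (r - 1) (p - int r + 1) (q + int r - 2)" "u' \<in> Z (r - 1) (p - int r + 1) (q + int r - 2)"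
    by (auto simp: B_def)
  then have "x - x' = (y - y') + D (u - u')"
    by (simp add: additive_diff[OF additive_D])
  then show "x - x' \<in> B r p q"
    using B_I[OF subgrp_diff[OF subgrp_Z Z(1,2)] subgrp_diff[OF subgrp_Z Z(3,4)]] by simp
qed

lemma Z_pred:
  assumes "1 \<le> r" shows "Z r p q \<subseteq> Z (r - 1) p q"
  using F_mono[of "p + int (r - 1)" "p + int r" "p + q + 1"] assms unfolding Z_def by auto

lemma Z_shift:
  assumes "1 \<le> r" shows "Z (r - 1) (p + 1) (q - 1) \<subseteq> Z r p q"
proof -
  have "p + 1 + int (r - 1) = p + int r" using assms by simp
  then show ?thesis using F_Suc[of p "p + q"] unfolding Z_def by auto
qed

lemma D_Z:
  assumes "x \<in> Z r p q" shows "D x \<in> Z r (p + int r) (q - int r + 1)"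
proof -
  have *: "p + int r + (q - int r + 1) = p + q + 1" by simp
  show ?thesis
    using assms D_D subgrp_zero[OF subgrp_F] unfolding Z_def * by auto
qed

lemma D_B:
  assumes "1 \<le> r" and "x \<in> B r p q" shows "D x \<in> B r (p + int r) (q - int r + 1)"
proof -
  obtain y u where x: "x = y + D u" and y: "y \<in> Z (r - 1) (p + 1) (q - 1)"
    and u: "u \<in> Z (r - 1) (p - int r + 1) (q + int r - 2)" using assms(2) by (auto simp: B_def)
  have "D (D u) = 0" using u D_D by (auto simp: Z_def)
  then have "D x = D y" by (simp add: x additive_add[OF additive_D])
  moreover have "p + int r - int r + 1 = p + 1" "q - int r + 1 + int r - 2 = q - 1" by simp_all
  ultimately show ?thesis using B_I2[of y r "p + int r" "q - int r + 1"] y by simp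
qed

section \<open>The pages, their differentials and convergence\<close>

context
  fixes E :: "nat \<Rightarrow> int \<Rightarrow> int \<Rightarrow> 'e monoid" and e :: "nat \<Rightarrow> int \<Rightarrow> int \<Rightarrow> 'x \<Rightarrow> 'e"
  assumes pres: "2 \<le> r \<Longrightarrow> presents (e r p q) (Z r p q) (B r p q) (E r p q)"
begin

definition d :: "nat \<Rightarrow> int \<Rightarrow> int \<Rightarrow> 'e \<Rightarrow> 'e" where
  "d r p q a = e r (p + int r) (q - int r + 1) (D (inv_into (Z r p q) (e r p q) a))"

text \<open>\<open>D\<close> maps \<open>B\<close> into \<open>B\<close>, so the representative
  chosen in \<open>d\<close> is immaterial.\<close>

lemma d_e:
  assumes r: "2 \<le> r" and x: "x \<in> Z r p q"
  shows "d r p q (e r p q x) = e r (p + int r) (q - int r + 1) (D x)"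
proof -
  let ?y = "inv_into (Z r p q) (e r p q) (e r p q x)"
  have y: "?y \<in> Z r p q" "e r p q ?y = e r p q x"
    using x by (simp_all add: inv_into_into f_inv_into_f)
  then have "?y - x \<in> B r p q" using presents_eq_iff[OF pres[OF r] y(1) x] by simp
  then have "D ?y - D x \<in> B r (p + int r) (q - int r + 1)"
    using D_B[of r "?y - x" p q] r by (simp add: additive_diff[OF additive_D])
  then show ?thesis
    unfolding d_def using presents_eq_iff[OF pres[OF r] D_Z[OF y(1)] D_Z[OF x]] by simp
qed

lemma d_hom: "2 \<le> r \<Longrightarrow> d r p q \<in> hom (E r p q) (E r (p + int r) (q - int r + 1))"
proof (rule homI)
  assume r: "2 \<le> r"
  show "d r p q a \<in> carrier (E r (p + int r) (q - int r + 1))" if "a \<in> carrier (E r p q)" for a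
  proof -
    have "a \<in> e r p q ` Z r p q" using that presents_image[OF pres[OF r]] by simp
    then obtain x where "x \<in> Z r p q" "a = e r p q x" by (elim imageE) simp
    then show ?thesis using d_e[OF r] presents_closed[OF pres[OF r] D_Z] by simp
  qed
  show "d r p q (a \<otimes>\<^bsub>E r p q\<^esub> b) = d r p q a \<otimes>\<^bsub>E r (p + int r) (q - int r + 1)\<^esub> d r p q b"
    if "a \<in> carrier (E r p q)" "b \<in> carrier (E r p q)" for a b
  proof -
    have "a \<in> e r p q ` Z r p q" "b \<in> e r p q ` Z r p q"
      using that presents_image[OF pres[OF r]] by simp_all
    then obtain x y where xy: "x \<in> Z r p q" "a = e r p q x" "y \<in> Z r p q" "b = e r p q y"
      by (elim imageE) simp
    then show ?thesis
      using d_e[OF r] presents_add[OF pres[OF r] xy(1,3), symmetric] subgrp_add[OF subgrp_Z xy(1,3)]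
        presents_add[OF pres[OF r] D_Z[OF xy(1)] D_Z[OF xy(3)]]
      by (simp add: additive_add[OF additive_D])
  qed
qed

lemma kernel_d:
  assumes r: "2 \<le> r"
  shows "kernel (E r p q) (E r (p + int r) (q - int r + 1)) (d r p q) =
    e r p q ` {x \<in> Z r p q. D x \<in> B r (p + int r) (q - int r + 1)}"
proof -
  have "d r p q (e r p q x) = \<one>\<^bsub>E r (p + int r) (q - int r + 1)\<^esub> \<longleftrightarrow>
      D x \<in> B r (p + int r) (q - int r + 1)" if "x \<in> Z r p q" for x
    using d_e[OF r that] presents_one_iff[OF pres[OF r] D_Z[OF that]] by simp
  then show ?thesis
    unfolding kernel_def presents_image[OF pres[OF r], symmetric] by auto
qed

lemma image_d:
  assumes r: "2 \<le> r"
  shows "d r (p - int r) (q + int r - 1) ` carrier (E r (p - int r) (q + int r - 1)) =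
    e r p q ` D ` Z r (p - int r) (q + int r - 1)"
proof -
  have *: "p - int r + int r = p" "q + int r - 1 - int r + 1 = q" by simp_all
  show ?thesis
    using d_e[OF r, of _ "p - int r" "q + int r - 1"]
    unfolding presents_image[OF pres[OF r], symmetric] image_image * by auto
qed

text \<open>An \<open>x\<close> in \<open>Z r\<close> represents a kernel element iff
  \<open>D x\<close> lies in \<open>B r\<close>, say \<open>D x = y + D w\<close>. Then
  \<open>x - w\<close> lies in \<open>Z (Suc r)\<close> while \<open>w\<close> lies in
  \<open>B r\<close>, so every class of the kernel has a representative in \<open>Z (Suc r)\<close>.
  On that subgroup, being in \<open>B r\<close> up to \<open>D\<close> of \<open>Z r\<close> amounts
  to being in \<open>B (Suc r)\<close>.\<close>

lemma page_iso:
  assumes r: "2 \<le> r"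
  shows "E (Suc r) p q \<cong>
    (E r p q\<lparr>carrier := kernel (E r p q) (E r (p + int r) (q - int r + 1)) (d r p q)\<rparr>)
    Mod (d r (p - int r) (q + int r - 1) ` carrier (E r (p - int r) (q + int r - 1)))"
proof -
  let ?Z1 = "{x \<in> Z r p q. D x \<in> B r (p + int r) (q - int r + 1)}"
  let ?Z2 = "D ` Z r (p - int r) (q + int r - 1)"
  have r1: "1 \<le> r" using r by simp
  have Z1: "subgrp ?Z1"
    unfolding subgrp_def
    by (auto simp: subgrp_zero[OF subgrp_Z] subgrp_zero[OF subgrp_B] additive_zero[OF additive_D]
        additive_diff[OF additive_D] subgrp_diff[OF subgrp_Z] subgrp_diff[OF subgrp_B])
  have Z2: "subgrp ?Z2" by (rule subgrp_image[OF additive_D subgrp_Z])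
  have "p - int r + int r = p" "q + int r - 1 - int r + 1 = q" by simp_all
  then have "D u \<in> Z r p q" if "u \<in> Z r (p - int r) (q + int r - 1)" for u
    using D_Z[OF that] by simp
  then have Z21: "?Z2 \<subseteq> ?Z1"
    using D_D subgrp_zero[OF subgrp_B] by (auto simp: Z_def)
  have "presents (\<lambda>x. e r p q ` ?Z2 #>\<^bsub>E r p q\<^esub> e r p q x) ?Z1 {x. \<exists>y\<in>?Z2. x - y \<in> B r p q}
     (E r p q\<lparr>carrier := e r p q ` ?Z1\<rparr> Mod e r p q ` ?Z2)"
    by (rule presents_subquot[OF pres[OF r] Z1 _ Z2 Z21]) auto
  then have prS: "presents (\<lambda>x. e r p q ` ?Z2 #>\<^bsub>E r p q\<^esub> e r p q x) (Z (Suc r) p q) (B (Suc r) p q)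
     (E r p q\<lparr>carrier := e r p q ` ?Z1\<rparr> Mod e r p q ` ?Z2)"
  proof (rule presents_restrict)
    show "subgrp (Z (Suc r) p q)" by (rule subgrp_Z)
    show "Z (Suc r) p q \<subseteq> ?Z1"
    proof
      fix x assume x: "x \<in> Z (Suc r) p q"
      have "D x \<in> F (p + int r + 1) (p + q + 1)" using x by (simp add: Z_def algebra_simps)
      moreover have "D (D x) = 0" using x D_D by (auto simp: Z_def)
      moreover have eq: "p + int r + 1 + (q - int r + 1 - 1) = p + q + 1" by simp
      ultimately have "D x \<in> Z (r - 1) (p + int r + 1) (q - int r + 1 - 1)"
        unfolding Z_def mem_Collect_eq eq by (simp add: subgrp_zero[OF subgrp_F] del: add_diff_eq)
      then have "D x \<in> B r (p + int r) (q - int r + 1)" by (rule B_I1)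
      moreover have "x \<in> Z r p q" using x Z_pred[of "Suc r"] by auto
      ultimately show "x \<in> ?Z1" by simp
    qed
    show "\<exists>y\<in>Z (Suc r) p q. x - y \<in> {x. \<exists>y\<in>?Z2. x - y \<in> B r p q}" if x: "x \<in> ?Z1" for x
    proof -
      have eqs: "p + int r - int r + 1 = p + 1" "q - int r + 1 + int r - 2 = q - 1"
        "p + int r + 1 + (q - int r + 1 - 1) = p + q + 1" by simp_all
      obtain y w where yw: "D x = y + D w" "y \<in> Z (r - 1) (p + int r + 1) (q - int r + 1 - 1)"
        "w \<in> Z (r - 1) (p + 1) (q - 1)" using x unfolding B_def eqs by blast
      have "y \<in> F (p + int (Suc r)) (p + q + 1)" using yw(2) unfolding Z_def eqs by (simp add: algebra_simps)
      then have "D (x - w) \<in> F (p + int (Suc r)) (p + q + 1)"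
        using yw(1) by (simp add: additive_diff[OF additive_D])
      moreover have "w \<in> Z r p q" using yw(3) Z_shift[OF r1] by blast
      then have "x - w \<in> F p (p + q)" using x subgrp_diff[OF subgrp_F] by (auto simp: Z_def)
      ultimately have "x - w \<in> Z (Suc r) p q" by (simp add: Z_def)
      moreover have "w \<in> B r p q" using yw(3) by (rule B_I1)
      then have "\<exists>y\<in>?Z2. x - (x - w) - y \<in> B r p q"
        using subgrp_zero[OF Z2] by (intro bexI[of _ 0]) (simp only: diff_0_right diff_diff_eq2 add_diff_cancel_left')
      ultimately show ?thesis by blast
    qed
    show "x \<in> {x. \<exists>y\<in>?Z2. x - y \<in> B r p q} \<longleftrightarrow> x \<in> B (Suc r) p q" if x: "x \<in> Z (Suc r) p q" for x
    proof
      assume "x \<in> {x. \<exists>y\<in>?Z2. x - y \<in> B r p q}"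
      then obtain u y w where u: "u \<in> Z r (p - int r) (q + int r - 1)" and x': "x - D u = y + D w"
        and y: "y \<in> Z (r - 1) (p + 1) (q - 1)" and w: "w \<in> Z (r - 1) (p - int r + 1) (q + int r - 2)"
        unfolding B_def by auto
      have e1: "p - int r + (q + int r - 1) = p + q - 1" and e2: "p - int r + 1 + (q + int r - 2) = p + q - 1"
        by simp_all
      have "w \<in> Z r (p - int r) (q + int r - 1)"
        using w Z_shift[OF r1, of "p - int r" "q + int r - 1"] by (auto simp: algebra_simps)
      then have uw: "u + w \<in> Z r (p - int r) (q + int r - 1)" using u subgrp_add[OF subgrp_Z] by blast
      have xy: "x = y + D (u + w)" using x' by (simp add: additive_add[OF additive_D] algebra_simps)
      \<comment> \<open>Hence \<open>D y = D x\<close>, and \<open>y\<close> inherits from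
        \<open>x\<close> the depth that membership in the next \<open>Z\<close> demands.\<close>
      have "D (D (u + w)) = 0" using uw D_D unfolding Z_def by blast
      then have "D y = D x" by (simp add: xy additive_add[OF additive_D])
      then have "y \<in> Z r (p + 1) (q - 1)"
        using x y by (simp add: Z_def algebra_simps)
      then have "y + D (u + w) \<in> B (Suc r) p q"
        using uw by (intro B_I) (simp_all add: algebra_simps)
      then show "x \<in> B (Suc r) p q" using xy by simp
    next
      assume "x \<in> B (Suc r) p q"
      then obtain y u where x': "x = y + D u" and y: "y \<in> Z r (p + 1) (q - 1)"
        and u: "u \<in> Z r (p - int r) (q + int r - 1)"
        unfolding B_def by (auto simp: algebra_simps)
      have "y \<in> B r p q" using y Z_pred[OF r1] by (intro B_I1) auto
      then show "x \<in> {x. \<exists>y\<in>?Z2. x - y \<in> B r p q}" using u x' by (auto intro!: bexI[of _ u])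
    qed
  qed
  show ?thesis
    unfolding kernel_d[OF r] image_d[OF r]
    by (rule presents_iso[OF pres prS]) (use r in simp_all)
qed

theorem spectral_sequence: "spectral_sequence E d"
  unfolding spectral_sequence_def
proof (intro allI impI conjI)
  fix r p q assume r: "2 \<le> (r::nat)"
  show "comm_group (E r p q)" by (rule presents_comm_group[OF pres[OF r]])
  show "d r p q \<in> hom (E r p q) (E r (p + int r) (q - int r + 1))" by (rule d_hom[OF r])
  show "d r (p - int r) (q + int r - 1) ` carrier (E r (p - int r) (q + int r - 1))
      \<subseteq> kernel (E r p q) (E r (p + int r) (q - int r + 1)) (d r p q)"
    unfolding kernel_d[OF r] image_d[OF r]
  proof (intro image_mono subsetI)
    fix x assume "x \<in> D ` Z r (p - int r) (q + int r - 1)"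
    then obtain u where u: "x = D u" "u \<in> Z r (p - int r) (q + int r - 1)" by blast
    have "D x = 0" using u D_D unfolding Z_def by auto
    moreover have "p - int r + int r = p" "q + int r - 1 - int r + 1 = q" by simp_all
    then have "x \<in> Z r p q" using D_Z[OF u(2)] u(1) by simp
    ultimately show "x \<in> {x \<in> Z r p q. D x \<in> B r (p + int r) (q - int r + 1)}"
      using subgrp_zero[OF subgrp_B] by simp
  qed
  show "E (Suc r) p q \<cong>
    (E r p q\<lparr>carrier := kernel (E r p q) (E r (p + int r) (q - int r + 1)) (d r p q)\<rparr>)
    Mod (d r (p - int r) (q + int r - 1) ` carrier (E r (p - int r) (q + int r - 1)))"
    by (rule page_iso[OF r])
qed

text \<open>For p < 0 the filtration does not change from p to p + 1, so all of \<open>Z\<close>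
  already counts as one step deeper and dies in \<open>B\<close>. For p \<ge> 0 > q the total degree
  is below p and the filtration is zero.\<close>

theorem first_quadrant: "first_quadrant E"
  unfolding first_quadrant_def
proof (intro allI impI)
  fix r :: nat and p q :: int assume r: "2 \<le> r" and pq: "p < 0 \<or> q < 0"
  have "x \<in> B r p q" if x: "x \<in> Z r p q" for x
  proof (cases "p < 0")
    case True
    then have "F p (p + q) = F (p + 1) (p + q)" using F_low[of p] F_low[of "p + 1"] by simp
    moreover have "p + 1 + int (r - 1) = p + int r" using r by simp
    ultimately have "x \<in> Z (r - 1) (p + 1) (q - 1)" using x by (simp add: Z_def)
    then show ?thesis by (rule B_I1)
  next
    case False
    then have "F p (p + q) = {0}" using pq by (intro F_high) simp
    then show ?thesis using x subgrp_zero[OF subgrp_B] by (auto simp: Z_def)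
  qed
  then have "e r p q x = \<one>\<^bsub>E r p q\<^esub>" if "x \<in> Z r p q" for x
    using presents_one_iff[OF pres[OF r]] that by blast
  then have "carrier (E r p q) = {\<one>\<^bsub>E r p q\<^esub>}"
    using presents_image[OF pres[OF r], of p q] subgrp_zero[OF subgrp_Z, of r p q] by auto
  then show "trivial_group (E r p q)"
    using presents_group[OF pres[OF r]] by (simp add: trivial_group_def)
qed

text \<open>The filtration of \<open>H n\<close> is by the classes of cocycles in
  \<open>F p\<close>. Once \<open>r\<close> is large, the target filtration of \<open>D\<close> is
  zero and its source filtration is everything, so the page is cocycles in \<open>F p\<close> modulo
  those in \<open>F (p + 1)\<close> and boundaries.\<close>

theorem converges_to:
  fixes H :: "nat \<Rightarrow> 'h monoid"
  assumes presH: "\<And>n. presents (k n) {x \<in> F 0 (int n). D x = 0} (D ` F 0 (int n - 1)) (H n)"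
  shows "converges_to E d H"
  unfolding converges_to_def
proof
  fix n :: nat
  define ZK where "ZK p = {x \<in> F p (int n). D x = 0}" for p
  have sub: "subgrp (ZK p)" for p
    unfolding ZK_def subgrp_def
    by (auto simp: subgrp_zero[OF subgrp_F] subgrp_diff[OF subgrp_F] additive_zero[OF additive_D]
        additive_diff[OF additive_D])
  have mono: "ZK (p + 1) \<subseteq> ZK p" for p using F_Suc by (auto simp: ZK_def)
  have F0: "F p m \<subseteq> F 0 m" for p m
    using F_low[of p m] F_mono[of 0 p m] by (cases "p \<le> 0") auto
  have le0: "ZK p \<subseteq> ZK 0" for p using F0[of p "int n"] by (auto simp: ZK_def)
  have pr: "presents (k n) (ZK 0) (D ` F 0 (int n - 1)) (H n)" unfolding ZK_def by (rule presH)
  have 0: "subgroup (k n ` ZK p) (H n)" for p by (rule presents_subgroup[OF pr sub le0])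
  have 1: "k n ` ZK (p + 1) \<subseteq> k n ` ZK p" for p by (rule image_mono[OF mono])
  have 2: "\<exists>s. k n ` ZK s = carrier (H n)" by (rule exI, rule presents_image[OF pr])
  have "int n < int n + 1" by linarith
  then have Ft: "F (int n + 1) (int n) = {0}" by (rule F_high)
  have "{x \<in> {0}. D x = 0} = {0}" using additive_zero[OF additive_D] by blast
  then have "ZK (int n + 1) = {0}" unfolding ZK_def Ft .
  then have "k n ` ZK (int n + 1) = {\<one>\<^bsub>H n\<^esub>}"
    using presents_zero[OF pr] by (simp only: image_insert image_empty)
  then have 3: "\<exists>t. k n ` ZK t = {\<one>\<^bsub>H n\<^esub>}" by (rule exI)
  have 4: "p + q = int n \<longrightarrow> (\<exists>r0\<ge>2. \<forall>r\<ge>r0.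
      (\<forall>x\<in>carrier (E r p q). d r p q x = \<one>\<^bsub>E r (p + int r) (q - int r + 1)\<^esub>) \<and>
      (\<forall>x\<in>carrier (E r (p - int r) (q + int r - 1)). d r (p - int r) (q + int r - 1) x = \<one>\<^bsub>E r p q\<^esub>) \<and>
      E r p q \<cong> (H n\<lparr>carrier := k n ` ZK p\<rparr>) Mod k n ` ZK (p + 1))" for p q
  \<comment> \<open>With r \<ge> p + 1 the source index p - r + 1 is at most 0; with r \<ge> n + 2 -
    p the target index p + r exceeds the degree n + 1.\<close>
  proof (intro impI exI[of _ "max 2 (nat (max (p + 1) (int n + 2 - p)))"] conjI allI)
    assume n: "p + q = int n"
    show "2 \<le> max 2 (nat (max (p + 1) (int n + 2 - p)))" by simp
    fix r assume "max 2 (nat (max (p + 1) (int n + 2 - p))) \<le> r"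
    then have r: "2 \<le> r" and rp: "p - int r + 1 \<le> 0" and rn: "int n + 1 < p + int r" by auto
    have Fout: "F (p + int r) (p + q + 1) = {0}" using rn n by (intro F_high) simp
    have Z_ZK: "Z r p q = ZK p" unfolding Z_def ZK_def Fout using n by simp
    show "\<forall>x\<in>carrier (E r p q). d r p q x = \<one>\<^bsub>E r (p + int r) (q - int r + 1)\<^esub>"
    proof
      fix a assume "a \<in> carrier (E r p q)"
      then obtain x where "x \<in> Z r p q" "a = e r p q x"
        using presents_image[OF pres[OF r], symmetric] by auto
      then show "d r p q a = \<one>\<^bsub>E r (p + int r) (q - int r + 1)\<^esub>"
        using d_e[OF r] presents_zero[OF pres[OF r]] Z_ZK by (simp add: ZK_def)
    qed
    have Fin: "F (p - int r + 1) m = F 0 m" "F (p - int r) m = F 0 m" for m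
      using F_low[of "p - int r + 1" m] F_low[of "p - int r" m] rp by simp_all
    have eqs: "p - int r + 1 + (q + int r - 2) = int n - 1" "p - int r + (q + int r - 1) = int n - 1"
      "p - int r + 1 + int (r - 1) = p" "p - int r + int r = p" "q + int r - 1 - int r + 1 = q"
      "int n - 1 + 1 = int n"
      using n r by simp_all
    have Zin: "Z (r - 1) (p - int r + 1) (q + int r - 2) = {u \<in> F 0 (int n - 1). D u \<in> F p (int n)}"
      "Z r (p - int r) (q + int r - 1) = {u \<in> F 0 (int n - 1). D u \<in> F p (int n)}"
      unfolding Z_def eqs Fin by simp_all
    show "\<forall>x\<in>carrier (E r (p - int r) (q + int r - 1)). d r (p - int r) (q + int r - 1) x = \<one>\<^bsub>E r p q\<^esub>"
    proof
      fix a assume "a \<in> carrier (E r (p - int r) (q + int r - 1))"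
      then obtain x where x: "x \<in> Z r (p - int r) (q + int r - 1)" "a = e r (p - int r) (q + int r - 1) x"
        using presents_image[OF pres[OF r], symmetric] by auto
      then have "D x \<in> B r p q" using Zin by (intro B_I2) simp
      moreover have "D x \<in> Z r p q" using D_Z[OF x(1)] by (simp only: eqs)
      ultimately have "e r p q (D x) = \<one>\<^bsub>E r p q\<^esub>" using presents_one_iff[OF pres[OF r]] by blast
      then show "d r (p - int r) (q + int r - 1) a = \<one>\<^bsub>E r p q\<^esub>"
        using d_e[OF r x(1)] x(2) by (simp only: eqs)
    qed
    have "presents (\<lambda>x. k n ` ZK (p + 1) #>\<^bsub>H n\<^esub> k n x) (ZK p)
        {x. \<exists>y\<in>ZK (p + 1). x - y \<in> D ` F 0 (int n - 1)} ((H n\<lparr>carrier := k n ` ZK p\<rparr>) Mod k n ` ZK (p + 1))"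
      by (rule presents_subquot[OF pr sub le0 sub mono])
    moreover have "x \<in> {x. \<exists>y\<in>ZK (p + 1). x - y \<in> D ` F 0 (int n - 1)} \<longleftrightarrow> x \<in> B r p q"
      if x: "x \<in> ZK p" for x
    proof
      assume "x \<in> {x. \<exists>y\<in>ZK (p + 1). x - y \<in> D ` F 0 (int n - 1)}"
      then obtain y u where y: "y \<in> ZK (p + 1)" and u: "u \<in> F 0 (int n - 1)" and xy: "x - y = D u" by auto
      have "D u \<in> F p (int n)"
        using x y mono[of p] subgrp_diff[OF subgrp_F] by (auto simp: xy[symmetric] ZK_def)
      moreover have "y \<in> Z (r - 1) (p + 1) (q - 1)"
        using y n by (auto simp: ZK_def Z_def subgrp_zero[OF subgrp_F])
      ultimately have "y + D u \<in> B r p q" using u Zin by (intro B_I) auto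
      then show "x \<in> B r p q" using xy by (simp add: algebra_simps)
    next
      assume "x \<in> B r p q"
      then obtain y u where xy: "x = y + D u" and y: "y \<in> Z (r - 1) (p + 1) (q - 1)"
        and u: "u \<in> F 0 (int n - 1)" unfolding B_def Zin by auto
      have "F (p + 1 + int (r - 1)) (p + q + 1) = {0}" using Fout r by simp
      then have "y \<in> ZK (p + 1)" using y n by (auto simp: Z_def ZK_def)
      then show "x \<in> {x. \<exists>y\<in>ZK (p + 1). x - y \<in> D ` F 0 (int n - 1)}" using xy u by (auto intro!: bexI[of _ y])
    qed
    ultimately show "E r p q \<cong> (H n\<lparr>carrier := k n ` ZK p\<rparr>) Mod k n ` ZK (p + 1)"
      by (rule presents_iso[OF pres[OF r, of p q, unfolded Z_ZK]])
  qed
  show "\<exists>F. (\<forall>p. subgroup (F p) (H n) \<and> F (p + 1) \<subseteq> F p) \<and> (\<exists>s. F s = carrier (H n)) \<and>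
      (\<exists>t. F t = {\<one>\<^bsub>H n\<^esub>}) \<and> (\<forall>p q. p + q = int n \<longrightarrow> (\<exists>r0\<ge>2. \<forall>r\<ge>r0.
      (\<forall>x\<in>carrier (E r p q). d r p q x = \<one>\<^bsub>E r (p + int r) (q - int r + 1)\<^esub>) \<and>
      (\<forall>x\<in>carrier (E r (p - int r) (q + int r - 1)). d r (p - int r) (q + int r - 1) x = \<one>\<^bsub>E r p q\<^esub>) \<and>
      E r p q \<cong> (H n\<lparr>carrier := F p\<rparr>) Mod F (p + 1)))"
    by (rule exI[of _ "\<lambda>p. k n ` ZK p"], intro conjI allI 0 1 2 3 4)
qed

end

end

section \<open>The column filtration of a double complex and its second page\<close>

context double_complex
begin

text \<open>Negative degrees are split off because \<open>nat\<close> would send them to degree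
  0.\<close>

definition filt :: "int \<Rightarrow> int \<Rightarrow> (nat \<Rightarrow> nat \<Rightarrow> 'x) set" where
  "filt p n = (if n < 0 then {0} else {t \<in> Tot (nat n). \<forall>i j. int i < p \<longrightarrow> t i j = 0})"

lemma filtered: "filtered_complex filt D"
proof
  show "subgrp (filt p n)" for p n
    using subgrp_Tot by (auto simp: filt_def subgrp_def)
  show "filt (p + 1) n \<subseteq> filt p n" for p n by (auto simp: filt_def)
  show "filt p n = filt 0 n" if "p \<le> 0" for p n using that by (auto simp: filt_def)
  show "filt p n = {0}" if "n < p" for p n
  proof (cases "n < 0")
    case False
    have "t = 0" if t: "t \<in> Tot (nat n)" "\<forall>i j. int i < p \<longrightarrow> t i j = 0" for t
    proof (intro ext)
      fix i j show "t i j = 0 i j"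
      proof (cases "int i < p")
        case False
        then have "i + j \<noteq> nat n" using \<open>n < p\<close> \<open>\<not> n < 0\<close> by linarith
        then show ?thesis using Tot_0[OF t(1)] by simp
      qed (use t in simp)
    qed
    then show ?thesis using False subgrp_zero[OF subgrp_Tot] by (auto simp: filt_def)
  qed (simp add: filt_def)
  show "additive D" by (rule additive_D)
  show "D t \<in> filt p (n + 1)" if "t \<in> filt p n" for t p n
  proof (cases "n < 0")
    case True
    then have "D t = 0" using that D_zero by (simp add: filt_def)
    then show ?thesis using subgrp_zero[OF subgrp_Tot] by (simp add: filt_def)
  next
    case False
    then have t: "t \<in> Tot (nat n)" "\<forall>i j. int i < p \<longrightarrow> t i j = 0" using that by (auto simp: filt_def)
    have "nat (n + 1) = Suc (nat n)" using False by simp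
    then have "D t \<in> Tot (nat (n + 1))" using D_closed[OF t(1)] by simp
    moreover have "D t i j = 0" if "int i < p" for i j
      using that t(2) by (simp add: D_def additive_zero[OF add1] additive_zero[OF add2] split: nat.split)
    ultimately show ?thesis using False by (simp add: filt_def)
  qed
  show "D (D t) = 0" if "t \<in> filt p n" for t p n
    using that D_D D_zero by (auto simp: filt_def split: if_splits)
qed

interpretation filtered_complex filt D by (rule filtered)

text \<open>Representatives for the iterated cohomology, first with respect to \<open>d2\<close> and
  then to \<open>d1\<close>: the \<open>d1\<close>-image of a \<open>d2\<close>-cocycle has to be a
  \<open>d2\<close>-boundary. In row 0 the only such boundary is 0.\<close>

definition E2_cocycles :: "nat \<Rightarrow> nat \<Rightarrow> 'x set" where
  "E2_cocycles p q = {y \<in> C p q. d2 p q y = 0 \<and>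
     (case q of 0 \<Rightarrow> d1 p q y = 0 | Suc k \<Rightarrow> \<exists>w\<in>C (Suc p) k. d1 p q y = d2 (Suc p) k w)}"

definition E2_boundaries :: "nat \<Rightarrow> nat \<Rightarrow> 'x set" where
  "E2_boundaries p q = {y. \<exists>z. (case p of 0 \<Rightarrow> z = 0 | Suc k \<Rightarrow> \<exists>x\<in>C k q. d2 k q x = 0 \<and> z = d1 k q x) \<and>
     (case q of 0 \<Rightarrow> y = z | Suc k \<Rightarrow> \<exists>w\<in>C p k. y = z + d2 p k w)}"

lemma E2_leading:
  assumes t: "t \<in> Z 2 (int p) (int q)"
  shows "t p q \<in> E2_cocycles p q"
proof -
  have tT: "t \<in> Tot (p + q)" and tz: "\<And>i j. i < p \<Longrightarrow> t i j = 0"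
    and Dz: "\<And>i j. i < Suc (Suc p) \<Longrightarrow> D t i j = 0"
    using t by (auto simp: Z_def filt_def nat_int_add split: if_splits)
  have "D t p (Suc q) = d2 p q (t p q)"
    using tz by (cases p) (simp_all add: D_def additive_zero[OF add1])
  then have "d2 p q (t p q) = 0" using Dz by simp
  moreover have "case q of 0 \<Rightarrow> d1 p q (t p q) = 0
      | Suc k \<Rightarrow> \<exists>w\<in>C (Suc p) k. d1 p q (t p q) = d2 (Suc p) k w"
  proof (cases q)
    case 0
    then show ?thesis using Dz[of "Suc p" q] by (simp add: D_Suc_0)
  next
    case (Suc k)
    have "d1 p q (t p q) = d2 (Suc p) k (- t (Suc p) k)"
      using Dz[of "Suc p" q] Suc by (simp add: D_Suc_Suc additive_minus[OF add2] eq_neg_iff_add_eq_0)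
    then show ?thesis using Suc subgrp_minus[OF subgrp_C Tot_C[OF tT]] by auto
  qed
  ultimately show ?thesis using Tot_C[OF tT] by (simp add: E2_cocycles_def)
qed

lemma filt_Tot: "t \<in> filt (int p) (int n) \<longleftrightarrow> t \<in> Tot n \<and> (\<forall>i j. i < p \<longrightarrow> t i j = 0)"
  by (auto simp: filt_def)

lemma single_filt: "x \<in> C i j \<Longrightarrow> n = int (i + j) \<Longrightarrow> p \<le> int i \<Longrightarrow> single i j x \<in> filt p n"
  by (auto simp: filt_def single_Tot) (auto simp: single_def)

text \<open>A zigzag of length two: the entry \<open>-w\<close> at (p + 1, q - 1) cancels
  \<open>d1\<close> of the entry \<open>y\<close>, and what remains of the total differential lies
  in column p + 2.\<close>

lemma E2_lift:
  assumes y: "y \<in> E2_cocycles p q"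
  shows "\<exists>t\<in>Z 2 (int p) (int q). t p q = y"
proof -
  have yC: "y \<in> C p q" and y2: "d2 p q y = 0" using y by (auto simp: E2_cocycles_def)
  have D1: "D (single p q y) = single (Suc p) q (d1 p q y)"
    using y2 by (simp add: D_single) (simp add: single_def fun_eq_iff)
  show ?thesis
  proof (cases q)
    case 0
    then have "d1 p q y = 0" using y by (simp add: E2_cocycles_def)
    then have "D (single p q y) = 0" using D1 by (simp add: single_def fun_eq_iff)
    then have "single p q y \<in> Z 2 (int p) (int q)"
      using single_filt[OF yC] subgrp_zero[OF subgrp_F] by (simp add: Z_def)
    then show ?thesis by (intro bexI[of _ "single p q y"]) (auto simp: single_apply)
  next
    case (Suc k)
    then obtain w where w: "w \<in> C (Suc p) k" "d1 p q y = d2 (Suc p) k w"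
      using y by (auto simp: E2_cocycles_def)
    let ?t = "single p q y - single (Suc p) k w"
    have "D ?t = - single (Suc (Suc p)) k (d1 (Suc p) k w)"
      using D1 w Suc by (simp add: additive_diff[OF additive_D] D_single)
    moreover have "single (Suc (Suc p)) k (d1 (Suc p) k w) \<in> filt (int p + int 2) (int p + int q + 1)"
      using d1_closed[OF w(1)] Suc by (intro single_filt) auto
    moreover have "?t \<in> filt (int p) (int p + int q)"
    proof (rule subgrp_diff[OF subgrp_F])
      show "single p q y \<in> filt (int p) (int p + int q)" by (rule single_filt[OF yC]) simp_all
      show "single (Suc p) k w \<in> filt (int p) (int p + int q)"
        by (rule single_filt[OF w(1)]) (use Suc in simp_all)
    qed
    ultimately have "?t \<in> Z 2 (int p) (int q)"
      by (simp add: Z_def subgrp_minus[OF subgrp_F])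
    moreover have "?t p q = y" by (simp add: single_def)
    ultimately show ?thesis by blast
  qed
qed

text \<open>Read off at (p, q), an element of \<open>B 2\<close> is a horizontal image of a vertical
  cocycle plus a vertical boundary. Conversely \<open>u1\<close> realises the horizontal part and
  \<open>u2\<close> the vertical part of the leading entry; subtracting \<open>D\<close> of their
  sum pushes \<open>t\<close> one filtration step deeper.\<close>

lemma B2_iff:
  assumes t: "t \<in> Z 2 (int p) (int q)"
  shows "t \<in> B 2 (int p) (int q) \<longleftrightarrow> t p q \<in> E2_boundaries p q"
proof
  assume "t \<in> B 2 (int p) (int q)"
  then obtain v u where tvu: "t = v + D u" and v: "v \<in> Z 1 (int p + 1) (int q - 1)"
    and u: "u \<in> Z 1 (int p - 1) (int q)" by (auto simp: B_def)
  have "v p q = 0" using v by (auto simp: Z_def filt_def split: if_splits)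
  then have tD: "t p q = D u p q" using tvu by simp
  show "t p q \<in> E2_boundaries p q"
  proof (cases "p + q = 0")
    case True
    then show ?thesis using tD by (auto simp: E2_boundaries_def D_0_0)
  next
    case False
    then have uT: "u \<in> Tot (nat (int p - 1 + int q))" and uz: "\<And>i j. Suc i < p \<Longrightarrow> u i j = 0"
      and Dz: "\<And>i j. i < p \<Longrightarrow> D u i j = 0"
      using u by (auto simp: Z_def filt_def split: if_splits)
    show ?thesis
    proof (cases p)
      case 0
      then show ?thesis using tD Tot_C[OF uT]
        by (cases q) (auto simp: E2_boundaries_def D_0_0 D_0_Suc intro!: bexI[of _ "u p (q - 1)"])
    next
      case (Suc k)
      have "D u k (Suc q) = d2 k q (u k q)"
        using uz Suc by (cases k) (simp_all add: D_def additive_zero[OF add1])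
      then have "d2 k q (u k q) = 0" using Dz Suc by simp
      then show ?thesis using tD Tot_C[OF uT] Suc
        by (cases q) (auto simp: E2_boundaries_def D_Suc_0 D_Suc_Suc)
    qed
  qed
next
  assume "t p q \<in> E2_boundaries p q"
  then obtain z where z: "case p of 0 \<Rightarrow> z = 0 | Suc k \<Rightarrow> \<exists>x\<in>C k q. d2 k q x = 0 \<and> z = d1 k q x"
    and zt: "case q of 0 \<Rightarrow> t p q = z | Suc k \<Rightarrow> \<exists>w\<in>C p k. t p q = z + d2 p k w"
    by (auto simp: E2_boundaries_def)
  have "\<exists>u\<in>filt (int p - 1) (int p + int q - 1). D u \<in> filt (int p) (int p + int q) \<and> D u p q = z"
  proof (cases p)
    case 0
    then show ?thesis using z subgrp_zero[OF subgrp_F] by (intro bexI[of _ 0]) (auto simp: D_zero)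
  next
    case (Suc k)
    then obtain x where x: "x \<in> C k q" "d2 k q x = 0" "z = d1 k q x" using z by auto
    have D: "D (single k q x) = single p q z"
      using x Suc by (simp add: D_single) (simp add: single_def fun_eq_iff)
    moreover have "single p q z \<in> filt (int p) (int p + int q)"
      using x Suc d1_closed by (intro single_filt) auto
    moreover have "single k q x \<in> filt (int p - 1) (int p + int q - 1)"
      using x Suc by (intro single_filt) auto
    ultimately show ?thesis by (auto simp: single_apply intro!: bexI[of _ "single k q x"])
  qed
  then obtain u1 where u1: "u1 \<in> filt (int p - 1) (int p + int q - 1)"
    "D u1 \<in> filt (int p) (int p + int q)" "D u1 p q = z" by blast
  have "\<exists>u\<in>filt (int p) (int p + int q - 1). D u p q = t p q - z"
  proof (cases q)
    case 0
    then show ?thesis using zt subgrp_zero[OF subgrp_F] by (intro bexI[of _ 0]) (auto simp: D_zero)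
  next
    case (Suc k)
    then obtain w where w: "w \<in> C p k" "t p q = z + d2 p k w" using zt by auto
    have "single p k w \<in> filt (int p) (int p + int q - 1)"
      using w Suc by (intro single_filt) auto
    moreover have "D (single p k w) p q = d2 p k w" using Suc by (simp add: D_single) (simp add: single_def)
    ultimately show ?thesis using w by auto
  qed
  then obtain u2 where u2: "u2 \<in> filt (int p) (int p + int q - 1)" "D u2 p q = t p q - z" by blast
  let ?u = "u1 + u2"
  have u2': "u2 \<in> filt (int p - 1) (int p + int q - 1)" using u2(1) F_Suc[of "int p - 1"] by auto
  have "D u2 \<in> filt (int p) (int p + int q)" using D_F[OF u2(1)] by simp
  then have Du: "D ?u \<in> filt (int p) (int p + int q)"
    using u1 subgrp_add[OF subgrp_F] by (simp add: additive_add[OF additive_D])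
  then have u: "?u \<in> Z 1 (int p - 1) (int q)"
    using subgrp_add[OF subgrp_F u1(1) u2'] by (simp add: Z_def algebra_simps)
  let ?v = "t - D ?u"
  have tF: "t \<in> filt (int p) (int (p + q))" and DtF: "D t \<in> filt (int p + 2) (int p + int q + 1)"
    using t by (auto simp: Z_def)
  have vF: "?v \<in> filt (int p) (int (p + q))" using tF Du subgrp_diff[OF subgrp_F] by simp
  \<comment> \<open>In column \<open>p\<close> the entry at \<open>q\<close> has been cancelled, and
    the other entries vanish for degree reasons.\<close>
  have vz: "?v i j = 0" if "i < Suc p" for i j
  proof (cases "i < p")
    case True
    then show ?thesis using vF by (simp only: filt_Tot)
  next
    case False
    then have i: "i = p" using that by simp
    show ?thesis
    proof (cases "j = q")
      case True
      then show ?thesis using i u1 u2 by (simp add: additive_add[OF additive_D])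
    next
      case False
      have "?v \<in> Tot (p + q)" using vF by (simp only: filt_Tot)
      then show ?thesis by (rule Tot_0) (use False i in simp)
    qed
  qed
  have "?v \<in> filt (int (Suc p)) (int (p + q))" using vF vz unfolding filt_Tot by blast
  moreover have "D ?v = D t"
    using D_D[OF subgrp_add[OF subgrp_F u1(1) u2']] by (simp add: additive_diff[OF additive_D])
  ultimately have "?v \<in> Z 1 (int p + 1) (int q - 1)"
    using DtF by (simp add: Z_def algebra_simps)
  then have "?v + D ?u \<in> B 2 (int p) (int q)" using u by (intro B_I) simp_all
  then show "t \<in> B 2 (int p) (int q)" by simp
qed

lemma E2_presents:
  assumes "presents h (E2_cocycles p q) (E2_boundaries p q) G"
  shows "presents (\<lambda>t. h (t p q)) (Z 2 (int p) (int q)) (B 2 (int p) (int q)) G"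
proof (rule presents_pull[OF assms subgrp_Z])
  show "(\<lambda>t. t p q) ` Z 2 (int p) (int q) = E2_cocycles p q"
  proof (intro equalityI subsetI)
    fix y assume "y \<in> E2_cocycles p q"
    from E2_lift[OF this] show "y \<in> (\<lambda>t. t p q) ` Z 2 (int p) (int q)"
      by (elim bexE) (rule image_eqI, simp_all)
  next
    fix y assume "y \<in> (\<lambda>t. t p q) ` Z 2 (int p) (int q)"
    then show "y \<in> E2_cocycles p q"
      by (elim imageE) (simp add: E2_leading)
  qed
qed (use B2_iff in auto)

text \<open>\<open>J\<close> encodes total cochains of one degree injectively in the type
  \<open>'y\<close>. A class of a page is then the \<open>J\<close>-image of its coset, a set over
  \<open>'y\<close>, and \<open>presents_make\<close> turns these sets into groups.\<close>

theorem spectral_sequence_exists: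
  fixes J :: "int \<Rightarrow> int \<Rightarrow> (nat \<Rightarrow> nat \<Rightarrow> 'x) \<Rightarrow> 'y" and H :: "nat \<Rightarrow> 'h monoid"
    and G :: "nat \<Rightarrow> nat \<Rightarrow> 'g monoid"
  assumes J: "\<And>p q. inj_on (J p q) (Tot (nat (p + q)))"
    and G: "\<And>p q. presents (h p q) (E2_cocycles p q) (E2_boundaries p q) (G p q)"
    and H: "\<And>n. presents (k n) {t \<in> Tot n. D t = 0} (D ` Tot_pred n) (H n)"
  shows "\<exists>(E :: nat \<Rightarrow> int \<Rightarrow> int \<Rightarrow> 'y set monoid) d. spectral_sequence E d \<and> first_quadrant E \<and>
    (\<forall>p q :: nat. E 2 (int p) (int q) \<cong> G p q) \<and> converges_to E d H"
proof -
  define e where "e r p q x = J p q ` {z \<in> Z r p q. z - x \<in> B r p q}" for r p q x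
  have eq: "e r p q x = e r p q y \<longleftrightarrow> x - y \<in> B r p q" if "x \<in> Z r p q" "y \<in> Z r p q" for r p q x y
  proof -
    have "Z r p q \<subseteq> Tot (nat (p + q))"
      using subgrp_zero[OF subgrp_Tot] by (auto simp: Z_def filt_def split: if_splits)
    then have "inj_on (J p q) (Z r p q)" using J inj_on_subset by blast
    then have "e r p q x = e r p q y \<longleftrightarrow> {z \<in> Z r p q. z - x \<in> B r p q} = {z \<in> Z r p q. z - y \<in> B r p q}"
      unfolding e_def by (intro inj_on_image_eq_iff) auto
    also have "\<dots> \<longleftrightarrow> x - y \<in> B r p q"
    proof
      assume "{z \<in> Z r p q. z - x \<in> B r p q} = {z \<in> Z r p q. z - y \<in> B r p q}"
      moreover have "x \<in> {z \<in> Z r p q. z - x \<in> B r p q}" using that subgrp_zero[OF subgrp_B] by simp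
      ultimately show "x - y \<in> B r p q" by simp
    next
      assume xy: "x - y \<in> B r p q"
      have "z - x \<in> B r p q \<longleftrightarrow> z - y \<in> B r p q" for z
      proof
        assume "z - x \<in> B r p q" then show "z - y \<in> B r p q"
          using subgrp_add[OF subgrp_B _ xy, of "z - x"] by simp
      next
        assume "z - y \<in> B r p q" then show "z - x \<in> B r p q"
          using subgrp_diff[OF subgrp_B _ xy, of "z - y"] by simp
      qed
      then show "{z \<in> Z r p q. z - x \<in> B r p q} = {z \<in> Z r p q. z - y \<in> B r p q}" by simp
    qed
    finally show ?thesis .
  qed
  define E :: "nat \<Rightarrow> int \<Rightarrow> int \<Rightarrow> 'y set monoid" where "E r p q = \<lparr>carrier = e r p q ` Z r p q,
    monoid.mult = (\<lambda>a b. e r p q (inv_into (Z r p q) (e r p q) a + inv_into (Z r p q) (e r p q) b)),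
    one = e r p q 0\<rparr>" for r p q
  have pres: "presents (e r p q) (Z r p q) (B r p q) (E r p q)" if "2 \<le> r" for r p q
    unfolding E_def by (rule presents_make[OF subgrp_Z subgrp_B eq])
  have E2: "E 2 (int p) (int q) \<cong> G p q" for p q
    using E2_presents[OF G] by (intro presents_iso[OF pres]) auto
  have "presents (k n) {x \<in> filt 0 (int n). D x = 0} (D ` filt 0 (int n - 1)) (H n)" for n
  proof -
    have "filt 0 (int n) = Tot n" by (simp add: filt_def)
    moreover have "filt 0 (int n - 1) = Tot_pred n"
      by (cases n) (simp_all add: filt_def Tot_pred_def)
    ultimately show ?thesis using H by simp
  qed
  then show ?thesis
    using spectral_sequence[of e E, OF pres] first_quadrant[of e E, OF pres] E2
      converges_to[of e E k H, OF pres] by blast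
qed

end

section \<open>Free rings and derivations\<close>

definition polys :: "'v set \<Rightarrow> ('v multiset \<Rightarrow>\<^sub>0 int) set" where
  "polys V = {p. \<forall>m\<in>Poly_Mapping.keys p. set_mset m \<subseteq> V}"

text \<open>Fixes the ring operations and leaves further record fields open, so that free rings,
  free \<Psi>-rings and their truncations are treated at once.\<close>

definition polyring :: "('a univ, 'x) ring_scheme \<Rightarrow> 'a univ set \<Rightarrow> bool" where
  "polyring P V \<longleftrightarrow> carrier P = enc ` polys V \<and> monoid.mult P = (\<lambda>a b. enc (dec a * dec b)) \<and>
     monoid.one P = enc 1 \<and> ring.zero P = enc 0 \<and> ring.add P = (\<lambda>a b. enc (dec a + dec b))"

lemma polyring_int_poly_ring: "polyring (int_poly_ring V) V"
  by (simp add: polyring_def int_poly_ring_def polys_def)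

lemma polyring_free_ring: "polyring (free_ring V) V"
  by (simp add: free_ring_def polyring_int_poly_ring)

lemma polyring_free_psi_ring: "polyring (free_psi_ring Y) {Adams i x |i x. 0 < i \<and> x \<in> Y}"
  by (simp add: polyring_def int_poly_ring_def polys_def free_psi_ring_def ring.defs Let_def)

lemma polyring_truncate: "polyring P V \<Longrightarrow> polyring (ring.truncate P) V"
  by (simp add: polyring_def ring.defs)

lemma polys_0: "0 \<in> polys V" and polys_1: "1 \<in> polys V"
  by (auto simp: polys_def)

lemma polys_uminus: "p \<in> polys V \<Longrightarrow> - p \<in> polys V"
  by (simp add: polys_def)

lemma polys_add: "p \<in> polys V \<Longrightarrow> q \<in> polys V \<Longrightarrow> p + q \<in> polys V"
  using Poly_Mapping.keys_add[of p q] by (fastforce simp: polys_def)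

lemma polys_mult: "p \<in> polys V \<Longrightarrow> q \<in> polys V \<Longrightarrow> p * q \<in> polys V"
  using Poly_Mapping.keys_mult[of p q] unfolding polys_def by fastforce

lemma polys_single: "set_mset m \<subseteq> V \<Longrightarrow> Poly_Mapping.single m k \<in> polys V"
  by (auto simp: polys_def)

lemma polys_induct [consumes 1, case_names zero add]:
  assumes p: "p \<in> polys V" and 0: "P 0"
    and add: "\<And>p m k. p \<in> polys V \<Longrightarrow> P p \<Longrightarrow> set_mset m \<subseteq> V \<Longrightarrow> P (Poly_Mapping.single m k + p)"
  shows "P p"
proof -
  let ?s = "\<lambda>K. \<Sum>m\<in>K. Poly_Mapping.single m (Poly_Mapping.lookup p m)"
  have "?s K \<in> polys V \<and> P (?s K)" if "finite K" "K \<subseteq> Poly_Mapping.keys p" for K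
    using that
  proof (induction K rule: finite_induct)
    case empty
    then show ?case using 0 by (simp add: polys_0)
  next
    case (insert m K)
    then have "set_mset m \<subseteq> V" using p by (auto simp: polys_def)
    then show ?case using insert by (simp add: add polys_add polys_single)
  qed
  moreover have "?s (Poly_Mapping.keys p) = p"
    by (rule poly_mapping_eqI)
      (simp add: Poly_Mapping.lookup_sum lookup_single when_def in_keys_iff)
  ultimately show ?thesis by (metis finite_keys order_refl)
qed

lemma polyring_carrierE:
  assumes "polyring P V" "a \<in> carrier P"
  obtains p where "a = enc p" "p \<in> polys V"
  using assms by (auto simp: polyring_def)

lemma enc_closed: "polyring P V \<Longrightarrow> p \<in> polys V \<Longrightarrow> enc p \<in> carrier P"
  by (simp add: polyring_def)

lemma gen_closed: "polyring P V \<Longrightarrow> v \<in> V \<Longrightarrow> gen v \<in> carrier P"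
  unfolding gen_def by (auto intro!: enc_closed polys_single)

lemma polyring_cring:
  assumes P: "polyring P V"
  shows "cring P"
proof -
  have add: "enc p \<oplus>\<^bsub>P\<^esub> enc q = enc (p + q)" and mult: "enc p \<otimes>\<^bsub>P\<^esub> enc q = enc (p * q)"
    and one: "\<one>\<^bsub>P\<^esub> = enc 1" and zero: "\<zero>\<^bsub>P\<^esub> = enc 0" for p q
    using P by (simp_all add: polyring_def)
  note cl = enc_closed[OF P]
  show ?thesis
  proof (rule cringI)
    show "abelian_group P"
    proof (rule abelian_groupI)
      fix x assume "x \<in> carrier P"
      then obtain p where p: "x = enc p" "p \<in> polys V" by (rule polyring_carrierE[OF P])
      show "\<exists>y\<in>carrier P. y \<oplus>\<^bsub>P\<^esub> x = \<zero>\<^bsub>P\<^esub>"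
        using p by (intro bexI[of _ "enc (- p)"]) (simp_all add: add zero cl polys_uminus)
    qed (auto elim!: polyring_carrierE[OF P] simp: add zero cl polys_0 polys_add algebra_simps)
    show "comm_monoid P"
      by (rule comm_monoidI)
        (auto elim!: polyring_carrierE[OF P] simp: mult one cl polys_1 polys_mult algebra_simps)
    show "(x \<oplus>\<^bsub>P\<^esub> y) \<otimes>\<^bsub>P\<^esub> z = x \<otimes>\<^bsub>P\<^esub> z \<oplus>\<^bsub>P\<^esub> y \<otimes>\<^bsub>P\<^esub> z"
      if "x \<in> carrier P" "y \<in> carrier P" "z \<in> carrier P" for x y z
      using that by (auto elim!: polyring_carrierE[OF P] simp: add mult algebra_simps)
  qed
qed

lemma polyring_a_inv:
  assumes P: "polyring P V" and p: "p \<in> polys V"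
  shows "\<ominus>\<^bsub>P\<^esub> enc p = enc (- p)"
proof -
  interpret P: cring P by (rule polyring_cring[OF P])
  have "enc (- p) \<oplus>\<^bsub>P\<^esub> enc p = \<zero>\<^bsub>P\<^esub>" using P by (simp add: polyring_def)
  then show ?thesis
    using P.minus_equality enc_closed[OF P] p polys_uminus by blast
qed

text \<open>Over the integers the indeterminates generate the polynomial ring: zero is 1 + (-1),
  constants are sums of 1 up to sign, and monomials are products.\<close>

lemma polyring_induct [consumes 2, case_names one gen add mult minus]:
  assumes P: "polyring P V" and u: "u \<in> carrier P"
    and one: "Q \<one>\<^bsub>P\<^esub>" and gen: "\<And>v. v \<in> V \<Longrightarrow> Q (gen v)"
    and add: "\<And>a b. a \<in> carrier P \<Longrightarrow> b \<in> carrier P \<Longrightarrow> Q a \<Longrightarrow> Q b \<Longrightarrow> Q (a \<oplus>\<^bsub>P\<^esub> b)"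
    and mult: "\<And>a b. a \<in> carrier P \<Longrightarrow> b \<in> carrier P \<Longrightarrow> Q a \<Longrightarrow> Q b \<Longrightarrow> Q (a \<otimes>\<^bsub>P\<^esub> b)"
    and minus: "\<And>a. a \<in> carrier P \<Longrightarrow> Q a \<Longrightarrow> Q (\<ominus>\<^bsub>P\<^esub> a)"
  shows "Q u"
proof -
  have add': "Q (enc (p + q))" if "p \<in> polys V" "q \<in> polys V" "Q (enc p)" "Q (enc q)" for p q
    using add[of "enc p" "enc q"] that P enc_closed[OF P] by (simp add: polyring_def)
  have mult': "Q (enc (p * q))" if "p \<in> polys V" "q \<in> polys V" "Q (enc p)" "Q (enc q)" for p q
    using mult[of "enc p" "enc q"] that P enc_closed[OF P] by (simp add: polyring_def)
  have minus': "Q (enc (- p))" if "p \<in> polys V" "Q (enc p)" for p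
    using minus[of "enc p"] that enc_closed[OF P] polyring_a_inv[OF P] by simp
  have one': "Q (enc 1)" using one P by (simp add: polyring_def)
  have zero': "Q (enc 0)"
    using add'[OF polys_1 polys_uminus[OF polys_1] one' minus'[OF polys_1 one']] by simp
  have nat': "Q (enc (Poly_Mapping.single {#} (int n)))" for n
  proof (induction n)
    case (Suc n)
    have "Poly_Mapping.single {#} (int (Suc n)) = Poly_Mapping.single ({#} :: 'a univ multiset) 1 + Poly_Mapping.single {#} (int n)"
      by (simp only: single_add[symmetric] of_nat_Suc add.commute)
    moreover have "Q (enc (Poly_Mapping.single {#} 1 + Poly_Mapping.single {#} (int n)))"
      by (rule add'[OF polys_single polys_single _ Suc]) (use one' in simp_all)
    ultimately show ?case by (simp only:)
  qed (simp add: zero')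
  have const: "Q (enc (Poly_Mapping.single {#} k))" for k :: int
  proof (cases "0 \<le> k")
    case True
    then show ?thesis using nat'[of "nat k"] by simp
  next
    case False
    then show ?thesis using minus'[OF polys_single nat'[of "nat (- k)"]] by (simp add: single_uminus)
  qed
  have mon: "Q (enc (Poly_Mapping.single m k))" if "set_mset m \<subseteq> V" for m k
    using that
  proof (induction m)
    case (add v m)
    have "Q (enc (Poly_Mapping.single {#v#} 1 * Poly_Mapping.single m k))"
      using add gen[of v] by (intro mult') (auto simp: polys_single gen_def)
    then show ?case by (simp add: mult_single)
  qed (simp add: const)
  have "Q (enc p)" if "p \<in> polys V" for p
    using that by (induction rule: polys_induct) (auto intro!: add' mon simp: zero' polys_single)
  then show ?thesis using u by (auto elim!: polyring_carrierE[OF P])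
qed

lemma ring_hom_polyring_eq:
  assumes P: "polyring P V" and B: "cring B" and f: "f \<in> ring_hom P B" and g: "g \<in> ring_hom P B"
    and eq: "\<And>v. v \<in> V \<Longrightarrow> f (gen v) = g (gen v)" and u: "u \<in> carrier P"
  shows "f u = g u"
proof -
  interpret f: ring_hom_cring P B f
    by (intro ring_hom_cring.intro ring_hom_cring_axioms.intro polyring_cring[OF P] B f)
  interpret g: ring_hom_cring P B g
    by (intro ring_hom_cring.intro ring_hom_cring_axioms.intro polyring_cring[OF P] B g)
  show ?thesis
    using P u by (induction rule: polyring_induct) (simp_all add: eq)
qed

section \<open>Evaluation of polynomials in a commutative ring\<close>

context
  fixes A :: "('b, 'x) ring_scheme" (structure) and V :: "'a univ set" and h :: "'a univ \<Rightarrow> 'b"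
  assumes A: "cring A" and h: "h \<in> V \<rightarrow> carrier A"
begin

interpretation A: cring A by (rule A)

definition mon :: "'a univ multiset \<Rightarrow> 'b" where
  "mon m = (\<Otimes>v\<in>set_mset m. h v [^] count m v)"

lemma mon_superset:
  "finite W \<Longrightarrow> set_mset m \<subseteq> W \<Longrightarrow> W \<subseteq> V \<Longrightarrow> mon m = (\<Otimes>v\<in>W. h v [^] count m v)"
  unfolding mon_def using h
  by (intro A.finprod_mono_neutral_cong_left) (auto simp: not_in_iff)

lemma mon_closed: "set_mset m \<subseteq> V \<Longrightarrow> mon m \<in> carrier A"
  unfolding mon_def using h by (intro A.finprod_closed) auto

lemma mon_plus: "set_mset m \<subseteq> V \<Longrightarrow> set_mset n \<subseteq> V \<Longrightarrow> mon (m + n) = mon m \<otimes> mon n"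
proof -
  assume m: "set_mset m \<subseteq> V" "set_mset n \<subseteq> V"
  let ?W = "set_mset m \<union> set_mset n"
  have W: "h v \<in> carrier A" if "v \<in># m \<or> v \<in># n" for v using h m that by auto
  have "mon (m + n) = (\<Otimes>v\<in>?W. h v [^] count (m + n) v)"
    using m by (intro mon_superset) auto
  also have "\<dots> = (\<Otimes>v\<in>?W. h v [^] count m v \<otimes> h v [^] count n v)"
    by (intro A.finprod_cong') (auto simp: A.nat_pow_mult W)
  also have "\<dots> = (\<Otimes>v\<in>?W. h v [^] count m v) \<otimes> (\<Otimes>v\<in>?W. h v [^] count n v)"
    by (intro A.finprod_multf) (auto simp: W)
  also have "\<dots> = mon m \<otimes> mon n"
    using m by (simp add: mon_superset[of ?W m] mon_superset[of ?W n])
  finally show ?thesis .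
qed

definition ev :: "('a univ multiset \<Rightarrow>\<^sub>0 int) \<Rightarrow> 'b" where
  "ev p = (\<Oplus>m\<in>Poly_Mapping.keys p. [Poly_Mapping.lookup p m] \<cdot> mon m)"

lemma poly_ev_ev: "poly_ev A h (enc p) = ev p"
  by (simp add: poly_ev_def ev_def mon_def)

lemma ev_superset:
  "finite T \<Longrightarrow> Poly_Mapping.keys p \<subseteq> T \<Longrightarrow> (\<And>m. m \<in> T \<Longrightarrow> set_mset m \<subseteq> V) \<Longrightarrow>
    ev p = (\<Oplus>m\<in>T. [Poly_Mapping.lookup p m] \<cdot> mon m)"
proof -
  assume T: "finite T" "Poly_Mapping.keys p \<subseteq> T" "\<And>m. m \<in> T \<Longrightarrow> set_mset m \<subseteq> V"
  have "[(0::int)] \<cdot> x = \<zero>" for x by (simp add: add_pow_def)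
  then show ?thesis
    unfolding ev_def using T
    by (intro A.add.finprod_mono_neutral_cong_left) (auto simp: mon_closed in_keys_iff)
qed

lemma ev_closed: "p \<in> polys V \<Longrightarrow> ev p \<in> carrier A"
  unfolding ev_def by (intro A.finsum_closed) (auto simp: polys_def mon_closed)

lemma ev_add: "p \<in> polys V \<Longrightarrow> q \<in> polys V \<Longrightarrow> ev (p + q) = ev p \<oplus> ev q"
proof -
  assume pq: "p \<in> polys V" "q \<in> polys V"
  let ?T = "Poly_Mapping.keys p \<union> Poly_Mapping.keys q"
  have T: "\<And>m. m \<in> ?T \<Longrightarrow> set_mset m \<subseteq> V" using pq by (auto simp: polys_def)
  have "ev (p + q) = (\<Oplus>m\<in>?T. [Poly_Mapping.lookup (p + q) m] \<cdot> mon m)"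
    using T Poly_Mapping.keys_add[of p q] by (intro ev_superset) auto
  also have "\<dots> = (\<Oplus>m\<in>?T. [Poly_Mapping.lookup p m] \<cdot> mon m \<oplus> [Poly_Mapping.lookup q m] \<cdot> mon m)"
    using T by (intro A.add.finprod_cong') (auto simp: lookup_add A.add.int_pow_mult mon_closed)
  also have "\<dots> = (\<Oplus>m\<in>?T. [Poly_Mapping.lookup p m] \<cdot> mon m) \<oplus> (\<Oplus>m\<in>?T. [Poly_Mapping.lookup q m] \<cdot> mon m)"
    using T by (intro A.finsum_addf) (auto simp: mon_closed)
  also have "\<dots> = ev p \<oplus> ev q" 
  proof -
    have "ev p = (\<Oplus>m\<in>?T. [Poly_Mapping.lookup p m] \<cdot> mon m)" by (rule ev_superset[OF _ _ T]) auto
    moreover have "ev q = (\<Oplus>m\<in>?T. [Poly_Mapping.lookup q m] \<cdot> mon m)"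
      by (rule ev_superset[OF _ _ T]) auto
    ultimately show ?thesis by simp
  qed
  finally show ?thesis .
qed

lemma ev_single: "set_mset m \<subseteq> V \<Longrightarrow> ev (Poly_Mapping.single m k) = [k] \<cdot> mon m"
  using ev_superset[of "{m}" "Poly_Mapping.single m k"] mon_closed[of m]
  by (auto simp: A.finsum_singleton)

lemma ev_0: "ev 0 = \<zero>"
  by (simp add: ev_def)

lemma ev_single_mult:
  assumes m: "set_mset m \<subseteq> V" and q: "q \<in> polys V"
  shows "ev (Poly_Mapping.single m k * q) = ev (Poly_Mapping.single m k) \<otimes> ev q"
  using q
proof (induction rule: polys_induct)
  case zero
  then show ?case using ev_closed[OF polys_single[OF m]] by (simp add: ev_0)
next
  case (add q n l)
  have mn: "set_mset (m + n) \<subseteq> V" using m add by auto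
  have "ev (Poly_Mapping.single (m + n) (k * l)) = ev (Poly_Mapping.single m k) \<otimes> ev (Poly_Mapping.single n l)"
    using m add mn
    by (simp add: ev_single mon_plus mon_closed A.add_pow_ldistr_int A.add_pow_rdistr_int
        A.add.int_pow_pow mult.commute)
  moreover have "Poly_Mapping.single m k * (Poly_Mapping.single n l + q) =
      Poly_Mapping.single (m + n) (k * l) + Poly_Mapping.single m k * q"
    by (simp add: distrib_left mult_single)
  ultimately show ?case
    using add m mn by (simp add: ev_add polys_single polys_mult ev_closed A.r_distr)
qed

lemma ev_mult:
  assumes p: "p \<in> polys V" and q: "q \<in> polys V"
  shows "ev (p * q) = ev p \<otimes> ev q"
  using p
proof (induction rule: polys_induct)
  case zero
  then show ?case using ev_closed[OF q] by (simp add: ev_0)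
next
  case (add p m k)
  then show ?case
    using q by (simp add: distrib_right ev_add ev_single_mult polys_single polys_mult ev_closed A.l_distr)
qed

lemma ev_1: "ev 1 = \<one>"
  using ev_single[of "{#}" 1] by (simp add: mon_def)

lemma poly_ev_hom:
  assumes P: "polyring P V"
  shows "poly_ev A h \<in> ring_hom P A"
proof (rule ring_hom_memI)
  show "poly_ev A h \<one>\<^bsub>P\<^esub> = \<one>" using P by (simp add: polyring_def poly_ev_ev ev_1)
  fix x y assume "x \<in> carrier P" "y \<in> carrier P"
  then obtain p q where "x = enc p" "p \<in> polys V" "y = enc q" "q \<in> polys V"
    by (auto elim!: polyring_carrierE[OF P])
  moreover have "enc p \<oplus>\<^bsub>P\<^esub> enc q = enc (p + q)" "enc p \<otimes>\<^bsub>P\<^esub> enc q = enc (p * q)" for p q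
    using P by (simp_all add: polyring_def)
  ultimately show "poly_ev A h (x \<otimes>\<^bsub>P\<^esub> y) = poly_ev A h x \<otimes> poly_ev A h y"
    and "poly_ev A h (x \<oplus>\<^bsub>P\<^esub> y) = poly_ev A h x \<oplus> poly_ev A h y"
    by (simp_all add: poly_ev_ev ev_add ev_mult)
next
  fix x assume "x \<in> carrier P"
  then show "poly_ev A h x \<in> carrier A"
    by (auto elim!: polyring_carrierE[OF P] simp: poly_ev_ev ev_closed)
qed

lemma poly_ev_gen: "v \<in> V \<Longrightarrow> poly_ev A h (gen v) = h v"
proof -
  assume v: "v \<in> V"
  then have hv: "h v \<in> carrier A" using h by auto
  then have m: "mon {#v#} = h v" by (simp add: mon_def)
  have "poly_ev A h (gen v) = [(1::int)] \<cdot> mon {#v#}"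
    unfolding gen_def poly_ev_ev by (rule ev_single) (use v in simp)
  then show ?thesis using m hv A.add.int_pow_1[of "h v"] by simp
qed

end

lemma ring_hom_comp_mem: "f \<in> ring_hom A B \<Longrightarrow> g \<in> ring_hom B C \<Longrightarrow> (\<lambda>x. g (f x)) \<in> ring_hom A C"
  by (auto simp: ring_hom_def Pi_iff)

text \<open>A module whose group is a subgroup of a type-class group, so that sums of derivations
  are pointwise sums of functions.\<close>

locale ring_action = cring R for R :: "('r, 'x) ring_scheme" (structure) +
  fixes N :: "'w::ab_group_add set" and act :: "'r \<Rightarrow> 'w \<Rightarrow> 'w"
  assumes subgrp_N: "subgrp N"
    and act_closed: "r \<in> carrier R \<Longrightarrow> x \<in> N \<Longrightarrow> act r x \<in> N"
    and act_add: "r \<in> carrier R \<Longrightarrow> x \<in> N \<Longrightarrow> y \<in> N \<Longrightarrow> act r (x + y) = act r x + act r y"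
    and act_add': "r \<in> carrier R \<Longrightarrow> s \<in> carrier R \<Longrightarrow> x \<in> N \<Longrightarrow> act (r \<oplus> s) x = act r x + act s x"
    and act_mult: "r \<in> carrier R \<Longrightarrow> s \<in> carrier R \<Longrightarrow> x \<in> N \<Longrightarrow> act (r \<otimes> s) x = act r (act s x)"
    and act_one: "x \<in> N \<Longrightarrow> act \<one> x = x"
begin

lemma act_zero: "r \<in> carrier R \<Longrightarrow> act r 0 = 0"
  using act_add[of r 0 0] subgrp_zero[OF subgrp_N] by simp

lemma act_minus: "r \<in> carrier R \<Longrightarrow> x \<in> N \<Longrightarrow> act r (- x) = - act r x"
  using act_add[of r x "- x"] subgrp_minus[OF subgrp_N] act_zero[of r]
  by (simp add: eq_neg_iff_add_eq_0 add.commute)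

lemma act_diff: "r \<in> carrier R \<Longrightarrow> x \<in> N \<Longrightarrow> y \<in> N \<Longrightarrow> act r (x - y) = act r x - act r y"
  using act_add[of r x "- y"] subgrp_minus[OF subgrp_N] act_minus[of r y] by simp

text \<open>Derivations are extended by 0 rather than by \<open>undefined\<close>, which makes them
  a subgroup of a function type.\<close>

definition Der :: "('s, 'y) ring_scheme \<Rightarrow> ('s \<Rightarrow> 'r) \<Rightarrow> ('s \<Rightarrow> 'w) set" where
  "Der S g = {d. (\<forall>u. u \<notin> carrier S \<longrightarrow> d u = 0) \<and> (\<forall>u\<in>carrier S. d u \<in> N) \<and>
     (\<forall>u\<in>carrier S. \<forall>v\<in>carrier S. d (u \<oplus>\<^bsub>S\<^esub> v) = d u + d v) \<and>
     (\<forall>u\<in>carrier S. \<forall>v\<in>carrier S. d (u \<otimes>\<^bsub>S\<^esub> v) = act (g u) (d v) + act (g v) (d u))}"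

lemma DerD:
  assumes "d \<in> Der S g"
  shows "u \<notin> carrier S \<Longrightarrow> d u = 0" and "u \<in> carrier S \<Longrightarrow> d u \<in> N"
    and "u \<in> carrier S \<Longrightarrow> v \<in> carrier S \<Longrightarrow> d (u \<oplus>\<^bsub>S\<^esub> v) = d u + d v"
    and "u \<in> carrier S \<Longrightarrow> v \<in> carrier S \<Longrightarrow> d (u \<otimes>\<^bsub>S\<^esub> v) = act (g u) (d v) + act (g v) (d u)"
  using assms by (auto simp: Der_def)

lemma Der_cong: "(\<And>u. u \<in> carrier S \<Longrightarrow> g u = g' u) \<Longrightarrow> Der S g = Der S g'"
  by (auto simp: Der_def)

lemma subgrp_Der: "(\<And>u. u \<in> carrier S \<Longrightarrow> g u \<in> carrier R) \<Longrightarrow> subgrp (Der S g)"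
  unfolding subgrp_def Der_def
  by (auto simp: subgrp_zero[OF subgrp_N] subgrp_diff[OF subgrp_N] act_zero act_diff)

lemma Der_comp:
  assumes T: "cring T" and d: "d \<in> Der S g" and f: "f \<in> ring_hom T S"
    and g: "\<And>u. u \<in> carrier T \<Longrightarrow> g (f u) = g' u"
  shows "(\<lambda>u. if u \<in> carrier T then d (f u) else 0) \<in> Der T g'"
proof -
  interpret T: cring T by (rule T)
  show ?thesis
    unfolding Der_def
    using DerD[OF d] g ring_hom_closed[OF f] ring_hom_add[OF f] ring_hom_mult[OF f] by auto
qed

lemma Der_eq:
  assumes P: "polyring P V" and g: "g \<in> ring_hom P R"
    and d: "d \<in> Der P g" and d': "d' \<in> Der P g" and eq: "\<And>v. v \<in> V \<Longrightarrow> d (gen v) = d' (gen v)"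
  shows "d = d'"
proof
  fix u
  interpret P: cring P by (rule polyring_cring[OF P])
  \<comment> \<open>Applying the product rule to 1 = 1 1 gives d(1) = d(1) + d(1).\<close>
  have one: "d \<one>\<^bsub>P\<^esub> = 0" if "d \<in> Der P g" for d
    using DerD(4)[OF that, of "\<one>\<^bsub>P\<^esub>" "\<one>\<^bsub>P\<^esub>"] DerD(2)[OF that, of "\<one>\<^bsub>P\<^esub>"] ring_hom_one[OF g]
    by (simp add: act_one)
  have zero: "d \<zero>\<^bsub>P\<^esub> = 0" if "d \<in> Der P g" for d
    using DerD(3)[OF that, of "\<zero>\<^bsub>P\<^esub>" "\<zero>\<^bsub>P\<^esub>"] by simp
  have minus: "d (\<ominus>\<^bsub>P\<^esub> a) = - d a" if "d \<in> Der P g" "a \<in> carrier P" for d a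
    using DerD(3)[OF that(1), of a "\<ominus>\<^bsub>P\<^esub> a"] that zero[OF that(1)]
    by (simp add: P.r_neg eq_neg_iff_add_eq_0 add.commute)
  show "d u = d' u"
  proof (cases "u \<in> carrier P")
    case True
    from P True show ?thesis
      by (induction rule: polyring_induct)
        (simp_all add: eq one[OF d] one[OF d'] minus[OF d] minus[OF d'] DerD(3,4)[OF d] DerD(3,4)[OF d'])
  next
    case False
    then show ?thesis using DerD(1)[OF d] DerD(1)[OF d'] by simp
  qed
qed

text \<open>The square-zero extension \<open>R \<oplus> N\<close>: a derivation into \<open>N\<close> is a section of its projection to \<open>R\<close>.\<close>

definition sqz :: "('r \<times> 'w) ring" where
  "sqz = \<lparr>carrier = carrier R \<times> N,
     monoid.mult = (\<lambda>a b. (fst a \<otimes> fst b, act (fst a) (snd b) + act (fst b) (snd a))),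
     monoid.one = (\<one>, 0), ring.zero = (\<zero>, 0), ring.add = (\<lambda>a b. (fst a \<oplus> fst b, snd a + snd b))\<rparr>"

lemma sqz_cring: "cring sqz"
proof (rule cringI)
  note N = subgrp_zero[OF subgrp_N] subgrp_add[OF subgrp_N] subgrp_minus[OF subgrp_N]
  show "abelian_group sqz"
  proof (rule abelian_groupI)
    fix x assume "x \<in> carrier sqz"
    then show "\<exists>y\<in>carrier sqz. y \<oplus>\<^bsub>sqz\<^esub> x = \<zero>\<^bsub>sqz\<^esub>"
      by (intro bexI[of _ "(\<ominus> fst x, - snd x)"]) (auto simp: sqz_def N l_neg)
  qed (auto simp: sqz_def N a_ac algebra_simps)
  show "comm_monoid sqz"
    by (rule comm_monoidI)
      (auto simp: sqz_def N act_closed act_zero act_one act_add act_mult[symmetric] m_ac algebra_simps)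
  show "(x \<oplus>\<^bsub>sqz\<^esub> y) \<otimes>\<^bsub>sqz\<^esub> z = x \<otimes>\<^bsub>sqz\<^esub> z \<oplus>\<^bsub>sqz\<^esub> y \<otimes>\<^bsub>sqz\<^esub> z"
    if "x \<in> carrier sqz" "y \<in> carrier sqz" "z \<in> carrier sqz" for x y z
    using that by (auto simp: sqz_def N act_add act_add' l_distr algebra_simps)
qed

text \<open>A derivation with prescribed values is the second component of the ring homomorphism to
  the square-zero extension that sends \<open>v\<close> to \<open>(g (gen v), h v)\<close>; its
  first component is \<open>g\<close>, because it is so on the indeterminates.\<close>

lemma Der_exists:
  assumes P: "polyring P V" and g: "g \<in> ring_hom P R" and h: "\<And>v. v \<in> V \<Longrightarrow> h v \<in> N"
  shows "\<exists>d\<in>Der P g. \<forall>v\<in>V. d (gen v) = h v"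
proof -
  interpret P: cring P by (rule polyring_cring[OF P])
  let ?h = "\<lambda>v. (g (gen v), h v)"
  define \<phi> where "\<phi> = poly_ev sqz ?h"
  have h': "?h \<in> V \<rightarrow> carrier sqz"
    using h ring_hom_closed[OF g gen_closed[OF P]] by (auto simp: sqz_def)
  have \<phi>: "\<phi> \<in> ring_hom P sqz" unfolding \<phi>_def by (rule poly_ev_hom[OF sqz_cring h' P])
  have \<phi>_gen: "\<phi> (gen v) = (g (gen v), h v)" if "v \<in> V" for v
    unfolding \<phi>_def using poly_ev_gen[OF sqz_cring h' that] by simp
  have fst: "fst \<in> ring_hom sqz R"
    by (auto simp: ring_hom_def sqz_def)
  have fst\<phi>: "fst (\<phi> u) = g u" if "u \<in> carrier P" for u
    by (rule ring_hom_polyring_eq[OF P _ ring_hom_comp_mem[OF \<phi> fst] g _ that])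
      (simp_all add: is_cring \<phi>_gen)
  have "(\<lambda>u. if u \<in> carrier P then snd (\<phi> u) else 0) \<in> Der P g"
    unfolding Der_def
    using ring_hom_closed[OF \<phi>] ring_hom_add[OF \<phi>] ring_hom_mult[OF \<phi>] fst\<phi>
    by (auto simp: sqz_def mem_Times_iff)
  then show ?thesis
    by (rule bexI[rotated]) (use \<phi>_gen gen_closed[OF P] in auto)
qed

end

section \<open>The two comonads\<close>

text \<open>What the two comonads share. Both come from free constructions on sets, so
  \<open>Ar\<close> is functorial for arbitrary maps of carriers, and only the naturality of the
  counit asks for a homomorphism. Maps are compared on carriers.\<close>

locale counital_functor =
  fixes G :: "('u, 'x) ring_comonad"
    and obj :: "('u, 'x) ring_scheme \<Rightarrow> bool"
    and arr :: "('u, 'x) ring_scheme \<Rightarrow> ('u, 'x) ring_scheme \<Rightarrow> ('u \<Rightarrow> 'u) \<Rightarrow> bool"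
  assumes obj_Ob: "obj A \<Longrightarrow> obj (Ob G A)"
    and arr_Ar: "obj A \<Longrightarrow> obj B \<Longrightarrow> f \<in> carrier A \<rightarrow> carrier B \<Longrightarrow> arr (Ob G A) (Ob G B) (Ar G B f)"
    and arr_Eps: "obj A \<Longrightarrow> arr (Ob G A) A (Eps G A)"
    and arr_closed: "arr A B f \<Longrightarrow> f \<in> carrier A \<rightarrow> carrier B"
    and arr_id: "obj A \<Longrightarrow> arr A A (\<lambda>x. x)"
    and arr_comp: "arr A B f \<Longrightarrow> arr B C g \<Longrightarrow> arr A C (\<lambda>x. g (f x))"
    and Ar_comp: "obj A \<Longrightarrow> obj B \<Longrightarrow> obj C \<Longrightarrow> f \<in> carrier A \<rightarrow> carrier B \<Longrightarrow>
      g \<in> carrier B \<rightarrow> carrier C \<Longrightarrow> (\<And>x. x \<in> carrier A \<Longrightarrow> g (f x) = k x) \<Longrightarrow>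
      u \<in> carrier (Ob G A) \<Longrightarrow> Ar G C g (Ar G B f u) = Ar G C k u"
    and Ar_id: "obj A \<Longrightarrow> (\<And>x. x \<in> carrier A \<Longrightarrow> f x = x) \<Longrightarrow> u \<in> carrier (Ob G A) \<Longrightarrow> Ar G A f u = u"
    and Eps_nat: "obj A \<Longrightarrow> obj B \<Longrightarrow> arr A B f \<Longrightarrow> u \<in> carrier (Ob G A) \<Longrightarrow>
      Eps G B (Ar G B f u) = f (Eps G A u)"
begin

abbreviation pw :: "nat \<Rightarrow> ('u, 'x) ring_scheme \<Rightarrow> ('u, 'x) ring_scheme" where
  "pw n A \<equiv> (Ob G ^^ n) A"

lemma obj_pw: "obj A \<Longrightarrow> obj (pw n A)"
  by (induction n) (simp_all add: obj_Ob)

lemma Ar_closed: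
  "obj A \<Longrightarrow> obj B \<Longrightarrow> f \<in> carrier A \<rightarrow> carrier B \<Longrightarrow> Ar G B f \<in> carrier (Ob G A) \<rightarrow> carrier (Ob G B)"
  by (rule arr_closed[OF arr_Ar])

lemma Ar_pow_closed:
  "obj A \<Longrightarrow> obj B \<Longrightarrow> f \<in> carrier A \<rightarrow> carrier B \<Longrightarrow> Ar_pow G n B f \<in> carrier (pw n A) \<rightarrow> carrier (pw n B)"
  by (induction n) (simp_all add: Ar_closed obj_pw)

text \<open>The outermost free functor turns any map of sets into a homomorphism. This lets the
  non-homomorphism x \<mapsto> x_1 act on the groups Der(G^(q+1) A, M^f).\<close>

lemma arr_Ar_pow_Suc:
  "obj A \<Longrightarrow> obj B \<Longrightarrow> f \<in> carrier A \<rightarrow> carrier B \<Longrightarrow>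
    arr (pw (Suc n) A) (pw (Suc n) B) (Ar_pow G (Suc n) B f)"
  by (simp add: arr_Ar obj_pw Ar_pow_closed)

lemma arr_Ar_pow: "obj A \<Longrightarrow> obj B \<Longrightarrow> arr A B f \<Longrightarrow> arr (pw n A) (pw n B) (Ar_pow G n B f)"
  using arr_Ar_pow_Suc[of A B f "n - 1"] arr_closed[of A B f] by (cases n) auto

lemma Ar_pow_comp:
  assumes "obj A" "obj B" "obj C" "f \<in> carrier A \<rightarrow> carrier B" "g \<in> carrier B \<rightarrow> carrier C"
    and "\<And>x. x \<in> carrier A \<Longrightarrow> g (f x) = k x"
  shows "u \<in> carrier (pw n A) \<Longrightarrow> Ar_pow G n C g (Ar_pow G n B f u) = Ar_pow G n C k u"
proof (induction n arbitrary: u)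
  case (Suc n)
  then show ?case
    using Ar_comp[OF obj_pw[OF assms(1), of n] obj_pw[OF assms(2), of n] obj_pw[OF assms(3), of n]
        Ar_pow_closed[OF assms(1,2,4)] Ar_pow_closed[OF assms(2,3,5)], of "Ar_pow G n C k" u]
    by simp
qed (simp add: assms)

lemma Ar_pow_id:
  assumes "obj A" "\<And>x. x \<in> carrier A \<Longrightarrow> f x = x"
  shows "u \<in> carrier (pw n A) \<Longrightarrow> Ar_pow G n A f u = u"
  by (induction n arbitrary: u) (simp_all add: assms Ar_id obj_pw)

lemma pw_add: "i \<le> n \<Longrightarrow> pw i (pw (n - i) A) = pw n A"
  using funpow_add[of i "n - i" "Ob G"] by (metis comp_apply le_add_diff_inverse)

lemma face_0: "face G A n 0 = Eps G (pw n A)"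
  by (simp add: face_def)

lemma face_Suc: "i \<le> n \<Longrightarrow> face G A (Suc n) (Suc i) = Ar G (pw n A) (face G A n i)"
  by (simp add: face_def pw_add)

lemma face_last: "face G A n n = Ar_pow G n A (Eps G A)"
  by (simp add: face_def)

lemma face_Ob: "i \<le> n \<Longrightarrow> face G (Ob G A) n i = face G A (Suc n) i"
  by (simp add: face_def Suc_diff_le funpow_swap1)

lemma arr_face: "obj A \<Longrightarrow> i \<le> n \<Longrightarrow> arr (pw (Suc n) A) (pw n A) (face G A n i)"
proof (induction n arbitrary: i)
  case 0
  then show ?case by (simp add: face_0 arr_Eps)
next
  case (Suc n)
  show ?case
  proof (cases i)
    case 0
    then show ?thesis using Suc arr_Eps[of "pw (Suc n) A"] by (simp add: face_0 obj_Ob obj_pw)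
  next
    case (Suc k)
    then have k: "k \<le> n" using Suc.prems by simp
    have "arr (Ob G (pw (Suc n) A)) (Ob G (pw n A)) (Ar G (pw n A) (face G A n k))"
      by (rule arr_Ar[OF obj_pw[OF Suc.prems(1)] obj_pw[OF Suc.prems(1)]
            arr_closed[OF Suc.IH[OF Suc.prems(1) k]]])
    then show ?thesis using Suc k by (simp add: face_Suc)
  qed
qed

lemma face_closed: "obj A \<Longrightarrow> i \<le> n \<Longrightarrow> u \<in> carrier (pw (Suc n) A) \<Longrightarrow> face G A n i u \<in> carrier (pw n A)"
  using arr_closed[OF arr_face] by blast

text \<open>The simplicial identities. For i = 0 this is naturality of the counit at the face j - 1;
  for i > 0 the functor is applied to the identity one degree lower.\<close>

lemma face_face:
  assumes "obj A"
  shows "i < j \<Longrightarrow> j \<le> Suc n \<Longrightarrow> u \<in> carrier (pw (Suc (Suc n)) A) \<Longrightarrow>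
    face G A n i (face G A (Suc n) j u) = face G A n (j - 1) (face G A (Suc n) i u)"
proof (induction n arbitrary: i j u)
  case 0
  then have ij: "i = 0" "j = Suc 0" by auto
  show ?case
    unfolding ij using Eps_nat[OF obj_pw[OF assms] obj_pw[OF assms] arr_face[OF assms, of 0 0], of u] 0(3)
    by (simp add: face_0 face_Suc)
next
  case (Suc n)
  obtain l where j: "j = Suc l" "l \<le> Suc n" using Suc.prems by (cases j) auto
  show ?case
  proof (cases i)
    case 0
    then show ?thesis
      using Eps_nat[OF obj_pw[OF assms] obj_pw[OF assms] arr_face[OF assms j(2)], of u] Suc.prems j
      by (simp add: face_0 face_Suc)
  next
    case (Suc k)
    then have kl: "k < l" "k \<le> n" "k \<le> Suc n" "l - 1 \<le> n" "l = Suc (l - 1)" using Suc.prems j by auto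
    let ?f = "face G A"
    have u: "u \<in> carrier (Ob G (pw (Suc (Suc n)) A))" using Suc.prems by simp
    have cl: "?f n i \<in> carrier (pw (Suc n) A) \<rightarrow> carrier (pw n A)" if "i \<le> n" for i n
      using face_closed[OF assms that] by blast
    have "Ar G (pw n A) (?f n k) (Ar G (pw (Suc n) A) (?f (Suc n) l) u) =
        Ar G (pw n A) (\<lambda>x. ?f n (l - 1) (?f (Suc n) k x)) u"
      by (rule Ar_comp[OF obj_pw[OF assms] obj_pw[OF assms] obj_pw[OF assms] cl[OF j(2)] cl[OF kl(2)] _ u])
        (use Suc.IH[OF kl(1) j(2)] in simp)
    also have "\<dots> = Ar G (pw n A) (?f n (l - 1)) (Ar G (pw (Suc n) A) (?f (Suc n) k) u)"
      by (rule Ar_comp[OF obj_pw[OF assms] obj_pw[OF assms] obj_pw[OF assms] cl[OF kl(3)] cl[OF kl(4)] _ u,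
            symmetric]) simp
    finally show ?thesis
      using Suc j kl face_Suc[of k n A] face_Suc[of l "Suc n" A] face_Suc[of "l - 1" n A]
        face_Suc[of k "Suc n" A] by simp
  qed
qed

text \<open>Induction over the faces as for the simplicial identities: face 0 is naturality of the
  counit, the others are the functor applied to a lower case.\<close>

lemma face_nat:
  assumes "obj A" "obj B" "arr A B f"
  shows "i \<le> n \<Longrightarrow> u \<in> carrier (pw (Suc n) A) \<Longrightarrow>
    Ar_pow G n B f (face G A n i u) = face G B n i (Ar_pow G (Suc n) B f u)"
proof (induction i arbitrary: n u)
  case 0
  then show ?case
    using Eps_nat[OF obj_pw[OF assms(1), of n] obj_pw[OF assms(2), of n] arr_Ar_pow[OF assms, of n], of u]
    by (simp add: face_0)
next
  case (Suc i)
  then obtain m where n: "n = Suc m" "i \<le> m" by (cases n) auto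
  note oA = obj_pw[OF assms(1)] and oB = obj_pw[OF assms(2)]
  have u: "u \<in> carrier (Ob G (pw (Suc m) A))" using Suc.prems n by simp
  have fcl: "Ar_pow G k B f \<in> carrier (pw k A) \<rightarrow> carrier (pw k B)" for k
    by (rule Ar_pow_closed[OF assms(1,2) arr_closed[OF assms(3)]])
  have "Ar G (pw m B) (Ar_pow G m B f) (Ar G (pw m A) (face G A m i) u) =
      Ar G (pw m B) (\<lambda>x. face G B m i (Ar_pow G (Suc m) B f x)) u"
    by (rule Ar_comp[OF oA oA oB _ fcl _ u]) (use face_closed[OF assms(1) n(2)] Suc.IH[OF n(2)] in auto)
  also have "\<dots> = Ar G (pw m B) (face G B m i) (Ar G (pw (Suc m) B) (Ar_pow G (Suc m) B f) u)"
    by (rule Ar_comp[OF oA oB oB fcl _ _ u, symmetric]) (use face_closed[OF assms(2) n(2)] in auto)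
  finally show ?case using n by (simp add: face_Suc)
qed

lemma arr_augmentation: "obj A \<Longrightarrow> arr (pw n A) A (augmentation G A n)"
proof (induction n)
  case 0
  have "augmentation G A 0 = (\<lambda>x. x)" by (simp add: fun_eq_iff)
  then show ?case using arr_id[OF 0] by simp
next
  case (Suc n)
  have "augmentation G A (Suc n) = (\<lambda>u. augmentation G A n (Eps G (pw n A) u))" by (simp add: fun_eq_iff)
  then show ?case
    using arr_comp[OF arr_Eps[OF obj_pw[OF Suc.prems]] Suc.IH[OF Suc.prems]] by simp
qed

lemma augmentation_closed: "obj A \<Longrightarrow> u \<in> carrier (pw n A) \<Longrightarrow> augmentation G A n u \<in> carrier A"
  using arr_closed[OF arr_augmentation] by blast

lemma augmentation_face:
  assumes "obj A"
  shows "i \<le> n \<Longrightarrow> u \<in> carrier (pw (Suc n) A) \<Longrightarrow>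
    augmentation G A n (face G A n i u) = augmentation G A (Suc n) u"
proof (induction n arbitrary: i u)
  case (Suc n)
  show ?case
  proof (cases i)
    case (Suc k)
    then have k: "k \<le> n" using Suc.prems by simp
    have "Eps G (pw (Suc n) A) u \<in> carrier (pw (Suc n) A)"
      using arr_closed[OF arr_Eps[OF obj_pw[OF assms, of "Suc n"]]] Suc.prems by auto
    then show ?thesis
      using Suc Suc.prems k Suc.IH[OF k, of "Eps G (pw (Suc n) A) u"]
        Eps_nat[OF obj_pw[OF assms] obj_pw[OF assms] arr_face[OF assms k], of u]
      by (simp add: face_Suc)
  qed (simp add: face_0)
qed (simp add: face_0)

lemma augmentation_nat:
  assumes "obj A" "obj B" "arr A B f"
  shows "u \<in> carrier (pw n A) \<Longrightarrow> augmentation G B n (Ar_pow G n B f u) = f (augmentation G A n u)"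
proof (induction n arbitrary: u)
  case (Suc n)
  have "Eps G (pw n A) u \<in> carrier (pw n A)"
    using arr_closed[OF arr_Eps[OF obj_pw[OF assms(1), of n]]] Suc.prems by auto
  then show ?case
    using Suc.IH[of "Eps G (pw n A) u"] Suc.prems
      Eps_nat[OF obj_pw[OF assms(1), of n] obj_pw[OF assms(2), of n] arr_Ar_pow[OF assms, of n], of u]
    by simp
qed simp

end

section \<open>The free ring comonad\<close>

abbreviation ring_arr :: "('u, 'x) ring_scheme \<Rightarrow> ('u, 'x) ring_scheme \<Rightarrow> ('u \<Rightarrow> 'u) \<Rightarrow> bool" where
  "ring_arr A B f \<equiv> f \<in> ring_hom A B"

lemma Ob_ring_free: "Ob ring_free_comonad A = free_ring (carrier A)"
  and Ar_ring_free: "Ar ring_free_comonad B f = poly_ev (free_ring (carrier B)) (\<lambda>x. gen (f x))"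
  and Eps_ring_free: "Eps ring_free_comonad A = poly_ev A (\<lambda>x. x)"
  by (simp_all add: ring_free_comonad_def)

lemma cring_free_ring: "cring (free_ring V)"
  by (rule polyring_cring[OF polyring_free_ring])

lemma Ar_ring_free_gen:
  "f \<in> carrier A \<rightarrow> carrier B \<Longrightarrow> x \<in> carrier A \<Longrightarrow> Ar ring_free_comonad B f (gen x) = gen (f x)"
  unfolding Ar_ring_free
  by (rule poly_ev_gen[OF cring_free_ring, of _ "carrier A"]) (auto intro!: gen_closed[OF polyring_free_ring])

lemma Ar_ring_free_hom:
  "f \<in> carrier A \<rightarrow> carrier B \<Longrightarrow> Ar ring_free_comonad B f \<in> ring_hom (free_ring (carrier A)) (free_ring (carrier B))"
  unfolding Ar_ring_free
  by (rule poly_ev_hom[OF cring_free_ring _ polyring_free_ring])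
    (auto intro!: gen_closed[OF polyring_free_ring])

lemma Eps_ring_free_hom: "cring A \<Longrightarrow> Eps ring_free_comonad A \<in> ring_hom (free_ring (carrier A)) A"
  unfolding Eps_ring_free by (rule poly_ev_hom[OF _ _ polyring_free_ring]) auto

lemma Eps_ring_free_gen: "cring A \<Longrightarrow> x \<in> carrier A \<Longrightarrow> Eps ring_free_comonad A (gen x) = x"
  unfolding Eps_ring_free by (rule poly_ev_gen[of _ _ "carrier A"]) auto

lemma ring_hom_id: "(\<lambda>x. x) \<in> ring_hom A A"
  by (simp add: ring_hom_def)

interpretation RF: counital_functor "ring_free_comonad :: ('a univ, unit) ring_comonad" cring ring_arr
proof (rule counital_functor.intro)
  fix A B C :: "'a univ ring" and f g k :: "'a univ \<Rightarrow> 'a univ" and u :: "'a univ"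
  show "cring (Ob ring_free_comonad A)" by (simp add: Ob_ring_free cring_free_ring)
  show "ring_arr (Ob ring_free_comonad A) (Ob ring_free_comonad B) (Ar ring_free_comonad B f)"
    if "f \<in> carrier A \<rightarrow> carrier B"
    using Ar_ring_free_hom[OF that] by (simp add: Ob_ring_free)
  show "ring_arr (Ob ring_free_comonad A) A (Eps ring_free_comonad A)" if "cring A"
    using Eps_ring_free_hom[OF that] by (simp add: Ob_ring_free)
  show "f \<in> carrier A \<rightarrow> carrier B" if "ring_arr A B f" using ring_hom_closed[OF that] by auto
  show "ring_arr A A (\<lambda>x. x)" by (rule ring_hom_id)
  show "ring_arr A C (\<lambda>x. g (f x))" if "ring_arr A B f" "ring_arr B C g"
    using that by (rule ring_hom_comp_mem)
  show "Ar ring_free_comonad C g (Ar ring_free_comonad B f u) = Ar ring_free_comonad C k u"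
    if f: "f \<in> carrier A \<rightarrow> carrier B" and g: "g \<in> carrier B \<rightarrow> carrier C"
      and k: "\<And>x. x \<in> carrier A \<Longrightarrow> g (f x) = k x" and u: "u \<in> carrier (Ob ring_free_comonad A)"
  proof (rule ring_hom_polyring_eq[OF polyring_free_ring cring_free_ring
        ring_hom_comp_mem[OF Ar_ring_free_hom[OF f] Ar_ring_free_hom[OF g]]])
    have k': "k \<in> carrier A \<rightarrow> carrier C" using f g k by (auto simp: Pi_iff) (metis k)
    show "ring_arr (free_ring (carrier A)) (free_ring (carrier C)) (Ar ring_free_comonad C k)"
      by (rule Ar_ring_free_hom[OF k'])
    show "Ar ring_free_comonad C g (Ar ring_free_comonad B f (gen x)) = Ar ring_free_comonad C k (gen x)"
      if "x \<in> carrier A" for x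
      using Ar_ring_free_gen[OF f that] Ar_ring_free_gen[OF g, of "f x"] Ar_ring_free_gen[OF k' that]
        f that k[OF that] by auto
    show "u \<in> carrier (free_ring (carrier A))" using u by (simp add: Ob_ring_free)
  qed
  show "Ar ring_free_comonad A f u = u"
    if f: "\<And>x. x \<in> carrier A \<Longrightarrow> f x = x" and u: "u \<in> carrier (Ob ring_free_comonad A)"
  proof -
    have f': "f \<in> carrier A \<rightarrow> carrier A" using f by auto
    show ?thesis
      by (rule ring_hom_polyring_eq[OF polyring_free_ring cring_free_ring Ar_ring_free_hom[OF f'] ring_hom_id])
        (use Ar_ring_free_gen[OF f'] f u in \<open>auto simp: Ob_ring_free\<close>)
  qed
  show "Eps ring_free_comonad B (Ar ring_free_comonad B f u) = f (Eps ring_free_comonad A u)"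
    if A: "cring A" and B: "cring B" and f: "ring_arr A B f" and u: "u \<in> carrier (Ob ring_free_comonad A)"
  proof -
    have f': "f \<in> carrier A \<rightarrow> carrier B" using ring_hom_closed[OF f] by auto
    show ?thesis
    proof (rule ring_hom_polyring_eq[OF polyring_free_ring B
        ring_hom_comp_mem[OF Ar_ring_free_hom[OF f'] Eps_ring_free_hom[OF B]]
        ring_hom_comp_mem[OF Eps_ring_free_hom[OF A] f]])
      show "Eps ring_free_comonad B (Ar ring_free_comonad B f (gen x)) = f (Eps ring_free_comonad A (gen x))"
        if "x \<in> carrier A" for x
        using that Ar_ring_free_gen[OF f' that] Eps_ring_free_gen[OF A that]
          Eps_ring_free_gen[OF B ring_hom_closed[OF f that]] by simp
      show "u \<in> carrier (free_ring (carrier A))" using u by (simp add: Ob_ring_free)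
    qed
  qed
qed

text \<open>
  On free rings the augmentation to a ring \<open>R\<close> only depends on the indeterminates, so it is preserved
  by maps of sets over \<open>R\<close>.
\<close>

lemma augmentation_ring_free_set:
  fixes A B :: "'a univ ring" and R :: "('r, 'x) ring_scheme"
  assumes A: "cring A" and B: "cring B" and R: "cring R"
    and p: "p \<in> ring_hom A R" and q: "q \<in> ring_hom B R"
    and f: "f \<in> carrier A \<rightarrow> carrier B" and qf: "\<And>x. x \<in> carrier A \<Longrightarrow> q (f x) = p x"
  shows "u \<in> carrier ((Ob ring_free_comonad ^^ n) A) \<Longrightarrow>
    q (augmentation ring_free_comonad B n (Ar_pow ring_free_comonad n B f u)) =
    p (augmentation ring_free_comonad A n u)"
proof (induction n arbitrary: u)
  case 0
  then show ?case using qf by simp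
next
  case (Suc n)
  let ?A = "(Ob ring_free_comonad ^^ n) A" and ?B = "(Ob ring_free_comonad ^^ n) B"
  let ?f = "Ar_pow ring_free_comonad n B f"
  have oA: "cring ?A" and oB: "cring ?B" using RF.obj_pw A B by auto
  have f': "?f \<in> carrier ?A \<rightarrow> carrier ?B" by (rule RF.Ar_pow_closed[OF A B f])
  have l: "(\<lambda>u. q (augmentation ring_free_comonad B n (Eps ring_free_comonad ?B (Ar ring_free_comonad ?B ?f u))))
      \<in> ring_hom (free_ring (carrier ?A)) R"
    by (rule ring_hom_comp_mem[OF ring_hom_comp_mem[OF ring_hom_comp_mem[OF
            Ar_ring_free_hom[OF f'] Eps_ring_free_hom[OF oB]] RF.arr_augmentation[OF B]] q])
  have r: "(\<lambda>u. p (augmentation ring_free_comonad A n (Eps ring_free_comonad ?A u)))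
      \<in> ring_hom (free_ring (carrier ?A)) R"
    by (rule ring_hom_comp_mem[OF ring_hom_comp_mem[OF Eps_ring_free_hom[OF oA] RF.arr_augmentation[OF A]] p])
  have "q (augmentation ring_free_comonad B n (Eps ring_free_comonad ?B (Ar ring_free_comonad ?B ?f u))) =
      p (augmentation ring_free_comonad A n (Eps ring_free_comonad ?A u))"
  proof (rule ring_hom_polyring_eq[OF polyring_free_ring R l r])
    show "q (augmentation ring_free_comonad B n (Eps ring_free_comonad ?B (Ar ring_free_comonad ?B ?f (gen x)))) =
        p (augmentation ring_free_comonad A n (Eps ring_free_comonad ?A (gen x)))" if "x \<in> carrier ?A" for x
      using that Ar_ring_free_gen[OF f' that] Eps_ring_free_gen[OF oA that]
        Eps_ring_free_gen[OF oB funcset_mem[OF f' that]] Suc.IH[OF that] by simp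
    show "u \<in> carrier (free_ring (carrier ?A))" using Suc.prems unfolding Ob_ring_free[of ?A, symmetric] by simp
  qed
  then show ?case by simp
qed

section \<open>The free \<Psi>-ring comonad\<close>

definition psi_arr :: "('u, 'x) psi_ring_scheme \<Rightarrow> ('u, 'y) psi_ring_scheme \<Rightarrow> ('u \<Rightarrow> 'u) \<Rightarrow> bool" where
  "psi_arr A B f \<longleftrightarrow> f \<in> ring_hom A B \<and> (\<forall>i>0. \<forall>x\<in>carrier A. f (Psi A i x) = Psi B i (f x))"

abbreviation adams_vars :: "'a univ set \<Rightarrow> 'a univ set" where
  "adams_vars Y \<equiv> {Adams i x |i x. 0 < i \<and> x \<in> Y}"

lemma cring_free_psi_ring: "cring (free_psi_ring Y)"
  by (rule polyring_cring[OF polyring_free_psi_ring])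

text \<open>The operations of a free \<Psi>-ring are evaluations into \<open>int_poly_ring\<close>,
  a record with the same ring operations but another type; this moves them to the free \<Psi>-ring
  itself.\<close>

lemma ring_hom_polyring_target: "polyring P V \<Longrightarrow> polyring Q V \<Longrightarrow> ring_hom S P = ring_hom S Q"
  by (simp add: polyring_def ring_hom_def)

lemma Psi_free: "Psi (free_psi_ring Y) j =
    poly_ev (int_poly_ring (adams_vars Y)) (adams_var (\<lambda>i x. gen (Adams (j * i) x)))"
  by (simp add: free_psi_ring_def Let_def ring.defs psi_ring.defs)

lemma adams_gen_closed: "0 < i \<Longrightarrow> x \<in> Y \<Longrightarrow> gen (Adams i x) \<in> carrier (free_psi_ring Y)"
  by (rule gen_closed[OF polyring_free_psi_ring]) auto

lemma Psi_free_hom: "0 < j \<Longrightarrow> Psi (free_psi_ring Y) j \<in> ring_hom (free_psi_ring Y) (free_psi_ring Y)"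
  unfolding Psi_free
    ring_hom_polyring_target[OF polyring_free_psi_ring polyring_int_poly_ring, of "free_psi_ring Y" Y]
  by (rule poly_ev_hom[OF polyring_cring[OF polyring_int_poly_ring] _ polyring_free_psi_ring])
    (auto intro!: gen_closed[OF polyring_int_poly_ring])

lemma Psi_free_gen: "0 < j \<Longrightarrow> 0 < i \<Longrightarrow> x \<in> Y \<Longrightarrow>
    Psi (free_psi_ring Y) j (gen (Adams i x)) = gen (Adams (j * i) x)"
  unfolding Psi_free
  by (subst poly_ev_gen[OF polyring_cring[OF polyring_int_poly_ring], of _ "adams_vars Y"])
    (auto intro!: gen_closed[OF polyring_int_poly_ring])

lemma psi_ring_free: "psi_ring (free_psi_ring Y)"
proof (intro psi_ring.intro psi_ring_axioms.intro)
  let ?F = "free_psi_ring Y"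
  note eq = ring_hom_polyring_eq[OF polyring_free_psi_ring cring_free_psi_ring]
  show "cring ?F" by (rule cring_free_psi_ring)
  show "Psi ?F i \<in> ring_hom ?F ?F" if "0 < i" for i using that by (rule Psi_free_hom)
  show "Psi ?F 1 u = u" if "u \<in> carrier ?F" for u
    by (rule eq[OF Psi_free_hom ring_hom_id _ that]) (auto simp: Psi_free_gen)
  show "Psi ?F i (Psi ?F j u) = Psi ?F (i * j) u" if "0 < i" "0 < j" "u \<in> carrier ?F" for i j u
    by (rule eq[OF ring_hom_comp_mem[OF Psi_free_hom[OF that(2)] Psi_free_hom[OF that(1)]] Psi_free_hom _ that(3)])
      (use that in \<open>auto simp: Psi_free_gen mult.assoc\<close>)
qed

lemma Ob_psi_free: "Ob psi_free_comonad A = free_psi_ring (carrier A)"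
  and Ar_psi_free: "Ar psi_free_comonad B f = poly_ev (free_psi_ring (carrier B)) (adams_var (\<lambda>i x. gen (Adams i (f x))))"
  and Eps_psi_free: "Eps psi_free_comonad A = poly_ev A (adams_var (Psi A))"
  by (simp_all add: psi_free_comonad_def)

lemma Ar_psi_free_hom:
  "f \<in> carrier A \<rightarrow> carrier B \<Longrightarrow>
    Ar psi_free_comonad B f \<in> ring_hom (free_psi_ring (carrier A)) (free_psi_ring (carrier B))"
  unfolding Ar_psi_free
  by (rule poly_ev_hom[OF cring_free_psi_ring _ polyring_free_psi_ring]) (auto intro!: adams_gen_closed)

lemma Ar_psi_free_gen:
  "f \<in> carrier A \<rightarrow> carrier B \<Longrightarrow> 0 < i \<Longrightarrow> x \<in> carrier A \<Longrightarrow>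
    Ar psi_free_comonad B f (gen (Adams i x)) = gen (Adams i (f x))"
  unfolding Ar_psi_free
  by (subst poly_ev_gen[OF cring_free_psi_ring, of _ "adams_vars (carrier A)"]) (auto intro!: adams_gen_closed)

lemma Psi_closed: "psi_ring A \<Longrightarrow> 0 < i \<Longrightarrow> x \<in> carrier A \<Longrightarrow> Psi A i x \<in> carrier A"
  by (rule ring_hom_closed[OF psi_ring.Psi_hom])

lemma psi_ring_cring: "psi_ring A \<Longrightarrow> cring A"
  by (simp add: psi_ring_def)

lemma Eps_psi_free_hom: "psi_ring A \<Longrightarrow> Eps psi_free_comonad A \<in> ring_hom (free_psi_ring (carrier A)) A"
  unfolding Eps_psi_free
  by (rule poly_ev_hom[OF psi_ring_cring _ polyring_free_psi_ring]) (auto simp: Psi_closed)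

lemma Eps_psi_free_gen:
  "psi_ring A \<Longrightarrow> 0 < i \<Longrightarrow> x \<in> carrier A \<Longrightarrow> Eps psi_free_comonad A (gen (Adams i x)) = Psi A i x"
  unfolding Eps_psi_free
  by (subst poly_ev_gen[OF psi_ring_cring, of _ _ "adams_vars (carrier A)"]) (auto simp: Psi_closed)

lemma psi_arr_hom: "psi_arr A B f \<Longrightarrow> f \<in> ring_hom A B"
  and psi_arr_Psi: "psi_arr A B f \<Longrightarrow> 0 < i \<Longrightarrow> x \<in> carrier A \<Longrightarrow> f (Psi A i x) = Psi B i (f x)"
  by (auto simp: psi_arr_def)

lemma psi_arr_free:
  assumes B: "psi_ring B" and f: "f \<in> ring_hom (free_psi_ring Y) B"
    and gen: "\<And>j i x. 0 < j \<Longrightarrow> 0 < i \<Longrightarrow> x \<in> Y \<Longrightarrow> f (gen (Adams (j * i) x)) = Psi B j (f (gen (Adams i x)))"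
  shows "psi_arr (free_psi_ring Y) B f"
  unfolding psi_arr_def
proof (intro conjI allI impI ballI)
  show "f (Psi (free_psi_ring Y) j u) = Psi B j (f u)" if j: "0 < j" and u: "u \<in> carrier (free_psi_ring Y)" for j u
    by (rule ring_hom_polyring_eq[OF polyring_free_psi_ring psi_ring_cring[OF B]
          ring_hom_comp_mem[OF Psi_free_hom[OF j] f] ring_hom_comp_mem[OF f psi_ring.Psi_hom[OF B j]] _ u])
      (use gen j in \<open>auto simp: Psi_free_gen\<close>)
qed (rule f)

interpretation PF: counital_functor
  "psi_free_comonad :: ('a univ, ('a univ, unit) psi_ring_ext) ring_comonad" psi_ring psi_arr
proof (rule counital_functor.intro)
  fix A B C :: "'a univ psi_ring" and f g k :: "'a univ \<Rightarrow> 'a univ" and u :: "'a univ"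
  show "psi_ring (Ob psi_free_comonad A)" by (simp add: Ob_psi_free psi_ring_free)
  show "psi_arr (Ob psi_free_comonad A) (Ob psi_free_comonad B) (Ar psi_free_comonad B f)"
    if f: "f \<in> carrier A \<rightarrow> carrier B"
    unfolding Ob_psi_free
    by (rule psi_arr_free[OF psi_ring_free Ar_psi_free_hom[OF f]])
      (use f in \<open>auto simp: Ar_psi_free_gen[OF f] Psi_free_gen Pi_iff\<close>)
  show "psi_arr (Ob psi_free_comonad A) A (Eps psi_free_comonad A)" if A: "psi_ring A"
    unfolding Ob_psi_free
    by (rule psi_arr_free[OF A Eps_psi_free_hom[OF A]])
      (auto simp: Eps_psi_free_gen[OF A] psi_ring.Psi_Psi[OF A])
  show "f \<in> carrier A \<rightarrow> carrier B" if "psi_arr A B f" using ring_hom_closed[OF psi_arr_hom[OF that]] by auto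
  show "psi_arr A A (\<lambda>x. x)" by (simp add: psi_arr_def ring_hom_id)
  show "psi_arr A C (\<lambda>x. g (f x))" if f: "psi_arr A B f" and g: "psi_arr B C g"
    unfolding psi_arr_def
    using ring_hom_comp_mem[OF psi_arr_hom[OF f] psi_arr_hom[OF g]] psi_arr_Psi[OF f] psi_arr_Psi[OF g]
      ring_hom_closed[OF psi_arr_hom[OF f]] by simp
  show "Ar psi_free_comonad C g (Ar psi_free_comonad B f u) = Ar psi_free_comonad C k u"
    if f: "f \<in> carrier A \<rightarrow> carrier B" and g: "g \<in> carrier B \<rightarrow> carrier C"
      and k: "\<And>x. x \<in> carrier A \<Longrightarrow> g (f x) = k x" and u: "u \<in> carrier (Ob psi_free_comonad A)"
  proof (rule ring_hom_polyring_eq[OF polyring_free_psi_ring cring_free_psi_ring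
        ring_hom_comp_mem[OF Ar_psi_free_hom[OF f] Ar_psi_free_hom[OF g]]])
    have k': "k \<in> carrier A \<rightarrow> carrier C" using f g k by (auto simp: Pi_iff) (metis k)
    show "Ar psi_free_comonad C k \<in> ring_hom (free_psi_ring (carrier A)) (free_psi_ring (carrier C))"
      by (rule Ar_psi_free_hom[OF k'])
    show "Ar psi_free_comonad C g (Ar psi_free_comonad B f (gen v)) = Ar psi_free_comonad C k (gen v)"
      if "v \<in> adams_vars (carrier A)" for v
      using that f k by (auto simp: Ar_psi_free_gen[OF f] Ar_psi_free_gen[OF g] Ar_psi_free_gen[OF k'] Pi_iff)
    show "u \<in> carrier (free_psi_ring (carrier A))" using u by (simp add: Ob_psi_free)
  qed
  show "Ar psi_free_comonad A f u = u"
    if f: "\<And>x. x \<in> carrier A \<Longrightarrow> f x = x" and u: "u \<in> carrier (Ob psi_free_comonad A)"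
  proof -
    have f': "f \<in> carrier A \<rightarrow> carrier A" using f by auto
    show ?thesis
      by (rule ring_hom_polyring_eq[OF polyring_free_psi_ring cring_free_psi_ring Ar_psi_free_hom[OF f'] ring_hom_id])
        (use Ar_psi_free_gen[OF f'] f u in \<open>auto simp: Ob_psi_free\<close>)
  qed
  show "Eps psi_free_comonad B (Ar psi_free_comonad B f u) = f (Eps psi_free_comonad A u)"
    if A: "psi_ring A" and B: "psi_ring B" and f: "psi_arr A B f" and u: "u \<in> carrier (Ob psi_free_comonad A)"
  proof -
    have f': "f \<in> carrier A \<rightarrow> carrier B" using ring_hom_closed[OF psi_arr_hom[OF f]] by auto
    show ?thesis
    proof (rule ring_hom_polyring_eq[OF polyring_free_psi_ring psi_ring_cring[OF B]
        ring_hom_comp_mem[OF Ar_psi_free_hom[OF f'] Eps_psi_free_hom[OF B]]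
        ring_hom_comp_mem[OF Eps_psi_free_hom[OF A] psi_arr_hom[OF f]]])
      show "Eps psi_free_comonad B (Ar psi_free_comonad B f (gen v)) = f (Eps psi_free_comonad A (gen v))"
        if "v \<in> adams_vars (carrier A)" for v
        using that f' psi_arr_Psi[OF f]
        by (auto simp: Ar_psi_free_gen[OF f'] Eps_psi_free_gen[OF A] Eps_psi_free_gen[OF B] Pi_iff)
      show "u \<in> carrier (free_psi_ring (carrier A))" using u by (simp add: Ob_psi_free)
    qed
  qed
qed

text \<open>The unit of the adjunction between \<Psi>-rings and sets, a map of sets only. It serves
  as an extra degeneracy of the comonad resolution.\<close>

definition psi_unit :: "'a univ \<Rightarrow> 'a univ" where
  "psi_unit x = gen (Adams 1 x)"

lemma psi_unit_closed: "psi_unit \<in> carrier A \<rightarrow> carrier (Ob psi_free_comonad A)"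
  by (auto simp: psi_unit_def Ob_psi_free intro!: adams_gen_closed)

lemma Eps_psi_unit: "psi_ring A \<Longrightarrow> x \<in> carrier A \<Longrightarrow> Eps psi_free_comonad A (psi_unit x) = x"
  unfolding psi_unit_def using Eps_psi_free_gen[of A 1 x] psi_ring.Psi_1[of A x] by simp

lemma Ar_psi_unit:
  "f \<in> carrier A \<rightarrow> carrier B \<Longrightarrow> x \<in> carrier A \<Longrightarrow> Ar psi_free_comonad B f (psi_unit x) = psi_unit (f x)"
  unfolding psi_unit_def by (rule Ar_psi_free_gen) auto

definition free_section :: "'a univ psi_ring \<Rightarrow> 'a univ \<Rightarrow> 'a univ" where
  "free_section F = poly_ev (free_ring (carrier F)) (\<lambda>v. gen (gen v))"

lemma free_section_hom:
  assumes "polyring F V"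
  shows "free_section F \<in> ring_hom F (free_ring (carrier F))"
  unfolding free_section_def
  by (rule poly_ev_hom[OF cring_free_ring _ assms])
    (auto intro!: gen_closed[OF polyring_free_ring] gen_closed[OF assms])

lemma Eps_free_section:
  assumes P: "polyring F V" and u: "u \<in> carrier F"
  shows "Eps ring_free_comonad (ring.truncate F) (free_section F u) = u"
proof -
  let ?U = "ring.truncate F"
  have U: "polyring ?U V" by (rule polyring_truncate[OF P])
  have c: "carrier ?U = carrier F" by (simp add: ring.defs)
  have s: "free_section F \<in> ring_hom ?U (free_ring (carrier ?U))"
    using free_section_hom[OF P] by (simp add: ring_hom_def ring.defs)
  show ?thesis
  proof (rule ring_hom_polyring_eq[OF U polyring_cring[OF U]
      ring_hom_comp_mem[OF s Eps_ring_free_hom[OF polyring_cring[OF U]]] ring_hom_id])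
    fix v assume v: "v \<in> V"
    have "free_section F (gen v) = gen (gen v)"
      unfolding free_section_def using v
      by (intro poly_ev_gen[OF cring_free_ring, of _ V])
        (auto intro!: gen_closed[OF polyring_free_ring] gen_closed[OF P])
    then show "Eps ring_free_comonad ?U (free_section F (gen v)) = gen v"
      using Eps_ring_free_gen[OF polyring_cring[OF U] gen_closed[OF U v]] by simp
  qed (use u c in simp)
qed

section \<open>Natural systems of cochain complexes\<close>

lemma carrier_pos_nat [simp]: "carrier pos_nat_monoid = {n. 0 < n}"
  and mult_pos_nat [simp]: "a \<otimes>\<^bsub>pos_nat_monoid\<^esub> b = a * b"
  and one_pos_nat [simp]: "\<one>\<^bsub>pos_nat_monoid\<^esub> = 1"
  by (simp_all add: pos_nat_monoid_def)

lemma comp_list_pos_nat: "comp_list pos_nat_monoid \<alpha>s = prod_list \<alpha>s"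
  by (induction \<alpha>s) (simp_all add: comp_list_def)

section \<open>Lists of positive numbers and the merging of adjacent entries\<close>

definition pos_lists :: "nat \<Rightarrow> nat list set" where
  "pos_lists n = {\<alpha>s. set \<alpha>s \<subseteq> {n. 0 < n} \<and> length \<alpha>s = n}"

lemma pos_lists_0 [simp]: "\<alpha>s \<in> pos_lists 0 \<longleftrightarrow> \<alpha>s = []"
  by (auto simp: pos_lists_def)

lemma pos_lists_length: "\<alpha>s \<in> pos_lists n \<Longrightarrow> length \<alpha>s = n"
  by (simp add: pos_lists_def)

lemma prod_list_pos: "\<alpha>s \<in> pos_lists n \<Longrightarrow> 0 < prod_list \<alpha>s"
proof (induction \<alpha>s arbitrary: n)
  case (Cons a \<alpha>s)
  then have "\<alpha>s \<in> pos_lists (n - 1)" "0 < a" by (auto simp: pos_lists_def)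
  then show ?case using Cons.IH by simp
qed simp

text \<open>\<open>merge\<close> with the index counted from 0, in recursive form so that the face
  identities follow by structural induction.\<close>

fun mg :: "nat \<Rightarrow> nat list \<Rightarrow> nat list" where
  "mg 0 (a # b # xs) = (a * b) # xs"
| "mg (Suc j) (a # xs) = a # mg j xs"
| "mg _ xs = xs"

lemma merge_mg: "Suc j < length \<alpha>s \<Longrightarrow> merge pos_nat_monoid (Suc j) \<alpha>s = mg j \<alpha>s"
proof (induction j \<alpha>s rule: mg.induct)
  case (2 j a xs)
  then show ?case by (simp add: merge_def)
qed (auto simp: merge_def)

lemma mg_pos_lists: "Suc j < Suc n \<Longrightarrow> \<alpha>s \<in> pos_lists (Suc n) \<Longrightarrow> mg j \<alpha>s \<in> pos_lists n"
proof (induction j \<alpha>s arbitrary: n rule: mg.induct)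
  case (2 j a xs)
  then obtain m where n: "n = Suc m" by (cases n) auto
  then have "xs \<in> pos_lists (Suc m)" "0 < a" using 2 by (auto simp: pos_lists_def)
  then have "mg j xs \<in> pos_lists m" using 2 n by simp
  then show ?case using \<open>0 < a\<close> n by (auto simp: pos_lists_def)
qed (auto simp: pos_lists_def)

lemma prod_list_mg: "prod_list (mg j \<alpha>s) = prod_list \<alpha>s"
  by (induction j \<alpha>s rule: mg.induct) (simp_all add: mult.assoc)

lemma mg_mg: "i < j \<Longrightarrow> Suc j < length \<alpha>s \<Longrightarrow> mg i (mg j \<alpha>s) = mg (j - 1) (mg i \<alpha>s)"
proof (induction i \<alpha>s arbitrary: j rule: mg.induct)
  case (1 a b xs)
  then obtain k where j: "j = Suc k" by (cases j) auto
  then show ?case using 1 by (cases k; cases xs) (auto simp: mult.assoc)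
next
  case (2 i a xs)
  then obtain k where j: "j = Suc k" by (cases j) auto
  then have "i < k" "Suc k < length xs" using 2 by auto
  moreover then obtain l where "k = Suc l" by (cases k) auto
  ultimately show ?case using 2 j by simp
qed auto

lemma hd_tl_mg_0: "1 < length \<alpha>s \<Longrightarrow> hd (mg 0 \<alpha>s) = hd \<alpha>s * hd (tl \<alpha>s) \<and> tl (mg 0 \<alpha>s) = tl (tl \<alpha>s)"
  by (cases \<alpha>s; cases "tl \<alpha>s") auto

lemma hd_tl_mg_Suc: "0 < length \<alpha>s \<Longrightarrow> hd (mg (Suc j) \<alpha>s) = hd \<alpha>s \<and> tl (mg (Suc j) \<alpha>s) = mg j (tl \<alpha>s)"
  by (cases \<alpha>s) auto

lemma mg_nonempty: "Suc j < length \<alpha>s \<Longrightarrow> mg j \<alpha>s \<noteq> []"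
  by (cases j; cases \<alpha>s; cases "tl \<alpha>s") auto

lemma last_butlast_mg:
  "Suc (Suc j) < length \<alpha>s \<Longrightarrow> last (mg j \<alpha>s) = last \<alpha>s \<and> butlast (mg j \<alpha>s) = mg j (butlast \<alpha>s)"
proof (induction j \<alpha>s rule: mg.induct)
  case (1 a b xs)
  then show ?case by (cases xs) auto
next
  case (2 j a xs)
  then show ?case using mg_nonempty[of j xs] by auto
qed auto

lemma last_butlast_mg_last:
  "length \<alpha>s = Suc (Suc j) \<Longrightarrow> last (mg j \<alpha>s) = last (butlast \<alpha>s) * last \<alpha>s \<and>
    butlast (mg j \<alpha>s) = butlast (butlast \<alpha>s)"
proof (induction j \<alpha>s rule: mg.induct)
  case (2 j a xs)
  then show ?case using mg_nonempty[of j xs] by (cases xs; cases "tl xs") auto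
qed auto

lemma mg_append: "Suc j < length \<alpha>s \<Longrightarrow> mg j (\<alpha>s @ \<beta>s) = mg j \<alpha>s @ \<beta>s"
  by (induction j \<alpha>s rule: mg.induct) auto

lemma mg_snoc: "length \<alpha>s = Suc j \<Longrightarrow> mg j (\<alpha>s @ [b]) = butlast \<alpha>s @ [last \<alpha>s * b]"
proof (induction j \<alpha>s rule: mg.induct)
  case (2 j a xs)
  then show ?case by (cases xs) auto
qed auto

lemma tl_pos_lists: "\<alpha>s \<in> pos_lists (Suc n) \<Longrightarrow> tl \<alpha>s \<in> pos_lists n \<and> 0 < hd \<alpha>s \<and> hd \<alpha>s * prod_list (tl \<alpha>s) = prod_list \<alpha>s"
  by (cases \<alpha>s) (auto simp: pos_lists_def)

lemma butlast_pos_lists: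
  "\<alpha>s \<in> pos_lists (Suc n) \<Longrightarrow> butlast \<alpha>s \<in> pos_lists n \<and> 0 < last \<alpha>s \<and> prod_list (butlast \<alpha>s) * last \<alpha>s = prod_list \<alpha>s"
  by (cases \<alpha>s rule: rev_cases) (auto simp: pos_lists_def)

lemma presents_sum:
  assumes pres: "presents h Z B G" and f: "\<And>i. i \<in> I \<Longrightarrow> f i \<in> Z"
  shows "h (sum f I) = finprod G (\<lambda>i. h (f i)) I"
proof -
  interpret G: comm_group G by (rule presents_comm_group[OF pres])
  note Z = presents_subgrp[OF pres]
  show ?thesis
    using f
  proof (induction I rule: infinite_finite_induct)
    case (insert i I)
    then show ?case
      using presents_add[OF pres, of "f i" "sum f I"] subgrp_sum[OF Z, of I f] presents_closed[OF pres]
      by (simp add: Pi_iff)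
  qed (simp_all add: presents_zero[OF pres] finprod_def)
qed

lemma presents_sg:
  assumes pres: "presents h Z B G" and x: "x \<in> Z"
  shows "h (sg n x) = h x [^]\<^bsub>G\<^esub> ((- 1 :: int) ^ n)"
proof -
  interpret G: comm_group G by (rule presents_comm_group[OF pres])
  show ?thesis
    using presents_minus[OF pres x] presents_closed[OF pres x]
    by (simp add: sg_def G.int_pow_neg)
qed

locale nat_complexes =
  fixes S :: "nat \<Rightarrow> nat \<Rightarrow> 'w::ab_group_add set"
    and \<delta> :: "nat \<Rightarrow> 'w \<Rightarrow> 'w" and L :: "nat \<Rightarrow> 'w \<Rightarrow> 'w" and U :: "nat \<Rightarrow> nat \<Rightarrow> 'w \<Rightarrow> 'w"
  assumes subgrp_S: "0 < f \<Longrightarrow> subgrp (S q f)"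
    and add_\<delta>: "additive (\<delta> q)" and add_L: "0 < u \<Longrightarrow> additive (L u)" and add_U: "additive (U q v)"
    and \<delta>_S: "0 < f \<Longrightarrow> x \<in> S q f \<Longrightarrow> \<delta> q x \<in> S (Suc q) f"
    and L_S: "0 < f \<Longrightarrow> 0 < u \<Longrightarrow> x \<in> S q f \<Longrightarrow> L u x \<in> S q (u * f)"
    and U_S: "0 < f \<Longrightarrow> 0 < v \<Longrightarrow> x \<in> S q f \<Longrightarrow> U q v x \<in> S q (f * v)"
    and \<delta>_\<delta>: "0 < f \<Longrightarrow> x \<in> S q f \<Longrightarrow> \<delta> (Suc q) (\<delta> q x) = 0"
    and L_L: "0 < f \<Longrightarrow> 0 < u \<Longrightarrow> 0 < v \<Longrightarrow> x \<in> S q f \<Longrightarrow> L u (L v x) = L (u * v) x"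
    and U_U: "0 < f \<Longrightarrow> 0 < u \<Longrightarrow> 0 < v \<Longrightarrow> x \<in> S q f \<Longrightarrow> U q u (U q v x) = U q (v * u) x"
    and L_U: "0 < f \<Longrightarrow> 0 < u \<Longrightarrow> 0 < v \<Longrightarrow> x \<in> S q f \<Longrightarrow> L u (U q v x) = U q v (L u x)"
    and \<delta>_L: "0 < f \<Longrightarrow> 0 < u \<Longrightarrow> x \<in> S q f \<Longrightarrow> \<delta> q (L u x) = L u (\<delta> q x)"
    and \<delta>_U: "0 < f \<Longrightarrow> 0 < v \<Longrightarrow> x \<in> S q f \<Longrightarrow> \<delta> q (U q v x) = U (Suc q) v (\<delta> q x)"
begin

text \<open>Drops degree 0. The complexes are set up with their augmentation in degree 0, and this
  recovers the unaugmented ones.\<close>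

lemma shift: "nat_complexes (\<lambda>q. S (Suc q)) (\<lambda>q. \<delta> (Suc q)) L (\<lambda>q. U (Suc q))"
  by unfold_locales
    (simp_all add: subgrp_S add_\<delta> add_L add_U \<delta>_S L_S U_S \<delta>_\<delta> L_L U_U L_U \<delta>_L \<delta>_U)

definition C :: "nat \<Rightarrow> nat \<Rightarrow> (nat list \<Rightarrow> 'w) set" where
  "C p q = {y. \<forall>\<alpha>s. if \<alpha>s \<in> pos_lists p then y \<alpha>s \<in> S q (prod_list \<alpha>s) else y \<alpha>s = 0}"

definition bf :: "nat \<Rightarrow> nat \<Rightarrow> nat \<Rightarrow> (nat list \<Rightarrow> 'w) \<Rightarrow> nat list \<Rightarrow> 'w" where
  "bf p q i y \<alpha>s = (if i = 0 then L (hd \<alpha>s) (y (tl \<alpha>s))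
     else if i = Suc p then U q (last \<alpha>s) (y (butlast \<alpha>s)) else y (mg (i - 1) \<alpha>s))"

definition bw :: "nat \<Rightarrow> nat \<Rightarrow> (nat list \<Rightarrow> 'w) \<Rightarrow> nat list \<Rightarrow> 'w" where
  "bw p q y = (\<lambda>\<alpha>s. if \<alpha>s \<in> pos_lists (Suc p) then \<Sum>i\<le>Suc p. sg i (bf p q i y \<alpha>s) else 0)"

text \<open>The sign (-1)^p makes the squares with \<open>bw\<close> anticommute.\<close>

definition dv :: "nat \<Rightarrow> nat \<Rightarrow> (nat list \<Rightarrow> 'w) \<Rightarrow> nat list \<Rightarrow> 'w" where
  "dv p q y = (\<lambda>\<alpha>s. sg p (\<delta> q (y \<alpha>s)))"

lemma C_D: "y \<in> C p q \<Longrightarrow> \<alpha>s \<in> pos_lists p \<Longrightarrow> y \<alpha>s \<in> S q (prod_list \<alpha>s)"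
  and C_0: "y \<in> C p q \<Longrightarrow> \<alpha>s \<notin> pos_lists p \<Longrightarrow> y \<alpha>s = 0"
  unfolding C_def by (metis (mono_tags, lifting) mem_Collect_eq)+

lemma C_I: "(\<And>\<alpha>s. \<alpha>s \<in> pos_lists p \<Longrightarrow> y \<alpha>s \<in> S q (prod_list \<alpha>s)) \<Longrightarrow>
    (\<And>\<alpha>s. \<alpha>s \<notin> pos_lists p \<Longrightarrow> y \<alpha>s = 0) \<Longrightarrow> y \<in> C p q"
  by (simp add: C_def)

lemma subgrp_C: "subgrp (C p q)"
  unfolding subgrp_def
proof (intro conjI ballI)
  show "0 \<in> C p q" by (rule C_I) (simp_all add: subgrp_zero[OF subgrp_S[OF prod_list_pos]])
  show "x - y \<in> C p q" if "x \<in> C p q" "y \<in> C p q" for x y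
    by (rule C_I)
      (simp_all add: subgrp_diff[OF subgrp_S[OF prod_list_pos]] C_D[OF that(1)] C_D[OF that(2)] C_0[OF that(1)] C_0[OF that(2)])
qed

lemma bf_add: "\<alpha>s \<in> pos_lists (Suc p) \<Longrightarrow> bf p q i (x + y) \<alpha>s = bf p q i x \<alpha>s + bf p q i y \<alpha>s"
  using tl_pos_lists[of \<alpha>s p] by (simp add: bf_def additive_add[OF add_L] additive_add[OF add_U])

lemma additive_bw: "additive (bw p q)"
  unfolding additive_def
proof (intro allI ext)
  fix x y \<alpha>s
  show "bw p q (x + y) \<alpha>s = (bw p q x + bw p q y) \<alpha>s"
    by (simp add: bw_def bf_add sg_add sum.distrib del: sum.atMost_Suc)
qed

lemma additive_dv: "additive (dv p q)"
  by (simp add: additive_def dv_def fun_eq_iff additive_add[OF add_\<delta>] sg_add)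

lemma bf_S:
  assumes y: "y \<in> C p q" and \<alpha>s: "\<alpha>s \<in> pos_lists (Suc p)" and i: "i \<le> Suc p"
  shows "bf p q i y \<alpha>s \<in> S q (prod_list \<alpha>s)"
proof -
  consider "i = 0" | "i = Suc p" | j where "i = Suc j" "Suc j < Suc p"
    using i by (cases i) (auto simp: le_less)
  then show ?thesis
  proof cases
    case 1
    then show ?thesis
      using tl_pos_lists[OF \<alpha>s] L_S[OF prod_list_pos _ C_D[OF y], of "tl \<alpha>s" p "hd \<alpha>s"] by (simp add: bf_def)
  next
    case 2
    then show ?thesis
      using butlast_pos_lists[OF \<alpha>s] U_S[OF prod_list_pos _ C_D[OF y], of "butlast \<alpha>s" p "last \<alpha>s"]
      by (simp add: bf_def)
  next
    case (3 j)
    then show ?thesis using C_D[OF y mg_pos_lists[OF 3(2) \<alpha>s]] by (simp add: bf_def prod_list_mg)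
  qed
qed

lemma bw_C: "y \<in> C p q \<Longrightarrow> bw p q y \<in> C (Suc p) q"
proof (rule C_I)
  assume y: "y \<in> C p q"
  show "bw p q y \<alpha>s \<in> S q (prod_list \<alpha>s)" if \<alpha>s: "\<alpha>s \<in> pos_lists (Suc p)" for \<alpha>s
  proof -
    note S = subgrp_S[OF prod_list_pos[OF \<alpha>s]]
    have "(\<Sum>i\<le>Suc p. sg i (bf p q i y \<alpha>s)) \<in> S q (prod_list \<alpha>s)"
      by (rule subgrp_sum[OF S]) (rule subgrp_sg[OF S bf_S[OF y \<alpha>s]], simp)
    then show ?thesis using \<alpha>s by (simp add: bw_def del: sum.atMost_Suc)
  qed
qed (simp add: bw_def)

lemma dv_C: "y \<in> C p q \<Longrightarrow> dv p q y \<in> C p (Suc q)"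
proof (rule C_I)
  assume y: "y \<in> C p q"
  show "dv p q y \<alpha>s \<in> S (Suc q) (prod_list \<alpha>s)" if "\<alpha>s \<in> pos_lists p" for \<alpha>s
    unfolding dv_def using that
    by (intro subgrp_sg[OF subgrp_S[OF prod_list_pos]] \<delta>_S[OF prod_list_pos] C_D[OF y]) auto
  show "dv p q y \<alpha>s = 0" if "\<alpha>s \<notin> pos_lists p" for \<alpha>s
    using C_0[OF y that] by (simp add: dv_def additive_zero[OF add_\<delta>])
qed

lemma dv_dv: "y \<in> C p q \<Longrightarrow> dv p (Suc q) (dv p q y) = 0"
proof
  fix \<alpha>s assume y: "y \<in> C p q"
  show "dv p (Suc q) (dv p q y) \<alpha>s = 0 \<alpha>s"
  proof (cases "\<alpha>s \<in> pos_lists p")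
    case True
    then show ?thesis
      using \<delta>_\<delta>[OF prod_list_pos[OF True] C_D[OF y True]] by (simp add: dv_def additive_sg[OF add_\<delta>])
  next
    case False
    then show ?thesis using C_0[OF y] by (simp add: dv_def additive_zero[OF add_\<delta>])
  qed
qed

lemma bf_\<delta>:
  assumes y: "y \<in> C p q" and \<alpha>s: "\<alpha>s \<in> pos_lists (Suc p)" and i: "i \<le> Suc p"
  shows "bf p (Suc q) i (\<lambda>\<alpha>s. \<delta> q (y \<alpha>s)) \<alpha>s = \<delta> q (bf p q i y \<alpha>s)"
  using tl_pos_lists[OF \<alpha>s] butlast_pos_lists[OF \<alpha>s]
    \<delta>_L[OF prod_list_pos _ C_D[OF y], of "tl \<alpha>s" p "hd \<alpha>s"] \<delta>_U[OF prod_list_pos _ C_D[OF y], of "butlast \<alpha>s" p "last \<alpha>s"]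
  by (simp add: bf_def)

lemma bw_dv: "y \<in> C p q \<Longrightarrow> bw p (Suc q) (dv p q y) + dv (Suc p) q (bw p q y) = 0"
proof
  fix \<alpha>s assume y: "y \<in> C p q"
  show "(bw p (Suc q) (dv p q y) + dv (Suc p) q (bw p q y)) \<alpha>s = 0 \<alpha>s"
  proof (cases "\<alpha>s \<in> pos_lists (Suc p)")
    case True
    have "dv p q y = sg p (\<lambda>\<alpha>s. \<delta> q (y \<alpha>s))" by (simp add: dv_def fun_eq_iff sg_apply)
    then have "bw p (Suc q) (dv p q y) \<alpha>s = sg p (bw p (Suc q) (\<lambda>\<alpha>s. \<delta> q (y \<alpha>s)) \<alpha>s)"
      by (simp add: additive_sg[OF additive_bw] sg_apply)
    also have "bw p (Suc q) (\<lambda>\<alpha>s. \<delta> q (y \<alpha>s)) \<alpha>s = \<delta> q (bw p q y \<alpha>s)"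
      using True bf_\<delta>[OF y True]
      by (simp add: bw_def additive_sum[OF add_\<delta>] additive_sg[OF add_\<delta>] del: sum.atMost_Suc)
    finally show ?thesis by (simp add: dv_def)
  next
    case False
    then show ?thesis by (simp add: bw_def dv_def additive_zero[OF add_\<delta>])
  qed
qed

lemma bf_sum:
  "\<alpha>s \<in> pos_lists (Suc p) \<Longrightarrow> bf p q j (\<lambda>\<beta>s. \<Sum>i\<in>I. g i \<beta>s) \<alpha>s = (\<Sum>i\<in>I. bf p q j (g i) \<alpha>s)"
  using tl_pos_lists[of \<alpha>s p] by (simp add: bf_def additive_sum[OF add_L] additive_sum[OF add_U])

lemma bf_sg: "\<alpha>s \<in> pos_lists (Suc p) \<Longrightarrow> bf p q j (\<lambda>\<beta>s. sg i (g \<beta>s)) \<alpha>s = sg i (bf p q j g \<alpha>s)"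
  using tl_pos_lists[of \<alpha>s p] by (simp add: bf_def additive_sg[OF add_L] additive_sg[OF add_U])

lemma bf_cong:
  assumes "\<alpha>s \<in> pos_lists (Suc p)" "j \<le> Suc p" "\<And>\<beta>s. \<beta>s \<in> pos_lists p \<Longrightarrow> x \<beta>s = y \<beta>s"
  shows "bf p q j x \<alpha>s = bf p q j y \<alpha>s"
  using assms(3) tl_pos_lists[OF assms(1)] butlast_pos_lists[OF assms(1)]
    mg_pos_lists[OF _ assms(1), of "j - 1"] assms(2) by (auto simp: bf_def)

text \<open>The cosimplicial identities. Two initial faces give functoriality of \<open>L\<close>,
  two final ones that of \<open>U\<close>, an initial and a final one their commutation; the
  remaining cases are identities between merged lists.\<close>

lemma bf_bf:
  assumes y: "y \<in> C p q" and \<alpha>s: "\<alpha>s \<in> pos_lists (Suc (Suc p))" and ij: "i < j" "j \<le> Suc (Suc p)"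
  shows "bf (Suc p) q j (bf p q i y) \<alpha>s = bf (Suc p) q i (bf p q (j - 1) y) \<alpha>s"
proof -
  have len: "length \<alpha>s = Suc (Suc p)" using \<alpha>s by (rule pos_lists_length)
  obtain l where j: "j = Suc l" using ij by (cases j) auto
  note t = tl_pos_lists[OF \<alpha>s] and b = butlast_pos_lists[OF \<alpha>s]
  note tt = tl_pos_lists[OF conjunct1[OF t]] and bb = butlast_pos_lists[OF conjunct1[OF b]]
    and bt = butlast_pos_lists[OF conjunct1[OF t]]
  have tlbl: "hd (butlast \<alpha>s) = hd \<alpha>s" "last (tl \<alpha>s) = last \<alpha>s" "tl (butlast \<alpha>s) = butlast (tl \<alpha>s)"
    using len by (cases \<alpha>s; cases "tl \<alpha>s"; simp)+
  consider "i = 0" "j = 1" | k where "i = 0" "l = Suc k" "l \<le> p" | "i = 0" "l = Suc p"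
    | k where "i = Suc k" "l \<le> p" | k where "i = Suc k" "k < p" "l = Suc p" | "i = Suc p" "l = Suc p"
    using ij j by (cases i; cases l) (auto simp: le_less less_Suc_eq)
  then show ?thesis
  proof cases
    case 1
    then show ?thesis
      using hd_tl_mg_0[of \<alpha>s] len t tt L_L[OF prod_list_pos _ _ C_D[OF y], of "tl (tl \<alpha>s)" p "hd \<alpha>s" "hd (tl \<alpha>s)"]
      by (simp add: bf_def)
  next
    case (2 k)
    then show ?thesis using hd_tl_mg_Suc[of \<alpha>s k] len j by (simp add: bf_def)
  next
    case 3
    then show ?thesis
      using j t b bt tlbl L_U[OF prod_list_pos _ _ C_D[OF y], of "butlast (tl \<alpha>s)" p "hd \<alpha>s" "last \<alpha>s"]
      by (simp add: bf_def)
  next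
    case (4 k)
    then show ?thesis using j ij mg_mg[of k l \<alpha>s] len by (simp add: bf_def)
  next
    case (5 k)
    then show ?thesis using j last_butlast_mg[of k \<alpha>s] len by (simp add: bf_def)
  next
    case 6
    then show ?thesis
      using j last_butlast_mg_last[of \<alpha>s p] len b bb
        U_U[OF prod_list_pos _ _ C_D[OF y], of "butlast (butlast \<alpha>s)" p "last \<alpha>s" "last (butlast \<alpha>s)"]
      by (simp add: bf_def)
  qed
qed

lemma bw_bw: "y \<in> C p q \<Longrightarrow> bw (Suc p) q (bw p q y) = 0"
proof
  fix \<alpha>s assume y: "y \<in> C p q"
  show "bw (Suc p) q (bw p q y) \<alpha>s = 0 \<alpha>s"
  proof (cases "\<alpha>s \<in> pos_lists (Suc (Suc p))")
    case True
    have "bf (Suc p) q j (bw p q y) \<alpha>s = (\<Sum>i\<le>Suc p. sg i (bf (Suc p) q j (bf p q i y) \<alpha>s))"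
      if "j \<le> Suc (Suc p)" for j
    proof -
      have "bf (Suc p) q j (bw p q y) \<alpha>s = bf (Suc p) q j (\<lambda>\<beta>s. \<Sum>i\<le>Suc p. sg i (bf p q i y \<beta>s)) \<alpha>s"
        by (rule bf_cong[OF True that]) (simp add: bw_def del: sum.atMost_Suc)
      then show ?thesis using True by (simp add: bf_sum bf_sg del: sum.atMost_Suc)
    qed
    then have "bw (Suc p) q (bw p q y) \<alpha>s =
        (\<Sum>j\<le>Suc (Suc p). sg j (\<Sum>i\<le>Suc p. sg i (bf (Suc p) q j (bf p q i y) \<alpha>s)))"
      using True by (simp add: bw_def del: sum.atMost_Suc)
    also have "\<dots> = 0"
      by (rule alternating_double_sum) (rule bf_bf[OF y True])
    finally show ?thesis by simp
  qed (simp add: bw_def)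
qed

lemma double_complex: "double_complex C bw dv"
  by unfold_locales
    (simp_all add: subgrp_C additive_bw additive_dv bw_C dv_C bw_bw dv_dv bw_dv)

interpretation DC: double_complex C bw dv by (rule double_complex)

definition Zq :: "nat \<Rightarrow> nat \<Rightarrow> 'w set" where
  "Zq q f = {x \<in> S q f. \<delta> q x = 0}"

definition Bq :: "nat \<Rightarrow> nat \<Rightarrow> 'w set" where
  "Bq q f = {x. case q of 0 \<Rightarrow> x = 0 | Suc k \<Rightarrow> \<exists>y\<in>S k f. x = \<delta> k y}"

text \<open>Boundaries in a product of complexes are boundaries in each factor: the primitives are
  chosen list by list, and the sign in \<open>dv\<close> is absorbed into them.\<close>

lemma pointwise_boundary:
  assumes y: "y \<in> C p q"
  shows "(\<forall>\<alpha>s\<in>pos_lists p. y \<alpha>s \<in> Bq q (prod_list \<alpha>s)) \<longleftrightarrow>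
    (case q of 0 \<Rightarrow> y = 0 | Suc k \<Rightarrow> \<exists>w\<in>C p k. y = dv p k w)"
proof (cases q)
  case 0
  have "y = 0 \<longleftrightarrow> (\<forall>\<alpha>s\<in>pos_lists p. y \<alpha>s = 0)"
    using C_0[OF y] by (auto simp: fun_eq_iff)
  then show ?thesis using 0 by (simp add: Bq_def)
next
  case (Suc k)
  have "(\<forall>\<alpha>s\<in>pos_lists p. \<exists>w\<in>S k (prod_list \<alpha>s). y \<alpha>s = \<delta> k w) \<longleftrightarrow> (\<exists>w\<in>C p k. y = dv p k w)"
  proof
    assume "\<forall>\<alpha>s\<in>pos_lists p. \<exists>w\<in>S k (prod_list \<alpha>s). y \<alpha>s = \<delta> k w"
    then have "\<forall>\<alpha>s\<in>pos_lists p. \<exists>w. w \<in> S k (prod_list \<alpha>s) \<and> y \<alpha>s = \<delta> k w" by blast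
    then obtain w where w: "\<forall>\<alpha>s\<in>pos_lists p. w \<alpha>s \<in> S k (prod_list \<alpha>s) \<and> y \<alpha>s = \<delta> k (w \<alpha>s)"
      by (rule bchoice[THEN exE])
    let ?w = "\<lambda>\<alpha>s. if \<alpha>s \<in> pos_lists p then sg p (w \<alpha>s) else 0"
    have "?w \<in> C p k"
      by (rule C_I) (use w in \<open>simp_all add: subgrp_sg[OF subgrp_S[OF prod_list_pos]]\<close>)
    moreover have "y = dv p k ?w"
      using w C_0[OF y] by (auto simp: fun_eq_iff dv_def additive_sg[OF add_\<delta>] additive_zero[OF add_\<delta>])
    ultimately show "\<exists>w\<in>C p k. y = dv p k w" by blast
  next
    assume "\<exists>w\<in>C p k. y = dv p k w"
    then obtain w where w: "w \<in> C p k" "y = dv p k w" by blast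
    show "\<forall>\<alpha>s\<in>pos_lists p. \<exists>w\<in>S k (prod_list \<alpha>s). y \<alpha>s = \<delta> k w"
    proof
      fix \<alpha>s assume \<alpha>s: "\<alpha>s \<in> pos_lists p"
      show "\<exists>w\<in>S k (prod_list \<alpha>s). y \<alpha>s = \<delta> k w"
        using w C_D[OF w(1) \<alpha>s] subgrp_sg[OF subgrp_S[OF prod_list_pos[OF \<alpha>s]]]
        by (intro bexI[of _ "sg p (w \<alpha>s)"]) (simp_all add: dv_def additive_sg[OF add_\<delta>])
    qed
  qed
  then show ?thesis using Suc by (simp add: Bq_def)
qed

text \<open>A Baues-Wirsching cochain with values in cohomology is represented by a family of
  cocycles modulo families of boundaries. Hence Baues-Wirsching cohomology is the iterated
  cohomology of the double complex, which is its second page.\<close>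

theorem presents_H_BW:
  fixes N :: "(nat, 'd) nat_system"
  assumes pres: "\<And>f. 0 < f \<Longrightarrow> presents (h f) (Zq q f) (Bq q f) (NOb N f)"
    and lower: "\<And>u f x. 0 < u \<Longrightarrow> 0 < f \<Longrightarrow> x \<in> Zq q f \<Longrightarrow> NMap N u 1 f (h f x) = h (u * f) (L u x)"
    and upper: "\<And>v f x. 0 < v \<Longrightarrow> 0 < f \<Longrightarrow> x \<in> Zq q f \<Longrightarrow> NMap N 1 v f (h f x) = h (f * v) (U q v x)"
  shows "\<exists>k. presents k (DC.E2_cocycles p q) (DC.E2_boundaries p q) (H_BW pos_nat_monoid N p)"
proof -
  \<comment> \<open>\<open>Sp\<close> consists of the families of cocycles, \<open>Np\<close> of the
    families of boundaries, and \<open>hp\<close> takes classes at each list.\<close>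
  define Sp where "Sp p = {y. \<forall>\<alpha>s. if \<alpha>s \<in> pos_lists p then y \<alpha>s \<in> Zq q (prod_list \<alpha>s) else y \<alpha>s = 0}" for p
  define Np where "Np p = {y. \<forall>\<alpha>s\<in>pos_lists p. y \<alpha>s \<in> Bq q (prod_list \<alpha>s)}" for p
  define hp where "hp p y = (\<lambda>\<alpha>s\<in>pos_lists p. h (prod_list \<alpha>s) (y \<alpha>s))" for p y
  have lists: "{\<alpha>s. set \<alpha>s \<subseteq> carrier pos_nat_monoid \<and> length \<alpha>s = n} = pos_lists n" for n
    by (simp add: pos_lists_def)
  have Sp: "y \<in> Sp p \<longleftrightarrow> y \<in> C p q \<and> dv p q y = 0" for p y
  proof
    assume "y \<in> Sp p"
    then have a: "\<And>\<alpha>s. \<alpha>s \<in> pos_lists p \<Longrightarrow> y \<alpha>s \<in> Zq q (prod_list \<alpha>s)"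
      and b: "\<And>\<alpha>s. \<alpha>s \<notin> pos_lists p \<Longrightarrow> y \<alpha>s = 0" unfolding Sp_def by (metis (mono_tags, lifting) mem_Collect_eq)+
    have "y \<in> C p q" by (rule C_I) (use a b in \<open>auto simp: Zq_def\<close>)
    moreover have "\<delta> q (y \<alpha>s) = 0" for \<alpha>s
      using a[of \<alpha>s] b[of \<alpha>s] by (cases "\<alpha>s \<in> pos_lists p") (auto simp: Zq_def additive_zero[OF add_\<delta>])
    ultimately show "y \<in> C p q \<and> dv p q y = 0" by (simp add: dv_def fun_eq_iff)
  next
    assume y: "y \<in> C p q \<and> dv p q y = 0"
    then have "\<delta> q (y \<alpha>s) = 0" for \<alpha>s by (simp add: dv_def fun_eq_iff)
    then show "y \<in> Sp p" using C_D[OF conjunct1[OF y]] C_0[OF conjunct1[OF y]] by (simp add: Sp_def Zq_def)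
  qed
  have Np: "y \<in> Np p \<longleftrightarrow> (case q of 0 \<Rightarrow> y = 0 | Suc k \<Rightarrow> \<exists>w\<in>C p k. y = dv p k w)" if "y \<in> C p q" for p y
    using pointwise_boundary[OF that] by (simp add: Np_def)
  have pr: "presents (hp p) (Sp p) (Np p) (BW_cochains pos_nat_monoid N p)" for p
    unfolding hp_def Sp_def Np_def BW_cochains_def comp_list_pos_nat lists
    by (rule presents_product[OF pres[OF prod_list_pos]])
  have bwS: "bw n q y \<in> Sp (Suc n)" if "y \<in> Sp n" for n y
  proof -
    have y: "y \<in> C n q" "dv n q y = 0" using that by (simp_all add: Sp)
    have "dv (Suc n) q (bw n q y) = - bw n (Suc q) (dv n q y)"
      using bw_dv[OF y(1)] by (simp add: eq_neg_iff_add_eq_0 add.commute)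
    then show ?thesis using y bw_C by (simp add: Sp additive_zero[OF additive_bw])
  qed
  have comm: "BW_coboundary pos_nat_monoid N n (hp n y) = hp (Suc n) (bw n q y)" if yS: "y \<in> Sp n" for n y
  proof
    fix \<alpha>s
    show "BW_coboundary pos_nat_monoid N n (hp n y) \<alpha>s = hp (Suc n) (bw n q y) \<alpha>s"
    proof (cases "\<alpha>s \<in> pos_lists (Suc n)")
      case False
      then show ?thesis by (simp add: BW_coboundary_def lists hp_def del: carrier_pos_nat)
    next
      case True
      let ?T = "NOb N (prod_list \<alpha>s)" and ?h = "h (prod_list \<alpha>s)"
      note t = tl_pos_lists[OF True] and b = butlast_pos_lists[OF True]
      have yC: "y \<in> C n q" and yd: "\<And>\<alpha>s. \<delta> q (y \<alpha>s) = 0" using yS by (auto simp: Sp dv_def fun_eq_iff)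
      have yZ: "y \<beta>s \<in> Zq q (prod_list \<beta>s)" if "\<beta>s \<in> pos_lists n" for \<beta>s
        using C_D[OF yC that] yd by (simp add: Zq_def)
      have T: "presents ?h (Zq q (prod_list \<alpha>s)) (Bq q (prod_list \<alpha>s)) ?T"
        by (rule pres[OF prod_list_pos[OF True]])
      interpret T: comm_group ?T by (rule presents_comm_group[OF T])
      have bfZ: "bf n q i y \<alpha>s \<in> Zq q (prod_list \<alpha>s)" if "i \<le> Suc n" for i
      proof -
        have "bf n (Suc q) i (\<lambda>\<alpha>s. \<delta> q (y \<alpha>s)) \<alpha>s = 0"
          using t by (simp add: yd bf_def additive_zero[OF add_L] additive_zero[OF add_U])
        then show ?thesis using bf_S[OF yC True that] bf_\<delta>[OF yC True that] by (simp add: Zq_def)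
      qed
      have 0: "NMap N (hd \<alpha>s) 1 (prod_list (tl \<alpha>s)) (hp n y (tl \<alpha>s)) = ?h (bf n q 0 y \<alpha>s)"
        using lower[of "hd \<alpha>s" "prod_list (tl \<alpha>s)"] t yZ prod_list_pos[of "tl \<alpha>s" n]
        by (simp add: hp_def bf_def)
      have last: "NMap N 1 (last \<alpha>s) (prod_list (butlast \<alpha>s)) (hp n y (butlast \<alpha>s)) = ?h (bf n q (Suc n) y \<alpha>s)"
        using upper[of "last \<alpha>s" "prod_list (butlast \<alpha>s)"] b yZ prod_list_pos[of "butlast \<alpha>s" n]
        by (simp add: hp_def bf_def)
      have mid: "hp n y (merge pos_nat_monoid j \<alpha>s) [^]\<^bsub>?T\<^esub> ((- 1 :: int) ^ j) = ?h (sg j (bf n q j y \<alpha>s))"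
        if "j \<in> {1..n}" for j
      proof -
        obtain i where j: "j = Suc i" "Suc i < Suc n" using \<open>j \<in> {1..n}\<close> by (cases j) auto
        have "hp n y (merge pos_nat_monoid j \<alpha>s) = ?h (bf n q j y \<alpha>s)"
          using j mg_pos_lists[OF j(2) True] pos_lists_length[OF True]
          by (simp add: merge_mg hp_def bf_def prod_list_mg)
        then show ?thesis using presents_sg[OF T bfZ[of j], of j] \<open>j \<in> {1..n}\<close> by simp
      qed
      have Z: "subgrp (Zq q (prod_list \<alpha>s))" by (rule presents_subgrp[OF T])
      have sgZ: "sg i (bf n q i y \<alpha>s) \<in> Zq q (prod_list \<alpha>s)" if "i \<le> Suc n" for i
        by (rule subgrp_sg[OF Z bfZ[OF that]])
      \<comment> \<open>Separates the initial face, the final face and the mergings, which are the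
        three factors in the definition of \<open>BW_coboundary\<close>.\<close>
      have "{..Suc n} = insert 0 (insert (Suc n) {1..n})" by auto
      then have split: "(\<Sum>i\<le>Suc n. sg i (bf n q i y \<alpha>s)) =
          bf n q 0 y \<alpha>s + (\<Sum>i\<in>{1..n}. sg i (bf n q i y \<alpha>s)) + sg (Suc n) (bf n q (Suc n) y \<alpha>s)"
        by (simp add: algebra_simps del: sum.atMost_Suc sg_Suc)
      have mids: "(\<Sum>i\<in>{1..n}. sg i (bf n q i y \<alpha>s)) \<in> Zq q (prod_list \<alpha>s)"
        by (rule subgrp_sum[OF Z]) (rule sgZ, simp)
      have "BW_coboundary pos_nat_monoid N n (hp n y) \<alpha>s =
          ?h (bf n q 0 y \<alpha>s) \<otimes>\<^bsub>?T\<^esub> (\<Otimes>\<^bsub>?T\<^esub>j\<in>{1..n}. hp n y (merge pos_nat_monoid j \<alpha>s) [^]\<^bsub>?T\<^esub> ((- 1 :: int) ^ j))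
          \<otimes>\<^bsub>?T\<^esub> ?h (bf n q (Suc n) y \<alpha>s) [^]\<^bsub>?T\<^esub> ((- 1 :: int) ^ Suc n)"
        using True 0 last
        by (simp add: BW_coboundary_def lists comp_list_pos_nat Let_def del: carrier_pos_nat)
      also have "(\<Otimes>\<^bsub>?T\<^esub>j\<in>{1..n}. hp n y (merge pos_nat_monoid j \<alpha>s) [^]\<^bsub>?T\<^esub> ((- 1 :: int) ^ j)) =
          (\<Otimes>\<^bsub>?T\<^esub>j\<in>{1..n}. ?h (sg j (bf n q j y \<alpha>s)))"
        by (rule T.finprod_cong') (use mid sgZ presents_closed[OF T] in auto)
      also have "\<dots> = ?h (\<Sum>j\<in>{1..n}. sg j (bf n q j y \<alpha>s))"
        by (rule presents_sum[OF T, symmetric]) (rule sgZ, simp)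
      also have "?h (bf n q (Suc n) y \<alpha>s) [^]\<^bsub>?T\<^esub> ((- 1 :: int) ^ Suc n) = ?h (sg (Suc n) (bf n q (Suc n) y \<alpha>s))"
        by (rule presents_sg[OF T bfZ, symmetric]) simp
      also have "?h (bf n q 0 y \<alpha>s) \<otimes>\<^bsub>?T\<^esub> ?h (\<Sum>j\<in>{1..n}. sg j (bf n q j y \<alpha>s)) \<otimes>\<^bsub>?T\<^esub>
          ?h (sg (Suc n) (bf n q (Suc n) y \<alpha>s)) = ?h (\<Sum>i\<le>Suc n. sg i (bf n q i y \<alpha>s))"
        unfolding split
        using presents_add[OF T bfZ[of 0] mids] presents_add[OF T subgrp_add[OF Z bfZ[of 0] mids] sgZ[of "Suc n"]]
        by simp
      also have "\<dots> = hp (Suc n) (bw n q y) \<alpha>s"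
        using True by (simp add: hp_def bw_def del: sum.atMost_Suc)
      finally show ?thesis .
    qed
  qed
  have zero: "0 \<in> Np m" for m by (rule presents_zero_mem[OF pr])
  have "presents (\<lambda>x. coboundaries (BW_cochains pos_nat_monoid N) (BW_coboundary pos_nat_monoid N) p
        #>\<^bsub>BW_cochains pos_nat_monoid N p\<^esub> hp p x) {x \<in> Sp p. bw p q x \<in> Np (Suc p)}
      {x. case p of 0 \<Rightarrow> x \<in> Np 0 | Suc k \<Rightarrow> \<exists>y\<in>Sp k. x - bw k q y \<in> Np p}
      (cohomology (BW_cochains pos_nat_monoid N) (BW_coboundary pos_nat_monoid N) p)"
    by (rule presents_cohomology[where h = hp and S = Sp and N = Np and D = "\<lambda>n. bw n q", OF pr bwS additive_bw comm])
      (use bw_bw Sp zero in auto)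
  moreover have "{x \<in> Sp p. bw p q x \<in> Np (Suc p)} = DC.E2_cocycles p q"
  proof -
    have "x \<in> Sp p \<and> bw p q x \<in> Np (Suc p) \<longleftrightarrow> x \<in> DC.E2_cocycles p q" for x
      using Np[OF bw_C, of x p] unfolding Sp DC.E2_cocycles_def by (auto split: nat.split)
    then show ?thesis by blast
  qed
  ultimately have "presents (\<lambda>x. coboundaries (BW_cochains pos_nat_monoid N) (BW_coboundary pos_nat_monoid N) p
        #>\<^bsub>BW_cochains pos_nat_monoid N p\<^esub> hp p x) (DC.E2_cocycles p q)
      {x. case p of 0 \<Rightarrow> x \<in> Np 0 | Suc k \<Rightarrow> \<exists>y\<in>Sp k. x - bw k q y \<in> Np p} (H_BW pos_nat_monoid N p)"
    by (simp add: H_BW_def)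
  then have "presents (\<lambda>x. coboundaries (BW_cochains pos_nat_monoid N) (BW_coboundary pos_nat_monoid N) p
        #>\<^bsub>BW_cochains pos_nat_monoid N p\<^esub> hp p x) (DC.E2_cocycles p q)
      (DC.E2_boundaries p q) (H_BW pos_nat_monoid N p)"
  \<comment> \<open>The cocycles stay the same; only the description of the boundaries is exchanged
    for that of the second page.\<close>
  proof (rule presents_restrict)
    show "\<exists>y\<in>DC.E2_cocycles p q. x - y \<in> {x. case p of 0 \<Rightarrow> x \<in> Np 0 | Suc k \<Rightarrow> \<exists>y\<in>Sp k. x - bw k q y \<in> Np p}"
      if "x \<in> DC.E2_cocycles p q" for x
      using that zero subgrp_zero[OF presents_subgrp[OF pr]]
      by (intro bexI[of _ x]) (auto split: nat.split intro!: bexI[of _ 0] simp: additive_zero[OF additive_bw])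
    show "x \<in> {x. case p of 0 \<Rightarrow> x \<in> Np 0 | Suc k \<Rightarrow> \<exists>y\<in>Sp k. x - bw k q y \<in> Np p} \<longleftrightarrow> x \<in> DC.E2_boundaries p q"
      if "x \<in> DC.E2_cocycles p q" for x
    proof -
      have x: "x \<in> C p q" using that by (simp add: DC.E2_cocycles_def)
      have N': "x - z \<in> Np p \<longleftrightarrow> (case q of 0 \<Rightarrow> x = z | Suc k \<Rightarrow> \<exists>w\<in>C p k. x = z + dv p k w)"
        if "z \<in> C p q" for z
        using Np[OF subgrp_diff[OF subgrp_C x that]] by (auto simp: algebra_simps split: nat.split)
      show ?thesis
      proof (cases p)
        case 0
        then show ?thesis
          using N'[of 0] subgrp_zero[OF subgrp_C] by (cases q) (simp_all add: DC.E2_boundaries_def)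
      next
        case (Suc k)
        define P where "P z \<longleftrightarrow> (case q of 0 \<Rightarrow> x = z | Suc l \<Rightarrow> \<exists>w\<in>C p l. x = z + dv p l w)" for z
        have "x \<in> DC.E2_boundaries p q \<longleftrightarrow> (\<exists>z. (\<exists>y\<in>C k q. dv k q y = 0 \<and> z = bw k q y) \<and> P z)"
          unfolding DC.E2_boundaries_def P_def Suc by simp
        also have "\<dots> \<longleftrightarrow> (\<exists>y\<in>Sp k. P (bw k q y))"
          unfolding Bex_def Sp by blast
        also have "\<dots> \<longleftrightarrow> (\<exists>y\<in>Sp k. x - bw k q y \<in> Np p)"
        proof (rule bex_cong[OF refl])
          fix y assume "y \<in> Sp k"
          then have "bw k q y \<in> C p q" using Suc bw_C by (simp add: Sp)
          then show "P (bw k q y) \<longleftrightarrow> x - bw k q y \<in> Np p" using N' by (simp add: P_def)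
        qed
        finally show ?thesis using Suc by simp
      qed
    qed
  qed (use DC.E2_cocycles_def presents_subgrp[OF \<open>presents _ (DC.E2_cocycles p q) _ _\<close>] in auto)
  then show ?thesis by blast
qed

text \<open>Functoriality holds on the nose for \<open>L\<close> and \<open>U\<close>, hence for
  classes, by computing with representatives.\<close>

theorem natural_system:
  fixes N :: "(nat, 'd) nat_system"
  assumes pres: "\<And>f. 0 < f \<Longrightarrow> presents (h f) (Zq q f) (Bq q f) (NOb N f)"
    and N: "\<And>u v f x. 0 < u \<Longrightarrow> 0 < v \<Longrightarrow> 0 < f \<Longrightarrow> x \<in> Zq q f \<Longrightarrow>
      NMap N u v f (h f x) = h (u * f * v) (U q v (L u x))"
    and unit: "\<And>f x. 0 < f \<Longrightarrow> x \<in> S q f \<Longrightarrow> U q 1 (L 1 x) = x"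
  shows "natural_system pos_nat_monoid N"
proof -
  have UL_Zq: "U q v (L u x) \<in> Zq q (u * f * v)" if "0 < u" "0 < v" "0 < f" "x \<in> Zq q f" for u v f x
    using that L_S[of f u x q] U_S[of "u * f" v "L u x" q] \<delta>_L[of f u x q] \<delta>_U[of "u * f" v "L u x" q]
    by (simp add: Zq_def additive_zero[OF add_L] additive_zero[OF add_U])
  have ex: "\<exists>x\<in>Zq q f. a = h f x" if "0 < f" "a \<in> carrier (NOb N f)" for f a
    using that presents_image[OF pres[OF that(1)]] by (metis imageE)
  have hom: "NMap N u v f \<in> hom (NOb N f) (NOb N (u * f * v))" if uvf: "0 < u" "0 < v" "0 < f" for u v f
  proof (rule homI)
    have pos: "0 < u * f * v" using uvf by simp
    show "NMap N u v f a \<in> carrier (NOb N (u * f * v))" if "a \<in> carrier (NOb N f)" for a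
      using ex[OF uvf(3) that] N[OF uvf] UL_Zq[OF uvf] presents_closed[OF pres[OF pos]] by auto
    show "NMap N u v f (a \<otimes>\<^bsub>NOb N f\<^esub> b) = NMap N u v f a \<otimes>\<^bsub>NOb N (u * f * v)\<^esub> NMap N u v f b"
      if ab: "a \<in> carrier (NOb N f)" "b \<in> carrier (NOb N f)" for a b
    proof -
      obtain x y where xy: "x \<in> Zq q f" "a = h f x" "y \<in> Zq q f" "b = h f y"
        using ex[OF uvf(3) ab(1)] ex[OF uvf(3) ab(2)] by auto
      have "a \<otimes>\<^bsub>NOb N f\<^esub> b = h f (x + y)"
        using presents_add[OF pres[OF uvf(3)] xy(1,3)] xy by simp
      moreover have "x + y \<in> Zq q f"
        by (rule subgrp_add[OF presents_subgrp[OF pres[OF uvf(3)]] xy(1,3)])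
      moreover have "U q v (L u (x + y)) = U q v (L u x) + U q v (L u y)"
        by (simp add: additive_add[OF add_L[OF uvf(1)]] additive_add[OF add_U])
      ultimately show ?thesis
        using presents_add[OF pres[OF pos] UL_Zq[OF uvf xy(1)] UL_Zq[OF uvf xy(3)]] N[OF uvf] xy by simp
    qed
  qed
  have id: "NMap N 1 1 f a = a" if f: "0 < f" and a: "a \<in> carrier (NOb N f)" for f a
  proof -
    obtain x where x: "x \<in> Zq q f" "a = h f x" using ex[OF f a] by auto
    then show ?thesis using N[of 1 1 f x] unit[OF f, of x] f by (simp add: Zq_def)
  qed
  have comp: "NMap N (u' * u) (v * v') f a = NMap N u' v' (u * f * v) (NMap N u v f a)"
    if "0 < u" "0 < v" "0 < u'" "0 < v'" "0 < f" and a: "a \<in> carrier (NOb N f)" for u v u' v' f a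
  proof -
    obtain x where x: "x \<in> Zq q f" "a = h f x" using ex[OF \<open>0 < f\<close> a] by auto
    then have xS: "x \<in> S q f" by (simp add: Zq_def)
    have Lx: "L u x \<in> S q (u * f)" using L_S xS that by simp
    have "U q v' (L u' (U q v (L u x))) = U q v' (U q v (L u' (L u x)))"
      using L_U[of "u * f" u' v "L u x" q] Lx that by simp
    also have "\<dots> = U q (v * v') (L u' (L u x))"
      using U_U[of "u' * (u * f)" v' v "L u' (L u x)" q] L_S[OF _ _ Lx, of u'] that by simp
    also have "\<dots> = U q (v * v') (L (u' * u) x)"
      using L_L[of f u' u x q] xS that by simp
    finally show ?thesis
      using x N[of "u' * u" "v * v'" f x] N[of u v f x] N[of u' v' "u * f * v" "U q v (L u x)"]
        UL_Zq[of u v f x] that by (simp add: ac_simps)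
  qed
  show ?thesis
    unfolding natural_system_def using presents_comm_group[OF pres] hom id comp by simp
qed

end

section \<open>The natural system of derivations\<close>

definition pre :: "'s set \<Rightarrow> ('s \<Rightarrow> 't) \<Rightarrow> ('t \<Rightarrow> 'w::ab_group_add) \<Rightarrow> 's \<Rightarrow> 'w" where
  "pre X f c = (\<lambda>s. if s \<in> X then c (f s) else 0)"

lemma additive_pre: "additive (pre X f)"
  by (auto simp: additive_def pre_def fun_eq_iff)

lemma pre_pre: "f \<in> X \<rightarrow> Y \<Longrightarrow> pre X f (pre Y g c) = pre X (\<lambda>s. g (f s)) c"
  by (auto simp: pre_def fun_eq_iff)

lemma pre_cong: "(\<And>s. s \<in> X \<Longrightarrow> f s = g s) \<Longrightarrow> pre X f c = pre X g c"
  by (auto simp: pre_def fun_eq_iff)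

definition altpre :: "nat \<Rightarrow> 's set \<Rightarrow> (nat \<Rightarrow> 's \<Rightarrow> 't) \<Rightarrow> ('t \<Rightarrow> 'w::ab_group_add) \<Rightarrow> 's \<Rightarrow> 'w" where
  "altpre n X f c = (\<Sum>i\<le>n. sg i (pre X (f i) c))"

lemma additive_altpre: "additive (altpre n X f)"
  unfolding additive_def altpre_def
  by (simp add: additive_add[OF additive_pre] sg_add sum.distrib del: sum.atMost_Suc)

lemma altpre_apply: "s \<in> X \<Longrightarrow> altpre n X f c s = (\<Sum>i\<le>n. sg i (c (f i s)))"
  by (simp add: altpre_def sum_fun_apply sg_apply pre_def del: sum.atMost_Suc)

lemma altpre_outside: "s \<notin> X \<Longrightarrow> altpre n X f c s = 0"
  by (simp add: altpre_def sum_fun_apply sg_apply pre_def del: sum.atMost_Suc)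

lemma altpre_altpre:
  assumes f: "\<And>j. j \<le> Suc n \<Longrightarrow> f j \<in> X \<rightarrow> Y"
    and ff: "\<And>i j s. i < j \<Longrightarrow> j \<le> Suc n \<Longrightarrow> s \<in> X \<Longrightarrow> g i (f j s) = g (j - 1) (f i s)"
  shows "altpre (Suc n) X f (altpre n Y g c) = 0"
proof -
  have "altpre (Suc n) X f (altpre n Y g c) =
      (\<Sum>j\<le>Suc n. sg j (\<Sum>i\<le>n. sg i (pre X (f j) (pre Y (g i) c))))"
    unfolding altpre_def by (simp only: additive_sum[OF additive_pre] additive_sg[OF additive_pre])
  also have "\<dots> = 0"
  proof (rule alternating_double_sum)
    fix i j assume ij: "i < j" "j \<le> Suc n"
    then have "f j \<in> X \<rightarrow> Y" "f i \<in> X \<rightarrow> Y" using f by auto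
    then show "pre X (f j) (pre Y (g i) c) = pre X (f i) (pre Y (g (j - 1)) c)"
      using ff[OF ij] by (simp add: pre_pre cong: pre_cong)
  qed
  finally show ?thesis .
qed

lemma hom_altpre:
  assumes "additive k" "\<And>i. i \<le> n \<Longrightarrow> k (pre X (f i) c) = pre Y (g i) (k' c)"
  shows "k (altpre n X f c) = altpre n Y g (k' c)"
  unfolding altpre_def using assms(2)
  by (simp add: additive_sum[OF assms(1)] additive_sg[OF assms(1)] del: sum.atMost_Suc)

lemma truncate_simps [simp]:
  "carrier (ring.truncate A) = carrier A" "monoid.mult (ring.truncate A) = monoid.mult A"
  "ring.add (ring.truncate A) = ring.add A" "monoid.one (ring.truncate A) = monoid.one A"
  "ring.zero (ring.truncate A) = ring.zero A"
  by (simp_all add: ring.defs)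

lemma ring_hom_truncate: "ring_hom (ring.truncate A) B = ring_hom A B"
    "ring_hom B (ring.truncate A) = ring_hom B A"
  by (simp_all add: ring_hom_def)

lemma cring_truncate: "cring A \<Longrightarrow> cring (ring.truncate A)"
proof -
  assume "cring A"
  then interpret A: cring A .
  have m: "a_inv (ring.truncate A) = a_inv A"
    by (simp add: a_inv_def m_inv_def fun_eq_iff)
  show ?thesis
  proof (rule cringI)
    show "abelian_group (ring.truncate A)"
      by (rule abelian_groupI) (use A.l_neg A.a_inv_closed in \<open>auto simp: A.a_ac\<close>)
    show "comm_monoid (ring.truncate A)"
      by (rule comm_monoidI) (auto simp: A.m_ac)
  qed (auto simp: A.l_distr)
qed

lemma base_psi_ring_simps [simp]:
  "carrier (base_psi_ring R) = Base ` carrier R" "\<one>\<^bsub>base_psi_ring R\<^esub> = Base \<one>\<^bsub>R\<^esub>"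
  "\<zero>\<^bsub>base_psi_ring R\<^esub> = Base \<zero>\<^bsub>R\<^esub>" "Base x \<otimes>\<^bsub>base_psi_ring R\<^esub> Base y = Base (x \<otimes>\<^bsub>R\<^esub> y)"
  "Base x \<oplus>\<^bsub>base_psi_ring R\<^esub> Base y = Base (x \<oplus>\<^bsub>R\<^esub> y)" "Psi (base_psi_ring R) i (Base x) = Base (Psi R i x)"
  by (simp_all add: base_psi_ring_def base_ring_def ring.defs psi_ring.defs)

lemma truncate_base_psi_ring: "ring.truncate (base_psi_ring R) = base_ring R"
  by (simp add: base_psi_ring_def base_ring_def ring.defs psi_ring.defs)

lemma psi_ring_base:
  assumes "psi_ring R" shows "psi_ring (base_psi_ring R)"
proof -
  interpret R: psi_ring R by fact
  have "cring (base_psi_ring R)"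
  proof (rule cringI)
    show "abelian_group (base_psi_ring R)"
    proof (rule abelian_groupI)
      show "\<exists>y\<in>carrier (base_psi_ring R). y \<oplus>\<^bsub>base_psi_ring R\<^esub> x = \<zero>\<^bsub>base_psi_ring R\<^esub>"
        if "x \<in> carrier (base_psi_ring R)" for x
        using that R.l_neg R.a_inv_closed by force
    qed (auto simp: R.a_ac)
    show "comm_monoid (base_psi_ring R)"
      by (rule comm_monoidI) (auto simp: R.m_ac)
  qed (auto simp: R.l_distr)
  moreover have "Psi (base_psi_ring R) i \<in> ring_hom (base_psi_ring R) (base_psi_ring R)" if "0 < i" for i
    using R.Psi_hom[OF that] by (auto simp: ring_hom_def)
  ultimately show ?thesis
    by (intro psi_ring.intro psi_ring_axioms.intro) (use R.Psi_1 R.Psi_Psi in auto)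
qed

section \<open>The module as a subgroup of a type-class group, and the complexes of
  derivations\<close>

locale psi_pair = psi_module R M for R :: "'a psi_ring" and M :: "('a, 'm) psi_module"
begin

lemma comm_group_M: "comm_group (add_monoid M)"
  by (rule abelian_group.a_comm_group[OF M.abelian_group_axioms])

text \<open>The additive group of \<open>M\<close> as a plain \<open>monoid\<close> record, the type
  that indexes the coordinates of \<open>big\<close>; \<open>add_monoid M\<close> has an extended
  record type.\<close>

definition AG :: "'m monoid" where
  "AG = \<lparr>carrier = carrier M, monoid.mult = ring.add M, one = ring.zero M\<rparr>"

lemma comm_group_AG: "comm_group AG"
  by (rule comm_groupI) (use M.l_neg M.a_inv_closed in \<open>auto simp: AG_def M.a_ac\<close>)

definition em :: "'m \<Rightarrow> 'm big" where "em = big_emb AG"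

text \<open>A retraction of the whole type \<open>big\<close> onto \<open>M\<close>, additive
  everywhere. Maps defined through it, such as \<open>lw\<close>, are therefore additive on the
  whole type and not only on \<open>NN\<close>.\<close>

definition prj :: "'m big \<Rightarrow> 'm" where "prj = big_pr AG"

definition NN :: "'m big set" where "NN = em ` carrier M"

definition act :: "'a \<Rightarrow> 'm big \<Rightarrow> 'm big" where "act r z = em (r \<odot>\<^bsub>M\<^esub> prj z)"

definition lw :: "nat \<Rightarrow> 'm big \<Rightarrow> 'm big" where "lw u z = em (psi M u (prj z))"

lemma prj_closed: "prj z \<in> carrier M"
  using big_pr_closed[OF comm_group_AG] by (simp add: prj_def AG_def)

lemma prj_em: "x \<in> carrier M \<Longrightarrow> prj (em x) = x"
  using big_pr_emb[OF comm_group_AG] by (simp add: prj_def em_def AG_def)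

lemma prj_add: "prj (y + z) = prj y \<oplus>\<^bsub>M\<^esub> prj z"
  using big_pr_add[OF comm_group_AG] by (simp add: prj_def AG_def)

lemma prj_zero: "prj 0 = \<zero>\<^bsub>M\<^esub>"
  using big_pr_zero[OF comm_group_AG] by (simp add: prj_def AG_def)

lemma em_zero: "em \<zero>\<^bsub>M\<^esub> = 0"
  using big_emb_one[OF comm_group_AG] by (simp add: em_def AG_def)

lemma em_add: "x \<in> carrier M \<Longrightarrow> y \<in> carrier M \<Longrightarrow> em (x \<oplus>\<^bsub>M\<^esub> y) = em x + em y"
  using big_emb_mult[OF comm_group_AG] by (simp add: em_def AG_def)

lemma em_closed: "x \<in> carrier M \<Longrightarrow> em x \<in> NN"
  by (simp add: NN_def)

lemma em_prj: "z \<in> NN \<Longrightarrow> em (prj z) = z"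
  by (auto simp: NN_def prj_em)

lemma subgrp_NN: "subgrp NN"
  unfolding subgrp_def
proof (intro conjI ballI)
  show "0 \<in> NN" using em_closed[of "\<zero>\<^bsub>M\<^esub>"] by (simp add: em_zero)
  fix y z assume "y \<in> NN" "z \<in> NN"
  then obtain a b where ab: "a \<in> carrier M" "y = em a" "b \<in> carrier M" "z = em b" by (auto simp: NN_def)
  have "em (a \<ominus>\<^bsub>M\<^esub> b) + em b = em a"
    using ab em_add[of "a \<ominus>\<^bsub>M\<^esub> b" b] by (simp add: M.minus_eq M.a_assoc M.l_neg)
  then have "y - z = em (a \<ominus>\<^bsub>M\<^esub> b)" using ab by (simp add: algebra_simps)
  then show "y - z \<in> NN" using ab em_closed by simp
qed

lemma presents_prj: "presents prj UNIV {z. prj z = \<zero>\<^bsub>M\<^esub>} (add_monoid M)"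
proof -
  have "carrier M \<subseteq> range prj" using prj_em by (metis rangeI subsetI)
  then have "range prj = carrier (add_monoid M)" using prj_closed by auto
  then show ?thesis
    unfolding presents_def using comm_group_M prj_add by (auto simp: comm_group_def subgrp_def)
qed

lemma lw_closed: "0 < u \<Longrightarrow> lw u z \<in> NN"
  by (simp add: lw_def em_closed psi_closed prj_closed)

lemma additive_lw: "0 < u \<Longrightarrow> additive (lw u)"
  by (simp add: additive_def lw_def prj_add psi_add prj_closed em_add psi_closed)

lemma lw_lw: "0 < u \<Longrightarrow> 0 < v \<Longrightarrow> lw u (lw v z) = lw (u * v) z"
  by (simp add: lw_def prj_em psi_closed prj_closed psi_psi)

lemma lw_1: "z \<in> NN \<Longrightarrow> lw 1 z = z"
  using psi_1 prj_closed em_prj by (simp add: lw_def)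

lemma lw_act: "0 < u \<Longrightarrow> r \<in> carrier R \<Longrightarrow> lw u (act r z) = act (Psi R u r) (lw u z)"
  by (simp add: lw_def act_def prj_em prj_closed psi_closed psi_smult)

lemma ring_action: "ring_action R NN act"
  by (intro ring_action.intro ring_action_axioms.intro)
    (auto simp: subgrp_NN act_def em_closed prj_closed prj_add em_add prj_em em_prj
      smult_r_distr smult_l_distr smult_assoc1 smult_one psi_ring_cring[OF psi_ring_axioms])

sublocale RA: ring_action R NN act by (rule ring_action)

lemma Psi_R_closed: "0 < f \<Longrightarrow> r \<in> carrier R \<Longrightarrow> Psi R f r \<in> carrier R"
  by (rule ring_hom_closed[OF Psi_hom])

definition over :: "'a univ psi_ring \<Rightarrow> ('a univ \<Rightarrow> 'a) \<Rightarrow> bool" where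
  "over A p \<longleftrightarrow> psi_ring A \<and> p \<in> ring_hom A R \<and> (\<forall>v>0. \<forall>x\<in>carrier A. p (Psi A v x) = Psi R v (p x))"

lemma overD: assumes "over A p"
  shows "psi_ring A" "cring (ring.truncate A)" "p \<in> ring_hom (ring.truncate A) R"
    "0 < v \<Longrightarrow> x \<in> carrier A \<Longrightarrow> p (Psi A v x) = Psi R v (p x)"
    "x \<in> carrier A \<Longrightarrow> p x \<in> carrier R"
    "0 < v \<Longrightarrow> Psi A v \<in> ring_hom (ring.truncate A) (ring.truncate A)"
    "0 < v \<Longrightarrow> Psi A v \<in> carrier (ring.truncate A) \<rightarrow> carrier (ring.truncate A)"
  using assms psi_ring.Psi_hom[of A v] ring_hom_closed[of p A R] Psi_closed[of A v]
  by (auto simp: over_def ring_hom_truncate cring_truncate psi_ring_cring)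

text \<open>The truncation forgets the Adams operations, so that the comonad on plain rings can be
  applied.\<close>

definition rng :: "'a univ psi_ring \<Rightarrow> nat \<Rightarrow> 'a univ ring" where
  "rng A m = (Ob ring_free_comonad ^^ m) (ring.truncate A)"

definition aug :: "'a univ psi_ring \<Rightarrow> nat \<Rightarrow> 'a univ \<Rightarrow> 'a univ" where
  "aug A m = augmentation ring_free_comonad (ring.truncate A) m"

definition fc :: "'a univ psi_ring \<Rightarrow> nat \<Rightarrow> nat \<Rightarrow> 'a univ \<Rightarrow> 'a univ" where
  "fc A m i = face ring_free_comonad (ring.truncate A) m i"

definition pv :: "'a univ psi_ring \<Rightarrow> nat \<Rightarrow> nat \<Rightarrow> 'a univ \<Rightarrow> 'a univ" where
  "pv A m v = Ar_pow ring_free_comonad m (ring.truncate A) (Psi A v)"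

text \<open>\<open>m\<close> counts free functors, so m = 0 is the augmentation Der(A, M^f) and
  \<open>adl A 0\<close> is induced by the counit. \<open>SS\<close> and \<open>dl\<close> are the
  same data shifted by one, without the augmentation.\<close>

definition DS :: "'a univ psi_ring \<Rightarrow> ('a univ \<Rightarrow> 'a) \<Rightarrow> nat \<Rightarrow> nat \<Rightarrow> ('a univ \<Rightarrow> 'm big) set" where
  "DS A p m f = RA.Der (rng A m) (\<lambda>u. Psi R f (p (aug A m u)))"

definition SS :: "'a univ psi_ring \<Rightarrow> ('a univ \<Rightarrow> 'a) \<Rightarrow> nat \<Rightarrow> nat \<Rightarrow> ('a univ \<Rightarrow> 'm big) set" where
  "SS A p q f = DS A p (Suc q) f"

definition adl :: "'a univ psi_ring \<Rightarrow> nat \<Rightarrow> ('a univ \<Rightarrow> 'm big) \<Rightarrow> 'a univ \<Rightarrow> 'm big" where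
  "adl A q = altpre q (carrier (rng A (Suc q))) (fc A q)"

definition dl :: "'a univ psi_ring \<Rightarrow> nat \<Rightarrow> ('a univ \<Rightarrow> 'm big) \<Rightarrow> 'a univ \<Rightarrow> 'm big" where
  "dl A q = adl A (Suc q)"

definition LL :: "nat \<Rightarrow> ('a univ \<Rightarrow> 'm big) \<Rightarrow> 'a univ \<Rightarrow> 'm big" where
  "LL u c = (\<lambda>s. lw u (c s))"

definition aUU :: "'a univ psi_ring \<Rightarrow> nat \<Rightarrow> nat \<Rightarrow> ('a univ \<Rightarrow> 'm big) \<Rightarrow> 'a univ \<Rightarrow> 'm big" where
  "aUU A q v = pre (carrier (rng A q)) (pv A q v)"

definition UU :: "'a univ psi_ring \<Rightarrow> nat \<Rightarrow> nat \<Rightarrow> ('a univ \<Rightarrow> 'm big) \<Rightarrow> 'a univ \<Rightarrow> 'm big" where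
  "UU A q = aUU A (Suc q)"

context
  fixes A :: "'a univ psi_ring" and p :: "'a univ \<Rightarrow> 'a"
  assumes ov: "over A p"
begin

lemma cring_rng: "cring (rng A m)"
  unfolding rng_def by (rule RF.obj_pw[OF overD(2)[OF ov]])

lemma aug_closed: "u \<in> carrier (rng A m) \<Longrightarrow> aug A m u \<in> carrier A"
  using RF.augmentation_closed[OF overD(2)[OF ov]] unfolding rng_def aug_def by simp

lemma weight_closed: "0 < f \<Longrightarrow> u \<in> carrier (rng A m) \<Longrightarrow> Psi R f (p (aug A m u)) \<in> carrier R"
  by (intro Psi_R_closed overD(5)[OF ov] aug_closed)

lemma weight_hom: "0 < f \<Longrightarrow> (\<lambda>u. Psi R f (p (aug A m u))) \<in> ring_hom (rng A m) R"
proof -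
  assume f: "0 < f"
  have "aug A m \<in> ring_hom (rng A m) (ring.truncate A)"
    unfolding aug_def rng_def by (rule RF.arr_augmentation[OF overD(2)[OF ov]])
  from ring_hom_comp_mem[OF ring_hom_comp_mem[OF this overD(3)[OF ov]] Psi_hom[OF f]] show ?thesis .
qed

lemma subgrp_DS: "0 < f \<Longrightarrow> subgrp (DS A p m f)"
  unfolding DS_def by (rule RA.subgrp_Der) (rule weight_closed)

lemma fc_hom: "i \<le> m \<Longrightarrow> fc A m i \<in> ring_hom (rng A (Suc m)) (rng A m)"
  unfolding fc_def rng_def by (rule RF.arr_face[OF overD(2)[OF ov]])

lemma fc_closed: "i \<le> m \<Longrightarrow> fc A m i \<in> carrier (rng A (Suc m)) \<rightarrow> carrier (rng A m)"
  using ring_hom_closed[OF fc_hom] by blast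

lemma aug_fc: "i \<le> m \<Longrightarrow> u \<in> carrier (rng A (Suc m)) \<Longrightarrow> aug A m (fc A m i u) = aug A (Suc m) u"
  unfolding aug_def fc_def rng_def by (rule RF.augmentation_face[OF overD(2)[OF ov]])

lemma fc_fc: "i < j \<Longrightarrow> j \<le> Suc m \<Longrightarrow> u \<in> carrier (rng A (Suc (Suc m))) \<Longrightarrow>
    fc A m i (fc A (Suc m) j u) = fc A m (j - 1) (fc A (Suc m) i u)"
  unfolding fc_def rng_def by (rule RF.face_face[OF overD(2)[OF ov]])

lemma pv_hom: "0 < v \<Longrightarrow> pv A m v \<in> ring_hom (rng A m) (rng A m)"
  unfolding pv_def rng_def by (rule RF.arr_Ar_pow[OF overD(2)[OF ov] overD(2)[OF ov] overD(6)[OF ov]])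

lemma pv_closed: "0 < v \<Longrightarrow> pv A m v \<in> carrier (rng A m) \<rightarrow> carrier (rng A m)"
  using ring_hom_closed[OF pv_hom] by blast

lemma aug_pv: "0 < v \<Longrightarrow> u \<in> carrier (rng A m) \<Longrightarrow> aug A m (pv A m v u) = Psi A v (aug A m u)"
  unfolding aug_def pv_def rng_def
  by (rule RF.augmentation_nat[OF overD(2)[OF ov] overD(2)[OF ov] overD(6)[OF ov]])

lemma pv_pv: "0 < u \<Longrightarrow> 0 < v \<Longrightarrow> s \<in> carrier (rng A m) \<Longrightarrow> pv A m u (pv A m v s) = pv A m (u * v) s"
  unfolding pv_def rng_def
  by (rule RF.Ar_pow_comp[OF overD(2)[OF ov] overD(2)[OF ov] overD(2)[OF ov] overD(7)[OF ov] overD(7)[OF ov]])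
    (auto simp: psi_ring.Psi_Psi[OF overD(1)[OF ov]])

lemma pv_1: "s \<in> carrier (rng A m) \<Longrightarrow> pv A m 1 s = s"
  unfolding pv_def rng_def
  by (rule RF.Ar_pow_id[OF overD(2)[OF ov]]) (auto simp: psi_ring.Psi_1[OF overD(1)[OF ov], simplified])

lemma pv_fc: "0 < v \<Longrightarrow> i \<le> m \<Longrightarrow> s \<in> carrier (rng A (Suc m)) \<Longrightarrow>
    pv A m v (fc A m i s) = fc A m i (pv A (Suc m) v s)"
  unfolding pv_def fc_def rng_def
  by (rule RF.face_nat[OF overD(2)[OF ov] overD(2)[OF ov] overD(6)[OF ov]])

lemma pre_fc_DS: "i \<le> m \<Longrightarrow> c \<in> DS A p m f \<Longrightarrow> pre (carrier (rng A (Suc m))) (fc A m i) c \<in> DS A p (Suc m) f"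
  unfolding DS_def pre_def by (rule RA.Der_comp[OF cring_rng _ fc_hom]) (auto simp: aug_fc)

text \<open>Precomposition with \<Psi>^v changes the weight from \<Psi>^f to \<Psi>^f \<Psi>^v =
  \<Psi>^(fv), because the map to \<open>R\<close> commutes with the Adams operations.\<close>

lemma pre_pv_DS: "0 < f \<Longrightarrow> 0 < v \<Longrightarrow> c \<in> DS A p m f \<Longrightarrow> pre (carrier (rng A m)) (pv A m v) c \<in> DS A p m (f * v)"
  unfolding DS_def pre_def
  by (rule RA.Der_comp[OF cring_rng _ pv_hom])
    (auto simp: aug_pv overD(4)[OF ov] aug_closed Psi_Psi overD(5)[OF ov])

text \<open>Rests on \<psi>^u(\<Psi>^f(r) m) = \<Psi>^(uf)(r) \<psi>^u(m).\<close>

lemma LL_DS: "0 < f \<Longrightarrow> 0 < u \<Longrightarrow> c \<in> DS A p m f \<Longrightarrow> LL u c \<in> DS A p m (u * f)"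
proof -
  assume f: "0 < f" and u: "0 < u" and c: "c \<in> DS A p m f"
  note D = RA.DerD[OF c[unfolded DS_def]]
  have "Psi R (u * f) (p (aug A m s)) = Psi R u (Psi R f (p (aug A m s)))" if "s \<in> carrier (rng A m)" for s
    using Psi_Psi[OF u f overD(5)[OF ov aug_closed[OF that]]] by simp
  then show ?thesis
    unfolding DS_def RA.Der_def LL_def
    using D weight_closed[OF f] additive_add[OF additive_lw[OF u]] additive_zero[OF additive_lw[OF u]]
    by (auto simp: lw_closed[OF u] lw_act[OF u])
qed

lemma adl_DS: "0 < f \<Longrightarrow> c \<in> DS A p q f \<Longrightarrow> adl A q c \<in> DS A p (Suc q) f"
  unfolding adl_def altpre_def
  by (rule subgrp_sum[OF subgrp_DS], assumption) (auto intro!: subgrp_sg[OF subgrp_DS] pre_fc_DS)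

lemma adl_adl: "adl A (Suc q) (adl A q c) = 0"
  unfolding adl_def by (rule altpre_altpre) (use fc_closed fc_fc in auto)

lemma additive_LL: "0 < u \<Longrightarrow> additive (LL u)"
  using additive_lw[of u] by (simp add: additive_def LL_def fun_eq_iff)

lemma LL_pre: "0 < u \<Longrightarrow> LL u (pre X f c) = pre X f (LL u c)"
  using additive_zero[OF additive_lw[of u]] by (auto simp: LL_def pre_def fun_eq_iff)

lemma augmented_nat_complexes: "nat_complexes (DS A p) (adl A) LL (aUU A)"
proof
  fix q f u v :: nat and x :: "'a univ \<Rightarrow> 'm big"
  show "subgrp (DS A p q f)" if "0 < f" by (rule subgrp_DS[OF that])
  show "additive (adl A q)" unfolding adl_def by (rule additive_altpre)
  show "additive (LL u)" if "0 < u" using that by (rule additive_LL)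
  show "additive (aUU A q v)" unfolding aUU_def by (rule additive_pre)
  show "adl A q x \<in> DS A p (Suc q) f" if "0 < f" "x \<in> DS A p q f" using that by (rule adl_DS)
  show "LL u x \<in> DS A p q (u * f)" if "0 < f" "0 < u" "x \<in> DS A p q f"
    using that by (rule LL_DS)
  show "aUU A q v x \<in> DS A p q (f * v)" if "0 < f" "0 < v" "x \<in> DS A p q f"
    using that unfolding aUU_def by (rule pre_pv_DS)
  show "adl A (Suc q) (adl A q x) = 0" by (rule adl_adl)
  show "LL u (LL v x) = LL (u * v) x" if "0 < u" "0 < v"
    using that by (simp add: LL_def lw_lw)
  show "aUU A q u (aUU A q v x) = aUU A q (v * u) x" if "0 < u" "0 < v"
    unfolding aUU_def using that pv_closed pv_pv by (simp add: pre_pre cong: pre_cong)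
  show "LL u (aUU A q v x) = aUU A q v (LL u x)" if "0 < u"
    unfolding aUU_def by (rule LL_pre[OF that])
  show "adl A q (LL u x) = LL u (adl A q x)" if "0 < u"
    unfolding adl_def by (rule hom_altpre[symmetric, OF additive_LL[OF that] LL_pre[OF that]])
  show "adl A q (aUU A q v x) = aUU A (Suc q) v (adl A q x)" if v: "0 < v"
    unfolding adl_def aUU_def
  proof (rule hom_altpre[symmetric, OF additive_pre])
    fix i assume i: "i \<le> q"
    show "pre (carrier (rng A (Suc q))) (pv A (Suc q) v) (pre (carrier (rng A (Suc q))) (fc A q i) x) =
        pre (carrier (rng A (Suc q))) (fc A q i) (pre (carrier (rng A q)) (pv A q v) x)"
      unfolding pre_pre[OF pv_closed[OF v]] pre_pre[OF fc_closed[OF i]]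
      by (rule pre_cong) (rule pv_fc[OF v i, symmetric])
  qed
qed

lemma nat_complexes: "nat_complexes (SS A p) (dl A) LL (UU A)"
proof -
  have "SS A p = (\<lambda>q. DS A p (Suc q))" "dl A = (\<lambda>q. adl A (Suc q))" "UU A = (\<lambda>q. aUU A (Suc q))"
    by (simp_all add: SS_def dl_def UU_def fun_eq_iff)
  then show ?thesis using nat_complexes.shift[OF augmented_nat_complexes] by simp
qed

lemma UU_LL_1: "x \<in> SS A p q f \<Longrightarrow> UU A q 1 (LL 1 x) = x"
proof
  fix s assume "x \<in> SS A p q f"
  note D = RA.DerD(1,2)[OF this[unfolded SS_def DS_def], of s]
  show "UU A q 1 (LL 1 x) s = x s"
    using D pv_1[of s "Suc q"] lw_1[of "x s"] by (cases "s \<in> carrier (rng A (Suc q))") (auto simp: UU_def aUU_def LL_def pre_def)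
qed

end

text \<open>Translates functions with values in \<open>big\<close>, zero outside \<open>X\<close>,
  into the extensional functions with values in \<open>M\<close> that the definitions of the
  cohomology groups use.\<close>

definition \<kappa> :: "'s set \<Rightarrow> ('s \<Rightarrow> 'm big) \<Rightarrow> 's \<Rightarrow> 'm" where
  "\<kappa> X d = (\<lambda>s\<in>X. prj (d s))"

lemma presents_\<kappa>:
  assumes sub: "subgrp Y" and Y: "\<And>d s. d \<in> Y \<Longrightarrow> s \<in> X \<Longrightarrow> d s \<in> NN" "\<And>d s. d \<in> Y \<Longrightarrow> s \<notin> X \<Longrightarrow> d s = 0"
    and Z: "\<kappa> X ` Y = Z"
  shows "presents (\<kappa> X) Y {0} \<lparr>carrier = Z, monoid.mult = (\<lambda>d e. \<lambda>s\<in>X. d s \<oplus>\<^bsub>M\<^esub> e s), one = (\<lambda>s\<in>X. \<zero>\<^bsub>M\<^esub>)\<rparr>"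
proof -
  let ?G = "\<lparr>carrier = Z, monoid.mult = (\<lambda>d e. \<lambda>s\<in>X. d s \<oplus>\<^bsub>M\<^esub> e s), one = (\<lambda>s\<in>X. \<zero>\<^bsub>M\<^esub>)\<rparr>"
  have add: "\<kappa> X (d + e) = \<kappa> X d \<otimes>\<^bsub>?G\<^esub> \<kappa> X e" for d e
    by (auto simp: \<kappa>_def prj_add restrict_def fun_eq_iff)
  have one: "\<kappa> X 0 = \<one>\<^bsub>?G\<^esub>" by (simp add: \<kappa>_def prj_zero)
  have Z': "carrier ?G = \<kappa> X ` Y" by (simp add: Z)
  have "group ?G"
  proof (rule groupI; (unfold Z')?)
    fix a assume "a \<in> \<kappa> X ` Y"
    then obtain d where d: "d \<in> Y" "a = \<kappa> X d" by blast
    then have "\<kappa> X (- d) \<otimes>\<^bsub>?G\<^esub> a = \<one>\<^bsub>?G\<^esub>" by (simp only: add[symmetric] one[symmetric] left_minus)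
    then show "\<exists>b\<in>\<kappa> X ` Y. b \<otimes>\<^bsub>?G\<^esub> a = \<one>\<^bsub>?G\<^esub>" using d subgrp_minus[OF sub] by blast
    show "\<one>\<^bsub>?G\<^esub> \<otimes>\<^bsub>?G\<^esub> a = a" unfolding d one[symmetric] add[symmetric] by simp
  next
    fix a b assume "a \<in> \<kappa> X ` Y" "b \<in> \<kappa> X ` Y"
    then show "a \<otimes>\<^bsub>?G\<^esub> b \<in> \<kappa> X ` Y"
      by (elim imageE) (simp only: add[symmetric] subgrp_add[OF sub] imageI)
  next
    fix a b c assume "a \<in> \<kappa> X ` Y" "b \<in> \<kappa> X ` Y" "c \<in> \<kappa> X ` Y"
    then show "a \<otimes>\<^bsub>?G\<^esub> b \<otimes>\<^bsub>?G\<^esub> c = a \<otimes>\<^bsub>?G\<^esub> (b \<otimes>\<^bsub>?G\<^esub> c)"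
      by (elim imageE) (simp only: add[symmetric] add.assoc)
  next
    show "\<one>\<^bsub>?G\<^esub> \<in> \<kappa> X ` Y" using subgrp_zero[OF sub] one by (metis imageI)
  qed
  moreover have "\<kappa> X d = \<one>\<^bsub>?G\<^esub> \<longleftrightarrow> d \<in> {0}" if d: "d \<in> Y" for d
  proof
    assume "\<kappa> X d = \<one>\<^bsub>?G\<^esub>"
    then have "prj (d s) = \<zero>\<^bsub>M\<^esub>" if "s \<in> X" for s
      using that by (auto simp: \<kappa>_def restrict_def fun_eq_iff split: if_splits)
    then have "d s = 0" for s
      using Y[OF d, of s] em_prj[of "d s"] em_zero by (cases "s \<in> X") auto
    then show "d \<in> {0}" by (simp add: fun_eq_iff)
  qed (use one in simp)
  ultimately show ?thesis unfolding presents_def using sub Z add by simp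
qed

lemma \<kappa>_Der:
  assumes S: "cring S" and g: "\<And>s. s \<in> carrier S \<Longrightarrow> g s \<in> carrier R"
  shows "\<kappa> (carrier S) ` RA.Der S g = {d \<in> carrier S \<rightarrow>\<^sub>E carrier M.
     (\<forall>r\<in>carrier S. \<forall>s\<in>carrier S. d (r \<oplus>\<^bsub>S\<^esub> s) = d r \<oplus>\<^bsub>M\<^esub> d s) \<and>
     (\<forall>r\<in>carrier S. \<forall>s\<in>carrier S. d (r \<otimes>\<^bsub>S\<^esub> s) = (g r \<odot>\<^bsub>M\<^esub> d s) \<oplus>\<^bsub>M\<^esub> (g s \<odot>\<^bsub>M\<^esub> d r))}" (is "_ = ?Z")
proof (intro equalityI subsetI)
  interpret S: cring S by (rule S)
  fix e assume "e \<in> \<kappa> (carrier S) ` RA.Der S g"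
  then obtain d where d: "d \<in> RA.Der S g" "e = \<kappa> (carrier S) d" by blast
  show "e \<in> ?Z"
    using RA.DerD[OF d(1)] g
    by (auto simp: d(2) \<kappa>_def prj_closed prj_add act_def prj_em)
next
  interpret S: cring S by (rule S)
  fix e assume e: "e \<in> ?Z"
  then have ec: "e s \<in> carrier M" if "s \<in> carrier S" for s using that by auto
  let ?d = "\<lambda>s. if s \<in> carrier S then em (e s) else 0"
  have "?d \<in> RA.Der S g"
    unfolding RA.Der_def using e ec g by (auto simp: em_closed em_add act_def prj_em)
  moreover have "e = \<kappa> (carrier S) ?d"
    using e ec by (auto simp: \<kappa>_def prj_em fun_eq_iff PiE_def extensional_def)
  ultimately show "e \<in> \<kappa> (carrier S) ` RA.Der S g" by blast
qed

lemma der_coboundary_\<kappa>: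
  assumes faces: "\<And>i. i \<le> Suc n \<Longrightarrow> face G A (Suc n) i \<in> carrier ((Ob G ^^ Suc (Suc n)) A) \<rightarrow> carrier ((Ob G ^^ Suc n) A)"
  shows "der_coboundary G A M n (\<kappa> (carrier ((Ob G ^^ Suc n) A)) d) =
    \<kappa> (carrier ((Ob G ^^ Suc (Suc n)) A)) (altpre (Suc n) (carrier ((Ob G ^^ Suc (Suc n)) A)) (face G A (Suc n)) d)"
proof
  fix s
  let ?X = "carrier ((Ob G ^^ Suc (Suc n)) A)" and ?Y = "carrier ((Ob G ^^ Suc n) A)"
  show "der_coboundary G A M n (\<kappa> ?Y d) s = \<kappa> ?X (altpre (Suc n) ?X (face G A (Suc n)) d) s"
  proof (cases "s \<in> ?X")
    case True
    have "prj (altpre (Suc n) ?X (face G A (Suc n)) d s) = prj (\<Sum>i\<le>Suc n. sg i (d (face G A (Suc n) i s)))"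
      by (simp only: altpre_apply[OF True])
    also have "\<dots> = finprod (add_monoid M) (\<lambda>i. prj (sg i (d (face G A (Suc n) i s)))) {..Suc n}"
      by (rule presents_sum[OF presents_prj]) simp
    also have "\<dots> = finprod (add_monoid M) (\<lambda>i. [((- 1 :: int) ^ i)] \<cdot>\<^bsub>M\<^esub> (\<kappa> ?Y d (face G A (Suc n) i s))) {..Suc n}"
    proof (rule comm_monoid.finprod_cong'[OF comm_group.axioms(1)[OF comm_group_M] refl])
      show "(\<lambda>i. [((- 1 :: int) ^ i)] \<cdot>\<^bsub>M\<^esub> (\<kappa> ?Y d (face G A (Suc n) i s))) \<in> {..Suc n} \<rightarrow> carrier (add_monoid M)"
        using funcset_mem[OF faces True] by (auto simp: \<kappa>_def prj_closed)
      show "prj (sg i (d (face G A (Suc n) i s))) = [((- 1 :: int) ^ i)] \<cdot>\<^bsub>M\<^esub> (\<kappa> ?Y d (face G A (Suc n) i s))"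
        if "i \<in> {..Suc n}" for i
        using presents_sg[OF presents_prj UNIV_I, of i "d (face G A (Suc n) i s)"] funcset_mem[OF faces True, of i] that
        by (simp add: \<kappa>_def add_pow_def)
    qed
    finally show ?thesis
      unfolding der_coboundary_def \<kappa>_def[of ?X] using True by (simp only: restrict_apply if_True finsum_def)
  next
    case False
    then show ?thesis unfolding der_coboundary_def \<kappa>_def[of ?X] by (simp only: restrict_apply if_False)
  qed
qed

section \<open>The Andre-Quillen groups of twisted modules and their natural system\<close>

lemma over_base: "over (base_psi_ring R) the_Base"
  unfolding over_def using psi_ring_base[OF psi_ring_axioms] by (auto simp: ring_hom_def)

abbreviation RB :: "'a univ psi_ring" where "RB \<equiv> base_psi_ring R"

lemma rng_RB: "(Ob ring_free_comonad ^^ m) (base_ring R) = rng RB m"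
  by (simp add: rng_def truncate_base_psi_ring)

lemma presents_AQ_cochains:
  assumes f: "0 < f"
  shows "presents (\<kappa> (carrier (rng RB (Suc q)))) (SS RB the_Base q f) {0} (AQ_cochains R (twist R M f) q)"
proof -
  let ?X = "carrier (rng RB (Suc q))"
  have w: "Psi R f (the_Base (aug RB (Suc q) s)) \<in> carrier R" if "s \<in> ?X" for s
    by (rule weight_closed[OF over_base f that])
  have im: "\<kappa> ?X ` SS RB the_Base q f =
      derivations (rng RB (Suc q)) (the_Base \<circ> augmentation ring_free_comonad (base_ring R) (Suc q)) (twist R M f)"
    unfolding SS_def DS_def derivations_def twist_def
    using \<kappa>_Der[OF cring_rng[OF over_base], of "Suc q" "\<lambda>u. Psi R f (the_Base (aug RB (Suc q) u))", OF w]
    by (simp add: aug_def truncate_base_psi_ring del: augmentation.simps)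
  have sub: "subgrp (SS RB the_Base q f)" unfolding SS_def by (rule subgrp_DS[OF over_base f])
  have val: "d s \<in> NN" if "d \<in> SS RB the_Base q f" "s \<in> ?X" for d s
    using RA.DerD(2)[OF that(1)[unfolded SS_def DS_def] that(2)] .
  have val0: "d s = 0" if "d \<in> SS RB the_Base q f" "s \<notin> ?X" for d s
    using RA.DerD(1)[OF that(1)[unfolded SS_def DS_def] that(2)] .
  have "presents (\<kappa> ?X) (SS RB the_Base q f) {0}
      \<lparr>carrier = derivations (rng RB (Suc q)) (the_Base \<circ> augmentation ring_free_comonad (base_ring R) (Suc q)) (twist R M f),
        monoid.mult = (\<lambda>d e. \<lambda>s\<in>?X. d s \<oplus>\<^bsub>M\<^esub> e s), one = (\<lambda>s\<in>?X. \<zero>\<^bsub>M\<^esub>)\<rparr>"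
    by (rule presents_\<kappa>[OF sub]) (erule (1) val, erule (1) val0, rule im)
  then show ?thesis
    unfolding AQ_cochains_def der_cochains_def rng_RB Let_def by (simp add: twist_def)
qed

lemma AQ_coboundary_\<kappa>:
  "AQ_coboundary R (twist R M f) q (\<kappa> (carrier (rng RB (Suc q))) c) = \<kappa> (carrier (rng RB (Suc (Suc q)))) (dl RB q c)"
proof -
  have "AQ_coboundary R (twist R M f) q d = der_coboundary ring_free_comonad (base_ring R) M q d" for d
    by (simp add: AQ_coboundary_def der_coboundary_def twist_def finsum_def add_pow_def)
  moreover have "face ring_free_comonad (base_ring R) m = fc RB m" for m
    by (simp add: fc_def truncate_base_psi_ring fun_eq_iff)
  ultimately show ?thesis
    using der_coboundary_\<kappa>[of q ring_free_comonad "base_ring R" c] fc_closed[OF over_base]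
    unfolding rng_RB dl_def adl_def by auto
qed

definition hAQ :: "nat \<Rightarrow> nat \<Rightarrow> ('a univ \<Rightarrow> 'm big) \<Rightarrow> ('a univ \<Rightarrow> 'm) set" where
  "hAQ q f x = coboundaries (AQ_cochains R (twist R M f)) (AQ_coboundary R (twist R M f)) q
     #>\<^bsub>AQ_cochains R (twist R M f) q\<^esub> \<kappa> (carrier (rng RB (Suc q))) x"

interpretation NC: nat_complexes "SS RB the_Base" "dl RB" LL "UU RB"
  by (rule nat_complexes[OF over_base])

lemma presents_H_AQ:
  assumes f: "0 < f"
  shows "presents (hAQ q f) (NC.Zq q f) (NC.Bq q f) (H_AQ R (twist R M f) q)"
proof -
  have "presents (hAQ q f) {x \<in> SS RB the_Base q f. dl RB q x \<in> {0}}
      {x. case q of 0 \<Rightarrow> x \<in> {0} | Suc k \<Rightarrow> \<exists>y\<in>SS RB the_Base k f. x - dl RB k y \<in> {0}}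
      (H_AQ R (twist R M f) q)"
    unfolding H_AQ_def hAQ_def
    by (rule presents_cohomology[where h = "\<lambda>q. \<kappa> (carrier (rng RB (Suc q)))" and N = "\<lambda>q. {0}"
          and S = "\<lambda>q. SS RB the_Base q f",
          OF presents_AQ_cochains[OF f] NC.\<delta>_S[OF f] NC.add_\<delta> AQ_coboundary_\<kappa>])
      (simp_all add: NC.\<delta>_\<delta>[OF f] fun_eq_iff)
  moreover have "{x. case q of 0 \<Rightarrow> x \<in> {0} | Suc k \<Rightarrow> \<exists>y\<in>SS RB the_Base k f. x - dl RB k y \<in> {0}} = NC.Bq q f"
    by (cases q) (simp_all add: NC.Bq_def)
  ultimately show ?thesis by (simp add: NC.Zq_def)
qed

lemma AQ_lower_hAQ:
  assumes f: "0 < f" and u: "0 < u" and x: "x \<in> SS RB the_Base q f"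
  shows "AQ_lower R M q u f (hAQ q f x) = hAQ q (u * f) (LL u x)"
  unfolding AQ_lower_def hAQ_def rng_RB
proof (rule induced_map_presents[where \<Phi> = "\<lambda>q. LL u" and S = "\<lambda>q. SS RB the_Base q f"
      and S' = "\<lambda>q. SS RB the_Base q (u * f)" and D = "dl RB" and D' = "dl RB"
      and h = "\<lambda>q. \<kappa> (carrier (rng RB (Suc q)))" and h' = "\<lambda>q. \<kappa> (carrier (rng RB (Suc q)))",
      OF presents_AQ_cochains[OF f] presents_AQ_cochains])
  have uf: "0 < u * f" using u f by simp
  show "0 < u * f" by (rule uf)
  show "additive (LL u)" by (rule NC.add_L[OF u])
  show "LL u x \<in> SS RB the_Base n (u * f)" if "x \<in> SS RB the_Base n f" for n x by (rule NC.L_S[OF f u that])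
  show "(\<lambda>s\<in>carrier (rng RB (Suc q)). psi M u (\<kappa> (carrier (rng RB (Suc q))) x s)) = \<kappa> (carrier (rng RB (Suc q))) (LL u x)" for x
    using u by (auto simp: \<kappa>_def LL_def lw_def prj_em psi_closed prj_closed)
  show "dl RB n x \<in> SS RB the_Base (Suc n) f" if "x \<in> SS RB the_Base n f" for n x by (rule NC.\<delta>_S[OF f that])
  show "dl RB n x \<in> SS RB the_Base (Suc n) (u * f)" if "x \<in> SS RB the_Base n (u * f)" for n x
    by (rule NC.\<delta>_S[OF uf that])
  show "LL u (dl RB n x) = dl RB n (LL u x)" if "x \<in> SS RB the_Base n f" for n x
    by (rule NC.\<delta>_L[OF f u that, symmetric])
qed (use x NC.add_\<delta> AQ_coboundary_\<kappa> in auto)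

lemma AQ_upper_hAQ:
  assumes f: "0 < f" and v: "0 < v" and x: "x \<in> SS RB the_Base q f"
  shows "AQ_upper R M q v f (hAQ q f x) = hAQ q (f * v) (UU RB q v x)"
  unfolding AQ_upper_def hAQ_def rng_RB
proof (rule induced_map_presents[where \<Phi> = "\<lambda>q. UU RB q v" and S = "\<lambda>q. SS RB the_Base q f"
      and S' = "\<lambda>q. SS RB the_Base q (f * v)" and D = "dl RB" and D' = "dl RB"
      and h = "\<lambda>q. \<kappa> (carrier (rng RB (Suc q)))" and h' = "\<lambda>q. \<kappa> (carrier (rng RB (Suc q)))",
      OF presents_AQ_cochains[OF f] presents_AQ_cochains])
  have fv: "0 < f * v" using v f by simp
  show "0 < f * v" by (rule fv)
  show "additive (UU RB n v)" for n by (rule NC.add_U)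
  show "UU RB n v x \<in> SS RB the_Base n (f * v)" if "x \<in> SS RB the_Base n f" for n x by (rule NC.U_S[OF f v that])
  have "Ar_pow ring_free_comonad (Suc q) (base_ring R) (Psi RB v) = pv RB (Suc q) v"
    by (simp add: pv_def truncate_base_psi_ring)
  then show "(\<lambda>s\<in>carrier (rng RB (Suc q)). \<kappa> (carrier (rng RB (Suc q))) x
      (Ar_pow ring_free_comonad (Suc q) (base_ring R) (Psi RB v) s)) = \<kappa> (carrier (rng RB (Suc q))) (UU RB q v x)" for x
    using funcset_mem[OF pv_closed[OF over_base v]] by (auto simp: \<kappa>_def UU_def aUU_def pre_def)
  show "dl RB n x \<in> SS RB the_Base (Suc n) f" if "x \<in> SS RB the_Base n f" for n x by (rule NC.\<delta>_S[OF f that])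
  show "dl RB n x \<in> SS RB the_Base (Suc n) (f * v)" if "x \<in> SS RB the_Base n (f * v)" for n x
    by (rule NC.\<delta>_S[OF fv that])
  show "UU RB (Suc n) v (dl RB n x) = dl RB n (UU RB n v x)" if "x \<in> SS RB the_Base n f" for n x
    by (rule NC.\<delta>_U[OF f v that, symmetric])
qed (use x NC.add_\<delta> AQ_coboundary_\<kappa> in auto)

lemma NMap_AQ:
  assumes "0 < u" "0 < v" "0 < f" "x \<in> SS RB the_Base q f"
  shows "NMap (AQ_system R M q) u v f (hAQ q f x) = hAQ q (u * f * v) (UU RB q v (LL u x))"
  using assms NC.L_S[of f u x q] AQ_lower_hAQ[of f u x q] AQ_upper_hAQ[of "u * f" v "LL u x" q]
  by (simp add: AQ_system_def)

lemma natural_system_AQ: "natural_system pos_nat_monoid (AQ_system R M q)"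
proof (rule NC.natural_system[of "hAQ q" q])
  show "presents (hAQ q f) (NC.Zq q f) (NC.Bq q f) (NOb (AQ_system R M q) f)" if "0 < f" for f
    using presents_H_AQ[OF that] by (simp add: AQ_system_def)
  show "NMap (AQ_system R M q) u v f (hAQ q f x) = hAQ q (u * f * v) (UU RB q v (LL u x))"
    if "0 < u" "0 < v" "0 < f" "x \<in> NC.Zq q f" for u v f x
    using NMap_AQ that by (simp add: NC.Zq_def)
  show "UU RB q 1 (LL 1 x) = x" if "x \<in> SS RB the_Base q f" for f x
    by (rule UU_LL_1[OF over_base that])
qed

interpretation DC: double_complex NC.C NC.bw NC.dv by (rule NC.double_complex)

lemma presents_H_BW_AQ:
  "\<exists>k. presents k (DC.E2_cocycles p q) (DC.E2_boundaries p q) (H_BW pos_nat_monoid (AQ_system R M q) p)"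
proof (rule NC.presents_H_BW[of "hAQ q"])
  show "presents (hAQ q f) (NC.Zq q f) (NC.Bq q f) (NOb (AQ_system R M q) f)" if "0 < f" for f
    using presents_H_AQ[OF that] by (simp add: AQ_system_def)
  show "NMap (AQ_system R M q) u 1 f (hAQ q f x) = hAQ q (u * f) (LL u x)" if "0 < u" "0 < f" "x \<in> NC.Zq q f" for u f x
  proof -
    have "x \<in> SS RB the_Base q f" using that by (simp add: NC.Zq_def)
    then have "UU RB q 1 (LL 1 (LL u x)) = LL u x" "LL 1 (LL u x) = LL u x"
      using UU_LL_1[OF over_base NC.L_S[of f u x q]] NC.L_L[of f 1 u x q] that by simp_all
    then show ?thesis using NMap_AQ[of u 1 f x q] that by (simp add: NC.Zq_def)
  qed
  show "NMap (AQ_system R M q) 1 v f (hAQ q f x) = hAQ q (f * v) (UU RB q v x)" if "0 < v" "0 < f" "x \<in> NC.Zq q f" for v f x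
  proof -
    have "LL 1 x = x"
    proof
      fix s
      have "x \<in> SS RB the_Base q f" using that by (simp add: NC.Zq_def)
      note D = RA.DerD(1,2)[OF this[unfolded SS_def DS_def], of s]
      show "LL 1 x s = x s"
        using D lw_1[of "x s"] subgrp_zero[OF subgrp_NN] lw_1[of 0]
        by (cases "s \<in> carrier (rng RB (Suc q))") (auto simp: LL_def)
    qed
    then show ?thesis using NMap_AQ[of 1 v f x q] that by (simp add: NC.Zq_def)
  qed
qed

end

section \<open>The double complex over a free \<open>\<Psi>\<close>-ring\<close>

context psi_pair
begin

context
  fixes A :: "'a univ psi_ring" and p :: "'a univ \<Rightarrow> 'a" and V :: "'a univ set"
  assumes ov: "over A p" and poly: "polyring A V"
begin

text \<open>An extra degeneracy at the inner end of the resolution: it splits the last face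
  (\<open>fc_rsec_last\<close>) and commutes with the others by naturality
  (\<open>fc_rsec\<close>).\<close>

definition rsec :: "nat \<Rightarrow> 'a univ \<Rightarrow> 'a univ" where
  "rsec q = Ar_pow ring_free_comonad q (Ob ring_free_comonad (ring.truncate A)) (free_section A)"

lemma section_arr: "free_section A \<in> ring_hom (ring.truncate A) (Ob ring_free_comonad (ring.truncate A))"
  using free_section_hom[OF poly] by (simp add: Ob_ring_free ring_hom_truncate)

lemma Ob_cring: "cring (Ob ring_free_comonad (ring.truncate A))"
  by (rule RF.obj_Ob[OF overD(2)[OF ov]])

lemma rng_Ob: "(Ob ring_free_comonad ^^ q) (Ob ring_free_comonad (ring.truncate A)) = rng A (Suc q)"
  by (simp add: rng_def funpow_swap1)

lemma rsec_hom: "rsec q \<in> ring_hom (rng A q) (rng A (Suc q))"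
  using RF.arr_Ar_pow[OF overD(2)[OF ov] Ob_cring section_arr, of q]
  by (simp only: rsec_def rng_Ob) (simp only: rng_def)

lemma rsec_closed: "s \<in> carrier (rng A q) \<Longrightarrow> rsec q s \<in> carrier (rng A (Suc q))"
  by (rule ring_hom_closed[OF rsec_hom])

lemma fc_rsec_last: "s \<in> carrier (rng A q) \<Longrightarrow> fc A q q (rsec q s) = s"
proof -
  assume s: "s \<in> carrier (rng A q)"
  have "Ar_pow ring_free_comonad q (ring.truncate A) (Eps ring_free_comonad (ring.truncate A)) (rsec q s) =
      Ar_pow ring_free_comonad q (ring.truncate A) (\<lambda>x. x) s"
    unfolding rsec_def
    by (rule RF.Ar_pow_comp[OF overD(2)[OF ov] Ob_cring overD(2)[OF ov]])
      (use RF.arr_closed[OF section_arr] RF.arr_closed[OF RF.arr_Eps[OF overD(2)[OF ov]]]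
          Eps_free_section[OF poly] s in \<open>auto simp: rng_def\<close>)
  also have "\<dots> = s"
    by (rule RF.Ar_pow_id[OF overD(2)[OF ov] refl]) (use s in \<open>simp add: rng_def\<close>)
  finally show ?thesis by (simp add: fc_def RF.face_last)
qed

lemma fc_rsec: "i \<le> q \<Longrightarrow> s \<in> carrier (rng A (Suc q)) \<Longrightarrow>
    fc A (Suc q) i (rsec (Suc q) s) = rsec q (fc A q i s)"
  using RF.face_nat[OF overD(2)[OF ov] Ob_cring section_arr, of i q s]
  by (simp add: fc_def rsec_def RF.face_Ob rng_def del: Ar_pow.simps)

lemma pre_rsec_DS: "x \<in> DS A p (Suc q) f \<Longrightarrow> pre (carrier (rng A q)) (rsec q) x \<in> DS A p q f"
  unfolding DS_def pre_def
proof (rule RA.Der_comp[OF cring_rng[OF ov] _ rsec_hom])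
  show "Psi R f (p (aug A (Suc q) (rsec q u))) = Psi R f (p (aug A q u))" if "u \<in> carrier (rng A q)" for u
    using aug_fc[OF ov order_refl rsec_closed[OF that]] fc_rsec_last[OF that] by simp
qed

text \<open>Evaluate the cocycle condition on \<open>rsec (Suc q) s\<close>. The last face returns
  \<open>x s\<close>, and the other faces pass through \<open>rsec\<close>, giving the coboundary of
  \<open>x\<close> composed with \<open>rsec\<close>.\<close>

lemma column_exact:
  assumes f: "0 < f" and x: "x \<in> DS A p (Suc q) f" and dx: "adl A (Suc q) x = 0"
  shows "\<exists>y\<in>DS A p q f. x = adl A q y"
proof (intro bexI)
  let ?y = "pre (carrier (rng A q)) (rsec q) x"
  \<comment> \<open>The last face enters the alternating sum with sign (-1)^(q + 1) and stands on
    the other side of the equation.\<close>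
  show "sg q ?y \<in> DS A p q f" by (rule subgrp_sg[OF subgrp_DS[OF ov f] pre_rsec_DS[OF x]])
  show "x = adl A q (sg q ?y)"
  proof
    fix s
    show "x s = adl A q (sg q ?y) s"
    proof (cases "s \<in> carrier (rng A (Suc q))")
      case True
      have "adl A q ?y s = (\<Sum>i\<le>q. sg i (x (rsec q (fc A q i s))))"
        using True funcset_mem[OF fc_closed[OF ov] True] by (simp add: adl_def altpre_apply pre_def)
      also have "\<dots> = (\<Sum>i\<le>q. sg i (x (fc A (Suc q) i (rsec (Suc q) s))))"
        using True by (simp add: fc_rsec)
      finally have y: "adl A q ?y s = (\<Sum>i\<le>q. sg i (x (fc A (Suc q) i (rsec (Suc q) s))))" .
      have "0 = adl A (Suc q) x (rsec (Suc q) s)" by (simp add: dx)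
      also have "\<dots> = adl A q ?y s + sg (Suc q) (x s)"
        using rsec_closed[OF True] fc_rsec_last[OF True] by (simp add: adl_def altpre_apply y[unfolded adl_def])
      finally have "sg q (adl A q ?y s) = x s"
        by (simp add: sg_def split: if_splits) (simp add: add_eq_0_iff)
      moreover have "adl A q (sg q ?y) s = sg q (adl A q ?y s)"
        by (simp add: adl_def additive_sg[OF additive_altpre] sg_apply)
      ultimately show ?thesis by simp
    next
      case False
      then show ?thesis using RA.DerD(1)[OF x[unfolded DS_def]] by (simp add: adl_def altpre_outside)
    qed
  qed
qed

text \<open>The counit is onto, since it has the section \<open>rsec 0\<close>.\<close>

lemma adl_0_inj:
  assumes x: "x \<in> DS A p 0 f" and dx: "adl A 0 x = 0"
  shows "x = 0"
proof
  fix s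
  show "x s = 0 s"
  proof (cases "s \<in> carrier (rng A 0)")
    case True
    have "adl A 0 x (rsec 0 s) = x s"
      using rsec_closed[OF True] fc_rsec_last[OF True] by (simp add: adl_def altpre_apply)
    then show ?thesis by (simp add: dx)
  next
    case False
    then show ?thesis using RA.DerD(1)[OF x[unfolded DS_def]] by simp
  qed
qed

end

text \<open>The \<Psi>-derivations of \<open>A\<close>, seen as the kernel of the first
  Baues-Wirsching coboundary on the augmentation row. The weight is 1, the product of the empty
  list.\<close>

definition Pd :: "'a univ psi_ring \<Rightarrow> ('a univ \<Rightarrow> 'a) \<Rightarrow> ('a univ \<Rightarrow> 'm big) set" where
  "Pd A p = {c \<in> DS A p 0 1. \<forall>v>0. LL v c = aUU A 0 v c}"

definition at_nil :: "('a univ \<Rightarrow> 'm big) \<Rightarrow> nat list \<Rightarrow> 'a univ \<Rightarrow> 'm big" where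
  "at_nil c = (\<lambda>\<alpha>s. if \<alpha>s = [] then c else 0)"

text \<open>Embeds the \<Psi>-derivations in degree 0 of the total complex, by way of the
  augmentation.\<close>

definition edge :: "'a univ psi_ring \<Rightarrow> ('a univ \<Rightarrow> 'm big) \<Rightarrow> nat \<Rightarrow> nat \<Rightarrow> nat list \<Rightarrow> 'a univ \<Rightarrow> 'm big" where
  "edge A c = double_complex.single 0 0 (at_nil (adl A 0 c))"

section \<open>Acyclicity of the total complex over a free \<Psi>-ring\<close>

context
  fixes A :: "'a univ psi_ring" and p :: "'a univ \<Rightarrow> 'a" and Y :: "'a univ set"
  assumes ov: "over A p" and A: "A = free_psi_ring Y"
begin

interpretation N: nat_complexes "DS A p" "adl A" LL "aUU A" by (rule augmented_nat_complexes[OF ov])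
interpretation S: nat_complexes "SS A p" "dl A" LL "UU A" by (rule nat_complexes[OF ov])
interpretation D: double_complex S.C S.bw S.dv by (rule S.double_complex)

lemma poly: "polyring A (adams_vars Y)"
  unfolding A by (rule polyring_free_psi_ring)

lemma S_C: "S.C i j = N.C i (Suc j)"
  by (simp add: S.C_def N.C_def SS_def)

lemma S_bw: "S.bw i j = N.bw i (Suc j)"
  by (rule ext) (simp only: S.bw_def N.bw_def S.bf_def N.bf_def UU_def[of A j])

lemma S_dv: "S.dv i j = N.dv i (Suc j)"
  by (simp add: S.dv_def N.dv_def dl_def fun_eq_iff)

lemma N_column_exact:
  assumes x: "x \<in> N.C i (Suc q)" and dx: "N.dv i (Suc q) x = 0"
  shows "\<exists>y\<in>N.C i q. N.dv i q y = x"
proof -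
  have "x \<alpha>s \<in> N.Bq (Suc q) (prod_list \<alpha>s)" if \<alpha>s: "\<alpha>s \<in> pos_lists i" for \<alpha>s
  proof -
    have "N.dv i (Suc q) x \<alpha>s = 0" by (simp add: dx)
    then have "adl A (Suc q) (x \<alpha>s) = 0" by (simp add: N.dv_def)
    from column_exact[OF ov poly prod_list_pos[OF \<alpha>s] N.C_D[OF x \<alpha>s] this]
    show ?thesis by (simp add: N.Bq_def)
  qed
  then show ?thesis using N.pointwise_boundary[OF x] by (auto simp: eq_commute)
qed

lemma N_column_inj:
  assumes a: "a \<in> N.C i 0" and da: "N.dv i 0 a = 0"
  shows "a = 0"
proof
  fix \<alpha>s
  show "a \<alpha>s = 0 \<alpha>s"
  proof (cases "\<alpha>s \<in> pos_lists i")
    case True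
    have "N.dv i 0 a \<alpha>s = 0" by (simp add: da)
    then have "adl A 0 (a \<alpha>s) = 0" by (simp add: N.dv_def)
    then show ?thesis using adl_0_inj[OF ov poly N.C_D[OF a True]] by simp
  qed (use N.C_0[OF a] in simp)
qed

lemma exact2: "D.exact2"
  unfolding D.exact2_def S_C S_dv using N_column_exact by blast

lemma rng_0: "rng A 0 = ring.truncate A"
  by (simp add: rng_def)

lemma poly_0: "polyring (rng A 0) (adams_vars Y)"
  unfolding rng_0 by (rule polyring_truncate[OF poly])

lemma gen_rng_0: "0 < i \<Longrightarrow> y \<in> Y \<Longrightarrow> gen (Adams i y) \<in> carrier (rng A 0)"
  by (rule gen_closed[OF poly_0]) auto

lemma aUU_gen:
  assumes "0 < v" "0 < i" "y \<in> Y"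
  shows "aUU A 0 v c (gen (Adams i y)) = c (gen (Adams (v * i) y))"
  using gen_rng_0[OF assms(2,3)] Psi_free_gen[OF assms] by (simp add: aUU_def pre_def pv_def A)

lemma DS_eq_gen:
  assumes f: "0 < f" and c: "c \<in> DS A p 0 f" and d: "d \<in> DS A p 0 f"
    and eq: "\<And>i y. 0 < i \<Longrightarrow> y \<in> Y \<Longrightarrow> c (gen (Adams i y)) = d (gen (Adams i y))"
  shows "c = d"
  by (rule RA.Der_eq[OF poly_0 weight_hom[OF ov f] c[unfolded DS_def] d[unfolded DS_def]]) (use eq in auto)

lemma DS_exists_gen:
  assumes f: "0 < f" and h: "\<And>i y. 0 < i \<Longrightarrow> y \<in> Y \<Longrightarrow> h i y \<in> NN"
  shows "\<exists>d\<in>DS A p 0 f. \<forall>i y. 0 < i \<longrightarrow> y \<in> Y \<longrightarrow> d (gen (Adams i y)) = h i y"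
proof -
  have "\<exists>d\<in>RA.Der (rng A 0) (\<lambda>u. Psi R f (p (aug A 0 u))). \<forall>v\<in>adams_vars Y. d (gen v) = adams_var h v"
    by (rule RA.Der_exists[OF poly_0 weight_hom[OF ov f]]) (use h in auto)
  then obtain d where d: "d \<in> DS A p 0 f" "\<forall>v\<in>adams_vars Y. d (gen v) = adams_var h v"
    unfolding DS_def by (rule bexE)
  have "d (gen (Adams i y)) = h i y" if "0 < i" "y \<in> Y" for i y
    using bspec[OF d(2), of "Adams i y"] that by auto
  then show ?thesis using d(1) by blast
qed

text \<open>The homotopy evaluates at \<open>x\<^sub>1\<close>, using the last entry of the list to produce \<open>x\<^sub>i = \<Psi>\<^sup>i x\<^sub>1\<close>.\<close>

lemma row_exact:
  assumes a: "a \<in> N.C (Suc n) 0" and da: "N.bw (Suc n) 0 a = 0"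
  shows "\<exists>b\<in>N.C n 0. N.bw n 0 b = a"
proof -
  have snoc: "\<beta>s @ [i] \<in> pos_lists (Suc m)" if "\<beta>s \<in> pos_lists m" "0 < i" for \<beta>s i m
    using that by (auto simp: pos_lists_def)
  \<comment> \<open>On the indeterminates a derivation takes arbitrary values, whatever the twist.
    So the values of \<open>b\<close> may be read off from derivations into another twist of the
    module.\<close>
  have "\<forall>\<beta>s\<in>pos_lists n. \<exists>d. d \<in> DS A p 0 (prod_list \<beta>s) \<and>
      (\<forall>i y. 0 < i \<longrightarrow> y \<in> Y \<longrightarrow> d (gen (Adams i y)) = sg (Suc n) (a (\<beta>s @ [i]) (gen (Adams 1 y))))"
  proof
    fix \<beta>s assume \<beta>s: "\<beta>s \<in> pos_lists n"
    have "sg (Suc n) (a (\<beta>s @ [i]) (gen (Adams 1 y))) \<in> NN" if "0 < i" "y \<in> Y" for i y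
      by (rule subgrp_sg[OF subgrp_NN RA.DerD(2)[OF N.C_D[OF a snoc[OF \<beta>s that(1)], unfolded DS_def]]])
        (use that gen_rng_0[of 1] in simp)
    from DS_exists_gen[OF prod_list_pos[OF \<beta>s], of "\<lambda>i y. sg (Suc n) (a (\<beta>s @ [i]) (gen (Adams 1 y)))", OF this]
    show "\<exists>d. d \<in> DS A p 0 (prod_list \<beta>s) \<and>
      (\<forall>i y. 0 < i \<longrightarrow> y \<in> Y \<longrightarrow> d (gen (Adams i y)) = sg (Suc n) (a (\<beta>s @ [i]) (gen (Adams 1 y))))"
      by blast
  qed
  then obtain b0 where b0: "\<forall>\<beta>s\<in>pos_lists n. b0 \<beta>s \<in> DS A p 0 (prod_list \<beta>s) \<and>
      (\<forall>i y. 0 < i \<longrightarrow> y \<in> Y \<longrightarrow> b0 \<beta>s (gen (Adams i y)) = sg (Suc n) (a (\<beta>s @ [i]) (gen (Adams 1 y))))"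
    by (rule bchoice[THEN exE])
  define b where "b \<beta>s = (if \<beta>s \<in> pos_lists n then b0 \<beta>s else 0)" for \<beta>s
  have b: "b \<in> N.C n 0" by (rule N.C_I) (use b0 in \<open>auto simp: b_def\<close>)
  have bg: "b \<beta>s (gen (Adams i y)) = sg (Suc n) (a (\<beta>s @ [i]) (gen (Adams 1 y)))"
    if "\<beta>s \<in> pos_lists n" "0 < i" "y \<in> Y" for \<beta>s i y
    using b0 that by (simp add: b_def)
  have "N.bw n 0 b = a"
  proof
    fix \<alpha>s
    show "N.bw n 0 b \<alpha>s = a \<alpha>s"
    proof (cases "\<alpha>s \<in> pos_lists (Suc n)")
      case True
      note t = tl_pos_lists[OF True] and bl = butlast_pos_lists[OF True]
      have ne: "\<alpha>s \<noteq> []" and len: "length \<alpha>s = Suc n" using pos_lists_length[OF True] by auto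
      show ?thesis
      proof (rule DS_eq_gen[OF prod_list_pos[OF True] N.C_D[OF N.bw_C[OF b] True] N.C_D[OF a True]])
        fix i y assume iy: "0 < (i::nat)" "y \<in> Y"
        let ?g = "gen (Adams i y)" and ?g1 = "gen (Adams 1 y)"
        \<comment> \<open>Each face of \<open>b\<close> at \<open>\<alpha>s\<close>, evaluated at
          x_i, is the face of \<open>a\<close> at \<open>\<alpha>s @ [i]\<close> with the same
          index, evaluated at x_1. For the final face, \<Psi> of the last entry turns x_i into
          another indeterminate, which corresponds to merging the last two entries of
          \<open>\<alpha>s @ [i]\<close>.\<close>
        have face: "N.bf n 0 j b \<alpha>s ?g = sg (Suc n) (N.bf (Suc n) 0 j a (\<alpha>s @ [i]) ?g1)" if "j \<le> Suc n" for j
        proof -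
          consider "j = 0" | k where "j = Suc k" "k < n" | "j = Suc n"
            using \<open>j \<le> Suc n\<close> by (cases j) (auto simp: le_less)
          then show ?thesis
          proof cases
            case 1
            have "additive (lw (hd \<alpha>s))" using t by (intro additive_lw) simp
            then show ?thesis
              using 1 t ne bg[OF _ iy, of "tl \<alpha>s"] by (simp add: N.bf_def LL_def additive_sg additive_minus)
          next
            case (2 k)
            then show ?thesis
              using mg_pos_lists[OF _ True, of k] bg[OF _ iy, of "mg k \<alpha>s"] mg_append[of k \<alpha>s "[i]"] len
              by (simp add: N.bf_def)
          next
            case 3
            have "0 < last \<alpha>s * i" using bl iy by simp
            then show ?thesis
              using 3 bl bg[OF _ _ iy(2), of "butlast \<alpha>s" "last \<alpha>s * i"] aUU_gen[OF _ iy, of "last \<alpha>s"]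
                mg_snoc[OF len, of i] by (simp add: N.bf_def)
          qed
        qed
        have si: "\<alpha>s @ [i] \<in> pos_lists (Suc (Suc n))" by (rule snoc[OF True iy(1)])
        have "0 = N.bw (Suc n) 0 a (\<alpha>s @ [i]) ?g1" by (simp add: da)
        also have "\<dots> = (\<Sum>j\<le>Suc (Suc n). sg j (N.bf (Suc n) 0 j a (\<alpha>s @ [i]) ?g1))"
          using si by (simp add: N.bw_def sum_fun_apply sg_apply del: sum.atMost_Suc)
        also have "\<dots> = (\<Sum>j\<le>Suc n. sg j (N.bf (Suc n) 0 j a (\<alpha>s @ [i]) ?g1)) +
            sg (Suc (Suc n)) (N.bf (Suc n) 0 (Suc (Suc n)) a (\<alpha>s @ [i]) ?g1)"
          by (rule sum.atMost_Suc)
        \<comment> \<open>The one face left over precomposes with \<Psi>^i, which takes x_1 to x_i,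
          and thus recovers \<open>a\<close> itself.\<close>
        also have "N.bf (Suc n) 0 (Suc (Suc n)) a (\<alpha>s @ [i]) ?g1 = a \<alpha>s ?g"
          using aUU_gen[OF iy(1) _ iy(2), of 1] by (simp add: N.bf_def)
        finally have sum: "(\<Sum>j\<le>Suc n. sg j (N.bf (Suc n) 0 j a (\<alpha>s @ [i]) ?g1)) = sg (Suc n) (a \<alpha>s ?g)"
          by (simp add: eq_neg_iff_add_eq_0 del: sum.atMost_Suc)
        have "N.bw n 0 b \<alpha>s ?g = (\<Sum>j\<le>Suc n. sg j (N.bf n 0 j b \<alpha>s ?g))"
          using True by (simp add: N.bw_def sum_fun_apply sg_apply del: sum.atMost_Suc)
        also have "\<dots> = (\<Sum>j\<le>Suc n. sg (Suc n) (sg j (N.bf (Suc n) 0 j a (\<alpha>s @ [i]) ?g1)))"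
          by (rule sum.cong[OF refl]) (use face in \<open>simp add: sg_def\<close>)
        also have "\<dots> = sg (Suc n) (sg (Suc n) (a \<alpha>s ?g))"
          by (simp only: sg_sum[symmetric] sum)
        finally show "N.bw n 0 b \<alpha>s ?g = a \<alpha>s ?g" by (simp only: sg_sg)
      qed
    next
      case False
      then show ?thesis using N.C_0[OF N.bw_C[OF b]] N.C_0[OF a] by simp
    qed
  qed
  then show ?thesis using b by blast
qed

text \<open>Exactness of the augmented columns lifts \<open>a\<close> to the augmentation row. The
  lift is again a cocycle for \<open>bw\<close>, because \<open>dv\<close> is injective on that
  row.\<close>

lemma edge_lift:
  assumes a: "a \<in> S.C n 0" and d1: "S.bw n 0 a = 0" and d2: "S.dv n 0 a = 0"
  shows "\<exists>a'\<in>N.C n 0. N.dv n 0 a' = a \<and> N.bw n 0 a' = 0"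
proof -
  obtain a' where a': "a' \<in> N.C n 0" "N.dv n 0 a' = a"
    using N_column_exact[of a n 0] a d2 by (auto simp: S_C S_dv)
  have "N.dv (Suc n) 0 (N.bw n 0 a') = - N.bw n (Suc 0) (N.dv n 0 a')"
    using N.bw_dv[OF a'(1)] by (simp add: eq_neg_iff_add_eq_0 add.commute)
  also have "\<dots> = 0" using d1 a' by (simp add: S_bw)
  finally have "N.bw n 0 a' = 0" by (rule N_column_inj[OF N.bw_C[OF a'(1)]])
  then show ?thesis using a' by blast
qed

text \<open>A total cocycle is moved to the row q = 0 by exact columns, lifted to the augmentation
  row and bounded there by some \<open>b\<close>. As the squares anticommute, \<open>- dv b\<close>
  is a primitive in the row q = 0.\<close>

lemma Tot_exact:
  assumes t: "t \<in> D.Tot (Suc n)" and Dt: "D.D t = 0"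
  shows "\<exists>u\<in>D.Tot n. D.D u = t"
proof -
  obtain u a where u: "u \<in> D.Tot n" and a: "a \<in> S.C (Suc n) 0" "t - D.D u = D.single (Suc n) 0 a"
    "S.bw (Suc n) 0 a = 0" "S.dv (Suc n) 0 a = 0"
    using D.cocycle_concentrate'[OF exact2 t Dt] by (auto simp: D.Tot_pred_def)
  obtain a' where a': "a' \<in> N.C (Suc n) 0" "N.dv (Suc n) 0 a' = a" "N.bw (Suc n) 0 a' = 0"
    using edge_lift[OF a(1,3,4)] by blast
  obtain b where b: "b \<in> N.C n 0" "N.bw n 0 b = a'" using row_exact[OF a'(1,3)] by blast
  let ?b = "- N.dv n 0 b"
  have bC: "?b \<in> S.C n 0" unfolding S_C by (rule subgrp_minus[OF N.subgrp_C N.dv_C[OF b(1)]])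
  have "S.dv n 0 ?b = 0"
    unfolding S_dv using N.dv_dv[OF b(1)] by (simp add: additive_minus[OF N.additive_dv])
  moreover have "S.bw n 0 ?b = a"
    unfolding S_bw using N.bw_dv[OF b(1)] a' b by (simp add: additive_minus[OF N.additive_bw] add_eq_0_iff)
  ultimately have "D.D (D.single n 0 ?b) = D.single (Suc n) 0 a"
    by (simp add: D.D_single) (simp add: D.single_def fun_eq_iff)
  then have "D.D (u + D.single n 0 ?b) = t"
    using a(2) by (simp add: additive_add[OF D.additive_D] algebra_simps)
  moreover have "u + D.single n 0 ?b \<in> D.Tot n"
    using u D.single_Tot[OF bC, of n] subgrp_add[OF D.subgrp_Tot] by simp
  ultimately show ?thesis by blast
qed

lemma bw_at_nil: "0 < v \<Longrightarrow> N.bw 0 0 (at_nil c) [v] = LL v c - aUU A 0 v c"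
  by (simp add: N.bw_def N.bf_def at_nil_def pos_lists_def)

lemma pos_lists_1: "\<alpha>s \<in> pos_lists (Suc 0) \<longleftrightarrow> (\<exists>v>0. \<alpha>s = [v])"
  by (cases \<alpha>s) (auto simp: pos_lists_def)

text \<open>On the list \<open>[v]\<close> the coboundary of \<open>c\<close> is the difference of
  \<psi>^v c and c \<Psi>^v.\<close>

lemma at_nil_bw_iff: "N.bw 0 0 (at_nil c) = 0 \<longleftrightarrow> (\<forall>v>0. LL v c = aUU A 0 v c)"
proof
  assume "N.bw 0 0 (at_nil c) = 0"
  then show "\<forall>v>0. LL v c = aUU A 0 v c" using bw_at_nil by (metis right_minus_eq zero_fun_apply)
next
  assume c: "\<forall>v>0. LL v c = aUU A 0 v c"
  show "N.bw 0 0 (at_nil c) = 0"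
  proof
    fix \<alpha>s
    show "N.bw 0 0 (at_nil c) \<alpha>s = 0 \<alpha>s"
    proof (cases "\<alpha>s \<in> pos_lists (Suc 0)")
      case True
      then obtain v where "0 < v" "\<alpha>s = [v]" by (auto simp: pos_lists_1)
      then show ?thesis using c bw_at_nil by simp
    qed (simp add: N.bw_def)
  qed
qed

lemma at_nil_C: "at_nil c \<in> N.C 0 0 \<longleftrightarrow> c \<in> DS A p 0 1"
  by (auto simp: N.C_def at_nil_def)

lemma dv_at_nil: "N.dv 0 0 (at_nil c) = at_nil (adl A 0 c)"
  by (auto simp: N.dv_def at_nil_def fun_eq_iff additive_zero[OF N.add_\<delta>, THEN fun_cong])

lemma C_0_at_nil: "a \<in> N.C 0 q \<Longrightarrow> a = at_nil (a [])"
  using N.C_0[of a 0 q] by (auto simp: at_nil_def fun_eq_iff)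

lemma edge_Pd: "c \<in> Pd A p \<Longrightarrow> edge A c \<in> D.Tot 0 \<and> D.D (edge A c) = 0"
proof
  assume "c \<in> Pd A p"
  then have c: "at_nil c \<in> N.C 0 0" "N.bw 0 0 (at_nil c) = 0"
    by (simp_all add: Pd_def at_nil_C at_nil_bw_iff)
  have C: "at_nil (adl A 0 c) \<in> S.C 0 0"
    using N.dv_C[OF c(1)] by (simp add: S_C dv_at_nil)
  then show "edge A c \<in> D.Tot 0" unfolding edge_def by (rule D.single_Tot) simp
  have "S.dv 0 0 (at_nil (adl A 0 c)) = 0"
    using N.dv_dv[OF c(1)] by (simp add: S_dv dv_at_nil)
  moreover have "S.bw 0 0 (at_nil (adl A 0 c)) = 0"
    using N.bw_dv[OF c(1)] c(2) by (simp add: S_bw dv_at_nil additive_zero[OF N.additive_dv])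
  ultimately show "D.D (edge A c) = 0"
    unfolding edge_def by (intro D.single_cocycle')
qed

text \<open>With \<open>edge_Pd\<close> and \<open>edge_inj\<close> this identifies the
  \<Psi>-derivations with the cocycles of degree 0; in positive degrees \<open>Tot_exact\<close>
  applies.\<close>

lemma edge_surj:
  assumes t: "t \<in> D.Tot 0" and Dt: "D.D t = 0"
  shows "\<exists>c\<in>Pd A p. t = edge A c"
proof -
  obtain a where a: "a \<in> S.C 0 0" "t = D.single 0 0 a" "S.bw 0 0 a = 0" "S.dv 0 0 a = 0"
    using D.cocycle_concentrate'[OF exact2 t Dt] by (auto simp: D.Tot_pred_def D.D_zero)
  obtain a' where a': "a' \<in> N.C 0 0" "N.dv 0 0 a' = a" "N.bw 0 0 a' = 0"
    using edge_lift[OF a(1,3,4)] by blast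
  have "a' = at_nil (a' [])" by (rule C_0_at_nil[OF a'(1)])
  then have "a' [] \<in> Pd A p" "a = at_nil (adl A 0 (a' []))"
    using a' at_nil_C[of "a' []"] at_nil_bw_iff[of "a' []"] dv_at_nil[of "a' []"] by (auto simp: Pd_def)
  then show ?thesis using a(2) by (auto simp: edge_def)
qed

lemma additive_edge: "additive (edge A)"
  by (auto simp: additive_def edge_def D.single_def at_nil_def additive_add[OF N.add_\<delta>] fun_eq_iff)

lemma edge_inj: "c \<in> Pd A p \<Longrightarrow> edge A c = 0 \<Longrightarrow> c = 0"
proof -
  assume c: "c \<in> Pd A p" "edge A c = 0"
  then have "edge A c 0 0 [] = 0" by simp
  then have "adl A 0 c = 0" by (simp add: edge_def D.single_def at_nil_def)
  moreover have "c \<in> DS A p 0 1" using c by (simp add: Pd_def)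
  ultimately show ?thesis by (rule adl_0_inj[OF ov poly, rotated])
qed

lemma subgrp_Pd: "subgrp (Pd A p)"
proof -
  have "additive (LL v)" if "0 < v" for v using that by (rule N.add_L)
  then show ?thesis
    unfolding Pd_def subgrp_def
    by (auto simp: subgrp_zero[OF subgrp_DS[OF ov]] subgrp_diff[OF subgrp_DS[OF ov]] additive_zero
        additive_diff additive_zero[OF N.add_U] additive_diff[OF N.add_U])
qed

end

end

section \<open>The comonad resolution of the double complex\<close>

context psi_pair
begin

text \<open>The complex K(A), named outside of any interpretation so that \<open>A\<close> can run
  through the resolution.\<close>

definition TT :: "'a univ psi_ring \<Rightarrow> ('a univ \<Rightarrow> 'a) \<Rightarrow> nat \<Rightarrow> (nat \<Rightarrow> nat \<Rightarrow> nat list \<Rightarrow> 'a univ \<Rightarrow> 'm big) set" where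
  "TT A p = double_complex.Tot (nat_complexes.C (SS A p))"

definition DD :: "'a univ psi_ring \<Rightarrow> (nat \<Rightarrow> nat \<Rightarrow> nat list \<Rightarrow> 'a univ \<Rightarrow> 'm big) \<Rightarrow>
    nat \<Rightarrow> nat \<Rightarrow> nat list \<Rightarrow> 'a univ \<Rightarrow> 'm big" where
  "DD A = double_complex.D (nat_complexes.bw LL (UU A)) (nat_complexes.dv (dl A))"

lemma double_complex_over: "over A p \<Longrightarrow>
    double_complex (nat_complexes.C (SS A p)) (nat_complexes.bw LL (UU A)) (nat_complexes.dv (dl A))"
  by (rule nat_complexes.double_complex[OF nat_complexes])

lemma TT_iff:
  assumes "over A p"
  shows "t \<in> TT A p n \<longleftrightarrow> (\<forall>i j \<alpha>s. (\<alpha>s \<in> pos_lists i \<longrightarrow> t i j \<alpha>s \<in> SS A p j (prod_list \<alpha>s)) \<and>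
    (\<alpha>s \<notin> pos_lists i \<longrightarrow> t i j \<alpha>s = 0)) \<and> (\<forall>i j. i + j \<noteq> n \<longrightarrow> t i j = 0)"
  unfolding TT_def double_complex.Tot_def[OF double_complex_over[OF assms]]
    nat_complexes.C_def[OF nat_complexes[OF assms]] by auto

text \<open>Restriction along \<open>\<phi>\<close>, which for positive \<open>m\<close> may be a
  mere map of sets.\<close>

definition resm :: "'a univ psi_ring \<Rightarrow> 'a univ psi_ring \<Rightarrow> ('a univ \<Rightarrow> 'a univ) \<Rightarrow> nat \<Rightarrow>
    ('a univ \<Rightarrow> 'm big) \<Rightarrow> 'a univ \<Rightarrow> 'm big" where
  "resm A B \<phi> m = pre (carrier (rng A m)) (Ar_pow ring_free_comonad m (ring.truncate B) \<phi>)"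

definition RR :: "'a univ psi_ring \<Rightarrow> 'a univ psi_ring \<Rightarrow> ('a univ \<Rightarrow> 'a univ) \<Rightarrow>
    (nat \<Rightarrow> nat \<Rightarrow> nat list \<Rightarrow> 'a univ \<Rightarrow> 'm big) \<Rightarrow> nat \<Rightarrow> nat \<Rightarrow> nat list \<Rightarrow> 'a univ \<Rightarrow> 'm big" where
  "RR A B \<phi> t = (\<lambda>i j \<alpha>s. resm A B \<phi> (Suc j) (t i j \<alpha>s))"

lemma additive_resm: "additive (resm A B \<phi> m)"
  unfolding resm_def by (rule additive_pre)

lemma additive_RR: "additive (RR A B \<phi>)"
  by (simp add: additive_def RR_def additive_add[OF additive_resm] fun_eq_iff)

lemma resm_resm:
  assumes A: "over A p" and B: "over B q" and C: "over C r"
    and \<phi>: "\<phi> \<in> carrier A \<rightarrow> carrier B" and \<psi>: "\<psi> \<in> carrier B \<rightarrow> carrier C"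
    and k: "\<And>x. x \<in> carrier A \<Longrightarrow> \<psi> (\<phi> x) = k x"
  shows "resm A B \<phi> m (resm B C \<psi> m c) = resm A C k m c"
proof -
  have \<phi>': "\<phi> \<in> carrier (ring.truncate A) \<rightarrow> carrier (ring.truncate B)"
    and \<psi>': "\<psi> \<in> carrier (ring.truncate B) \<rightarrow> carrier (ring.truncate C)" using \<phi> \<psi> by simp_all
  have cl: "Ar_pow ring_free_comonad m (ring.truncate B) \<phi> \<in> carrier (rng A m) \<rightarrow> carrier (rng B m)"
    unfolding rng_def by (rule RF.Ar_pow_closed[OF overD(2)[OF A] overD(2)[OF B] \<phi>'])
  show ?thesis
    unfolding resm_def pre_pre[OF cl]
  proof (rule pre_cong)
    fix s assume s: "s \<in> carrier (rng A m)"
    show "Ar_pow ring_free_comonad m (ring.truncate C) \<psi> (Ar_pow ring_free_comonad m (ring.truncate B) \<phi> s) =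
        Ar_pow ring_free_comonad m (ring.truncate C) k s"
      by (rule RF.Ar_pow_comp[OF overD(2)[OF A] overD(2)[OF B] overD(2)[OF C] \<phi>' \<psi>'])
        (use k s in \<open>auto simp: rng_def\<close>)
  qed
qed

lemma RR_RR:
  assumes "over A p" "over B q" "over C r" "\<phi> \<in> carrier A \<rightarrow> carrier B" "\<psi> \<in> carrier B \<rightarrow> carrier C"
    and "\<And>x. x \<in> carrier A \<Longrightarrow> \<psi> (\<phi> x) = k x"
  shows "RR A B \<phi> (RR B C \<psi> t) = RR A C k t"
  using resm_resm[OF assms] by (simp add: RR_def)

lemma RR_id:
  assumes A: "over A p" and k: "\<And>x. x \<in> carrier A \<Longrightarrow> k x = x" and t: "t \<in> TT A p n"
  shows "RR A A k t = t"
proof (intro ext)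
  fix i j \<alpha>s s
  have id: "Ar_pow ring_free_comonad (Suc j) (ring.truncate A) k s = s" if "s \<in> carrier (rng A (Suc j))"
    by (rule RF.Ar_pow_id[OF overD(2)[OF A]]) (use k that in \<open>auto simp: rng_def\<close>)
  have "s \<notin> carrier (rng A (Suc j)) \<Longrightarrow> t i j \<alpha>s s = 0"
  proof (cases "\<alpha>s \<in> pos_lists i")
    case True
    then have "t i j \<alpha>s \<in> SS A p j (prod_list \<alpha>s)" using t TT_iff[OF A] by blast
    then show "s \<notin> carrier (rng A (Suc j)) \<Longrightarrow> t i j \<alpha>s s = 0"
      unfolding SS_def DS_def by (rule RA.DerD(1))
  next
    case False
    then have "t i j \<alpha>s = 0" using t TT_iff[OF A] by blast
    then show ?thesis by simp
  qed
  then show "RR A A k t i j \<alpha>s s = t i j \<alpha>s s"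
    using id by (simp add: RR_def resm_def pre_def del: Ar_pow.simps)
qed

text \<open>Every entry of a total cochain lives on G^(j+1), so the outermost free functor makes
  \<open>\<phi>\<close> a homomorphism, and the augmentation to \<open>R\<close> is preserved
  because it is so on indeterminates.\<close>

lemma RR_TT:
  assumes A: "over A p" and B: "over B q" and \<phi>: "\<phi> \<in> carrier A \<rightarrow> carrier B"
    and q: "\<And>x. x \<in> carrier A \<Longrightarrow> q (\<phi> x) = p x" and t: "t \<in> TT B q n"
  shows "RR A B \<phi> t \<in> TT A p n"
proof -
  have \<phi>': "\<phi> \<in> carrier (ring.truncate A) \<rightarrow> carrier (ring.truncate B)" using \<phi> by simp
  have SS: "resm A B \<phi> (Suc j) c \<in> SS A p j f" if c: "c \<in> SS B q j f" for j c f
    unfolding resm_def pre_def SS_def DS_def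
  proof (rule RA.Der_comp[OF cring_rng[OF A] c[unfolded SS_def DS_def]])
    show "Ar_pow ring_free_comonad (Suc j) (ring.truncate B) \<phi> \<in> ring_hom (rng A (Suc j)) (rng B (Suc j))"
      unfolding rng_def by (rule RF.arr_Ar_pow_Suc[OF overD(2)[OF A] overD(2)[OF B] \<phi>'])
    show "Psi R f (q (aug B (Suc j) (Ar_pow ring_free_comonad (Suc j) (ring.truncate B) \<phi> u))) =
        Psi R f (p (aug A (Suc j) u))" if "u \<in> carrier (rng A (Suc j))" for u
      using augmentation_ring_free_set[OF overD(2)[OF A] overD(2)[OF B] psi_ring_cring[OF psi_ring_axioms]
          overD(3)[OF A] overD(3)[OF B] \<phi>', of u "Suc j"] q that
      by (simp add: aug_def rng_def del: Ar_pow.simps augmentation.simps)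
  qed
  show ?thesis
    using t SS unfolding TT_iff[OF A] TT_iff[OF B]
    by (simp add: RR_def additive_zero[OF additive_resm]) (simp add: fun_eq_iff additive_zero[OF additive_resm])
qed

section \<open>Naturality in homomorphisms of \<Psi>-rings\<close>

context
  fixes A B :: "'a univ psi_ring" and p q :: "'a univ \<Rightarrow> 'a" and \<phi> :: "'a univ \<Rightarrow> 'a univ"
  assumes A: "over A p" and B: "over B q" and \<phi>: "psi_arr A B \<phi>"
begin

lemma phi_ring: "\<phi> \<in> ring_hom (ring.truncate A) (ring.truncate B)"
  using psi_arr_hom[OF \<phi>] by (simp add: ring_hom_truncate)

lemma phi_closed: "\<phi> \<in> carrier (ring.truncate A) \<rightarrow> carrier (ring.truncate B)"
  using ring_hom_closed[OF phi_ring] by blast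

lemma resm_closed: "Ar_pow ring_free_comonad m (ring.truncate B) \<phi> \<in> carrier (rng A m) \<rightarrow> carrier (rng B m)"
  unfolding rng_def by (rule RF.Ar_pow_closed[OF overD(2)[OF A] overD(2)[OF B] phi_closed])

lemma resm_DS:
  assumes q: "\<And>x. x \<in> carrier A \<Longrightarrow> q (\<phi> x) = p x" and c: "c \<in> DS B q m f"
  shows "resm A B \<phi> m c \<in> DS A p m f"
  unfolding resm_def pre_def DS_def
proof (rule RA.Der_comp[OF cring_rng[OF A] c[unfolded DS_def]])
  show "Ar_pow ring_free_comonad m (ring.truncate B) \<phi> \<in> ring_hom (rng A m) (rng B m)"
    unfolding rng_def by (rule RF.arr_Ar_pow[OF overD(2)[OF A] overD(2)[OF B] phi_ring])
  show "Psi R f (q (aug B m (Ar_pow ring_free_comonad m (ring.truncate B) \<phi> u))) = Psi R f (p (aug A m u))"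
    if u: "u \<in> carrier (rng A m)" for u
    using RF.augmentation_nat[OF overD(2)[OF A] overD(2)[OF B] phi_ring, of u m] q[OF aug_closed[OF A u]] u
    by (simp add: aug_def rng_def)
qed

lemma resm_adl: "adl A m (resm A B \<phi> m c) = resm A B \<phi> (Suc m) (adl B m c)"
  unfolding adl_def
proof (rule hom_altpre[symmetric, OF additive_resm])
  fix i assume i: "i \<le> m"
  show "resm A B \<phi> (Suc m) (pre (carrier (rng B (Suc m))) (fc B m i) c) =
      pre (carrier (rng A (Suc m))) (fc A m i) (resm A B \<phi> m c)"
    unfolding resm_def pre_pre[OF resm_closed] pre_pre[OF fc_closed[OF A i]]
  proof (rule pre_cong)
    fix s assume "s \<in> carrier (rng A (Suc m))"
    then show "fc B m i (Ar_pow ring_free_comonad (Suc m) (ring.truncate B) \<phi> s) =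
        Ar_pow ring_free_comonad m (ring.truncate B) \<phi> (fc A m i s)"
      using RF.face_nat[OF overD(2)[OF A] overD(2)[OF B] phi_ring i, of s] by (simp add: fc_def rng_def)
  qed
qed

lemma resm_aUU:
  assumes v: "0 < v" shows "aUU A m v (resm A B \<phi> m c) = resm A B \<phi> m (aUU B m v c)"
  unfolding aUU_def resm_def pre_pre[OF pv_closed[OF A v]] pre_pre[OF resm_closed]
proof (rule pre_cong)
  fix s assume s: "s \<in> carrier (rng A m)"
  have s': "s \<in> carrier ((Ob ring_free_comonad ^^ m) (ring.truncate A))" using s by (simp add: rng_def)
  have "Ar_pow ring_free_comonad m (ring.truncate B) \<phi> (pv A m v s) =
      Ar_pow ring_free_comonad m (ring.truncate B) (\<lambda>x. \<phi> (Psi A v x)) s"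
    unfolding pv_def
    by (rule RF.Ar_pow_comp[OF overD(2)[OF A] overD(2)[OF A] overD(2)[OF B] overD(7)[OF A v] phi_closed refl s'])
  also have "\<dots> = pv B m v (Ar_pow ring_free_comonad m (ring.truncate B) \<phi> s)"
    unfolding pv_def
    by (rule RF.Ar_pow_comp[OF overD(2)[OF A] overD(2)[OF B] overD(2)[OF B] phi_closed overD(7)[OF B v] _ s', symmetric])
      (use psi_arr_Psi[OF \<phi> v] in simp)
  finally show "Ar_pow ring_free_comonad m (ring.truncate B) \<phi> (pv A m v s) =
      pv B m v (Ar_pow ring_free_comonad m (ring.truncate B) \<phi> s)" .
qed

lemma resm_LL: "0 < u \<Longrightarrow> LL u (resm A B \<phi> m c) = resm A B \<phi> m (LL u c)"
  unfolding resm_def by (rule LL_pre[OF A])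

interpretation NA: nat_complexes "SS A p" "dl A" LL "UU A" by (rule nat_complexes[OF A])
interpretation NB: nat_complexes "SS B q" "dl B" LL "UU B" by (rule nat_complexes[OF B])
interpretation DA: double_complex NA.C NA.bw NA.dv by (rule NA.double_complex)
interpretation DB: double_complex NB.C NB.bw NB.dv by (rule NB.double_complex)

lemma resm_bf:
  assumes "\<alpha>s \<in> pos_lists (Suc k)"
  shows "NA.bf k j i (\<lambda>\<beta>s. resm A B \<phi> (Suc j) (y \<beta>s)) \<alpha>s = resm A B \<phi> (Suc j) (NB.bf k j i y \<alpha>s)"
  using tl_pos_lists[OF assms] butlast_pos_lists[OF assms]
  by (simp add: NA.bf_def NB.bf_def resm_LL resm_aUU UU_def)

lemma resm_bw: "NA.bw k j (\<lambda>\<beta>s. resm A B \<phi> (Suc j) (y \<beta>s)) = (\<lambda>\<alpha>s. resm A B \<phi> (Suc j) (NB.bw k j y \<alpha>s))"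
proof
  fix \<alpha>s
  show "NA.bw k j (\<lambda>\<beta>s. resm A B \<phi> (Suc j) (y \<beta>s)) \<alpha>s = resm A B \<phi> (Suc j) (NB.bw k j y \<alpha>s)"
    by (cases "\<alpha>s \<in> pos_lists (Suc k)")
      (simp_all add: NA.bw_def NB.bw_def resm_bf additive_sum[OF additive_resm] additive_sg[OF additive_resm]
        additive_zero[OF additive_resm] del: sum.atMost_Suc)
qed

lemma resm_dv: "NA.dv k j (\<lambda>\<beta>s. resm A B \<phi> (Suc j) (y \<beta>s)) = (\<lambda>\<alpha>s. resm A B \<phi> (Suc (Suc j)) (NB.dv k j y \<alpha>s))"
  by (simp add: NA.dv_def NB.dv_def dl_def resm_adl additive_sg[OF additive_resm])

text \<open>Here \<open>\<phi>\<close> is a homomorphism of \<Psi>-rings: the Andre-Quillen faces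
  involve the counit of \<open>A\<close>, and the final Baues-Wirsching face involves its Adams
  operations.\<close>

lemma RR_DD: "DD A (RR A B \<phi> t) = RR A B \<phi> (DD B t)"
proof (intro ext)
  fix i j \<alpha>s s
  have "DA.D (RR A B \<phi> t) i j \<alpha>s = RR A B \<phi> (DB.D t) i j \<alpha>s"
    unfolding DA.D_def DB.D_def RR_def
    by (cases i; cases j) (simp_all add: resm_bw resm_dv additive_add[OF additive_resm] additive_zero[OF additive_resm])
  then show "DD A (RR A B \<phi> t) i j \<alpha>s s = RR A B \<phi> (DD B t) i j \<alpha>s s"
    by (simp add: DD_def)
qed

lemma resm_Pd:
  assumes q: "\<And>x. x \<in> carrier A \<Longrightarrow> q (\<phi> x) = p x" and c: "c \<in> Pd B q"
  shows "resm A B \<phi> 0 c \<in> Pd A p"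
  using c resm_DS[OF q, of c 0 1] resm_LL resm_aUU by (simp add: Pd_def)

lemma edge_resm: "edge A (resm A B \<phi> 0 c) = RR A B \<phi> (edge B c)"
  by (simp add: edge_def resm_adl RR_def at_nil_def DA.single_def DB.single_def fun_eq_iff
      additive_zero[OF additive_resm, THEN fun_cong])

end

section \<open>The comonad resolution of \<open>R\<close> by free \<Psi>-rings\<close>

definition FF :: "nat \<Rightarrow> 'a univ psi_ring" where
  "FF s = (Ob psi_free_comonad ^^ s) RB"

definition pp :: "nat \<Rightarrow> 'a univ \<Rightarrow> 'a" where
  "pp s u = the_Base (augmentation psi_free_comonad RB s u)"

definition pf :: "nat \<Rightarrow> nat \<Rightarrow> 'a univ \<Rightarrow> 'a univ" where
  "pf s k = face psi_free_comonad RB s k"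

lemma psi_RB: "psi_ring RB"
  by (rule psi_ring_base[OF psi_ring_axioms])

lemma FF_Suc: "FF (Suc s) = free_psi_ring (carrier (FF s))"
  by (simp add: FF_def Ob_psi_free)

lemma over_FF: "over (FF s) (pp s)"
proof -
  have a: "psi_arr (FF s) RB (augmentation psi_free_comonad RB s)"
    unfolding FF_def by (rule PF.arr_augmentation[OF psi_RB])
  note b = over_base[unfolded over_def]
  have "pp s = (\<lambda>u. the_Base (augmentation psi_free_comonad RB s u))"
    by (simp add: pp_def fun_eq_iff)
  then have "pp s \<in> ring_hom (FF s) R"
    using ring_hom_comp_mem[OF psi_arr_hom[OF a], of the_Base R] b by simp
  moreover have "psi_ring (FF s)" unfolding FF_def by (rule PF.obj_pw[OF psi_RB])
  moreover have "pp s (Psi (FF s) v x) = Psi R v (pp s x)" if "0 < v" "x \<in> carrier (FF s)" for v x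
    using psi_arr_Psi[OF a that] ring_hom_closed[OF psi_arr_hom[OF a] that(2)] by (auto simp: pp_def)
  ultimately show ?thesis by (simp add: over_def)
qed

lemma FF_0: "FF 0 = RB"
  by (simp add: FF_def)

lemma pp_0: "pp 0 = the_Base"
  by (simp add: pp_def fun_eq_iff)

lemma pf_arr: "k \<le> s \<Longrightarrow> psi_arr (FF (Suc s)) (FF s) (pf s k)"
  unfolding FF_def pf_def by (rule PF.arr_face[OF psi_RB])

lemma pf_closed: "k \<le> s \<Longrightarrow> pf s k \<in> carrier (FF (Suc s)) \<rightarrow> carrier (FF s)"
  by (rule PF.arr_closed[OF pf_arr])

lemma pp_pf: "k \<le> s \<Longrightarrow> x \<in> carrier (FF (Suc s)) \<Longrightarrow> pp s (pf s k x) = pp (Suc s) x"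
  unfolding FF_def pf_def pp_def using PF.augmentation_face[OF psi_RB] by metis

lemma pf_pf: "i < j \<Longrightarrow> j \<le> Suc s \<Longrightarrow> x \<in> carrier (FF (Suc (Suc s))) \<Longrightarrow>
    pf s i (pf (Suc s) j x) = pf s (j - 1) (pf (Suc s) i x)"
  unfolding FF_def pf_def by (rule PF.face_face[OF psi_RB])

lemma unit_closed: "psi_unit \<in> carrier (FF s) \<rightarrow> carrier (FF (Suc s))"
  using psi_unit_closed[of "FF s"] by (simp add: FF_def)

lemma pf_unit_0: "x \<in> carrier (FF s) \<Longrightarrow> pf s 0 (psi_unit x) = x"
  unfolding pf_def PF.face_0 FF_def by (rule Eps_psi_unit[OF PF.obj_pw[OF psi_RB]])

text \<open>With \<open>pf_unit_0\<close> these are the identities of an extra degeneracy: it splits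
  face 0 and shifts the other faces by one.\<close>

lemma pf_unit_Suc: "k \<le> s \<Longrightarrow> x \<in> carrier (FF (Suc s)) \<Longrightarrow> pf (Suc s) (Suc k) (psi_unit x) = psi_unit (pf s k x)"
  using Ar_psi_unit[OF PF.arr_closed[OF PF.arr_face[OF psi_RB]]]
  unfolding pf_def FF_def by (simp add: PF.face_Suc)

lemma pp_unit: "x \<in> carrier (FF s) \<Longrightarrow> pp (Suc s) (psi_unit x) = pp s x"
  using pp_pf[OF le0 funcset_mem[OF unit_closed]] pf_unit_0[of x s] by metis

text \<open>The double complex with total degree \<open>n\<close> of K in one direction and
  resolution degree \<open>s\<close> in the other. \<open>xd1\<close> is the differential of K,
  \<open>xd2\<close> the alternating sum of the faces, with the sign (-1)^n that makes the squares
  anticommute.\<close>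

definition XX :: "nat \<Rightarrow> nat \<Rightarrow> (nat \<Rightarrow> nat \<Rightarrow> nat list \<Rightarrow> 'a univ \<Rightarrow> 'm big) set" where
  "XX n s = TT (FF (Suc s)) (pp (Suc s)) n"

definition xd1 :: "nat \<Rightarrow> nat \<Rightarrow> (nat \<Rightarrow> nat \<Rightarrow> nat list \<Rightarrow> 'a univ \<Rightarrow> 'm big) \<Rightarrow>
    nat \<Rightarrow> nat \<Rightarrow> nat list \<Rightarrow> 'a univ \<Rightarrow> 'm big" where
  "xd1 n s = DD (FF (Suc s))"

definition RF' :: "nat \<Rightarrow> nat \<Rightarrow> (nat \<Rightarrow> nat \<Rightarrow> nat list \<Rightarrow> 'a univ \<Rightarrow> 'm big) \<Rightarrow>
    nat \<Rightarrow> nat \<Rightarrow> nat list \<Rightarrow> 'a univ \<Rightarrow> 'm big" where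
  "RF' s k = RR (FF (Suc s)) (FF s) (pf s k)"

definition RU :: "nat \<Rightarrow> (nat \<Rightarrow> nat \<Rightarrow> nat list \<Rightarrow> 'a univ \<Rightarrow> 'm big) \<Rightarrow>
    nat \<Rightarrow> nat \<Rightarrow> nat list \<Rightarrow> 'a univ \<Rightarrow> 'm big" where
  "RU s = RR (FF s) (FF (Suc s)) psi_unit"

definition xd2 :: "nat \<Rightarrow> nat \<Rightarrow> (nat \<Rightarrow> nat \<Rightarrow> nat list \<Rightarrow> 'a univ \<Rightarrow> 'm big) \<Rightarrow>
    nat \<Rightarrow> nat \<Rightarrow> nat list \<Rightarrow> 'a univ \<Rightarrow> 'm big" where
  "xd2 n s t = sg n (\<Sum>k\<le>Suc s. sg k (RF' (Suc s) k t))"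

lemma additive_RF': "additive (RF' s k)" and additive_RU: "additive (RU s)"
  by (simp_all add: RF'_def RU_def additive_RR)

lemma RF'_TT: "k \<le> s \<Longrightarrow> t \<in> TT (FF s) (pp s) n \<Longrightarrow> RF' s k t \<in> TT (FF (Suc s)) (pp (Suc s)) n"
  unfolding RF'_def by (rule RR_TT[OF over_FF over_FF pf_closed pp_pf])

lemma RU_TT: "t \<in> TT (FF (Suc s)) (pp (Suc s)) n \<Longrightarrow> RU s t \<in> TT (FF s) (pp s) n"
  unfolding RU_def by (rule RR_TT[OF over_FF over_FF unit_closed pp_unit])

lemma RF'_DD: "k \<le> s \<Longrightarrow> DD (FF (Suc s)) (RF' s k t) = RF' s k (DD (FF s) t)"
  unfolding RF'_def by (rule RR_DD[OF over_FF over_FF pf_arr])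

lemma RF'_RF':
  assumes "i < j" "j \<le> Suc s"
  shows "RF' (Suc s) j (RF' s i t) = RF' (Suc s) i (RF' s (j - 1) t)"
proof -
  have "i \<le> Suc s" "i \<le> s" "j - 1 \<le> s" using assms by auto
  then have "RF' (Suc s) i (RF' s (j - 1) t) =
      RR (FF (Suc (Suc s))) (FF s) (\<lambda>x. pf s i (pf (Suc s) j x)) t"
    unfolding RF'_def using pf_pf[OF assms] by (intro RR_RR[OF over_FF over_FF over_FF] pf_closed) auto
  moreover have "RF' (Suc s) j (RF' s i t) = RR (FF (Suc (Suc s))) (FF s) (\<lambda>x. pf s i (pf (Suc s) j x)) t"
    unfolding RF'_def using \<open>i \<le> s\<close> assms by (intro RR_RR[OF over_FF over_FF over_FF] pf_closed) auto
  ultimately show ?thesis by simp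
qed

lemma RU_RF'_0: "t \<in> TT (FF s) (pp s) n \<Longrightarrow> RU s (RF' s 0 t) = t"
proof -
  assume t: "t \<in> TT (FF s) (pp s) n"
  have "RU s (RF' s 0 t) = RR (FF s) (FF s) (\<lambda>x. x) t"
    unfolding RU_def RF'_def
    by (rule RR_RR[OF over_FF over_FF over_FF unit_closed pf_closed pf_unit_0]) auto
  also have "\<dots> = t" by (rule RR_id[OF over_FF refl t])
  finally show ?thesis .
qed

lemma RU_RF'_Suc: "k \<le> s \<Longrightarrow> RU (Suc s) (RF' (Suc s) (Suc k) t) = RF' s k (RU s t)"
proof -
  assume k: "k \<le> s"
  have "RU (Suc s) (RF' (Suc s) (Suc k) t) = RR (FF (Suc s)) (FF (Suc s)) (\<lambda>x. psi_unit (pf s k x)) t"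
    unfolding RU_def RF'_def
    by (rule RR_RR[OF over_FF over_FF over_FF unit_closed pf_closed pf_unit_Suc[OF k]]) (use k in simp_all)
  also have "\<dots> = RF' s k (RU s t)"
    unfolding RU_def RF'_def
    by (rule RR_RR[OF over_FF over_FF over_FF pf_closed[OF k] unit_closed refl, symmetric])
  finally show ?thesis .
qed

lemma subgrp_TT: "over A p \<Longrightarrow> subgrp (TT A p n)"
  unfolding TT_def by (rule double_complex.subgrp_Tot[OF double_complex_over])

lemma additive_DD: "over A p \<Longrightarrow> additive (DD A)"
  unfolding DD_def by (rule double_complex.additive_D[OF double_complex_over])

lemma DD_TT: "over A p \<Longrightarrow> t \<in> TT A p n \<Longrightarrow> DD A t \<in> TT A p (Suc n)"
  unfolding TT_def DD_def by (rule double_complex.D_closed[OF double_complex_over])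

lemma DD_DD: "over A p \<Longrightarrow> t \<in> TT A p n \<Longrightarrow> DD A (DD A t) = 0"
  unfolding TT_def DD_def by (rule double_complex.D_D[OF double_complex_over])

lemma additive_xd2: "additive (xd2 n s)"
  unfolding additive_def xd2_def by (simp add: additive_add[OF additive_RF'] sg_add sum.distrib del: sum.atMost_Suc)

lemma XX_double_complex: "double_complex XX xd1 xd2"
proof
  fix n s and t :: "nat \<Rightarrow> nat \<Rightarrow> nat list \<Rightarrow> 'a univ \<Rightarrow> 'm big"
  show "subgrp (XX n s)" unfolding XX_def by (rule subgrp_TT[OF over_FF])
  show "additive (xd1 n s)" unfolding xd1_def by (rule additive_DD[OF over_FF])
  show "additive (xd2 n s)" by (rule additive_xd2)
  show "xd1 n s t \<in> XX (Suc n) s" if "t \<in> XX n s"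
    using that unfolding XX_def xd1_def by (rule DD_TT[OF over_FF])
  show "xd2 n s t \<in> XX n (Suc s)" if "t \<in> XX n s"
    unfolding xd2_def XX_def
    by (intro subgrp_sg[OF subgrp_TT[OF over_FF]] subgrp_sum[OF subgrp_TT[OF over_FF]] RF'_TT)
      (use that in \<open>auto simp: XX_def\<close>)
  show "xd1 (Suc n) s (xd1 n s t) = 0" if "t \<in> XX n s"
    using that unfolding XX_def xd1_def by (rule DD_DD[OF over_FF])
  show "xd2 n (Suc s) (xd2 n s t) = 0"
  proof -
    let ?y = "\<Sum>i\<le>Suc s. sg i (RF' (Suc s) i t)"
    have "xd2 n (Suc s) (xd2 n s t) = sg n (xd2 n (Suc s) ?y)"
      by (simp only: xd2_def[of n s t] additive_sg[OF additive_xd2])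
    also have "\<dots> = sg n (sg n (\<Sum>j\<le>Suc (Suc s). sg j (\<Sum>i\<le>Suc s. sg i (RF' (Suc (Suc s)) j (RF' (Suc s) i t)))))"
      by (simp only: xd2_def[of n "Suc s"] additive_sg[OF additive_RF'] additive_sum[OF additive_RF'])
    also have "(\<Sum>j\<le>Suc (Suc s). sg j (\<Sum>i\<le>Suc s. sg i (RF' (Suc (Suc s)) j (RF' (Suc s) i t)))) = 0"
      by (rule alternating_double_sum) (rule RF'_RF')
    finally show ?thesis by (simp only: sg_zero)
  qed
  show "xd1 n (Suc s) (xd2 n s t) + xd2 (Suc n) s (xd1 n s t) = 0"
    unfolding xd1_def xd2_def
    using RF'_DD[of _ "Suc s" t]
    by (simp add: additive_sg[OF additive_DD[OF over_FF]] additive_sum[OF additive_DD[OF over_FF]] del: sum.atMost_Suc)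
qed

interpretation X: double_complex XX xd1 xd2 by (rule XX_double_complex)

lemma XX_exact1: "X.exact1"
  unfolding X.exact1_def XX_def xd1_def TT_def DD_def
  using Tot_exact[OF over_FF FF_Suc] by blast

text \<open>Apply the restriction along the extra degeneracy to the cocycle condition: face 0 gives
  back \<open>t\<close>, and the other faces give the faces of \<open>RU t\<close> with the opposite
  sign. The factor \<open>sg n\<close> undoes the sign in \<open>xd2\<close>.\<close>

lemma XX_exact2: "X.exact2"
  unfolding X.exact2_def
proof (intro allI ballI impI)
  fix n s t assume t: "t \<in> XX n (Suc s)" and dt: "xd2 n (Suc s) t = 0"
  have "0 = RU (Suc (Suc s)) (\<Sum>k\<le>Suc (Suc s). sg k (RF' (Suc (Suc s)) k t))"
    using dt by (simp add: xd2_def additive_zero[OF additive_RU] del: sum.atMost_Suc)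
  also have "\<dots> = (\<Sum>k\<le>Suc (Suc s). sg k (RU (Suc (Suc s)) (RF' (Suc (Suc s)) k t)))"
    by (simp only: additive_sum[OF additive_RU] additive_sg[OF additive_RU])
  also have "\<dots> = RU (Suc (Suc s)) (RF' (Suc (Suc s)) 0 t) +
      (\<Sum>k\<le>Suc s. sg (Suc k) (RU (Suc (Suc s)) (RF' (Suc (Suc s)) (Suc k) t)))"
    by (simp only: sum.atMost_Suc_shift sg_0)
  also have "RU (Suc (Suc s)) (RF' (Suc (Suc s)) 0 t) = t"
    using t unfolding XX_def by (rule RU_RF'_0)
  also have "(\<Sum>k\<le>Suc s. sg (Suc k) (RU (Suc (Suc s)) (RF' (Suc (Suc s)) (Suc k) t))) =
      - (\<Sum>k\<le>Suc s. sg k (RF' (Suc s) k (RU (Suc s) t)))"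
    by (simp add: RU_RF'_Suc sum_negf del: sum.atMost_Suc)
  finally have "t + - (\<Sum>k\<le>Suc s. sg k (RF' (Suc s) k (RU (Suc s) t))) = 0"
    by (rule sym)
  then have "t = (\<Sum>k\<le>Suc s. sg k (RF' (Suc s) k (RU (Suc s) t)))"
    unfolding eq_neg_iff_add_eq_0[symmetric] add.inverse_inverse .
  moreover have "xd2 n s (sg n (RU (Suc s) t)) = (\<Sum>k\<le>Suc s. sg k (RF' (Suc s) k (RU (Suc s) t)))"
    unfolding additive_sg[OF additive_xd2] by (simp only: xd2_def sg_sg)
  ultimately have "t = xd2 n s (sg n (RU (Suc s) t))" by simp
  moreover have "sg n (RU (Suc s) t) \<in> XX n s"
    using t unfolding XX_def by (intro subgrp_sg[OF subgrp_TT[OF over_FF]] RU_TT)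
  ultimately show "\<exists>y\<in>XX n s. xd2 n s y = t" by metis
qed

section \<open>\<Psi>-ring cohomology as one edge of the double complex, and K(R) as the
  other\<close>

definition dpsi :: "nat \<Rightarrow> ('a univ \<Rightarrow> 'm big) \<Rightarrow> 'a univ \<Rightarrow> 'm big" where
  "dpsi n = altpre (Suc n) (carrier (FF (Suc (Suc n)))) (pf (Suc n))"

abbreviation Pn :: "nat \<Rightarrow> ('a univ \<Rightarrow> 'm big) set" where
  "Pn n \<equiv> Pd (FF (Suc n)) (pp (Suc n))"

lemma dpsi_resm: "dpsi n c = (\<Sum>k\<le>Suc n. sg k (resm (FF (Suc (Suc n))) (FF (Suc n)) (pf (Suc n) k) 0 c))"
  by (simp add: dpsi_def altpre_def resm_def rng_def del: sum.atMost_Suc)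

lemma dpsi_Pn: "c \<in> Pn n \<Longrightarrow> dpsi n c \<in> Pn (Suc n)"
  unfolding dpsi_resm
  by (intro subgrp_sum[OF subgrp_Pd[OF over_FF FF_Suc]] subgrp_sg[OF subgrp_Pd[OF over_FF FF_Suc]]
      resm_Pd[OF over_FF over_FF pf_arr pp_pf]) auto

lemma dpsi_dpsi: "dpsi (Suc n) (dpsi n c) = 0"
  unfolding dpsi_def by (rule altpre_altpre) (use pf_closed pf_pf in auto)

lemma additive_dpsi: "additive (dpsi n)"
  unfolding dpsi_def by (rule additive_altpre)

lemma additive_edge_FF: "additive (edge (FF (Suc n)))"
  by (rule additive_edge[OF over_FF FF_Suc])

lemma xd2_edge: "xd2 0 n (edge (FF (Suc n)) c) = edge (FF (Suc (Suc n))) (dpsi n c)"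
  unfolding dpsi_resm xd2_def RF'_def
  by (simp add: additive_sum[OF additive_edge_FF] additive_sg[OF additive_edge_FF]
      edge_resm[OF over_FF over_FF pf_arr] del: sum.atMost_Suc)

lemma \<kappa>_Pn: "\<kappa> (carrier (FF (Suc n))) ` Pn n =
    psi_derivations (FF (Suc n)) (the_Base \<circ> augmentation psi_free_comonad RB (Suc n)) M"
proof -
  let ?F = "FF (Suc n)" and ?X = "carrier (FF (Suc n))"
  let ?p = "the_Base \<circ> augmentation psi_free_comonad RB (Suc n)"
  have r0: "rng ?F 0 = ring.truncate ?F" by (simp add: rng_def)
  have pR: "pp (Suc n) s \<in> carrier R" if "s \<in> ?X" for s by (rule overD(5)[OF over_FF that])
  have w: "pp (Suc n) s \<in> carrier R" if "s \<in> carrier (rng ?F 0)" for s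
    using that by (intro pR) (simp add: r0)
  have DS: "DS ?F (pp (Suc n)) 0 1 = RA.Der (rng ?F 0) (pp (Suc n))"
    unfolding DS_def by (rule RA.Der_cong) (use Psi_1[OF pR] in \<open>simp add: r0 aug_def del: One_nat_def\<close>)
  have der: "\<kappa> ?X ` DS ?F (pp (Suc n)) 0 1 = derivations ?F ?p M"
    using \<kappa>_Der[where S = "rng ?F 0" and g = "pp (Suc n)", OF cring_rng[OF over_FF] w]
    unfolding DS by (simp add: derivations_def r0 pp_def del: augmentation.simps)
  have psi: "(\<forall>v>0. LL v d = aUU ?F 0 v d) \<longleftrightarrow>
      (\<forall>i>0. \<forall>s\<in>?X. psi M i (\<kappa> ?X d s) = \<kappa> ?X d (Psi ?F i s))" if d: "d \<in> DS ?F (pp (Suc n)) 0 1" for d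
  proof -
    have dN: "d s \<in> NN" if "s \<in> ?X" for s
      using RA.DerD(2)[OF d[unfolded DS_def], of s] that by (simp add: r0)
    have d0: "d s = 0" if "s \<notin> ?X" for s
      using RA.DerD(1)[OF d[unfolded DS_def], of s] that by (simp add: r0)
    have "LL v d = aUU ?F 0 v d \<longleftrightarrow> (\<forall>s\<in>?X. psi M v (\<kappa> ?X d s) = \<kappa> ?X d (Psi ?F v s))" if v: "0 < v" for v
    proof -
      have Pc: "Psi ?F v s \<in> ?X" if "s \<in> ?X" for s using overD(7)[OF over_FF v] that by auto
      have "LL v d = aUU ?F 0 v d \<longleftrightarrow> (\<forall>s\<in>?X. lw v (d s) = d (Psi ?F v s))"
        using d0 additive_zero[OF additive_lw[OF v]]
        by (auto simp: LL_def aUU_def pre_def pv_def r0 fun_eq_iff)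
      also have "\<dots> \<longleftrightarrow> (\<forall>s\<in>?X. psi M v (prj (d s)) = prj (d (Psi ?F v s)))"
      proof (rule ball_cong[OF refl])
        fix s assume s: "s \<in> ?X"
        show "lw v (d s) = d (Psi ?F v s) \<longleftrightarrow> psi M v (prj (d s)) = prj (d (Psi ?F v s))"
          using em_prj[OF dN[OF Pc[OF s]]] prj_em[OF psi_closed[OF v prj_closed]] unfolding lw_def by metis
      qed
      finally show ?thesis using Pc by (simp add: \<kappa>_def)
    qed
    then show ?thesis by auto
  qed
  have "Pn n = {d \<in> DS ?F (pp (Suc n)) 0 1. \<forall>i>0. \<forall>s\<in>?X. psi M i (\<kappa> ?X d s) = \<kappa> ?X d (Psi ?F i s)}"
    unfolding Pd_def using psi by blast
  then show ?thesis unfolding psi_derivations_def der[symmetric] by blast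
qed

lemma presents_psi_cochains: "presents (\<kappa> (carrier (FF (Suc n)))) (Pn n) {0}
    (der_cochains psi_free_comonad (\<lambda>S p. psi_derivations S p M) RB the_Base M n)"
proof -
  let ?X = "carrier (FF (Suc n))"
  have r0: "rng (FF (Suc n)) 0 = ring.truncate (FF (Suc n))" by (simp add: rng_def)
  have dD: "d \<in> DS (FF (Suc n)) (pp (Suc n)) 0 1" if "d \<in> Pn n" for d
    using that by (simp add: Pd_def)
  have val: "d s \<in> NN" if "d \<in> Pn n" "s \<in> ?X" for d s
    using RA.DerD(2)[OF dD[OF that(1), unfolded DS_def], of s] that(2) by (simp add: r0)
  have val0: "d s = 0" if "d \<in> Pn n" "s \<notin> ?X" for d s
    using RA.DerD(1)[OF dD[OF that(1), unfolded DS_def], of s] that(2) by (simp add: r0)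
  have "presents (\<kappa> ?X) (Pn n) {0} \<lparr>carrier = psi_derivations (FF (Suc n)) (the_Base \<circ> augmentation psi_free_comonad RB (Suc n)) M,
      monoid.mult = (\<lambda>d e. \<lambda>s\<in>?X. d s \<oplus>\<^bsub>M\<^esub> e s), one = (\<lambda>s\<in>?X. \<zero>\<^bsub>M\<^esub>)\<rparr>"
    by (rule presents_\<kappa>[OF subgrp_Pd[OF over_FF FF_Suc]]) (erule (1) val, erule (1) val0, rule \<kappa>_Pn)
  then show ?thesis by (simp add: der_cochains_def Let_def FF_def del: funpow.simps augmentation.simps)
qed

lemma presents_H_Psi: "\<exists>h. presents h {c \<in> Pn n. dpsi n c = 0}
    {c. case n of 0 \<Rightarrow> c = 0 | Suc k \<Rightarrow> \<exists>b\<in>Pn k. c = dpsi k b} (H_Psi R M n)"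
proof -
  have comm: "der_coboundary psi_free_comonad RB M n (\<kappa> (carrier (FF (Suc n))) c) = \<kappa> (carrier (FF (Suc (Suc n)))) (dpsi n c)" for n c
    using der_coboundary_\<kappa>[of n psi_free_comonad RB c] pf_closed[of _ "Suc n"]
    unfolding dpsi_def FF_def pf_def by blast
  let ?h = "\<lambda>x. coboundaries (der_cochains psi_free_comonad (\<lambda>S p. psi_derivations S p M) RB the_Base M)
      (der_coboundary psi_free_comonad RB M) n
      #>\<^bsub>der_cochains psi_free_comonad (\<lambda>S p. psi_derivations S p M) RB the_Base M n\<^esub> \<kappa> (carrier (FF (Suc n))) x"
  have "presents ?h {c \<in> Pn n. dpsi n c \<in> {0}}
      {x. case n of 0 \<Rightarrow> x \<in> {0} | Suc k \<Rightarrow> \<exists>y\<in>Pn k. x - dpsi k y \<in> {0}} (H_Psi R M n)"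
    unfolding H_Psi_def
    by (rule presents_cohomology[where h = "\<lambda>n. \<kappa> (carrier (FF (Suc n)))" and N = "\<lambda>n. {0}" and S = Pn,
          OF presents_psi_cochains dpsi_Pn additive_dpsi comm])
      (simp_all add: dpsi_dpsi fun_eq_iff)
  moreover have "{x. case n of 0 \<Rightarrow> x \<in> {0} | Suc k \<Rightarrow> \<exists>y\<in>Pn k. x - dpsi k y \<in> {0}} =
      {c. case n of 0 \<Rightarrow> c = 0 | Suc k \<Rightarrow> \<exists>b\<in>Pn k. c = dpsi k b}"
    by (cases n) simp_all
  ultimately have "presents ?h {c \<in> Pn n. dpsi n c = 0}
    {c. case n of 0 \<Rightarrow> c = 0 | Suc k \<Rightarrow> \<exists>b\<in>Pn k. c = dpsi k b} (H_Psi R M n)" by simp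
  then show ?thesis by (rule exI[of _ ?h])
qed

lemma edge_FF: "c \<in> Pn n \<Longrightarrow> edge (FF (Suc n)) c \<in> XX 0 n \<and> xd1 0 n (edge (FF (Suc n)) c) = 0"
  unfolding XX_def xd1_def TT_def DD_def by (rule edge_Pd[OF over_FF FF_Suc])

lemma edge_FF_surj: "t \<in> XX 0 n \<Longrightarrow> xd1 0 n t = 0 \<Longrightarrow> \<exists>c\<in>Pn n. t = edge (FF (Suc n)) c"
  unfolding XX_def xd1_def TT_def DD_def by (rule edge_surj[OF over_FF FF_Suc])

lemma edge_FF_eq: "c \<in> Pn n \<Longrightarrow> c' \<in> Pn n \<Longrightarrow> edge (FF (Suc n)) c = edge (FF (Suc n)) c' \<Longrightarrow> c = c'"
  using edge_inj[OF over_FF FF_Suc subgrp_diff[OF subgrp_Pd[OF over_FF FF_Suc]], of c n c']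
  by (simp add: additive_diff[OF additive_edge_FF])

text \<open>\<open>edge\<close> maps the \<Psi>-derivations bijectively onto the kernel of
  \<open>xd1\<close> in degree 0 and turns \<open>dpsi\<close> into \<open>xd2\<close>, so this edge
  is the complex that defines \<open>H_Psi\<close>.\<close>

lemma presents_edge: "\<exists>h. presents h (X.edge_cocycles n) (X.edge_boundaries n) (H_Psi R M n)"
proof -
  let ?Z = "{c \<in> Pn n. dpsi n c = 0}"
  obtain h where h: "presents h ?Z {c. case n of 0 \<Rightarrow> c = 0 | Suc k \<Rightarrow> \<exists>b\<in>Pn k. c = dpsi k b} (H_Psi R M n)"
    using presents_H_Psi by blast
  let ?e = "edge (FF (Suc n))"
  have e0: "?e 0 = 0" by (rule additive_zero[OF additive_edge_FF])
  have P0: "0 \<in> Pn m" for m by (rule subgrp_zero[OF subgrp_Pd[OF over_FF FF_Suc]])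
  show ?thesis
  proof (rule presents_rel[OF h X.subgrp_edge_cocycles, where R = "\<lambda>a b. a \<in> ?Z \<and> b = ?e a"])
    show "\<exists>a\<in>?Z. a \<in> ?Z \<and> b = ?e a" if b: "b \<in> X.edge_cocycles n" for b
    proof -
      obtain c where c: "c \<in> Pn n" "b = ?e c" using b edge_FF_surj by (auto simp: X.edge_cocycles_def)
      have "edge (FF (Suc (Suc n))) (dpsi n c) = 0"
        using b c by (simp add: X.edge_cocycles_def xd2_edge)
      then have "dpsi n c = 0"
        using edge_inj[OF over_FF FF_Suc dpsi_Pn[OF c(1)]] by simp
      then show ?thesis using c by blast
    qed
    show "\<exists>b\<in>X.edge_cocycles n. a \<in> ?Z \<and> b = ?e a" if "a \<in> ?Z" for a
      using that edge_FF by (simp add: X.edge_cocycles_def xd2_edge additive_zero[OF additive_edge_FF])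
    show "a - a' \<in> ?Z \<and> b - b' = ?e (a - a')" if "a \<in> ?Z \<and> b = ?e a" "a' \<in> ?Z \<and> b' = ?e a'" for a b a' b'
      using that subgrp_diff[OF subgrp_Pd[OF over_FF FF_Suc]]
      by (simp add: additive_diff[OF additive_edge_FF] additive_diff[OF additive_dpsi])
    show "a \<in> {c. case n of 0 \<Rightarrow> c = 0 | Suc k \<Rightarrow> \<exists>b\<in>Pn k. c = dpsi k b} \<longleftrightarrow> b \<in> X.edge_boundaries n"
      if "a \<in> ?Z" "a \<in> ?Z \<and> b = ?e a" for a b
    proof (cases n)
      case 0
      then show ?thesis using that e0 edge_FF_eq[of a n 0] P0[of n] by (auto simp: X.edge_boundaries_def)
    next
      case (Suc k)
      have "(\<exists>c\<in>Pn k. a = dpsi k c) \<longleftrightarrow> (\<exists>t\<in>XX 0 k. xd1 0 k t = 0 \<and> b = xd2 0 k t)"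
      proof
        assume "\<exists>c\<in>Pn k. a = dpsi k c"
        then obtain c where "c \<in> Pn k" "a = dpsi k c" by blast
        then show "\<exists>t\<in>XX 0 k. xd1 0 k t = 0 \<and> b = xd2 0 k t"
          using that Suc edge_FF[of c k] by (auto simp: xd2_edge intro!: bexI[of _ "edge (FF (Suc k)) c"])
      next
        assume "\<exists>t\<in>XX 0 k. xd1 0 k t = 0 \<and> b = xd2 0 k t"
        then obtain c where c: "c \<in> Pn k" "b = xd2 0 k (edge (FF (Suc k)) c)"
          using edge_FF_surj by blast
        then have "?e a = ?e (dpsi k c)" using that Suc by (simp add: xd2_edge)
        moreover have "a \<in> Pn n" using that(1) by simp
        moreover have "dpsi k c \<in> Pn n" unfolding Suc by (rule dpsi_Pn[OF c(1)])
        ultimately have "a = dpsi k c" using edge_FF_eq by blast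
        then show "\<exists>c\<in>Pn k. a = dpsi k c" by (rule bexI[OF _ c(1)])
      qed
      then show ?thesis using Suc by (simp add: X.edge_boundaries_def)
    qed
  qed
qed

text \<open>The kernel of \<open>xd2\<close> in resolution degree 0 is a copy of K^n(R): if the two
  faces of \<open>t\<close> agree, applying the extra degeneracy to both shows that \<open>t\<close>
  is the restriction of \<open>RU 0 t\<close>.\<close>

lemma xd2_0_iff:
  assumes t: "t \<in> XX n 0"
  shows "xd2 n 0 t = 0 \<longleftrightarrow> (\<exists>u\<in>TT RB the_Base n. t = RF' 0 0 u)"
proof
  assume "xd2 n 0 t = 0"
  then have "RF' 1 0 t = RF' 1 1 t" by (simp add: xd2_def)
  then have "RU 1 (RF' 1 0 t) = RU 1 (RF' 1 1 t)" by simp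
  moreover have "RU 1 (RF' 1 0 t) = t" using RU_RF'_0[of t 1 n] t by (simp add: XX_def)
  moreover have "RU 1 (RF' 1 1 t) = RF' 0 0 (RU 0 t)" using RU_RF'_Suc[of 0 0 t] by simp
  moreover have "RU 0 t \<in> TT RB the_Base n" using RU_TT[of t 0 n] t by (simp add: XX_def FF_0 pp_0)
  ultimately show "\<exists>u\<in>TT RB the_Base n. t = RF' 0 0 u" by metis
next
  assume "\<exists>u\<in>TT RB the_Base n. t = RF' 0 0 u"
  then obtain u where "t = RF' 0 0 u" by blast
  then show "xd2 n 0 t = 0" using RF'_RF'[of 0 1 0 u] by (simp add: xd2_def)
qed

text \<open>Restriction along the augmentation is injective, since the extra degeneracy splits it,
  and by \<open>xd2_0_iff\<close> it identifies K(R) with the second edge;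
  \<open>edge_transfer\<close> then carries the presentation over.\<close>

theorem presents_H_Psi_total:
  "\<exists>h. presents h {t \<in> TT RB the_Base n. DD RB t = 0}
     {t. case n of 0 \<Rightarrow> t = 0 | Suc k \<Rightarrow> \<exists>u\<in>TT RB the_Base k. t = DD RB u} (H_Psi R M n)"
proof -
  let ?Z = "{b \<in> XX n 0. xd2 n 0 b = 0 \<and> xd1 n 0 b = 0}"
  let ?B = "{b. case n of 0 \<Rightarrow> b = 0 | Suc k \<Rightarrow> \<exists>c\<in>XX k 0. xd2 k 0 c = 0 \<and> b = xd1 k 0 c}"
  let ?Y = "{t \<in> TT RB the_Base n. DD RB t = 0}"
  let ?A = "{t. case n of 0 \<Rightarrow> t = 0 | Suc k \<Rightarrow> \<exists>u\<in>TT RB the_Base k. t = DD RB u}"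
  obtain h0 where "presents h0 (X.edge_cocycles n) (X.edge_boundaries n) (H_Psi R M n)"
    using presents_edge by blast
  from X.edge_transfer[OF XX_exact1 XX_exact2 this]
  obtain h where h: "presents h ?Z ?B (H_Psi R M n)" by blast
  have TT: "RF' 0 0 u \<in> XX m 0" if "u \<in> TT RB the_Base m" for u m
    using RF'_TT[of 0 0 u m] that by (simp add: XX_def FF_0 pp_0)
  have D: "xd1 m 0 (RF' 0 0 u) = RF' 0 0 (DD RB u)" for u m
    using RF'_DD[of 0 0 u] by (simp add: xd1_def FF_0)
  have inj: "u = v" if "u \<in> TT RB the_Base m" "v \<in> TT RB the_Base m" "RF' 0 0 u = RF' 0 0 v" for u v m
  proof -
    have RU: "RU 0 (RF' 0 0 w) = w" if "w \<in> TT RB the_Base m" for w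
      using RU_RF'_0[of w 0 m] that unfolding FF_0 pp_0 by blast
    have "u = RU 0 (RF' 0 0 u)" by (rule RU[OF that(1), symmetric])
    also have "\<dots> = RU 0 (RF' 0 0 v)" by (simp only: that(3))
    also have "\<dots> = v" by (rule RU[OF that(2)])
    finally show ?thesis .
  qed
  have z: "RF' 0 0 0 = 0" by (rule additive_zero[OF additive_RF'])
  note sT = subgrp_TT[OF over_base] and aD = additive_DD[OF over_base]
  show ?thesis
  proof (rule presents_rel[OF h, where R = "\<lambda>a b. b \<in> ?Y \<and> a = RF' 0 0 b"])
    show "subgrp ?Y"
      unfolding subgrp_def
      using subgrp_zero[OF sT, of n] subgrp_diff[OF sT, of _ n] by (simp add: additive_zero[OF aD] additive_diff[OF aD])
    show "\<exists>a\<in>?Z. b \<in> ?Y \<and> a = RF' 0 0 b" if b: "b \<in> ?Y" for b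
      using b TT[of b n] D[of n b] xd2_0_iff[OF TT[of b n]] z by auto
    show "\<exists>b\<in>?Y. b \<in> ?Y \<and> a = RF' 0 0 b" if a: "a \<in> ?Z" for a
    proof -
      obtain u where u: "u \<in> TT RB the_Base n" "a = RF' 0 0 u" using a xd2_0_iff[of a n] by auto
      have "RF' 0 0 (DD RB u) = RF' 0 0 0" using a u D[of n u] z by simp
      from inj[OF DD_TT[OF over_base u(1)] subgrp_zero[OF sT] this] have "DD RB u = 0" .
      then have "u \<in> ?Y" using u(1) by simp
      show ?thesis by (intro bexI[where x = u] conjI) (fact \<open>u \<in> ?Y\<close> u(2))+
    qed
    show "b - b' \<in> ?Y \<and> a - a' = RF' 0 0 (b - b')" if "b \<in> ?Y \<and> a = RF' 0 0 b" "b' \<in> ?Y \<and> a' = RF' 0 0 b'" for a b a' b'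
      using that subgrp_diff[OF sT, of b n b'] by (simp add: additive_diff[OF aD] additive_diff[OF additive_RF'])
    show "a \<in> ?B \<longleftrightarrow> b \<in> ?A" if "b \<in> ?Y" "b \<in> ?Y \<and> a = RF' 0 0 b" for a b
    proof (cases n)
      case 0
      then show ?thesis using that z inj[of b n 0] subgrp_zero[OF sT, of n] by auto
    next
      case (Suc k)
      have "(\<exists>c\<in>XX k 0. xd2 k 0 c = 0 \<and> a = xd1 k 0 c) \<longleftrightarrow> (\<exists>u\<in>TT RB the_Base k. b = DD RB u)"
      proof
        assume "\<exists>c\<in>XX k 0. xd2 k 0 c = 0 \<and> a = xd1 k 0 c"
        then obtain u where u: "u \<in> TT RB the_Base k" "a = xd1 k 0 (RF' 0 0 u)" using xd2_0_iff by blast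
        from u(2) have eq: "RF' 0 0 b = RF' 0 0 (DD RB u)" using that(2) D[of k u] by (elim conjE) (simp only:)
        have "DD RB u \<in> TT RB the_Base n" unfolding Suc by (rule DD_TT[OF over_base u(1)])
        moreover have "b \<in> TT RB the_Base n" using that(1) by simp
        ultimately have "b = DD RB u" using inj eq by blast
        then show "\<exists>u\<in>TT RB the_Base k. b = DD RB u" by (rule bexI[OF _ u(1)])
      next
        assume "\<exists>u\<in>TT RB the_Base k. b = DD RB u"
        then obtain u where u: "u \<in> TT RB the_Base k" "b = DD RB u" by blast
        then show "\<exists>c\<in>XX k 0. xd2 k 0 c = 0 \<and> a = xd1 k 0 c"
          using TT[OF u(1)] D[of k u] xd2_0_iff[OF TT[OF u(1)]] that by (intro bexI[of _ "RF' 0 0 u"]) auto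
      qed
      then show ?thesis using Suc by simp
    qed
  qed
qed

section \<open>Encoding total cochains and assembling the spectral sequence\<close>

interpretation NC: nat_complexes "SS RB the_Base" "dl RB" LL "UU RB"
  by (rule nat_complexes[OF over_base])

interpretation DC: double_complex NC.C NC.bw NC.dv by (rule NC.double_complex)

definition total_code :: "nat \<Rightarrow> (nat \<Rightarrow> nat \<Rightarrow> nat list \<Rightarrow> 'a univ \<Rightarrow> 'm big) \<Rightarrow> nat list \<Rightarrow> 'a univ \<Rightarrow> 'm" where
  "total_code n t = (\<lambda>\<alpha>s s. prj (t (length \<alpha>s) (n - length \<alpha>s) \<alpha>s s))"

lemma inj_total_code: "inj_on (total_code n) (DC.Tot n)"
proof (rule inj_onI)
  have Tot: "DC.Tot n = TT RB the_Base n" by (simp add: TT_def)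
  have NN: "t i j \<alpha>s s \<in> NN" if t: "t \<in> TT RB the_Base n" for t i j \<alpha>s s
  proof (cases "\<alpha>s \<in> pos_lists i \<and> s \<in> carrier (rng RB (Suc j))")
    case True
    then have "t i j \<alpha>s \<in> SS RB the_Base j (prod_list \<alpha>s)" using t TT_iff[OF over_base] by blast
    from RA.DerD(2)[OF this[unfolded SS_def DS_def] conjunct2[OF True]] show ?thesis .
  next
    case False
    then have "t i j \<alpha>s s = 0"
    proof (cases "\<alpha>s \<in> pos_lists i")
      case True
      then have "t i j \<alpha>s \<in> SS RB the_Base j (prod_list \<alpha>s)" using t TT_iff[OF over_base] by blast
      from RA.DerD(1)[OF this[unfolded SS_def DS_def]] show ?thesis using True False by blast
    next
      case False
      then have "t i j \<alpha>s = 0" using t TT_iff[OF over_base] by blast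
      then show ?thesis by simp
    qed
    then show ?thesis using subgrp_zero[OF subgrp_NN] by simp
  qed
  fix t u assume t: "t \<in> DC.Tot n" and u: "u \<in> DC.Tot n" and eq: "total_code n t = total_code n u"
  show "t = u"
  proof (intro ext)
    fix i j \<alpha>s s
    show "t i j \<alpha>s s = u i j \<alpha>s s"
    proof (cases "i + j = n \<and> \<alpha>s \<in> pos_lists i")
      case True
      then have "length \<alpha>s = i" "n - i = j" using pos_lists_length by auto
      then have "prj (t i j \<alpha>s s) = prj (u i j \<alpha>s s)"
        using fun_cong[OF fun_cong[OF eq, of \<alpha>s], of s] by (simp add: total_code_def)
      then show ?thesis using em_prj NN t u Tot by metis
    next
      case False
      then have "t i j \<alpha>s = 0" "u i j \<alpha>s = 0"
        using t u unfolding Tot TT_iff[OF over_base] by (metis zero_fun_apply)+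
      then show ?thesis by simp
    qed
  qed
qed

theorem spectral_sequence:
  "\<exists>(E :: nat \<Rightarrow> int \<Rightarrow> int \<Rightarrow> (nat list \<Rightarrow> 'a univ \<Rightarrow> 'm) set monoid) d.
     spectral_sequence E d \<and> first_quadrant E \<and>
     (\<forall>p q :: nat. E 2 (int p) (int q) \<cong> H_BW pos_nat_monoid (AQ_system R M q) p) \<and>
     converges_to E d (H_Psi R M)"
proof -
  have "\<forall>p q. \<exists>h. presents h (DC.E2_cocycles p q) (DC.E2_boundaries p q) (H_BW pos_nat_monoid (AQ_system R M q) p)"
    using presents_H_BW_AQ by blast
  then obtain h where h: "\<And>p q. presents (h p q) (DC.E2_cocycles p q) (DC.E2_boundaries p q)
      (H_BW pos_nat_monoid (AQ_system R M q) p)" by metis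
  have "\<exists>k. presents k {t \<in> DC.Tot n. DC.D t = 0} (DC.D ` DC.Tot_pred n) (H_Psi R M n)" for n
  proof -
    have "{t. case n of 0 \<Rightarrow> t = 0 | Suc k \<Rightarrow> \<exists>u\<in>TT RB the_Base k. t = DD RB u} = DC.D ` DC.Tot_pred n"
    proof (cases n)
      case 0
      show ?thesis unfolding 0 DC.Tot_pred_def by (simp add: DC.D_zero)
    next
      case (Suc k)
      show ?thesis unfolding Suc DC.Tot_pred_def TT_def DD_def by (simp add: image_def)
    qed
    then show ?thesis using presents_H_Psi_total[of n] by (simp add: TT_def DD_def)
  qed
  then have "\<forall>n. \<exists>k. presents k {t \<in> DC.Tot n. DC.D t = 0} (DC.D ` DC.Tot_pred n) (H_Psi R M n)" ..
  from choice[OF this] obtain k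
    where "\<forall>n. presents (k n) {t \<in> DC.Tot n. DC.D t = 0} (DC.D ` DC.Tot_pred n) (H_Psi R M n)" by (elim exE)
  then have k: "\<And>n. presents (k n) {t \<in> DC.Tot n. DC.D t = 0} (DC.D ` DC.Tot_pred n) (H_Psi R M n)" ..
  show ?thesis
    by (rule DC.spectral_sequence_exists[of "\<lambda>p q. total_code (nat (p + q))" h _ k, OF inj_total_code h k])
qed

end

theorem theorem7p3:
  fixes R :: "'a psi_ring" and M :: "('a, 'm) psi_module"
  assumes "psi_ring R" and "psi_module R M"
  shows "(\<forall>q. natural_system pos_nat_monoid (AQ_system R M q)) \<and>
    (\<exists>(E :: nat \<Rightarrow> int \<Rightarrow> int \<Rightarrow> (nat list \<Rightarrow> 'a univ \<Rightarrow> 'm) set monoid) d.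
       spectral_sequence E d \<and>
       first_quadrant E \<and>
       (\<forall>p q :: nat. E 2 (int p) (int q) \<cong> H_BW pos_nat_monoid (AQ_system R M q) p) \<and>
       converges_to E d (H_Psi R M))"
proof -
  interpret psi_pair R M by (rule psi_pair.intro[OF assms(2)])
  show ?thesis using natural_system_AQ spectral_sequence by blast
qed

end
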